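(* For $n\ge 1$ let $a(n)$ be the number of similarity classes of finite groups having exactly $n$ subgroups. Then $$(a(1),a(2),\ldots,a(12)) = (1,\,1,\,1,\,2,\,2,\,5,\,1,\,7,\,2,\,12,\,4,\,11).$$
   Context: The number of subgroups of a group $G$ counts all subgroups (not up to conjugacy or isomorphism), including the trivial subgroup and $G$ itself. Similarity. Let $G$ be a finite group and let $\pi=\{p_1,\ldots,p_c\}$ be the set of primes $p$ dividing $|G|$ such that a Sylow $p$-subgroup of $G$ is cyclic and contained in the center of $G$. Then $G = P_1\times\cdots\times P_c\times \widetilde{G}$, where $P_i$ is the Sylow $p_i$-subgroup of $G$ and $\widetilde{G}=O_{\pi'}(G)$ is the largest normal subgroup of $G$ of order not divisible by any prime in $\pi$. Write $|P_i|=p_i^{n_i}$. Let $H$ be another finite group with corresponding decomposition $H=Q_1\times\cdots\times Q_d\times\widetilde{H}$, $|Q_i|=q_i^{m_i}$. The groups $G$ and $H$ are called similar if and only if: (1) $\widetilde{G}\cong\widetilde{H}$; (2) $c=d$; (3) after some reordering, $n_i=m_i$ for all $i$ (the primes $p_i$ and $q_i$ need not agree). Similarity is an equivalence relation on finite groups, and similar groups have the same number of subgroups; its equivalence classes are the similarity classes. *)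

theory Defs
  imports "HOL-Algebra.Algebra" "HOL-Computational_Algebra.Primes"
begin

definition num_subgroups :: "('a, 'm) monoid_scheme \<Rightarrow> nat" where
  "num_subgroups G = card {H. subgroup H G}"

definition group_center :: "('a, 'm) monoid_scheme \<Rightarrow> 'a set" where
  "group_center G = {z \<in> carrier G. \<forall>x \<in> carrier G. z \<otimes>\<^bsub>G\<^esub> x = x \<otimes>\<^bsub>G\<^esub> z}"

definition sylow_subgroup :: "nat \<Rightarrow> 'a set \<Rightarrow> ('a, 'm) monoid_scheme \<Rightarrow> bool" where
  "sylow_subgroup p P G \<longleftrightarrow> subgroup P G \<and> card P = p ^ multiplicity p (card (carrier G))"

definition central_cyclic_primes :: "('a, 'm) monoid_scheme \<Rightarrow> nat set" where
  "central_cyclic_primes G =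
     {p. Factorial_Ring.prime p \<and> p dvd card (carrier G) \<and>
         (\<exists>P. sylow_subgroup p P G \<and> cyclic_group (G\<lparr>carrier := P\<rparr>) \<and> P \<subseteq> group_center G)}"

(* O_{\<pi>'}(G). "Largest" is with respect to inclusion; for a finite group G it exists,
   because the product of two normal \<pi>'-subgroups is again a normal \<pi>'-subgroup. *)
definition pi_prime_core :: "nat set \<Rightarrow> ('a, 'm) monoid_scheme \<Rightarrow> 'a set" where
  "pi_prime_core \<pi> G = (GREATEST N. N \<lhd> G \<and> (\<forall>p \<in> \<pi>. \<not> p dvd card N))"

definition tilde_part :: "('a, 'm) monoid_scheme \<Rightarrow> ('a, 'm) monoid_scheme" where
  "tilde_part G = G\<lparr>carrier := pi_prime_core (central_cyclic_primes G) G\<rparr>"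

(* The bijection f expresses both that G and H have equally many central cyclic primes and
   that, after reordering, the exponents of their Sylow subgroups agree. *)
definition similar_groups :: "('a, 'm) monoid_scheme \<Rightarrow> ('b, 'n) monoid_scheme \<Rightarrow> bool" where
  "similar_groups G H \<longleftrightarrow>
     tilde_part G \<cong> tilde_part H \<and>
     (\<exists>f. bij_betw f (central_cyclic_primes G) (central_cyclic_primes H) \<and>
          (\<forall>p \<in> central_cyclic_primes G.
             multiplicity p (card (carrier G)) = multiplicity (f p) (card (carrier H))))"

(* Every finite group is isomorphic, hence similar, to one whose carrier is a finite set of
   natural numbers, so groups over the type nat represent all similarity classes. *)
definition finite_groups :: "nat monoid set" where
  "finite_groups = {G. group G \<and> finite (carrier G)}"

definition similarity_rel :: "nat monoid rel" where
  "similarity_rel = {(G, H). G \<in> finite_groups \<and> H \<in> finite_groups \<and> similar_groups G H}"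

definition similarity_classes :: "nat \<Rightarrow> nat monoid set set" where
  "similarity_classes n = {G \<in> finite_groups. num_subgroups G = n} // similarity_rel"

(* card is 0 on infinite sets, so a positive value of num_similarity_classes n also says
   that there are only finitely many similarity classes. *)
definition num_similarity_classes :: "nat \<Rightarrow> nat" where
  "num_similarity_classes n = card (similarity_classes n)"

end

theory Submission
  imports Defs "HOL-Number_Theory.Number_Theory" "HOL-Library.Code_Binary_Nat"
begin

text \<open>A group with at most 12 subgroups is cyclic, has a cyclic normal subgroup of prime index, or is \<open>A\<^sub>4\<close>.
  If all Sylow subgroups are normal, a noncyclic one has many maximal subgroups, which leaves room for one
  noncyclic Sylow subgroup, with a cyclic maximal subgroup. Otherwise the normalizer of some Sylow subgroup lies in a
  maximal subgroup \<open>M\<close>, which is not normal by the Frattini argument, and the conjugates of \<open>M\<close> and of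
  its maximal subgroups already account for most of the 12 subgroups.

  If \<open>a\<close> of order \<open>N\<close> generates a normal subgroup of prime index \<open>p\<close> and \<open>b\<^sup>p = a\<^sup>j\<close>, \<open>b a = a\<^sup>k b\<close>, then
  the group is determined by \<open>(N, p, k, j)\<close> and has \<open>\<tau>(N) + \<Sum>\<^sub>d |{t < d. d dvd t S + j}|\<close> subgroups, where \<open>d\<close> runs over
  the divisors of \<open>N\<close> and \<open>S = 1 + k + \<dots> + k\<^bsup>p-1\<^esup>\<close>. After central cyclic Sylow subgroups have been split off, the
  bound 12 leaves finitely many parameters, and a finite search reduces them to 25 representatives.
  A similarity class is thus a representative together with a multiset of exponents \<open>n\<^sub>i\<close>, and its groups have
  \<open>s \<cdot> \<Prod>\<^sub>i (n\<^sub>i + 1)\<close> subgroups, where \<open>s\<close> is the number of subgroups of the representative.\<close>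

text \<open>Everything happens inside one fixed carrier: subgroups, their Sylow subgroups and their
  maximal subgroups are all sets \<open>H\<close> with \<open>sg H\<close>, and quotient groups are
  replaced by relative orders (\<open>pow_mem_sg\<close>) and the product formula
  \<open>card_set_mult\<close>. The counting rests on a dichotomy: a maximal subgroup is normal or
  self-normalizing, and in the second case it has as many conjugates as its index, at least three.
  The bound 12 is used tightly: several exclusions exhibit exactly 13 subgroups, and in
  \<open>L_meets_K\<close> exactly 12 are listed, so that no other subgroup can exist. The obstacle
  on the way to similarity classes is that infinitely many groups share a subgroup count. Therefore
  all central cyclic Sylow subgroups are gathered in one central cyclic factor generated by
  \<open>z\<close>, of order prime to the rest \<open>T\<close>: only \<open>T\<close> has to be
  classified up to isomorphism, and \<open>z\<close> enters through the exponents of its order.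
  Every multiset of positive exponents occurs, since primes not dividing the order of
  \<open>T\<close> never run out.\<close>

hide_const (open) Divisibility.prime

section \<open>Conjugation and Sylow theory\<close>

lemma card_eq_card_image_times:
  assumes "finite A" "\<And>x. x \<in> A \<Longrightarrow> card {y \<in> A. f y = f x} = c"
  shows "card A = card (f ` A) * c"
proof -
  have "card A = (\<Sum>x\<in>A. 1)" by simp
  also have "\<dots> = (\<Sum>y\<in>f ` A. \<Sum>x\<in>{x \<in> A. f x = y}. 1)"
    by (rule sum.image_gen[OF assms(1)])
  also have "\<dots> = (\<Sum>y\<in>f ` A. c)"
    by (rule sum.cong) (auto simp: assms(2))
  finally show ?thesis by simp
qed

locale fin_group = group G for G (structure) +
  assumes fin: "finite (carrier G)"
begin

abbreviation sg :: "'a set \<Rightarrow> bool" where "sg H \<equiv> subgroup H G"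

definition cj :: "'a \<Rightarrow> 'a set \<Rightarrow> 'a set" where
  "cj x H = (\<lambda>h. x \<otimes> h \<otimes> inv x) ` H"

definition norm :: "'a set \<Rightarrow> 'a set" where
  "norm H = {x \<in> carrier G. cj x H = H}"

definition orb :: "'a set \<Rightarrow> 'a set \<Rightarrow> 'a set set" where
  "orb P H = (\<lambda>x. cj x H) ` P"

text \<open>Sylow subgroups of a subgroup \<open>M\<close> of the fixed group. The condition is an
  index prime to \<open>p\<close>, so the trivial subgroup qualifies when \<open>p\<close> does not
  divide the order of \<open>M\<close>.\<close>

definition psyl :: "nat \<Rightarrow> 'a set \<Rightarrow> 'a set \<Rightarrow> bool" where
  "psyl p P M \<longleftrightarrow> sg P \<and> P \<subseteq> M \<and> (\<exists>a. card P = p ^ a) \<and> \<not> p dvd (card M div card P)"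

definition maxin :: "'a set \<Rightarrow> 'a set \<Rightarrow> bool" where
  "maxin M K \<longleftrightarrow> sg M \<and> sg K \<and> M \<subset> K \<and> (\<forall>H. sg H \<longrightarrow> M \<subseteq> H \<longrightarrow> H \<subseteq> K \<longrightarrow> H = M \<or> H = K)"

section \<open>Subgroups as subsets of one finite group\<close>

lemma sg_sub: "sg H \<Longrightarrow> H \<subseteq> carrier G"
  by (rule subgroup.subset)

lemma sg_fin: "sg H \<Longrightarrow> finite H"
  using fin finite_subset sg_sub by blast

lemma sg_ne: "sg H \<Longrightarrow> \<one> \<in> H"
  by (rule subgroup.one_closed)

lemma sg_card_pos: "sg H \<Longrightarrow> card H > 0"
  using sg_fin sg_ne card_gt_0_iff by blast

lemma sg_mem: "sg H \<Longrightarrow> x \<in> H \<Longrightarrow> x \<in> carrier G"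
  using sg_sub by blast

lemma sg_mult: "sg H \<Longrightarrow> x \<in> H \<Longrightarrow> y \<in> H \<Longrightarrow> x \<otimes> y \<in> H"
  by (rule subgroup.m_closed)

lemma sg_inv: "sg H \<Longrightarrow> x \<in> H \<Longrightarrow> inv x \<in> H"
  by (rule subgroup.m_inv_closed)

lemma sg_pow: "sg H \<Longrightarrow> x \<in> H \<Longrightarrow> x [^] (n::nat) \<in> H"
  by (induction n) (auto simp: sg_ne sg_mult)

lemma sg_Int: "sg H \<Longrightarrow> sg K \<Longrightarrow> sg (H \<inter> K)"
  by (rule subgroups_Inter_pair)

lemma sg_carrier: "sg (carrier G)"
  by (rule subgroup_self)

lemma sg_one: "sg {\<one>}"
  by (rule triv_subgroup)

lemma finite_sgs: "finite {H. sg H}"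
  by (rule finite_subset[of _ "Pow (carrier G)"]) (auto simp: fin dest: sg_sub)

lemma sg_restrict: "sg K \<Longrightarrow> fin_group (G\<lparr>carrier := K\<rparr>)"
  by (simp add: fin_group_def fin_group_axioms_def subgroup_imp_group sg_fin)

lemma sg_restrict_iff: "sg K \<Longrightarrow> subgroup H (G\<lparr>carrier := K\<rparr>) \<longleftrightarrow> sg H \<and> H \<subseteq> K"
  using incl_subgroup[of K H] subgroup_incl[of H K] subgroup.subset[of H "G\<lparr>carrier := K\<rparr>"] by auto

lemma ord_pos: "x \<in> carrier G \<Longrightarrow> ord x > 0"
  using ord_ge_1[OF fin, of x] by simp

text \<open>In a finite group closure under products is enough, because an inverse is a power with
  positive exponent.\<close>

lemma sgI:
  assumes "H \<subseteq> carrier G" "H \<noteq> {}" "\<And>x y. x \<in> H \<Longrightarrow> y \<in> H \<Longrightarrow> x \<otimes> y \<in> H"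
  shows "sg H"
proof (rule subgroupI[OF assms(1,2)])
  fix x assume x: "x \<in> H"
  have xG: "x \<in> carrier G" using x assms(1) by blast
  have pw: "x [^] Suc n \<in> H" for n :: nat
    using x assms(3) xG by (induction n) auto
  \<comment> \<open>The exponent \<open>2 * ord x - 1\<close> is used instead of
    \<open>ord x - 1\<close>: it stays positive for \<open>ord x = 1\<close>, and \<open>pw\<close>
    covers positive exponents only.\<close>
  have "x [^] Suc (2 * ord x - 2) \<otimes> x = x [^] (ord x * 2)"
    using ord_pos[OF xG] xG by (subst nat_pow_Suc[symmetric]) (simp add: Suc_diff_Suc numeral_2_eq_2 mult.commute)
  also have "\<dots> = \<one>" using xG by (metis nat_pow_pow pow_ord_eq_1 nat_pow_one)
  finally have "inv x = x [^] Suc (2 * ord x - 2)"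
    using inv_equality xG by simp
  then show "inv x \<in> H" using pw by simp
qed (use assms in auto)

lemma card_dvd:
  assumes "sg H" "sg K" "H \<subseteq> K"
  shows "card H dvd card K"
proof -
  interpret K: fin_group "G\<lparr>carrier := K\<rparr>" by (rule sg_restrict[OF assms(2)])
  have "subgroup H (G\<lparr>carrier := K\<rparr>)" using assms sg_restrict_iff by blast
  from K.lagrange[OF this] show ?thesis unfolding order_def by (simp add: dvd_def mult.commute) (metis mult.commute)
qed

lemma card_eqI: "sg H \<Longrightarrow> sg K \<Longrightarrow> H \<subseteq> K \<Longrightarrow> card K \<le> card H \<Longrightarrow> H = K"
  using card_seteq sg_fin by blast

lemma card_lt: "sg H \<Longrightarrow> sg K \<Longrightarrow> H \<subset> K \<Longrightarrow> 2 * card H \<le> card K"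
proof -
  assume a: "sg H" "sg K" "H \<subset> K"
  have "card H dvd card K" using card_dvd a by blast
  then obtain c where c: "card K = card H * c" by blast
  have "card H < card K" using a psubset_card_mono sg_fin by blast
  then have "c \<noteq> 0" "c \<noteq> 1" using c by auto
  then have "c \<ge> 2" by simp
  then show ?thesis using c by simp
qed

section \<open>Conjugation, normalizers and orbits\<close>

lemma cj_sub: "x \<in> carrier G \<Longrightarrow> H \<subseteq> carrier G \<Longrightarrow> cj x H \<subseteq> carrier G"
  by (auto simp: cj_def)

lemma cj_one: "H \<subseteq> carrier G \<Longrightarrow> cj \<one> H = H"
  unfolding cj_def by (force simp: image_iff subset_iff)

lemma cj_cj:
  assumes "x \<in> carrier G" "y \<in> carrier G" "H \<subseteq> carrier G"
  shows "cj x (cj y H) = cj (x \<otimes> y) H"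
  unfolding cj_def image_image
  by (rule image_cong[OF refl]) (use assms in \<open>auto simp: inv_mult_group m_assoc subset_iff\<close>)

lemma cj_inv_cj: "x \<in> carrier G \<Longrightarrow> H \<subseteq> carrier G \<Longrightarrow> cj (inv x) (cj x H) = H"
  by (simp add: cj_cj cj_one)

lemma cj_cj_inv: "x \<in> carrier G \<Longrightarrow> H \<subseteq> carrier G \<Longrightarrow> cj x (cj (inv x) H) = H"
  by (simp add: cj_cj cj_one)

lemma cj_mono: "H \<subseteq> K \<Longrightarrow> cj x H \<subseteq> cj x K"
  by (auto simp: cj_def)

lemma cj_inj: "x \<in> carrier G \<Longrightarrow> H \<subseteq> carrier G \<Longrightarrow> K \<subseteq> carrier G \<Longrightarrow> cj x H = cj x K \<longleftrightarrow> H = K"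
  by (metis cj_inv_cj)

lemma cj_le_iff: "x \<in> carrier G \<Longrightarrow> H \<subseteq> carrier G \<Longrightarrow> K \<subseteq> carrier G \<Longrightarrow> cj x H \<subseteq> cj x K \<longleftrightarrow> H \<subseteq> K"
  by (metis cj_inv_cj cj_mono)

lemma card_cj: "x \<in> carrier G \<Longrightarrow> H \<subseteq> carrier G \<Longrightarrow> card (cj x H) = card H"
  unfolding cj_def by (rule card_image) (auto simp: inj_on_def subset_iff)

lemma sg_cj:
  assumes "x \<in> carrier G" "sg H" shows "sg (cj x H)"
proof (rule sgI)
  show "cj x H \<subseteq> carrier G" using assms cj_sub sg_sub by blast
  show "cj x H \<noteq> {}" using sg_ne[OF assms(2)] by (auto simp: cj_def)
  fix u v assume "u \<in> cj x H" "v \<in> cj x H"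
  then obtain h k where hk: "h \<in> H" "k \<in> H" "u = x \<otimes> h \<otimes> inv x" "v = x \<otimes> k \<otimes> inv x"
    by (auto simp: cj_def)
  have c: "h \<in> carrier G" "k \<in> carrier G" using hk sg_mem assms by auto
  have "inv x \<otimes> (x \<otimes> (k \<otimes> inv x)) = k \<otimes> inv x"
    using c assms by (simp add: m_assoc[symmetric])
  then have "u \<otimes> v = x \<otimes> (h \<otimes> k) \<otimes> inv x"
    using c assms hk by (simp add: m_assoc)
  then show "u \<otimes> v \<in> cj x H" using sg_mult[OF assms(2) hk(1,2)] by (auto simp: cj_def)
qed

lemma cj_self: "sg H \<Longrightarrow> x \<in> H \<Longrightarrow> cj x H = H"
proof -
  assume a: "sg H" "x \<in> H"
  have "cj x H \<subseteq> H" using a by (auto simp: cj_def intro!: sg_mult sg_inv)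
  then show ?thesis using a card_cj sg_mem sg_sub sg_cj card_eqI by (metis order_refl)
qed

lemma sg_norm:
  assumes "H \<subseteq> carrier G" shows "sg (norm H)"
proof (rule sgI)
  show "norm H \<noteq> {}" using cj_one[OF assms] by (auto simp: norm_def)
qed (use assms in \<open>auto simp: norm_def cj_cj[symmetric]\<close>)

lemma norm_sub: "norm H \<subseteq> carrier G"
  by (auto simp: norm_def)

lemma sub_norm: "sg H \<Longrightarrow> H \<subseteq> norm H"
  by (auto simp: norm_def cj_self sg_mem)

lemma norm_cj:
  assumes "x \<in> carrier G" "H \<subseteq> carrier G"
  shows "norm (cj x H) = cj x (norm H)"
proof -
  have le: "cj x (norm H) \<subseteq> norm (cj x H)" if "x \<in> carrier G" "H \<subseteq> carrier G" for x H
  proof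
    fix y assume "y \<in> cj x (norm H)"
    then obtain n where n: "n \<in> carrier G" "cj n H = H" "y = x \<otimes> n \<otimes> inv x"
      by (smt (verit, best) cj_def image_iff mem_Collect_eq norm_def)
    have "x \<otimes> n \<otimes> inv x \<otimes> x = x \<otimes> n" using n that by (simp add: m_assoc)
    then have "cj y (cj x H) = cj (x \<otimes> n) H"
      using n that by (simp add: cj_cj)
    also have "\<dots> = cj x H" using n that by (metis cj_cj)
    finally show "y \<in> norm (cj x H)" using n that by (simp add: norm_def)
  qed
  have "cj (inv x) (norm (cj x H)) \<subseteq> norm H"
    using le[of "inv x" "cj x H"] assms by (simp add: cj_sub cj_inv_cj)
  then have "norm (cj x H) \<subseteq> cj x (norm H)"
    by (metis assms(1) cj_cj_inv cj_mono norm_sub)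
  then show ?thesis using le assms by blast
qed

text \<open>Two elements of \<open>P\<close> give the same conjugate of \<open>H\<close> exactly if
  they lie in the same left coset of \<open>P \<inter> norm H\<close>. \<open>H\<close> may be any
  subset and need not be related to \<open>P\<close>.\<close>

lemma orbit_stab:
  assumes "sg P" "H \<subseteq> carrier G"
  shows "card (orb P H) * card (P \<inter> norm H) = card P"
proof -
  have "card {y \<in> P. cj y H = cj x H} = card (P \<inter> norm H)" if x: "x \<in> P" for x
  proof -
    have xG: "x \<in> carrier G" using x assms sg_mem by blast
    have "{y \<in> P. cj y H = cj x H} = (\<lambda>n. x \<otimes> n) ` (P \<inter> norm H)"
    proof (intro equalityI subsetI)
      fix y assume y: "y \<in> {y \<in> P. cj y H = cj x H}"
      then have yG: "y \<in> carrier G" using assms sg_mem by blast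
      have "cj (inv x \<otimes> y) H = H" using y yG xG assms by (metis (mono_tags, lifting) cj_cj cj_inv_cj inv_closed mem_Collect_eq)
      then have "inv x \<otimes> y \<in> P \<inter> norm H" using x y yG xG assms by (auto simp: norm_def intro!: sg_mult sg_inv)
      moreover have "y = x \<otimes> (inv x \<otimes> y)" using xG yG by (simp add: m_assoc[symmetric])
      ultimately show "y \<in> (\<lambda>n. x \<otimes> n) ` (P \<inter> norm H)" by blast
    next
      fix y assume "y \<in> (\<lambda>n. x \<otimes> n) ` (P \<inter> norm H)"
      then obtain n where n: "n \<in> P" "n \<in> norm H" "y = x \<otimes> n" by blast
      have "cj (x \<otimes> n) H = cj x H" using n xG assms by (metis (mono_tags, lifting) cj_cj mem_Collect_eq norm_def)
      then show "y \<in> {y \<in> P. cj y H = cj x H}" using n x assms sg_mult by blast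
    qed
    moreover have "inj_on (\<lambda>n. x \<otimes> n) (P \<inter> norm H)"
      using xG assms sg_mem by (auto simp: inj_on_def)
    ultimately show ?thesis by (simp add: card_image)
  qed
  from card_eq_card_image_times[OF sg_fin[OF assms(1)] this]
  show ?thesis by (simp add: orb_def)
qed

text \<open>A member that is not fixed has a \<open>Q\<close>-orbit whose size is a power of
  \<open>p\<close> other than 1. This serves two purposes: a fixed member exists if \<open>p\<close>
  does not divide the size of \<open>F\<close>, and the size of \<open>F\<close> is known modulo
  \<open>p\<close> once the fixed members are known.\<close>

lemma fixed_points:
  assumes "prime (p::nat)" "sg Q" "card Q = p ^ n" "finite F"
    and F: "\<And>f. f \<in> F \<Longrightarrow> f \<subseteq> carrier G" "\<And>f x. f \<in> F \<Longrightarrow> x \<in> Q \<Longrightarrow> cj x f \<in> F"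
  shows "p dvd card {f \<in> F. \<not> Q \<subseteq> norm f}"
proof -
  define F' where "F' = {f \<in> F. \<not> Q \<subseteq> norm f}"
  define r where "r = {(f, g). f \<in> F' \<and> g \<in> orb Q f}"
  have QG: "x \<in> carrier G" if "x \<in> Q" for x using that assms sg_mem by blast
  have cl: "cj x f \<in> F'" if "f \<in> F'" "x \<in> Q" for x f
  proof -
    have f: "f \<in> F" "\<not> Q \<subseteq> norm f" "f \<subseteq> carrier G" using that F by (auto simp: F'_def)
    have "\<not> Q \<subseteq> norm (cj x f)"
    proof
      assume "Q \<subseteq> norm (cj x f)"
      then have "Q \<subseteq> cj x (norm f)" using norm_cj f QG that by simp
      moreover have "cj x Q = Q" using cj_self assms that by blast
      ultimately have "cj x Q \<subseteq> cj x (norm f)" by simp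
      then show False using f cj_le_iff QG[OF that(2)] norm_sub assms sg_sub by metis
    qed
    then show ?thesis using F f that by (simp add: F'_def)
  qed
  have F'G: "f \<subseteq> carrier G" if "f \<in> F'" for f using that F by (auto simp: F'_def)
  have "equiv F' r"
  proof (rule equivI)
    show "r \<subseteq> F' \<times> F'" using cl by (auto simp: r_def orb_def)
    show "refl_on F' r" unfolding refl_on_def r_def orb_def using sg_ne[OF assms(2)] F'G cj_one by (metis (mono_tags, lifting) case_prodI image_eqI mem_Collect_eq)
    show "sym r"
    proof (rule symI)
      fix f g assume "(f, g) \<in> r"
      then obtain x where x: "f \<in> F'" "x \<in> Q" "g = cj x f" by (auto simp: r_def orb_def)
      then have "g \<in> F'" "f = cj (inv x) g" "inv x \<in> Q" using cl cj_inv_cj F'G QG sg_inv assms by auto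
      then show "(g, f) \<in> r" by (auto simp: r_def orb_def)
    qed
    show "trans r"
    proof (rule transI)
      fix f g h assume "(f, g) \<in> r" "(g, h) \<in> r"
      then obtain x y where x: "f \<in> F'" "x \<in> Q" "g = cj x f" "y \<in> Q" "h = cj y g" by (auto simp: r_def orb_def)
      then have "h = cj (y \<otimes> x) f" "y \<otimes> x \<in> Q" using cj_cj F'G QG sg_mult assms by auto
      then show "(f, h) \<in> r" using x by (auto simp: r_def orb_def)
    qed
  qed
  moreover have "p dvd card C" if "C \<in> F' // r" for C
  proof -
    obtain f where f: "f \<in> F'" "C = r `` {f}" using \<open>C \<in> F' // r\<close> by (auto elim: quotientE)
    then have C: "C = orb Q f" by (auto simp: r_def)
    have os: "card C * card (Q \<inter> norm f) = p ^ n" using orbit_stab[OF assms(2) F'G[OF f(1)]] C assms by simp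
    then have "card C dvd p ^ n" by (metis dvd_triv_left)
    then obtain i where i: "card C = p ^ i" using assms(1) divides_primepow_nat by blast
    have "i \<noteq> 0"
    proof
      assume "i = 0"
      then have "card (Q \<inter> norm f) = card Q" using os i assms by simp
      then have "Q \<inter> norm f = Q" using card_subset_eq sg_fin assms by (metis inf_le1)
      then show False using f by (auto simp: F'_def)
    qed
    then show ?thesis using i by simp
  qed
  ultimately show ?thesis using equiv_imp_dvd_card[of F' r p] assms(4) by (simp add: F'_def)
qed

text \<open>The pairs with product \<open>h \<otimes> k\<close> are
  \<open>(h \<otimes> d, inv d \<otimes> k)\<close> with \<open>d\<close> in the intersection.
  Neither factor has to normalize the other, so the formula also bounds orders when the product set
  is not a subgroup.\<close>

lemma card_set_mult:
  assumes "sg H" "sg K"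
  shows "card (H <#> K) * card (H \<inter> K) = card H * card K"
proof -
  define f where "f = (\<lambda>(h, k). h \<otimes> k)"
  have "card {z \<in> H \<times> K. f z = f w} = card (H \<inter> K)" if wHK: "w \<in> H \<times> K" for w
  proof -
    obtain h k where w: "w = (h, k)" "h \<in> H" "k \<in> K" using wHK by auto
    have c: "h \<in> carrier G" "k \<in> carrier G" using w assms sg_mem by auto
    have "{z \<in> H \<times> K. f z = f w} = (\<lambda>d. (h \<otimes> d, inv d \<otimes> k)) ` (H \<inter> K)"
    proof (intro equalityI subsetI)
      fix z assume "z \<in> {z \<in> H \<times> K. f z = f w}"
      then obtain h' k' where z: "z = (h', k')" "h' \<in> H" "k' \<in> K" "h' \<otimes> k' = h \<otimes> k" by (auto simp: f_def w)
      have c': "h' \<in> carrier G" "k' \<in> carrier G" using z assms sg_mem by auto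
      define d where "d = inv h \<otimes> h'"
      have "d \<in> H" using z w assms by (simp add: d_def sg_mult sg_inv)
      have "h' = h \<otimes> d" using c c' by (simp add: d_def m_assoc[symmetric])
      have "d \<otimes> k' = k" using z c c' by (simp add: d_def m_assoc) (simp add: m_assoc[symmetric])
      then have "d = k \<otimes> inv k'" using c c' d_def inv_solve_right by auto
      then have "d \<in> K" using z w assms by (simp add: sg_mult sg_inv)
      have "k' = inv d \<otimes> k" using \<open>d \<otimes> k' = k\<close> c c' d_def inv_solve_left by auto
      then show "z \<in> (\<lambda>d. (h \<otimes> d, inv d \<otimes> k)) ` (H \<inter> K)"
        using \<open>d \<in> H\<close> \<open>d \<in> K\<close> \<open>h' = h \<otimes> d\<close> z by blast
    next
      fix z assume "z \<in> (\<lambda>d. (h \<otimes> d, inv d \<otimes> k)) ` (H \<inter> K)"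
      then obtain d where d: "d \<in> H" "d \<in> K" "z = (h \<otimes> d, inv d \<otimes> k)" by blast
      have dc: "d \<in> carrier G" using d assms sg_mem by auto
      have "h \<otimes> d \<otimes> (inv d \<otimes> k) = h \<otimes> (d \<otimes> inv d) \<otimes> k" using c dc by (simp only: m_assoc inv_closed m_closed)
      then have "h \<otimes> d \<otimes> (inv d \<otimes> k) = h \<otimes> k" using c dc by simp
      then show "z \<in> {z \<in> H \<times> K. f z = f w}" using d w assms by (simp add: f_def sg_mult sg_inv)
    qed
    moreover have "inj_on (\<lambda>d. (h \<otimes> d, inv d \<otimes> k)) (H \<inter> K)"
      using c assms sg_mem by (auto simp: inj_on_def)
    ultimately show ?thesis by (simp add: card_image)
  qed
  from card_eq_card_image_times[OF _ this]
  have "card (H \<times> K) = card (f ` (H \<times> K)) * card (H \<inter> K)" using assms sg_fin by blast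
  moreover have "f ` (H \<times> K) = H <#> K" by (force simp: f_def set_mult_def)
  ultimately show ?thesis by (simp add: card_cartesian_product)
qed

lemma sg_set_mult:
  assumes "sg H" "sg K" "H \<subseteq> norm K"
  shows "sg (H <#> K)"
proof (rule sgI)
  show "H <#> K \<subseteq> carrier G" using assms sg_sub by (simp add: set_mult_closed)
  show "H <#> K \<noteq> {}" using sg_ne assms by (auto simp: set_mult_def)
  fix u v assume "u \<in> H <#> K" "v \<in> H <#> K"
  then obtain h k h' k' where hk: "h \<in> H" "k \<in> K" "h' \<in> H" "k' \<in> K" "u = h \<otimes> k" "v = h' \<otimes> k'"
    by (auto simp: set_mult_def)
  have c: "h \<in> carrier G" "k \<in> carrier G" "h' \<in> carrier G" "k' \<in> carrier G"
    using hk assms sg_mem by auto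
  have "inv h' \<in> norm K" using sg_inv[OF assms(1) hk(3)] assms by blast
  then have "cj (inv h') K = K" by (simp add: norm_def)
  then have "inv h' \<otimes> k \<otimes> inv (inv h') \<in> K" using hk by (auto simp: cj_def)
  then have "inv h' \<otimes> k \<otimes> h' \<in> K" using c by simp
  then have "inv h' \<otimes> k \<otimes> h' \<otimes> k' \<in> K" using hk assms sg_mult by blast
  moreover have "h \<otimes> h' \<in> H" using hk assms sg_mult by blast
  moreover have "u \<otimes> v = (h \<otimes> h') \<otimes> (inv h' \<otimes> k \<otimes> h' \<otimes> k')"
  proof -
    have "h' \<otimes> (inv h' \<otimes> (k \<otimes> (h' \<otimes> k'))) = k \<otimes> (h' \<otimes> k')" using c by (simp add: m_assoc[symmetric])
    then show ?thesis using c hk by (simp add: m_assoc)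
  qed
  ultimately show "u \<otimes> v \<in> H <#> K" by (auto simp: set_mult_def)
qed

lemma set_mult_upper:
  assumes "sg H" "sg K" shows "H \<subseteq> H <#> K" "K \<subseteq> H <#> K"
proof -
  show "H \<subseteq> H <#> K"
  proof
    fix x assume "x \<in> H"
    then have "x = x \<otimes> \<one>" using assms sg_mem by simp
    then show "x \<in> H <#> K" using \<open>x \<in> H\<close> sg_ne[OF assms(2)] unfolding set_mult_def by blast
  qed
  show "K \<subseteq> H <#> K"
  proof
    fix x assume "x \<in> K"
    then have "x = \<one> \<otimes> x" using assms sg_mem by simp
    then show "x \<in> H <#> K" using \<open>x \<in> K\<close> sg_ne[OF assms(1)] unfolding set_mult_def by blast
  qed
qed

lemma set_mult_least: "sg M \<Longrightarrow> H \<subseteq> M \<Longrightarrow> K \<subseteq> M \<Longrightarrow> H <#> K \<subseteq> M"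
  by (auto simp: set_mult_def sg_mult subset_iff)

section \<open>Sylow theorems for subgroups of the fixed group\<close>

lemma ex_prime_power_sg:
  assumes "prime (p::nat)" "sg M" "p ^ a dvd card M"
  shows "\<exists>H. sg H \<and> H \<subseteq> M \<and> card H = p ^ a"
proof -
  obtain m where m: "card M = p ^ a * m" using assms(3) by blast
  interpret K: fin_group "G\<lparr>carrier := M\<rparr>" by (rule sg_restrict[OF assms(2)])
  have "order (G\<lparr>carrier := M\<rparr>) = p ^ a * m" using m by (simp add: order_def)
  from sylow_thm[OF assms(1) K.is_group this] K.fin
  show ?thesis using sg_restrict_iff[OF assms(2)] by auto
qed

lemma ex_psyl:
  assumes "prime (p::nat)" "sg M" shows "\<exists>P. psyl p P M"
proof -
  have z: "card M \<noteq> 0" using sg_card_pos assms by (metis neq0_conv)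
  obtain H where H: "sg H" "H \<subseteq> M" "card H = p ^ multiplicity p (card M)"
    using ex_prime_power_sg[OF assms multiplicity_dvd] by blast
  have "\<not> p dvd card M div card H"
    unfolding H(3) using z multiplicity_decompose assms(1) by (metis not_prime_unit)
  then show ?thesis using H unfolding psyl_def by blast
qed

lemma psyl_index:
  assumes "psyl p P M" "sg M" obtains i where "card M = card P * i" "\<not> p dvd i" "i > 0"
proof -
  have "card P dvd card M" using assms card_dvd by (simp add: psyl_def)
  then have "card M = card P * (card M div card P)" by simp
  moreover have "card M div card P > 0" using calculation sg_card_pos[OF assms(2)] by (metis mult_0_right neq0_conv)
  ultimately show ?thesis using that assms by (auto simp: psyl_def)
qed

text \<open>The product \<open>Q <#> P\<close> is again a \<open>p\<close>-group, and its order
  divides that of \<open>M\<close>, in which the order of \<open>P\<close> is already the full power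
  of \<open>p\<close>.\<close>

lemma psyl_max:
  assumes p: "prime (p::nat)" and P: "psyl p P M" and M: "sg M"
    and Q: "sg Q" "Q \<subseteq> M" "card Q = p ^ n" "Q \<subseteq> norm P"
  shows "Q \<subseteq> P"
proof -
  have PG: "sg P" "P \<subseteq> M" using P by (auto simp: psyl_def)
  obtain a where a: "card P = p ^ a" using P by (auto simp: psyl_def)
  have s: "sg (Q <#> P)" using sg_set_mult Q PG by blast
  have le: "Q <#> P \<subseteq> M" using set_mult_least M Q PG by blast
  have "card (Q <#> P) dvd card Q * card P" using card_set_mult[OF Q(1) PG(1)] by (metis dvd_triv_left)
  then have "card (Q <#> P) dvd p ^ (n + a)" using Q a by (simp add: power_add)
  then obtain b where b: "card (Q <#> P) = p ^ b" using p divides_primepow_nat by blast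
  obtain i where i: "card M = card P * i" "\<not> p dvd i" using psyl_index[OF P M] by blast
  have "p ^ b dvd p ^ a * i" using card_dvd[OF s M le] b i a by simp
  moreover have "coprime (p ^ b) i" using i p by (simp add: prime_imp_coprime coprime_power_left_iff)
  ultimately have "p ^ b dvd p ^ a" by (simp add: coprime_dvd_mult_left_iff)
  then have "p ^ b \<le> p ^ a" using p by (simp add: dvd_imp_le prime_gt_0_nat)
  then have "P = Q <#> P" using card_eqI[OF PG(1) s] set_mult_upper[OF Q(1) PG(1)] a b by simp
  then show ?thesis using set_mult_upper[OF Q(1) PG(1)] by simp
qed

lemma orb_sg: "sg H \<Longrightarrow> sg M \<Longrightarrow> K \<in> orb M H \<Longrightarrow> sg K"
  by (auto simp: orb_def sg_cj sg_mem)

lemma orb_closed: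
  "H \<subseteq> carrier G \<Longrightarrow> sg M \<Longrightarrow> K \<in> orb M H \<Longrightarrow> x \<in> M \<Longrightarrow> cj x K \<in> orb M H"
  by (auto simp: orb_def cj_cj sg_mem sg_mult)

lemma orb_sub: "H \<subseteq> carrier G \<Longrightarrow> sg M \<Longrightarrow> K \<in> orb M H \<Longrightarrow> K \<subseteq> carrier G"
  unfolding orb_def using cj_sub sg_mem by blast

lemma finite_orb: "sg M \<Longrightarrow> finite (orb M H)"
  by (simp add: orb_def sg_fin)

lemma orb_self: "H \<subseteq> carrier G \<Longrightarrow> sg M \<Longrightarrow> H \<in> orb M H"
  unfolding orb_def using sg_ne cj_one by (metis image_eqI)

lemma psyl_cj: "psyl p P M \<Longrightarrow> sg M \<Longrightarrow> x \<in> M \<Longrightarrow> psyl p (cj x P) M"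
  unfolding psyl_def
  by (metis card_cj cj_mono cj_self sg_cj sg_mem sg_sub)

text \<open>\<open>Q\<close> acts on the \<open>M\<close>-conjugates of \<open>P\<close>. Their
  number divides the index of \<open>P\<close>, hence is prime to \<open>p\<close>, so
  \<open>Q\<close> normalizes some conjugate and lies in it by \<open>psyl_max\<close>.\<close>

lemma sylow2:
  assumes p: "prime (p::nat)" and P: "psyl p P M" and M: "sg M"
    and Q: "sg Q" "Q \<subseteq> M" "card Q = p ^ n"
  shows "\<exists>x\<in>M. Q \<subseteq> cj x P"
proof -
  have PG: "sg P" "P \<subseteq> M" "P \<subseteq> carrier G" using P sg_sub by (auto simp: psyl_def)
  have d: "p dvd card {f \<in> orb M P. \<not> Q \<subseteq> norm f}"
    by (rule fixed_points[OF p Q(1,3) finite_orb[OF M]])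
      (erule orb_sub[OF PG(3) M], erule orb_closed[OF PG(3) M], erule subsetD[OF Q(2)])
  obtain i where i: "card M = card P * i" "\<not> p dvd i" using psyl_index[OF P M] by blast
  have "P \<subseteq> M \<inter> norm P" using PG(2) sub_norm[OF PG(1)] by simp
  then have "card P dvd card (M \<inter> norm P)" using card_dvd[OF PG(1) sg_Int[OF M sg_norm[OF PG(3)]]] by simp
  then obtain c where c: "card (M \<inter> norm P) = card P * c" by blast
  have "card (orb M P) * (card P * c) = card P * i"
    using orbit_stab[OF M PG(3)] c i by metis
  then have "card (orb M P) * c = i" using sg_card_pos[OF PG(1)] by simp
  then have "\<not> p dvd card (orb M P)" using i by auto
  then have "{f \<in> orb M P. \<not> Q \<subseteq> norm f} \<noteq> orb M P" using d by metis
  then obtain f where f: "f \<in> orb M P" "Q \<subseteq> norm f" by blast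
  then obtain x where x: "x \<in> M" "f = cj x P" by (auto simp: orb_def)
  have "Q \<subseteq> f" using psyl_max[OF p psyl_cj[OF P M x(1)] M Q] f x by simp
  then show ?thesis using x by blast
qed

text \<open>In the action of \<open>P\<close> on its own conjugates only \<open>P\<close> is fixed,
  by \<open>psyl_max\<close>.\<close>

lemma sylow3:
  assumes p: "prime (p::nat)" and P: "psyl p P M" and M: "sg M"
  shows "card (orb M P) mod p = 1"
proof -
  have PG: "sg P" "P \<subseteq> M" "P \<subseteq> carrier G" using P sg_sub by (auto simp: psyl_def)
  obtain a where a: "card P = p ^ a" using P by (auto simp: psyl_def)
  have d: "p dvd card {f \<in> orb M P. \<not> P \<subseteq> norm f}"
    by (rule fixed_points[OF p PG(1) a finite_orb[OF M]])
      (erule orb_sub[OF PG(3) M], erule orb_closed[OF PG(3) M], erule subsetD[OF PG(2)])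
  have "f = P" if f: "f \<in> orb M P" "P \<subseteq> norm f" for f
  proof -
    obtain x where x: "x \<in> M" "f = cj x P" using f by (auto simp: orb_def)
    have "P \<subseteq> f" using psyl_max[OF p psyl_cj[OF P M x(1)] M PG(1,2) a] f x by simp
    then show ?thesis using card_eqI[OF PG(1)] x sg_cj card_cj PG sg_mem[OF M] by (metis order_refl)
  qed
  moreover have "P \<in> orb M P" "P \<subseteq> norm P" using orb_self PG M sub_norm by auto
  ultimately have "orb M P = insert P {f \<in> orb M P. \<not> P \<subseteq> norm f}" "P \<notin> {f \<in> orb M P. \<not> P \<subseteq> norm f}" by auto
  then have "card (orb M P) = Suc (card {f \<in> orb M P. \<not> P \<subseteq> norm f})"
    by (metis (no_types, lifting) card_insert_disjoint finite_insert finite_orb[OF M])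
  then show ?thesis using d prime_gt_1_nat[OF p] by (auto elim!: dvdE simp: mod_Suc)
qed

text \<open>The normalizer inside \<open>K\<close> lies between \<open>M\<close> and
  \<open>K\<close>. This dichotomy drives the counting in the later sections.\<close>

lemma maxin_norm:
  assumes "maxin M K" shows "K \<inter> norm M = M \<or> K \<subseteq> norm M"
proof -
  have "sg (K \<inter> norm M)" "M \<subseteq> K \<inter> norm M"
    using assms sub_norm sg_norm sg_Int sg_sub by (auto simp: maxin_def)
  then show ?thesis using assms unfolding maxin_def by blast
qed

text \<open>If \<open>M\<close> were self-normalizing in \<open>K\<close>, it would be the only
  fixed point of its action on its conjugates; their number would be a power of \<open>p\<close>
  that is 1 modulo \<open>p\<close>, and \<open>M\<close> would equal \<open>K\<close>. For the
  index, a single element whose \<open>p\<close>-th power lies in \<open>M\<close> is adjoined to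
  the normal subgroup \<open>M\<close>.\<close>

lemma maxin_pgroup:
  assumes p: "prime (p::nat)" and K: "card K = p ^ n" and M: "maxin M K"
  shows "K \<subseteq> norm M" "card K = p * card M"
proof -
  have sM: "sg M" "sg K" "M \<subset> K" using M by (auto simp: maxin_def)
  have MG: "M \<subseteq> carrier G" using sg_sub sM by auto
  obtain a where a: "card M = p ^ a" using card_dvd[of M K] sM K divides_primepow_nat p by (metis less_imp_le)
  show n: "K \<subseteq> norm M"
  proof (rule ccontr)
    assume nn: "\<not> K \<subseteq> norm M"
    then have KM: "K \<inter> norm M = M" using maxin_norm[OF M] by blast
    have d: "p dvd card {f \<in> orb K M. \<not> M \<subseteq> norm f}"
      by (rule fixed_points[OF p sM(1) a finite_orb[OF sM(2)]])
        (erule orb_sub[OF MG sM(2)], erule orb_closed[OF MG sM(2)], erule subsetD[OF psubset_imp_subset[OF sM(3)]])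
    have "f = M" if f: "f \<in> orb K M" "M \<subseteq> norm f" for f
    proof -
      obtain x where x: "x \<in> K" "f = cj x M" using f by (auto simp: orb_def)
      have xG: "x \<in> carrier G" using x sM sg_mem by blast
      have "K \<inter> norm f = cj x (K \<inter> norm M)"
      proof -
        have "norm f = cj x (norm M)" using norm_cj xG MG x by simp
        moreover have "cj x (A \<inter> B) = cj x A \<inter> cj x B" if "A \<subseteq> carrier G" "B \<subseteq> carrier G" for A B
          unfolding cj_def by (rule inj_on_image_Int[of _ "carrier G"]) (use that xG in \<open>auto simp: inj_on_def\<close>)
        ultimately show ?thesis using cj_self[OF sM(2) x(1)] norm_sub sg_sub[OF sM(2)] by metis
      qed
      then have "K \<inter> norm f = f" using KM x by simp
      then have "M \<subseteq> f" using f(2) psubset_imp_subset[OF sM(3)] by auto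
      then show ?thesis using card_eqI[OF sM(1)] x sg_cj card_cj MG sM xG by (metis order_refl)
    qed
    moreover have "M \<in> orb K M" "M \<subseteq> norm M" using orb_self MG sM sub_norm by auto
    ultimately have "orb K M = insert M {f \<in> orb K M. \<not> M \<subseteq> norm f}" "M \<notin> {f \<in> orb K M. \<not> M \<subseteq> norm f}" by auto
    then have "card (orb K M) = Suc (card {f \<in> orb K M. \<not> M \<subseteq> norm f})"
      by (metis (no_types, lifting) card_insert_disjoint finite_insert finite_orb[OF sM(2)])
    then have np: "\<not> p dvd card (orb K M)" using d p dvd_add_right_iff[of p "card {f \<in> orb K M. \<not> M \<subseteq> norm f}" 1] by auto
    have os: "card (orb K M) * card M = p ^ n" using orbit_stab[OF sM(2) MG] KM K by simp
    then obtain i where "card (orb K M) = p ^ i" using divides_primepow_nat p by (metis dvd_triv_left)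
    then have "card (orb K M) = 1" using np by (cases i) auto
    then have "card M = card K" using os K by simp
    then show False using sM card_eqI by (metis order_refl psubset_eq)
  qed
  have pd: "p dvd card K div card M"
  proof -
    obtain i where i: "card K = card M * i" using card_dvd[of M K] sM by blast
    then have "i dvd p ^ n" using K by (metis dvd_triv_right)
    then obtain e where e: "i = p ^ e" using divides_primepow_nat p by blast
    have "e \<noteq> 0" using i e sM card_eqI by (metis mult.right_neutral order_refl power_0 psubset_eq)
    then show ?thesis using i e sg_card_pos[OF sM(1)] by simp
  qed
  have "p ^ Suc a dvd card K"
    using pd a card_dvd[of M K] sM by (metis dvd_div_iff_mult less_imp_le mult.commute not_gr_zero power_Suc sg_card_pos)
  obtain x where x: "x \<in> K" "x \<notin> M" using sM by blast
  have xG: "x \<in> carrier G" using x sM sg_mem by blast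
  have ex: "\<exists>i. x [^] (p ^ i) \<in> M"
  proof -
    interpret Kg: fin_group "G\<lparr>carrier := K\<rparr>" by (rule sg_restrict[OF sM(2)])
    have "x [^]\<^bsub>G\<lparr>carrier := K\<rparr>\<^esub> order (G\<lparr>carrier := K\<rparr>) = \<one>"
      using Kg.pow_order_eq_1[of x] x by simp
    then have "x [^] (p ^ n) = \<one>" using K by (simp add: nat_pow_consistent[symmetric] order_def)
    then show ?thesis using sg_ne sM by metis
  qed
  \<comment> \<open>The element \<open>y\<close> below is the last one outside \<open>M\<close> in
    the sequence of iterated \<open>p\<close>-th powers of \<open>x\<close>.\<close>
  define i where "i = (LEAST i. x [^] (p ^ i) \<in> M)"
  have i: "x [^] (p ^ i) \<in> M" unfolding i_def using LeastI_ex[OF ex] .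
  have "i \<noteq> 0" using i x xG by (cases i) auto
  define y where "y = x [^] (p ^ (i - 1))"
  have y: "y \<notin> M" using not_less_Least[of "i - 1" "\<lambda>i. x [^] (p ^ i) \<in> M"] \<open>i \<noteq> 0\<close> by (simp add: y_def i_def)
  have yK: "y \<in> K" using x sM sg_pow by (simp add: y_def)
  have yG: "y \<in> carrier G" using xG by (simp add: y_def)
  have yp: "y [^] p \<in> M"
  proof -
    have "y [^] p = x [^] (p ^ i)" using xG \<open>i \<noteq> 0\<close> by (simp add: y_def nat_pow_pow power_eq_if mult.commute)
    then show ?thesis using i by simp
  qed
  \<comment> \<open>The union of the cosets of \<open>M\<close> by \<open>y [^] j\<close> with
    \<open>j < p\<close>. It is a subgroup, so it is \<open>K\<close> by maximality, and it has at
    most \<open>p * card M\<close> elements.\<close>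
  define Y where "Y = (\<lambda>(m, j). m \<otimes> y [^] j) ` (M \<times> {..<p})"
  have pw: "y [^] (j::nat) \<in> norm M" for j using yK n sM sg_pow by (meson subsetD)
  have Ymem: "m \<otimes> y [^] j \<in> Y" if m: "m \<in> M" for m and j :: nat
    using m
  proof (induction j arbitrary: m rule: less_induct)
    case (less j)
    show ?case
    proof (cases "j < p")
      case True then show ?thesis using less.prems unfolding Y_def by force
    next
      case False
      have "y [^] j = y [^] p \<otimes> y [^] (j - p)" using False yG by (simp add: nat_pow_mult)
      then have "m \<otimes> y [^] j = (m \<otimes> y [^] p) \<otimes> y [^] (j - p)"
        using yG less.prems sM sg_mem by (simp add: m_assoc)
      moreover have "m \<otimes> y [^] p \<in> M" using less yp sM sg_mult by blast
      moreover have "j - p < j" using False p prime_gt_0_nat by (metis diff_less less_le_trans not_less)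
      ultimately show ?thesis using less.IH[of "j - p"] by simp
    qed
  qed
  have "sg Y"
  proof (rule sgI)
    show "Y \<subseteq> carrier G" using sM sg_mem yG by (auto simp: Y_def)
    show "Y \<noteq> {}" using Ymem sg_ne sM by blast
    fix u v assume "u \<in> Y" "v \<in> Y"
    then obtain m j m' j' where u: "m \<in> M" "m' \<in> M" "u = m \<otimes> y [^] (j::nat)" "v = m' \<otimes> y [^] (j'::nat)"
      by (auto simp: Y_def)
    have c: "m \<in> carrier G" "m' \<in> carrier G" using u sM sg_mem by auto
    have "y [^] j \<otimes> m' \<otimes> inv (y [^] j) \<in> M" using pw[of j] u by (auto simp: norm_def cj_def)
    then have "m \<otimes> (y [^] j \<otimes> m' \<otimes> inv (y [^] j)) \<in> M" using u sM sg_mult by blast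
    from Ymem[OF this, of "j + j'"]
    have "m \<otimes> (y [^] j \<otimes> m' \<otimes> inv (y [^] j)) \<otimes> y [^] (j + j') \<in> Y" .
    moreover have "inv (y [^] j) \<otimes> y [^] (j + j') = y [^] j'"
      using yG by (simp add: nat_pow_mult[symmetric] m_assoc[symmetric])
    ultimately show "u \<otimes> v \<in> Y" using u c yG by (simp add: m_assoc)
  qed
  have "M \<subseteq> Y" using Ymem[of _ 0] sM sg_mem by force
  have "y \<in> Y" using Ymem[of \<one> 1] sg_ne sM yG by simp
  have "Y \<subseteq> K" using sM yK by (auto simp: Y_def intro!: sg_mult[OF sM(2)] sg_pow[OF sM(2)])
  then have "Y = K" using M \<open>sg Y\<close> \<open>M \<subseteq> Y\<close> \<open>y \<in> Y\<close> y unfolding maxin_def by blast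
  moreover have "card Y \<le> card M * p"
    unfolding Y_def using card_image_le[of "M \<times> {..<p}"] sg_fin sM by (metis card_cartesian_product card_lessThan finite_cartesian_product finite_lessThan)
  ultimately have "card K \<le> card M * p" by simp
  moreover have "card K \<ge> p * card M" using \<open>p ^ Suc a dvd card K\<close> a sM sg_card_pos dvd_imp_le by (metis power_Suc)
  ultimately show "card K = p * card M" by (simp add: mult.commute)
qed

lemma ex_maxin:
  assumes "sg H" "sg K" "H \<subset> K" shows "\<exists>M. maxin M K \<and> H \<subseteq> M"
proof -
  let ?S = "{M. sg M \<and> H \<subseteq> M \<and> M \<subset> K}"
  have "finite ?S" "H \<in> ?S" using finite_sgs assms by auto
  then obtain M where M: "M \<in> ?S" and m: "\<And>b. b \<in> ?S \<Longrightarrow> M \<subseteq> b \<Longrightarrow> M = b" using finite_has_maximal[of ?S] by (metis (no_types, lifting) empty_iff)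
  have "L = M \<or> L = K" if "sg L" "M \<subseteq> L" "L \<subseteq> K" for L
    using m[of L] M that by auto
  then show ?thesis using M assms(2) unfolding maxin_def by auto
qed

text \<open>The conjugate of \<open>P\<close> by \<open>g\<close> is another Sylow subgroup of the
  normal subgroup \<open>M\<close>, hence also the conjugate by some \<open>x\<close> in
  \<open>M\<close>; then \<open>inv x \<otimes> g\<close> normalizes \<open>P\<close>.\<close>

lemma frattini:
  assumes p: "prime (p::nat)" and P: "psyl p P M" and M: "sg M" "carrier G \<subseteq> norm M"
  shows "carrier G = M <#> norm P"
proof
  have PG: "sg P" "P \<subseteq> M" "P \<subseteq> carrier G" using P sg_sub by (auto simp: psyl_def)
  show "M <#> norm P \<subseteq> carrier G" using M sg_sub norm_sub by (simp add: set_mult_closed)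
  show "carrier G \<subseteq> M <#> norm P"
  proof
    fix g assume g: "g \<in> carrier G"
    have le: "cj g P \<subseteq> M" using cj_mono[OF PG(2), of g] M(2) g by (auto simp: norm_def)
    obtain a where "card P = p ^ a" using P by (auto simp: psyl_def)
    then have "card (cj g P) = p ^ a" using card_cj g PG by simp
    from sylow2[OF p P M(1) sg_cj[OF g PG(1)] le this]
    obtain x where x: "x \<in> M" "cj g P \<subseteq> cj x P" by blast
    have xG: "x \<in> carrier G" using x M sg_mem by blast
    have "cj g P = cj x P" using card_eqI[OF sg_cj sg_cj] x g xG PG card_cj by (metis order_refl)
    then have "cj (inv x \<otimes> g) P = P" using g xG PG by (metis cj_cj cj_inv_cj inv_closed)
    then have "inv x \<otimes> g \<in> norm P" using g xG by (simp add: norm_def)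
    moreover have "g = x \<otimes> (inv x \<otimes> g)" using g xG by (simp add: m_assoc[symmetric])
    ultimately show "g \<in> M <#> norm P" using x unfolding set_mult_def by blast
  qed
qed

end

section \<open>Cyclic subgroups\<close>

lemma num_subgroups_cong_iso:
  assumes "G \<cong> H" "group G" "group H"
  shows "num_subgroups G = num_subgroups H"
proof -
  obtain h where h: "h \<in> iso G H" using assms(1) by (auto simp: is_iso_def)
  then interpret h: group_hom G H h
    using assms by (simp add: group_hom_def group_hom_axioms_def iso_def)
  have bij: "bij_betw h (carrier G) (carrier H)" using h by (simp add: iso_def)
  have "bij_betw ((`) h) {K. subgroup K G} {K. subgroup K H}"
  proof (rule bij_betw_imageI)
    show "inj_on ((`) h) {K. subgroup K G}"
    proof (rule inj_onI)
      fix K L assume "K \<in> {K. subgroup K G}" "L \<in> {K. subgroup K G}" "h ` K = h ` L"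
      then show "K = L"
        using inj_on_image_eq_iff[of h "carrier G" K L] bij subgroup.subset[of K G] subgroup.subset[of L G]
        by (simp add: bij_betw_def)
    qed
    show "(`) h ` {K. subgroup K G} = {K. subgroup K H}"
    proof (intro equalityI subsetI)
      fix K assume "K \<in> (`) h ` {K. subgroup K G}"
      then show "K \<in> {K. subgroup K H}" using h.subgroup_img_is_subgroup by auto
    next
      fix K assume K: "K \<in> {K. subgroup K H}"
      define g where "g = inv_into (carrier G) h"
      have g: "g \<in> iso H G" unfolding g_def using assms(2) h by (rule group.iso_set_sym)
      then interpret g: group_hom H G g
        using assms by (simp add: group_hom_def group_hom_axioms_def iso_def)
      have "subgroup (g ` K) G" using K g.subgroup_img_is_subgroup by auto
      moreover have "h ` g ` K = K"
      proof -
        have "h (g x) = x" if "x \<in> K" for x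
          using that K subgroup.subset bij unfolding g_def bij_betw_def by (metis f_inv_into_f mem_Collect_eq subsetD)
        then show ?thesis by (force simp: image_iff)
      qed
      ultimately show "K \<in> (`) h ` {K. subgroup K G}" by (metis image_eqI mem_Collect_eq)
    qed
  qed
  then show ?thesis unfolding num_subgroups_def by (rule bij_betw_same_card)
qed

context fin_group
begin

text \<open>Natural exponents suffice because the group is finite, and they keep the exponent
  arithmetic in \<open>nat\<close>.\<close>

definition cyc :: "'a \<Rightarrow> 'a set" where
  "cyc x = range (\<lambda>i::nat. x [^] i)"

lemma cyc_pow: "x [^] (i::nat) \<in> cyc x"
  by (auto simp: cyc_def)

lemma cycE: "y \<in> cyc x \<Longrightarrow> (\<And>i::nat. y = x [^] i \<Longrightarrow> thesis) \<Longrightarrow> thesis"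
  by (auto simp: cyc_def)

lemma cyc_self: "x \<in> carrier G \<Longrightarrow> x \<in> cyc x"
  using cyc_pow[of x 1] by simp

lemma cyc_carrier: "x \<in> carrier G \<Longrightarrow> cyc x \<subseteq> carrier G"
  by (auto simp: cyc_def)

lemma sg_cyc: "x \<in> carrier G \<Longrightarrow> sg (cyc x)"
  by (rule sgI) (auto simp: cyc_def nat_pow_mult)

lemma cyc_least: "sg H \<Longrightarrow> x \<in> H \<Longrightarrow> cyc x \<subseteq> H"
  by (auto simp: cyc_def sg_pow)

lemma cyc_commute: "x \<in> carrier G \<Longrightarrow> u \<in> cyc x \<Longrightarrow> v \<in> cyc x \<Longrightarrow> u \<otimes> v = v \<otimes> u"
  by (elim cycE) (simp add: nat_pow_mult add.commute)

lemma pow_eq_cong: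
  assumes "x \<in> carrier G"
  shows "x [^] (m::nat) = x [^] (n::nat) \<longleftrightarrow> [m = n] (mod ord x)"
proof -
  have "x [^] m = x [^] n \<longleftrightarrow> int (ord x) dvd (int n - int m)"
    using int_pow_eq[OF assms, of "int m" "int n"] by (simp add: int_pow_int)
  also have "\<dots> \<longleftrightarrow> [int n = int m] (mod int (ord x))" by (simp add: cong_iff_dvd_diff)
  also have "\<dots> \<longleftrightarrow> [m = n] (mod ord x)" by (metis cong_int_iff cong_sym)
  finally show ?thesis .
qed

lemma card_cyc: assumes "x \<in> carrier G" shows "card (cyc x) = ord x"
proof -
  have "cyc x = (\<lambda>i::nat. x [^] i) ` {..<ord x}"
  proof (intro equalityI subsetI)
    fix y assume "y \<in> cyc x"
    then obtain i :: nat where "y = x [^] i" by (rule cycE)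
    also have "\<dots> = x [^] (i mod ord x)" by (subst pow_eq_cong[OF assms]) (simp add: cong_def)
    finally show "y \<in> (\<lambda>i::nat. x [^] i) ` {..<ord x}" using ord_pos[OF assms] by simp
  qed (auto simp: cyc_def)
  moreover have "inj_on (\<lambda>i::nat. x [^] i) {..<ord x}"
    by (auto simp: inj_on_def pow_eq_cong[OF assms] cong_def)
  ultimately show ?thesis by (simp add: card_image)
qed

lemma ord_dvd_card: "sg H \<Longrightarrow> x \<in> H \<Longrightarrow> ord x dvd card H"
  using card_dvd[of "cyc x" H] cyc_least sg_cyc card_cyc sg_mem by metis

text \<open>The number \<open>d\<close> is the order of \<open>x\<close> modulo \<open>H\<close>; it
  makes sense without normality and takes the place of the quotient group.\<close>

lemma pow_mem_sg:
  assumes "sg H" "x \<in> carrier G"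
  obtains d :: nat where "d > 0" "\<And>n. x [^] n \<in> H \<longleftrightarrow> d dvd n" "d dvd ord x"
proof -
  define d where "d = (LEAST n::nat. n > 0 \<and> x [^] n \<in> H)"
  have "ord x > 0 \<and> x [^] ord x \<in> H" using ord_pos assms sg_ne by simp
  then have d: "d > 0 \<and> x [^] d \<in> H"
    unfolding d_def by (rule LeastI)
  have iff: "x [^] n \<in> H \<longleftrightarrow> d dvd n" for n
  proof
    assume n: "x [^] n \<in> H"
    have "x [^] n = x [^] (n mod d) \<otimes> (x [^] d) [^] (n div d)"
      using assms by (simp add: nat_pow_pow nat_pow_mult)
    then have "x [^] (n mod d) = x [^] n \<otimes> inv ((x [^] d) [^] (n div d))"
      using assms inv_solve_right by simp
    then have "x [^] (n mod d) \<in> H" using n d assms sg_mult sg_inv sg_pow by simp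
    then have "n mod d = 0" using not_less_Least[of "n mod d" "\<lambda>n. n > 0 \<and> x [^] n \<in> H"] d
      by (metis d_def mod_less_divisor neq0_conv)
    then show "d dvd n" by auto
  next
    assume "d dvd n"
    then obtain c where "n = d * c" by blast
    then show "x [^] n \<in> H" using d assms sg_pow[of H "x [^] d" c] by (simp add: nat_pow_pow)
  qed
  show ?thesis by (rule that[of d]) (use d iff in \<open>auto simp: iff[symmetric] assms sg_ne\<close>)
qed

lemma pow_in_cyc_pow:
  assumes "x \<in> carrier G" "d dvd ord x"
  shows "x [^] (n::nat) \<in> cyc (x [^] d) \<longleftrightarrow> d dvd n"
proof
  assume "x [^] n \<in> cyc (x [^] d)"
  then obtain i where "x [^] n = x [^] (d * i)" using assms by (auto simp: cyc_def nat_pow_pow)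
  then have "[n = d * i] (mod ord x)" using pow_eq_cong assms by blast
  then have "[n = d * i] (mod d)" using assms(2) cong_dvd_modulus_nat by blast
  then show "d dvd n" by (simp add: cong_def mod_eq_0_iff_dvd)
next
  assume "d dvd n"
  then show "x [^] n \<in> cyc (x [^] d)" using assms by (auto simp: cyc_def nat_pow_pow[symmetric])
qed

lemma cyc_Int:
  assumes "sg H" "x \<in> carrier G" "\<And>n::nat. x [^] n \<in> H \<longleftrightarrow> d dvd n" "d dvd ord x"
  shows "H \<inter> cyc x = cyc (x [^] d)"
proof
  show "H \<inter> cyc x \<subseteq> cyc (x [^] d)"
  proof
    fix y assume "y \<in> H \<inter> cyc x"
    then obtain n :: nat where "y = x [^] n" "y \<in> H" by (auto elim: cycE)
    then show "y \<in> cyc (x [^] d)" using assms(3)[of n] pow_in_cyc_pow[OF assms(2,4), of n] by simp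
  qed
  show "cyc (x [^] d) \<subseteq> H \<inter> cyc x"
    using cyc_least[OF sg_Int[OF assms(1) sg_cyc[OF assms(2)]], of "x [^] d"] assms(3)[of d] cyc_pow[of x d] by simp
qed

lemma sg_cyc_eq:
  assumes "sg H" "H \<subseteq> cyc x" "x \<in> carrier G"
  shows "\<exists>d. d dvd ord x \<and> H = cyc (x [^] d)"
proof -
  obtain d where d: "\<And>n. x [^] n \<in> H \<longleftrightarrow> d dvd n" "d dvd ord x"
    using pow_mem_sg[OF assms(1,3)] by metis
  have "H = cyc (x [^] d)"
  proof
    show "cyc (x [^] d) \<subseteq> H" using cyc_least assms d by simp
    show "H \<subseteq> cyc (x [^] d)"
    proof
      fix y assume "y \<in> H"
      then show "y \<in> cyc (x [^] d)" using assms(2) d pow_in_cyc_pow[OF assms(3) d(2)] by (metis cycE subsetD)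
    qed
  qed
  then show ?thesis using d by blast
qed

lemma card_sg_cyc:
  assumes "x \<in> carrier G"
  shows "card {H. sg H \<and> H \<subseteq> cyc x} = card {d. d dvd ord x}"
proof -
  have "bij_betw (\<lambda>d. cyc (x [^] d)) {d. d dvd ord x} {H. sg H \<and> H \<subseteq> cyc x}"
  proof (rule bij_betw_imageI)
    show "inj_on (\<lambda>d. cyc (x [^] d)) {d. d dvd ord x}"
    proof (rule inj_onI)
      fix d e assume "d \<in> {d. d dvd ord x}" "e \<in> {d. d dvd ord x}" "cyc (x [^] d) = cyc (x [^] e)"
      then have "e dvd d" "d dvd e" using pow_in_cyc_pow[OF assms] by (metis dvd_refl mem_Collect_eq)+
      then show "d = e" using dvd_antisym by blast
    qed
    show "(\<lambda>d. cyc (x [^] d)) ` {d. d dvd ord x} = {H. sg H \<and> H \<subseteq> cyc x}"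
    proof (intro equalityI subsetI)
      fix H assume "H \<in> (\<lambda>d. cyc (x [^] d)) ` {d. d dvd ord x}"
      then show "H \<in> {H. sg H \<and> H \<subseteq> cyc x}"
        using assms sg_cyc cyc_least[OF sg_cyc[OF assms] cyc_pow] by auto
    next
      fix H assume "H \<in> {H. sg H \<and> H \<subseteq> cyc x}"
      then show "H \<in> (\<lambda>d. cyc (x [^] d)) ` {d. d dvd ord x}" using sg_cyc_eq[of H x] assms by blast
    qed
  qed
  then show ?thesis using bij_betw_same_card by fastforce
qed

lemma cyc_card_unique:
  assumes "sg H" "H \<subseteq> cyc x" "sg K" "K \<subseteq> cyc x" "x \<in> carrier G" "card H = card K"
  shows "H = K"
proof -
  obtain d where d: "d dvd ord x" "H = cyc (x [^] d)" using sg_cyc_eq assms by blast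
  obtain e where e: "e dvd ord x" "K = cyc (x [^] e)" using sg_cyc_eq assms by blast
  have z: "d \<noteq> 0" "e \<noteq> 0" using d e ord_pos[OF assms(5)] by (metis dvd_0_left neq0_conv)+
  have "ord x div d = ord x div e" using d e assms z by (simp add: card_cyc ord_pow)
  then have q: "d * (ord x div e) = ord x" "e * (ord x div e) = ord x"
    using dvd_mult_div_cancel[OF d(1)] dvd_mult_div_cancel[OF e(1)] by simp_all
  then have "ord x div e \<noteq> 0" using ord_pos[OF assms(5)] by (metis mult_0_right neq0_conv)
  then have "d = e" using q by (metis mult_cancel2)
  then show ?thesis using d e by simp
qed

lemma cyc_pow_coprime:
  assumes "x \<in> carrier G" "coprime u (ord x)"
  shows "cyc (x [^] (u::nat)) = cyc x"
proof (rule card_eqI)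
  show "card (cyc x) \<le> card (cyc (x [^] u))"
  proof -
    have "coprime (ord x) u" using assms(2) by (metis coprime_commute)
    then have "gcd (ord x) u = 1" by (rule coprime_imp_gcd_eq_1)
    moreover have "ord (x [^] u) = ord x div gcd (ord x) u"
      using ord_pow_gen[OF assms(1), of u] ord_pos[OF assms(1)] by (cases "u = 0") auto
    ultimately show ?thesis using card_cyc assms(1) by (metis div_by_1 le_refl nat_pow_closed)
  qed
qed (use assms sg_cyc cyc_least cyc_pow in auto)

end

section \<open>Groups with a cyclic normal subgroup of prime index\<close>

text \<open>The exponent of \<open>a\<close> in the \<open>n\<close>-th power of
  \<open>a \<otimes> b\<close> when conjugation by \<open>b\<close> raises \<open>a\<close> to the
  power \<open>k\<close>.\<close>

definition geo :: "nat \<Rightarrow> nat \<Rightarrow> nat" where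
  "geo k n = (\<Sum>y<n. k ^ y)"

text \<open>The pair \<open>(d, t)\<close> encodes the subgroup generated by \<open>a^d\<close> and
  \<open>a^t b\<close>. The divisibility says that the \<open>p\<close>-th power of
  \<open>a^t b\<close>, which is \<open>a^(t * geo k p + j)\<close>, is a power of
  \<open>a^d\<close>, so that the subgroup meets \<open>cyc a\<close> in nothing more than
  \<open>cyc (a^d)\<close>.\<close>

definition mcpairs :: "nat \<Rightarrow> nat \<Rightarrow> nat \<Rightarrow> nat \<Rightarrow> (nat \<times> nat) set" where
  "mcpairs N p k j = {(d, t). d dvd N \<and> t < d \<and> d dvd t * geo k p + j}"

definition mcount :: "nat \<Rightarrow> nat \<Rightarrow> nat \<Rightarrow> nat \<Rightarrow> nat" where
  "mcount N p k j = card {d. d dvd N} + card (mcpairs N p k j)"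

text \<open>The relation \<open>ba\<close> makes \<open>cyc a\<close> normal. Only the residues of
  \<open>k\<close> and \<open>j\<close> modulo \<open>N\<close> matter; they are kept unreduced so
  that generators can be changed freely.\<close>

locale metacyc = fin_group G for G (structure) +
  fixes a b :: 'a and N p k j :: nat
  assumes aG: "a \<in> carrier G" and bG: "b \<in> carrier G"
    and ord_a: "ord a = N" and p: "Factorial_Ring.prime p"
    and order: "card (carrier G) = N * p"
    and b_notin: "b \<notin> cyc a"
    and bp: "b [^] p = a [^] j" and ba: "b \<otimes> a = a [^] k \<otimes> b"
begin

lemma N_pos: "N > 0"
  using ord_pos aG ord_a by blast

lemma sgA: "sg (cyc a)"
  using sg_cyc aG .

lemma apow_eq: "a [^] m = a [^] n \<longleftrightarrow> [m = n] (mod N)" for m n :: nat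
  using pow_eq_cong[OF aG] ord_a by simp

lemma b_apow: "b \<otimes> a [^] (i::nat) = a [^] (k * i) \<otimes> b"
proof (induction i)
  case (Suc i)
  have "b \<otimes> a [^] Suc i = a [^] (k * i) \<otimes> b \<otimes> a"
    using Suc aG bG by (simp add: m_assoc[symmetric])
  also have "\<dots> = a [^] (k * i) \<otimes> (a [^] k \<otimes> b)" using aG bG ba by (simp add: m_assoc)
  also have "\<dots> = a [^] (k * Suc i) \<otimes> b"
    using aG bG by (simp add: m_assoc[symmetric] nat_pow_mult add.commute)
  finally show ?case .
qed (use bG in simp)

lemma bpow_apow: "b [^] y \<otimes> a [^] i = a [^] (k ^ y * i) \<otimes> b [^] y" for y i :: nat
proof (induction y arbitrary: i)
  case (Suc y)
  have "b [^] Suc y \<otimes> a [^] i = b [^] y \<otimes> (b \<otimes> a [^] i)" using aG bG by (simp add: m_assoc)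
  also have "\<dots> = b [^] y \<otimes> a [^] (k * i) \<otimes> b" using b_apow aG bG by (simp add: m_assoc)
  also have "\<dots> = a [^] (k ^ Suc y * i) \<otimes> b [^] Suc y" using Suc aG bG by (simp add: m_assoc algebra_simps)
  finally show ?case .
qed (use aG in simp)

lemma elem_mult:
  "(a [^] i \<otimes> b [^] y) \<otimes> (a [^] i' \<otimes> b [^] y') = a [^] (i + k ^ y * i') \<otimes> b [^] (y + y')" for i y i' y' :: nat
proof -
  have "(a [^] i \<otimes> b [^] y) \<otimes> (a [^] i' \<otimes> b [^] y') = a [^] i \<otimes> (b [^] y \<otimes> a [^] i') \<otimes> b [^] y'"
    using aG bG by (simp add: m_assoc)
  also have "\<dots> = a [^] i \<otimes> a [^] (k ^ y * i') \<otimes> (b [^] y \<otimes> b [^] y')"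
    using aG bG bpow_apow by (simp add: m_assoc)
  finally show ?thesis using aG bG by (simp add: nat_pow_mult)
qed

lemma elem_pow:
  "(a [^] t \<otimes> b [^] v) [^] y = a [^] (t * geo (k ^ v) y) \<otimes> b [^] (v * y)" for t v y :: nat
proof (induction y)
  case (Suc y)
  have "(a [^] t \<otimes> b [^] v) [^] Suc y = (a [^] (t * geo (k ^ v) y) \<otimes> b [^] (v * y)) \<otimes> (a [^] t \<otimes> b [^] v)"
    using Suc by simp
  also have "\<dots> = a [^] (t * geo (k ^ v) y + k ^ (v * y) * t) \<otimes> b [^] (v * y + v)" by (rule elem_mult)
  also have "t * geo (k ^ v) y + k ^ (v * y) * t = t * geo (k ^ v) (Suc y)"
    by (simp add: geo_def algebra_simps power_mult)
  finally show ?case by (simp add: add.commute)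
qed (simp add: geo_def)

lemma bpow_mult_p: "b [^] (p * w) = a [^] (j * w)" for w :: nat
  using bp aG bG by (simp add: nat_pow_pow[symmetric])

lemma elem_bpow_p: "(a [^] t \<otimes> b) [^] (p * w) = a [^] ((t * geo k p + j) * w)" for t w :: nat
proof -
  have "(a [^] t \<otimes> b) [^] p = a [^] (t * geo k p + j)"
    using elem_pow[of t 1 p] bp aG bG by (simp add: nat_pow_mult)
  then show ?thesis using aG bG by (simp add: nat_pow_pow[symmetric])
qed

text \<open>An exact equation and not a congruence, because \<open>y * w\<close> is to serve as an
  exponent of \<open>b\<close>, and \<open>b^(p * u)\<close> is a power of \<open>a\<close>.\<close>

lemma inverse_mod_p: assumes "\<not> p dvd y" obtains w u :: nat where "y * w = 1 + p * u"
proof -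
  have "coprime y p" using assms p by (simp add: prime_imp_coprime coprime_commute)
  then obtain w where w: "[y * w = 1] (mod p)" using cong_solve_coprime_nat[of y p] by auto
  have "y * w \<noteq> 0"
  proof
    assume "y * w = 0"
    then have "p dvd 1" using w by (metis cong_0_iff cong_sym)
    then show False using p not_prime_unit by blast
  qed
  then obtain u where "y * w = 1 + p * u" using w cong_le_nat[of 1 "y * w" p] by (auto simp: cong_sym mult.commute)
  then show ?thesis using that by blast
qed

lemma mem_A_cancel: "x \<in> carrier G \<Longrightarrow> a [^] (i::nat) \<otimes> x \<in> cyc a \<longleftrightarrow> x \<in> cyc a"
proof
  assume x: "x \<in> carrier G" "a [^] i \<otimes> x \<in> cyc a"
  have "x = inv (a [^] i) \<otimes> (a [^] i \<otimes> x)" using x aG by (simp add: m_assoc[symmetric])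
  then show "x \<in> cyc a" using x sg_mult[OF sgA] sg_inv[OF sgA] cyc_pow by metis
qed (auto intro: sg_mult[OF sgA] cyc_pow)

lemma mem_A_cancel_right: "x \<in> carrier G \<Longrightarrow> x \<otimes> a [^] (i::nat) \<in> cyc a \<longleftrightarrow> x \<in> cyc a"
proof
  assume x: "x \<in> carrier G" "x \<otimes> a [^] i \<in> cyc a"
  have "x = (x \<otimes> a [^] i) \<otimes> inv (a [^] i)" using x aG by (simp add: m_assoc)
  then show "x \<in> cyc a" using x sg_mult[OF sgA] sg_inv[OF sgA] cyc_pow by metis
qed (auto intro: sg_mult[OF sgA] cyc_pow)

lemma bpow_mem: "b [^] (y::nat) \<in> cyc a \<longleftrightarrow> p dvd y"
proof
  assume y: "b [^] y \<in> cyc a"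
  show "p dvd y"
  proof (rule ccontr)
    assume "\<not> p dvd y"
    then obtain w u where wu: "y * w = 1 + p * u" by (rule inverse_mod_p)
    have "(b [^] y) [^] w = b \<otimes> a [^] (j * u)"
    proof -
      have "(b [^] y) [^] w = b [^] (1 + p * u)" using wu bG by (simp only: nat_pow_pow)
      also have "\<dots> = b \<otimes> b [^] (p * u)" using nat_pow_mult[OF bG, of 1 "p * u"] bG by simp
      finally show ?thesis using bpow_mult_p by simp
    qed
    moreover have "(b [^] y) [^] w \<in> cyc a" using sg_pow[OF sgA y] .
    ultimately show False using mem_A_cancel_right b_notin bG by metis
  qed
next
  assume "p dvd y"
  then show "b [^] y \<in> cyc a" using bpow_mult_p cyc_pow by auto
qed

text \<open>Reducing the exponent of \<open>b\<close> below \<open>p\<close> converts each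
  \<open>b^p\<close> into \<open>a^j\<close>. The criterion mentions only the parameters; together
  with \<open>elem_mult\<close> this makes them determine the group.\<close>

lemma elem_eq:
  "a [^] i \<otimes> b [^] y = a [^] i' \<otimes> b [^] y' \<longleftrightarrow>
     y mod p = y' mod p \<and> [i + j * (y div p) = i' + j * (y' div p)] (mod N)" for i y i' y' :: nat
proof -
  have red: "a [^] i \<otimes> b [^] y = a [^] (i + j * (y div p)) \<otimes> b [^] (y mod p)" for i y :: nat
  proof -
    have "b [^] y = b [^] (p * (y div p)) \<otimes> b [^] (y mod p)" using bG by (simp add: nat_pow_mult)
    then show ?thesis using aG bG by (simp add: bpow_mult_p m_assoc[symmetric] nat_pow_mult)
  qed
  have uniq: "y = y'" if "a [^] i \<otimes> b [^] y = a [^] i' \<otimes> b [^] y'" "y \<le> y'" "y' < p" for i y i' y' :: nat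
  proof -
    have "a [^] i \<otimes> b [^] y = a [^] i' \<otimes> b [^] (y' - y) \<otimes> b [^] y"
      using that aG bG by (simp add: m_assoc nat_pow_mult)
    then have "a [^] i = a [^] i' \<otimes> b [^] (y' - y)" using aG bG by simp
    then have "a [^] i' \<otimes> b [^] (y' - y) \<in> cyc a" using cyc_pow[of a i] by simp
    then have "b [^] (y' - y) \<in> cyc a" using mem_A_cancel[of "b [^] (y' - y)" i'] bG by simp
    then have "p dvd y' - y" using bpow_mem by blast
    then show ?thesis using that by (metis diff_is_0_eq dvd_imp_le le_antisym le_less_trans less_imp_diff_less neq0_conv not_less)
  qed
  have "y mod p = y' mod p" if e: "a [^] i \<otimes> b [^] y = a [^] i' \<otimes> b [^] y'"
  proof -
    have "y mod p < p" "y' mod p < p" using p prime_gt_0_nat by auto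
    then show ?thesis using uniq e red by (metis nle_le)
  qed
  then show ?thesis using red[of i y] red[of i' y'] aG bG apow_eq by auto
qed

lemma elem_inj: "inj_on (\<lambda>(i, y). a [^] i \<otimes> b [^] y) ({..<N} \<times> {..<p})"
  by (auto simp: inj_on_def elem_eq cong_def)

lemma elem_image: "(\<lambda>(i, y). a [^] i \<otimes> b [^] y) ` ({..<N} \<times> {..<p}) = carrier G"
  by (rule card_subset_eq[OF fin]) (use aG bG elem_inj in \<open>auto simp: card_image order\<close>)

lemma elem_ex: "x \<in> carrier G \<Longrightarrow> \<exists>i y. i < N \<and> y < p \<and> x = a [^] i \<otimes> b [^] y"
  using elem_image by fastforce

text \<open>The element \<open>b^p\<close> lies in the abelian subgroup \<open>cyc a\<close>, so
  conjugation by it fixes \<open>a\<close>.\<close>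

lemma kp: "[k ^ p = 1] (mod N)"
proof -
  have "a [^] (k ^ p) \<otimes> b [^] p = b [^] p \<otimes> a" using bpow_apow[of p 1] aG by simp
  also have "\<dots> = a \<otimes> b [^] p" using bp aG by (metis cyc_commute cyc_pow cyc_self)
  finally have "a [^] (k ^ p) = a [^] (1::nat)" using aG bG by simp
  then show ?thesis using apow_eq by blast
qed

text \<open>\<open>b\<close> commutes with its own power \<open>b^p = a^j\<close>.\<close>

lemma kj: "[k * j = j] (mod N)"
proof -
  have "a [^] (k * j) \<otimes> b = b \<otimes> b [^] p" using b_apow bp by simp
  also have "\<dots> = a [^] j \<otimes> b" using bp bG by (metis nat_pow_Suc nat_pow_Suc2)
  finally show ?thesis using aG bG apow_eq by simp
qed

text \<open>Any other element of the coset of \<open>b\<close> is an equally good second generator,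
  and only \<open>j\<close> changes. All facts about \<open>b\<close> thus become available for
  \<open>a^t b\<close>.\<close>

lemma metacyc_shift: "metacyc G a (a [^] t \<otimes> b) N p k (t * geo k p + j)" for t :: nat
proof unfold_locales
  show "a [^] t \<otimes> b \<in> carrier G" using aG bG by simp
  show "a [^] t \<otimes> b \<notin> cyc a" using mem_A_cancel b_notin bG by simp
  show "(a [^] t \<otimes> b) [^] p = a [^] (t * geo k p + j)" using elem_bpow_p[of t 1] by simp
  have "a [^] t \<otimes> b \<otimes> a = a [^] t \<otimes> (a [^] k \<otimes> b)" using aG bG ba by (simp add: m_assoc)
  also have "\<dots> = a [^] k \<otimes> (a [^] t \<otimes> b)"
    using aG bG by (simp add: m_assoc[symmetric] nat_pow_mult add.commute)
  finally show "a [^] t \<otimes> b \<otimes> a = a [^] k \<otimes> (a [^] t \<otimes> b)" .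
qed (use aG ord_a p order in auto)

definition mcsub :: "nat \<Rightarrow> nat \<Rightarrow> 'a set" where
  "mcsub d t = {a [^] i \<otimes> (a [^] t \<otimes> b) [^] y | i y :: nat. d dvd i}"

lemma mcsub_memI: "d dvd i \<Longrightarrow> a [^] (i::nat) \<otimes> (a [^] t \<otimes> b) [^] (y::nat) \<in> mcsub d t"
  by (auto simp: mcsub_def)

lemma sg_mcsub: "sg (mcsub d t)"
proof (rule sgI)
  interpret s: metacyc G a "a [^] t \<otimes> b" N p k "t * geo k p + j" by (rule metacyc_shift)
  show "mcsub d t \<subseteq> carrier G" using aG bG by (auto simp: mcsub_def)
  show "mcsub d t \<noteq> {}" using mcsub_memI[of d 0] by blast
  fix u v assume "u \<in> mcsub d t" "v \<in> mcsub d t"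
  then obtain i y i' y' :: nat where "d dvd i" "d dvd i'" "u = a [^] i \<otimes> (a [^] t \<otimes> b) [^] y"
      "v = a [^] i' \<otimes> (a [^] t \<otimes> b) [^] y'"
    unfolding mcsub_def by blast
  then show "u \<otimes> v \<in> mcsub d t" using s.elem_mult mcsub_memI by simp
qed

text \<open>Besides the powers of \<open>a^d\<close>, the only source of powers of \<open>a\<close>
  is \<open>(a^t b)^p\<close>, whose exponent is a multiple of \<open>d\<close> by the condition in
  \<open>mcpairs\<close>.\<close>

lemma mcsub_a: 
  assumes "(d, t) \<in> mcpairs N p k j" shows "a [^] (n::nat) \<in> mcsub d t \<longleftrightarrow> d dvd n"
proof
  interpret s: metacyc G a "a [^] t \<otimes> b" N p k "t * geo k p + j" by (rule metacyc_shift)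
  assume "a [^] n \<in> mcsub d t"
  then obtain i y :: nat where iy: "d dvd i" "a [^] n \<otimes> (a [^] t \<otimes> b) [^] (0::nat) = a [^] i \<otimes> (a [^] t \<otimes> b) [^] y"
    using aG by (auto simp: mcsub_def)
  then have "[n = i + (t * geo k p + j) * (y div p)] (mod N)" unfolding s.elem_eq by simp
  then have "[n = i + (t * geo k p + j) * (y div p)] (mod d)"
    using assms cong_dvd_modulus_nat by (auto simp: mcpairs_def)
  moreover have "d dvd i + (t * geo k p + j) * (y div p)" using iy assms by (auto simp: mcpairs_def)
  ultimately show "d dvd n" using cong_dvd_iff by blast
next
  assume "d dvd n" then show "a [^] n \<in> mcsub d t" using mcsub_memI[of d n t 0] aG by simp
qed

lemma mcsub_c: "a [^] t \<otimes> b \<in> mcsub d t"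
  using mcsub_memI[of d 0 t 1] aG bG by simp

lemma ab_unique_mod:
  assumes H: "sg H" and d: "\<And>n::nat. a [^] n \<in> H \<longleftrightarrow> d dvd n"
    and "a [^] (t::nat) \<otimes> b \<in> H" "a [^] (t'::nat) \<otimes> b \<in> H" "t < d" "t' < d"
  shows "t = t'"
proof -
  have le: "t = t'" if "a [^] t \<otimes> b \<in> H" "a [^] t' \<otimes> b \<in> H" "t' < d" "t \<le> t'" for t t' :: nat
  proof -
    have "a [^] t' \<otimes> b = a [^] (t' - t) \<otimes> (a [^] t \<otimes> b)"
      using that aG bG by (simp add: m_assoc[symmetric] nat_pow_mult)
    then have "a [^] (t' - t) = a [^] t' \<otimes> b \<otimes> inv (a [^] t \<otimes> b)"
      using aG bG inv_solve_right by simp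
    then have "a [^] (t' - t) \<in> H" using that sg_mult[OF H] sg_inv[OF H] by simp
    then have "d dvd t' - t" using d by blast
    then show ?thesis using that by (metis diff_is_0_eq dvd_imp_le le_antisym le_less_trans less_imp_diff_less neq0_conv not_less)
  qed
  show ?thesis using le assms by (metis nle_le)
qed

lemma sg_not_le_A:
  assumes H: "sg H" "\<not> H \<subseteq> cyc a"
  shows "\<exists>(d, t) \<in> mcpairs N p k j. H = mcsub d t"
proof -
  obtain d where d: "d > 0" "\<And>n. a [^] n \<in> H \<longleftrightarrow> d dvd n" "d dvd N"
    using pow_mem_sg[OF H(1) aG] ord_a by metis
  obtain x where x: "x \<in> H" "x \<notin> cyc a" using H by blast
  obtain i y :: nat where iy: "x = a [^] i \<otimes> b [^] y" using elem_ex[OF sg_mem[OF H(1) x(1)]] by blast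
  then have "\<not> p dvd y" using x mem_A_cancel bpow_mem bG by simp
  \<comment> \<open>Raising to the power \<open>w\<close> makes the exponent of \<open>b\<close>
    equal to 1 up to a multiple of \<open>p\<close>, so \<open>H\<close> contains some
    \<open>a^t0 b\<close>.\<close>
  then obtain w u where wu: "y * w = 1 + p * u" by (rule inverse_mod_p)
  have "x [^] w = a [^] (i * geo (k ^ y) w) \<otimes> b [^] (1 + p * u)" using elem_pow iy wu by simp
  also have "\<dots> = a [^] (i * geo (k ^ y) w) \<otimes> (a [^] (j * u) \<otimes> b)"
    using bG aG nat_pow_mult[OF bG, of "p * u" 1] by (simp add: bpow_mult_p)
  also have "\<dots> = a [^] (i * geo (k ^ y) w + j * u) \<otimes> b"
    using aG bG by (simp add: m_assoc[symmetric] nat_pow_mult)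
  finally obtain t0 where t0: "a [^] (t0::nat) \<otimes> b \<in> H" using sg_pow[OF H(1) x(1)] by metis
  define t where "t = t0 mod d"
  have "a [^] t0 \<otimes> b = a [^] (d * (t0 div d)) \<otimes> (a [^] t \<otimes> b)"
    using aG bG by (simp add: m_assoc[symmetric] nat_pow_mult t_def)
  then have "a [^] t \<otimes> b = inv (a [^] (d * (t0 div d))) \<otimes> (a [^] t0 \<otimes> b)"
    using aG bG by (simp add: m_assoc[symmetric])
  moreover have "a [^] (d * (t0 div d)) \<in> H" using d by simp
  ultimately have c: "a [^] t \<otimes> b \<in> H" using t0 sg_mult[OF H(1)] sg_inv[OF H(1)] by simp
  then have "(a [^] t \<otimes> b) [^] (p * 1) \<in> H" using sg_pow[OF H(1)] by blast
  then have "d dvd t * geo k p + j" using d elem_bpow_p[of t 1] by simp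
  then have pr: "(d, t) \<in> mcpairs N p k j" using d by (simp add: mcpairs_def t_def)
  have "H = mcsub d t"
  proof
    show "mcsub d t \<subseteq> H" using c d sg_mult[OF H(1)] sg_pow[OF H(1)] by (auto simp: mcsub_def)
    interpret s: metacyc G a "a [^] t \<otimes> b" N p k "t * geo k p + j" by (rule metacyc_shift)
    show "H \<subseteq> mcsub d t"
    proof
      fix x assume xH: "x \<in> H"
      then obtain i y :: nat where x: "x = a [^] i \<otimes> (a [^] t \<otimes> b) [^] y" using s.elem_ex sg_mem[OF H(1)] by blast
      then have "a [^] i = x \<otimes> inv ((a [^] t \<otimes> b) [^] y)" using aG bG by (simp add: m_assoc)
      then have "a [^] i \<in> H" using xH c sg_mult[OF H(1)] sg_inv[OF H(1)] sg_pow[OF H(1)] by simp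
      then show "x \<in> mcsub d t" using d x mcsub_memI by blast
    qed
  qed
  then show ?thesis using pr by blast
qed

lemma num_subgroups_metacyc: "num_subgroups G = mcount N p k j"
proof -
  have bij: "bij_betw (\<lambda>(d, t). mcsub d t) (mcpairs N p k j) {H. sg H \<and> \<not> H \<subseteq> cyc a}"
  proof (rule bij_betw_imageI)
    show "inj_on (\<lambda>(d, t). mcsub d t) (mcpairs N p k j)"
    proof (rule inj_onI, clarify)
      fix d t d' t' assume A: "(d, t) \<in> mcpairs N p k j" "(d', t') \<in> mcpairs N p k j" "mcsub d t = mcsub d' t'"
      have "d dvd d'" "d' dvd d" using mcsub_a A by (metis dvd_refl)+
      then have "d = d'" using dvd_antisym by blast
      moreover have "t = t'"
        by (rule ab_unique_mod[OF sg_mcsub[of d t]])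
          (use A mcsub_a mcsub_c \<open>d = d'\<close> in \<open>auto simp: mcpairs_def\<close>)
      ultimately show "d = d' \<and> t = t'" by blast
    qed
    show "(\<lambda>(d, t). mcsub d t) ` mcpairs N p k j = {H. sg H \<and> \<not> H \<subseteq> cyc a}"
    proof (intro equalityI subsetI)
      fix H assume "H \<in> (\<lambda>(d, t). mcsub d t) ` mcpairs N p k j"
      then obtain d t where "H = mcsub d t" by auto
      moreover have "a [^] t \<otimes> b \<notin> cyc a" using mem_A_cancel b_notin bG by simp
      ultimately show "H \<in> {H. sg H \<and> \<not> H \<subseteq> cyc a}" using sg_mcsub mcsub_c by auto
    next
      fix H assume "H \<in> {H. sg H \<and> \<not> H \<subseteq> cyc a}"
      then show "H \<in> (\<lambda>(d, t). mcsub d t) ` mcpairs N p k j" using sg_not_le_A[of H] by fastforce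
    qed
  qed
  have "{H. sg H} = {H. sg H \<and> H \<subseteq> cyc a} \<union> {H. sg H \<and> \<not> H \<subseteq> cyc a}" by auto
  then have "num_subgroups G = card ({H. sg H \<and> H \<subseteq> cyc a} \<union> {H. sg H \<and> \<not> H \<subseteq> cyc a})"
    unfolding num_subgroups_def by (rule arg_cong)
  also have "\<dots> = card {H. sg H \<and> H \<subseteq> cyc a} + card {H. sg H \<and> \<not> H \<subseteq> cyc a}"
    by (rule card_Un_disjoint) (auto intro: finite_subset[OF _ finite_sgs])
  finally show ?thesis using card_sg_cyc[OF aG] bij_betw_same_card[OF bij] ord_a by (simp add: mcount_def)
qed

text \<open>Together with \<open>cyc a\<close> the subgroup generates the whole group, and it meets
  \<open>cyc a\<close> in \<open>N div d\<close> elements; the product formula gives its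
  order.\<close>

lemma card_mcsub:
  assumes "(d, t) \<in> mcpairs N p k j" shows "card (mcsub d t) * d = N * p"
proof -
  have d: "d dvd N" "d \<noteq> 0" using assms N_pos by (auto simp: mcpairs_def)
  have "mcsub d t \<inter> cyc a = cyc (a [^] d)"
    using cyc_Int[OF sg_mcsub aG mcsub_a[OF assms]] ord_a d by simp
  then have i: "card (mcsub d t \<inter> cyc a) = N div d" using card_cyc aG ord_a d by (simp add: ord_pow)
  have cl: "mcsub d t \<subseteq> norm (cyc a)"
  proof
    fix x assume "x \<in> mcsub d t"
    then have xG: "x \<in> carrier G" using sg_mcsub sg_mem by blast
    then obtain i y :: nat where x: "x = a [^] i \<otimes> b [^] y" using elem_ex by blast
    have "cj x (cyc a) \<subseteq> cyc a"
    proof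
      fix z assume "z \<in> cj x (cyc a)"
      then obtain n :: nat where z: "z = x \<otimes> a [^] n \<otimes> inv x" by (auto simp: cj_def cyc_def)
      have "x \<otimes> a [^] n = a [^] (k ^ y * n) \<otimes> x"
        using elem_mult[of i y n 0] elem_mult[of "k ^ y * n" 0 i y] x aG bG by (simp add: add.commute)
      then have "z = a [^] (k ^ y * n)" using z xG aG by (simp add: m_assoc)
      then show "z \<in> cyc a" using cyc_pow by simp
    qed
    then show "x \<in> norm (cyc a)" using card_eqI[OF sg_cj[OF xG sgA] sgA] card_cj[OF xG sg_sub[OF sgA]] xG
      by (simp add: norm_def)
  qed
  have s: "sg (mcsub d t <#> cyc a)" using sg_set_mult[OF sg_mcsub sgA cl] .
  note up = set_mult_upper[OF sg_mcsub sgA, of d t]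
  have "carrier G \<subseteq> mcsub d t <#> cyc a"
  proof
    fix x assume "x \<in> carrier G"
    then obtain i y :: nat where x: "x = a [^] i \<otimes> b [^] y" using elem_ex by blast
    have "a [^] t \<otimes> b \<in> mcsub d t <#> cyc a" "a [^] t \<in> mcsub d t <#> cyc a" "a [^] i \<in> mcsub d t <#> cyc a"
      using up mcsub_c cyc_pow by blast+
    moreover have "b = inv (a [^] t) \<otimes> (a [^] t \<otimes> b)" using aG bG by (simp add: m_assoc[symmetric])
    ultimately show "x \<in> mcsub d t <#> cyc a" using x s sg_mult sg_inv sg_pow by metis
  qed
  then have "mcsub d t <#> cyc a = carrier G" using sg_sub[OF s] by blast
  then have "N * p * (N div d) = card (mcsub d t) * N"
    using card_set_mult[OF sg_mcsub sgA, of d t] i order card_cyc[OF aG] ord_a by simp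
  then have "p * (N div d) = card (mcsub d t)" using N_pos by simp
  then show ?thesis using d by (metis dvd_div_mult_self mult.assoc mult.commute)
qed

text \<open>The element \<open>a^u\<close> generates \<open>cyc a\<close> again, \<open>b^v\<close>
  acts on it by \<open>k^v\<close>, and the left side of the last congruence is the exponent in the
  \<open>p\<close>-th power of \<open>a^t b^v\<close>.\<close>

lemma reparam:
  assumes "coprime u N" "\<not> p dvd v" "[k' = k ^ v] (mod N)"
    and "[t * geo (k ^ v) p + j * v = u * j'] (mod N)"
  shows "metacyc G (a [^] u) (a [^] t \<otimes> b [^] v) N p k' j'"
proof unfold_locales
  have cyc: "cyc (a [^] u) = cyc a" using cyc_pow_coprime aG assms ord_a by simp
  show "ord (a [^] u) = N" using cyc card_cyc aG ord_a by (metis nat_pow_closed)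
  show "a [^] t \<otimes> b [^] v \<notin> cyc (a [^] u)" using cyc mem_A_cancel bpow_mem assms bG by simp
  have "(a [^] t \<otimes> b [^] v) [^] p = a [^] (t * geo (k ^ v) p + j * v)"
    using elem_pow[of t v p] bpow_mult_p[of v] aG by (simp add: nat_pow_mult mult.commute)
  also have "\<dots> = (a [^] u) [^] j'" using assms(4) aG by (simp add: apow_eq nat_pow_pow)
  finally show "(a [^] t \<otimes> b [^] v) [^] p = (a [^] u) [^] j'" .
  have "a [^] t \<otimes> b [^] v \<otimes> a [^] u = a [^] (t + k ^ v * u) \<otimes> b [^] v"
    using elem_mult[of t v u 0] aG bG by simp
  moreover have "(a [^] u) [^] k' \<otimes> (a [^] t \<otimes> b [^] v) = a [^] (u * k' + t) \<otimes> b [^] v"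
    using aG bG by (simp add: nat_pow_pow m_assoc[symmetric] nat_pow_mult)
  moreover have "[t + k ^ v * u = u * k' + t] (mod N)"
    using assms(3) by (metis add.commute cong_add_lcancel_nat cong_scalar_right cong_sym mult.commute)
  ultimately show "a [^] t \<otimes> b [^] v \<otimes> a [^] u = (a [^] u) [^] k' \<otimes> (a [^] t \<otimes> b [^] v)"
    using apow_eq by metis
qed (use aG bG p order in auto)

end

text \<open>Equality and products of the words \<open>a^i b^y\<close> follow rules that involve only
  \<open>N\<close>, \<open>p\<close>, \<open>k\<close>, \<open>j\<close>. So sending a word to the
  same word on the other side is well defined, and the choice of the word in \<open>h\<close> is
  harmless.\<close>

lemma metacyc_iso:
  assumes "metacyc G a b N p k j" "metacyc H a' b' N p k j"
  shows "G \<cong> H"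
proof -
  interpret G: metacyc G a b N p k j by fact
  interpret H: metacyc H a' b' N p k j by fact
  define F where "F = (\<lambda>(i::nat, y::nat). a [^]\<^bsub>G\<^esub> i \<otimes>\<^bsub>G\<^esub> b [^]\<^bsub>G\<^esub> y)"
  define F' where "F' = (\<lambda>(i::nat, y::nat). a' [^]\<^bsub>H\<^esub> i \<otimes>\<^bsub>H\<^esub> b' [^]\<^bsub>H\<^esub> y)"
  define h where "h x = F' (SOME q. F q = x)" for x
  have FF': "F q = F q' \<longleftrightarrow> F' q = F' q'" for q q'
    unfolding F_def F'_def by (cases q; cases q') (simp add: G.elem_eq H.elem_eq)
  have hF: "h (F q) = F' q" for q
  proof -
    have "F (SOME q'. F q' = F q) = F q" by (rule someI) simp
    then show ?thesis using FF' by (simp add: h_def)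
  qed
  have surj: "\<exists>q. x = F q" if "x \<in> carrier G" for x using G.elem_ex[OF that] by (auto simp: F_def)
  have surj': "\<exists>q. x = F' q" if "x \<in> carrier H" for x using H.elem_ex[OF that] by (auto simp: F'_def)
  have c: "F q \<in> carrier G" "F' q \<in> carrier H" for q
    using G.aG G.bG H.aG H.bG by (auto simp: F_def F'_def split: prod.split)
  have "h \<in> iso G H"
  proof (rule isoI)
    show "h \<in> hom G H"
    proof (rule homI)
      show "h x \<in> carrier H" if "x \<in> carrier G" for x using surj[OF that] hF c by auto
      show "h (x \<otimes>\<^bsub>G\<^esub> y) = h x \<otimes>\<^bsub>H\<^esub> h y" if xy: "x \<in> carrier G" "y \<in> carrier G" for x y
      proof -
        obtain i u where x: "x = F (i, u)" using surj[OF xy(1)] by auto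
        obtain i' u' where y: "y = F (i', u')" using surj[OF xy(2)] by auto
        have "x \<otimes>\<^bsub>G\<^esub> y = F (i + k ^ u * i', u + u')" using G.elem_mult by (simp add: F_def x y)
        then have "h (x \<otimes>\<^bsub>G\<^esub> y) = F' (i + k ^ u * i', u + u')" using hF by simp
        also have "\<dots> = F' (i, u) \<otimes>\<^bsub>H\<^esub> F' (i', u')" using H.elem_mult by (simp add: F'_def)
        finally show ?thesis using hF x y by simp
      qed
    qed
    show "bij_betw h (carrier G) (carrier H)"
    proof (rule bij_betw_imageI)
      show "inj_on h (carrier G)"
      proof (rule inj_onI)
        fix x y assume xy: "x \<in> carrier G" "y \<in> carrier G" "h x = h y"
        obtain q q' where "x = F q" "y = F q'" using surj xy by blast
        then show "x = y" using xy(3) hF FF' by simp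
      qed
      show "h ` carrier G = carrier H"
      proof (intro equalityI subsetI)
        fix x assume "x \<in> h ` carrier G"
        then obtain y where y: "y \<in> carrier G" "x = h y" by blast
        obtain q where "y = F q" using surj y by blast
        then show "x \<in> carrier H" using y hF c by simp
      next
        fix x assume "x \<in> carrier H"
        then obtain q where "x = F' q" using surj' by blast
        then have "x = h (F q)" using hF by simp
        then show "x \<in> h ` carrier G" using c by blast
      qed
    qed
  qed
  then show ?thesis by (auto simp: is_iso_def)
qed

text \<open>The extension of the integers modulo \<open>p\<close> by the integers modulo
  \<open>N\<close> with action \<open>k\<close>: a carry in \<open>y + y'\<close> contributes one
  factor \<open>b^p = a^j\<close>.\<close>

definition MC :: "nat \<Rightarrow> nat \<Rightarrow> nat \<Rightarrow> nat \<Rightarrow> (nat \<times> nat) monoid" where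
  "MC N p k j = \<lparr>carrier = {..<N} \<times> {..<p},
     monoid.mult = (\<lambda>(i, y) (i', y'). ((i + k ^ y * i' + j * ((y + y') div p)) mod N, (y + y') mod p)),
     one = (0, 0)\<rparr>"

lemma MC_simps:
  "carrier (MC N p k j) = {..<N} \<times> {..<p}"
  "(i, y) \<otimes>\<^bsub>MC N p k j\<^esub> (i', y') = ((i + k ^ y * i' + j * ((y + y') div p)) mod N, (y + y') mod p)"
  "\<one>\<^bsub>MC N p k j\<^esub> = (0, 0)"
  by (simp_all add: MC_def)

lemma div_mod_add_div:
  fixes p :: nat assumes "p > 0" shows "x div p + (x mod p + z) div p = (x + z) div p"
proof -
  have "x + z = x mod p + z + x div p * p" by (metis add.assoc add.commute mod_mult_div_eq mult.commute)
  then have "(x + z) div p = (x mod p + z + x div p * p) div p" by (rule arg_cong)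
  also have "\<dots> = x div p + (x mod p + z) div p" using assms by (subst div_mult_self1) auto
  finally show ?thesis by simp
qed

lemma MC_group:
  assumes "N > 0" "p > 0" "[k ^ p = 1] (mod N)" "[k * j = j] (mod N)"
  shows "group (MC N p k j)"
proof (rule groupI)
  have kmod: "[k ^ (y mod p) = k ^ y] (mod N)" for y
  proof -
    have "k ^ y = k ^ (y mod p) * (k ^ p) ^ (y div p)"
      by (simp add: power_mult[symmetric] power_add[symmetric])
    moreover have "[k ^ (y mod p) * (k ^ p) ^ (y div p) = k ^ (y mod p) * 1 ^ (y div p)] (mod N)"
      using assms(3) by (intro cong_mult cong_pow) auto
    ultimately show ?thesis by (simp add: cong_sym)
  qed
  have kj: "[k ^ y * j = j] (mod N)" for y
  proof (induction y)
    case (Suc y)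
    have "[k * (k ^ y * j) = k * j] (mod N)" using Suc by (rule cong_scalar_left)
    then show ?case using assms(4) cong_trans by (simp add: mult.assoc) blast
  qed simp
  fix x y z assume xyz: "x \<in> carrier (MC N p k j)" "y \<in> carrier (MC N p k j)"
  obtain i u where x: "x = (i, u)" by (cases x)
  obtain i' u' where y: "y = (i', u')" by (cases y)
  show "x \<otimes>\<^bsub>MC N p k j\<^esub> y \<in> carrier (MC N p k j)" using assms by (simp add: x y MC_simps)
  assume "z \<in> carrier (MC N p k j)"
  obtain i'' u'' where z: "z = (i'', u'')" by (cases z)
  \<comment> \<open>Both bracketings produce the same total carry, that of the sum
    \<open>u + u' + u''\<close>.\<close>
  have dv: "(u + u') div p + ((u + u') mod p + u'') div p = (u' + u'') div p + (u + (u' + u'') mod p) div p"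
  proof -
    have "(u + u') div p + ((u + u') mod p + u'') div p = (u + u' + u'') div p"
      using div_mod_add_div[OF assms(2), of "u + u'" u''] by simp
    moreover have "(u' + u'') div p + (u + (u' + u'') mod p) div p = (u + u' + u'') div p"
      using div_mod_add_div[OF assms(2), of "u' + u''" u] by (simp add: ac_simps)
    ultimately show ?thesis by simp
  qed
  have "[(i + k ^ u * i' + j * ((u + u') div p)) mod N + k ^ ((u + u') mod p) * i'' + j * (((u + u') mod p + u'') div p)
     = i + k ^ u * i' + j * ((u + u') div p) + k ^ (u + u') * i'' + j * (((u + u') mod p + u'') div p)] (mod N)"
    by (intro cong_add cong_mult kmod cong_refl) (simp add: cong_def)
  also have "i + k ^ u * i' + j * ((u + u') div p) + k ^ (u + u') * i'' + j * (((u + u') mod p + u'') div p)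
    = i + k ^ u * i' + k ^ (u + u') * i'' + j * ((u + u') div p + ((u + u') mod p + u'') div p)"
    by (simp add: algebra_simps)
  also have "\<dots> = i + k ^ u * (i' + k ^ u' * i'') + j * ((u' + u'') div p) + j * ((u + (u' + u'') mod p) div p)"
    unfolding dv by (simp add: algebra_simps power_add)
  \<comment> \<open>Here the action has to fix \<open>j\<close>, since the carry of the inner
    product is moved past \<open>b^u\<close>.\<close>
  also have "[\<dots> = i + k ^ u * (i' + k ^ u' * i'') + (k ^ u * j) * ((u' + u'') div p) + j * ((u + (u' + u'') mod p) div p)] (mod N)"
    by (intro cong_add cong_mult cong_refl cong_sym[OF kj])
  also have "i + k ^ u * (i' + k ^ u' * i'') + (k ^ u * j) * ((u' + u'') div p) + j * ((u + (u' + u'') mod p) div p)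
    = i + k ^ u * (i' + k ^ u' * i'' + j * ((u' + u'') div p)) + j * ((u + (u' + u'') mod p) div p)"
    by (simp add: algebra_simps)
  also have "[\<dots> = i + k ^ u * ((i' + k ^ u' * i'' + j * ((u' + u'') div p)) mod N) + j * ((u + (u' + u'') mod p) div p)] (mod N)"
    by (intro cong_add cong_mult cong_refl) (simp add: cong_def)
  finally show "x \<otimes>\<^bsub>MC N p k j\<^esub> y \<otimes>\<^bsub>MC N p k j\<^esub> z = x \<otimes>\<^bsub>MC N p k j\<^esub> (y \<otimes>\<^bsub>MC N p k j\<^esub> z)"
    unfolding x y z MC_simps by (simp add: cong_def add.assoc mod_simps)
next
  show "\<one>\<^bsub>MC N p k j\<^esub> \<in> carrier (MC N p k j)" using assms by (simp add: MC_simps)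
  fix x assume xc: "x \<in> carrier (MC N p k j)"
  obtain i u where x: "x = (i, u)" by (cases x)
  have iu: "i < N" "u < p" using xc x by (auto simp: MC_simps)
  show "\<one>\<^bsub>MC N p k j\<^esub> \<otimes>\<^bsub>MC N p k j\<^esub> x = x" using iu by (simp add: x MC_simps)
  \<comment> \<open>Data of the left inverse: \<open>v\<close> is the negative of \<open>u\<close>
    modulo \<open>p\<close>, and \<open>c\<close> is the first coordinate that remains to be
    cancelled.\<close>
  define v where "v = (p - u) mod p"
  define c where "c = (k ^ v * i + j * ((v + u) div p)) mod N"
  have "(v + u) mod p = 0" using iu by (cases "u = 0") (auto simp: v_def)
  moreover have "((N - c) mod N + k ^ v * i + j * ((v + u) div p)) mod N = 0"
  proof -
    have cN: "c < N" using assms by (simp add: c_def)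
    have "((N - c) mod N + k ^ v * i + j * ((v + u) div p)) mod N = ((N - c) + c) mod N"
      unfolding c_def by (simp add: mod_simps add.assoc)
    then show ?thesis using cN by simp
  qed
  ultimately have "((N - c) mod N, v) \<otimes>\<^bsub>MC N p k j\<^esub> x = \<one>\<^bsub>MC N p k j\<^esub>" by (simp add: x MC_simps)
  moreover have "((N - c) mod N, v) \<in> carrier (MC N p k j)" using assms by (simp add: MC_simps v_def)
  ultimately show "\<exists>y\<in>carrier (MC N p k j). y \<otimes>\<^bsub>MC N p k j\<^esub> x = \<one>\<^bsub>MC N p k j\<^esub>" by blast
qed

text \<open>The generator is written \<open>1 mod N\<close> so that \<open>N = 1\<close> is covered,
  where it is the identity.\<close>

lemma MC_metacyc:
  assumes "N > 0" "Factorial_Ring.prime p" "[k ^ p = 1] (mod N)" "[k * j = j] (mod N)"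
  shows "metacyc (MC N p k j) (1 mod N, 0) (0, 1) N p k j"
proof -
  have p1: "p > 1" using assms(2) prime_gt_1_nat by blast
  interpret M: group "MC N p k j" using MC_group assms p1 by simp
  interpret M: fin_group "MC N p k j" by unfold_locales (simp add: MC_simps)
  have ap: "(1 mod N, 0) [^]\<^bsub>MC N p k j\<^esub> n = (n mod N, 0)" for n :: nat
    by (induction n) (auto simp: MC_simps mod_simps)
  have bp': "(0, 1) [^]\<^bsub>MC N p k j\<^esub> n = (0, n)" if "n < p" for n :: nat
    using that by (induction n) (auto simp: MC_simps)
  have ac: "(1 mod N, 0) \<in> carrier (MC N p k j)" using assms p1 by (simp add: MC_simps)
  show ?thesis
  proof unfold_locales
    show "M.ord (1 mod N, 0) = N" unfolding M.ord_unique[OF ac] ap by (auto simp: MC_simps)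
    show "(0, 1) \<notin> M.cyc (1 mod N, 0)" unfolding M.cyc_def ap by auto
    have "(0, 1) [^]\<^bsub>MC N p k j\<^esub> p = (0, 1) [^]\<^bsub>MC N p k j\<^esub> (p - 1) \<otimes>\<^bsub>MC N p k j\<^esub> (0, 1)"
      using p1 by (metis Suc_diff_1 M.nat_pow_Suc less_trans zero_less_one)
    also have "\<dots> = (j mod N, 0)" using p1 bp'[of "p - 1"] by (simp add: MC_simps)
    finally show "(0, 1) [^]\<^bsub>MC N p k j\<^esub> p = (1 mod N, 0) [^]\<^bsub>MC N p k j\<^esub> j" by (simp only: ap)
    show "(0, 1) \<otimes>\<^bsub>MC N p k j\<^esub> (1 mod N, 0) = (1 mod N, 0) [^]\<^bsub>MC N p k j\<^esub> k \<otimes>\<^bsub>MC N p k j\<^esub> (0, 1)"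
      unfolding ap using p1 by (simp add: MC_simps mod_simps)
  qed (use assms p1 ac in \<open>auto simp: MC_simps card_cartesian_product\<close>)
qed

context fin_group
begin

text \<open>For any \<open>b\<close> outside \<open>cyc a\<close> the order of \<open>b\<close>
  modulo \<open>cyc a\<close> is not 1 and divides the index by the product formula, so it equals
  \<open>p\<close>.\<close>

lemma metacyc_ex:
  assumes a: "a \<in> carrier G" and p: "Factorial_Ring.prime p" and o: "card (carrier G) = ord a * p"
    and n: "carrier G \<subseteq> norm (cyc a)"
  shows "\<exists>b k j. metacyc G a b (ord a) p k j"
proof -
  have "card (cyc a) < card (carrier G)"
    using o card_cyc[OF a] ord_pos[OF a] prime_gt_1_nat[OF p] by simp
  then obtain b where b: "b \<in> carrier G" "b \<notin> cyc a" using cyc_carrier[OF a] by (metis less_irrefl subsetI subset_antisym)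
  have "b \<otimes> a \<otimes> inv b \<in> cyc a" using n b cyc_self[OF a] by (auto simp: norm_def cj_def)
  then obtain k :: nat where "b \<otimes> a \<otimes> inv b = a [^] k" by (rule cycE)
  then have k: "b \<otimes> a = a [^] k \<otimes> b" using a b by (metis inv_solve_right' m_closed nat_pow_closed)
  obtain d where d: "d > 0" "\<And>n. b [^] n \<in> cyc a \<longleftrightarrow> d dvd n" "d dvd ord b"
    using pow_mem_sg[OF sg_cyc[OF a] b(1)] by metis
  have bn: "cyc b \<subseteq> norm (cyc a)" using n b cyc_carrier by blast
  have s: "sg (cyc b <#> cyc a)" using sg_set_mult sg_cyc a b bn by blast
  have "cyc b \<inter> cyc a = cyc (b [^] d)"
    using cyc_Int[OF sg_cyc[OF a] b(1) d(2,3)] by (simp add: Int_commute)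
  then have "card (cyc b \<inter> cyc a) = ord b div d" using card_cyc b d by (simp add: ord_pow)
  then have "card (cyc b <#> cyc a) * (ord b div d) = ord b * ord a"
    using card_set_mult[OF sg_cyc[OF b(1)] sg_cyc[OF a]] card_cyc a b by simp
  then have "card (cyc b <#> cyc a) = d * ord a"
    using d ord_pos[OF b(1)] by (auto elim!: dvdE)
  then have "d * ord a dvd ord a * p" using card_dvd[OF s sg_carrier sg_sub[OF s]] o by simp
  then have "d dvd p" using ord_pos[OF a] by (simp add: mult.commute)
  moreover have "d \<noteq> 1" using d(2)[of 1] b by simp
  ultimately have "d = p" using p by (meson prime_nat_iff)
  then have "b [^] p \<in> cyc a" using d by simp
  then obtain j :: nat where j: "b [^] p = a [^] j" by (rule cycE)
  have "metacyc G a b (ord a) p k j"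
    by unfold_locales (use a b p o k j in auto)
  then show ?thesis by blast
qed

end

section \<open>Coprime direct factors and similarity\<close>

lemma div_div_self: "(m::nat) dvd n \<Longrightarrow> n > 0 \<Longrightarrow> n div (n div m) = m"
  by (auto elim!: dvdE)

definition tau :: "nat \<Rightarrow> nat" where
  "tau n = card {d. d dvd n}"

context fin_group
begin

lemma set_multE: "x \<in> A <#> B \<Longrightarrow> (\<And>u v. u \<in> A \<Longrightarrow> v \<in> B \<Longrightarrow> x = u \<otimes> v \<Longrightarrow> thesis) \<Longrightarrow> thesis"
  by (auto simp: set_mult_def)

lemma num_subgroups_restrict:
  assumes "sg A" shows "num_subgroups (G\<lparr>carrier := A\<rparr>) = card {H. sg H \<and> H \<subseteq> A}"
  unfolding num_subgroups_def sg_restrict_iff[OF assms] ..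

lemma num_subgroups_mono:
  assumes "sg A" shows "num_subgroups (G\<lparr>carrier := A\<rparr>) \<le> num_subgroups G"
  unfolding num_subgroups_restrict[OF assms] unfolding num_subgroups_def
  by (rule card_mono[OF finite_sgs]) auto

lemma pow_card_sg: "sg H \<Longrightarrow> x \<in> H \<Longrightarrow> x [^] card H = \<one>"
  using ord_dvd_card sg_mem pow_eq_id by blast

lemma coprime_Int:
  assumes "sg A" "sg B" "coprime (card A) (card B)"
  shows "A \<inter> B = {\<one>}"
proof -
  have s: "sg (A \<inter> B)" using assms sg_Int by blast
  have "card (A \<inter> B) dvd card A" "card (A \<inter> B) dvd card B" using card_dvd s assms by blast+
  then have "card (A \<inter> B) = 1" using assms(3) by (meson coprime_common_divisor_nat)
  then show ?thesis using sg_ne[OF s] by (metis card_1_singletonE singletonD)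
qed

lemma coprime_set_mult:
  assumes "sg A" "sg B" "coprime (card A) (card B)" "card A * card B = card (carrier G)"
  shows "A <#> B = carrier G"
proof (rule card_subset_eq[OF fin])
  show "A <#> B \<subseteq> carrier G" using assms sg_sub by (simp add: set_mult_closed)
  show "card (A <#> B) = card (carrier G)"
    using card_set_mult[OF assms(1,2)] coprime_Int[OF assms(1-3)] assms(4) by simp
qed

text \<open>The exponent \<open>n\<close> from the Chinese remainder theorem kills \<open>v\<close>
  and fixes \<open>u\<close>, so \<open>u\<close> is a power of
  \<open>u \<otimes> v\<close>.\<close>

lemma coprime_component:
  assumes A: "sg A" "sg B" "coprime (card A) (card B)" and H: "sg H"
    and uv: "u \<in> A" "v \<in> B" "u \<otimes> v = v \<otimes> u" "u \<otimes> v \<in> H"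
  shows "u \<in> H" "v \<in> H"
proof -
  have c: "u \<in> carrier G" "v \<in> carrier G" using uv A sg_mem by auto
  obtain n where n: "[n = 1] (mod card A)" "[n = 0] (mod card B)"
    using binary_chinese_remainder_nat[OF A(3)] by blast
  have "(u \<otimes> v) [^] n = u [^] n \<otimes> v [^] n" using pow_mult_distrib uv c by blast
  also have "v [^] n = \<one>"
    using n(2) ord_dvd_card[OF A(2) uv(2)] c pow_eq_id cong_0_iff dvd_trans by blast
  also have "u [^] n = u [^] (1::nat)"
    unfolding pow_eq_cong[OF c(1)] using n(1) ord_dvd_card[OF A(1) uv(1)] cong_dvd_modulus_nat by blast
  finally have "(u \<otimes> v) [^] n = u" using c by simp
  then show u: "u \<in> H" using sg_pow[OF H uv(4)] by metis
  have "v = inv u \<otimes> (u \<otimes> v)" using c by (simp add: m_assoc[symmetric])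
  then show "v \<in> H" using u uv sg_mult[OF H] sg_inv[OF H] by metis
qed

text \<open>By \<open>coprime_component\<close> a subgroup contains both components of each of its
  elements, hence is the product of its intersections with the two factors.\<close>

lemma num_subgroups_coprime:
  assumes A: "sg A" "sg B" "coprime (card A) (card B)" "card A * card B = card (carrier G)"
    and com: "\<And>u v. u \<in> A \<Longrightarrow> v \<in> B \<Longrightarrow> u \<otimes> v = v \<otimes> u"
  shows "num_subgroups G = card {H. sg H \<and> H \<subseteq> A} * card {H. sg H \<and> H \<subseteq> B}"
proof -
  have one: "A \<inter> B = {\<one>}" using coprime_Int A by blast
  have bij: "bij_betw (\<lambda>H. (H \<inter> A, H \<inter> B)) {H. sg H} ({H. sg H \<and> H \<subseteq> A} \<times> {H. sg H \<and> H \<subseteq> B})"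
  proof (rule bij_betw_byWitness[where f' = "\<lambda>(H, K). H <#> K"])
    show "\<forall>H\<in>{H. sg H}. (case (H \<inter> A, H \<inter> B) of (H, K) \<Rightarrow> H <#> K) = H"
    proof
      fix H assume "H \<in> {H. sg H}"
      then have H: "sg H" by simp
      have "H \<subseteq> (H \<inter> A) <#> (H \<inter> B)"
      proof
        fix x assume x: "x \<in> H"
        then have "x \<in> A <#> B" using coprime_set_mult[OF A] sg_mem[OF H] by blast
        then obtain u v where uv: "u \<in> A" "v \<in> B" "x = u \<otimes> v" by (rule set_multE)
        then have "u \<in> H" "v \<in> H" using coprime_component[OF A(1-3) H uv(1,2) com[OF uv(1,2)]] x by simp_all
        then show "x \<in> (H \<inter> A) <#> (H \<inter> B)" using uv unfolding set_mult_def by blast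
      qed
      moreover have "(H \<inter> A) <#> (H \<inter> B) \<subseteq> H" by (rule set_mult_least[OF H]) auto
      ultimately show "(case (H \<inter> A, H \<inter> B) of (H, K) \<Rightarrow> H <#> K) = H" by auto
    qed
    show "\<forall>P\<in>{H. sg H \<and> H \<subseteq> A} \<times> {H. sg H \<and> H \<subseteq> B}.
        ((case P of (H, K) \<Rightarrow> H <#> K) \<inter> A, (case P of (H, K) \<Rightarrow> H <#> K) \<inter> B) = P"
    proof (clarify)
      fix H K assume HK: "sg H" "H \<subseteq> A" "sg K" "K \<subseteq> B"
      have "(H <#> K) \<inter> A \<subseteq> H"
      proof
        fix x assume "x \<in> (H <#> K) \<inter> A"
        then obtain u v where uv: "u \<in> H" "v \<in> K" "x = u \<otimes> v" "x \<in> A" by (elim IntE set_multE)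
        have c: "u \<in> carrier G" "v \<in> carrier G" using uv HK sg_mem by auto
        have "v = inv u \<otimes> x" using c uv by (simp add: m_assoc[symmetric])
        then have "v \<in> A" using uv HK sg_mult[OF A(1)] sg_inv[OF A(1)] by blast
        then have "v = \<one>" using one uv HK by blast
        then show "x \<in> H" using uv c by simp
      qed
      moreover have "(H <#> K) \<inter> B \<subseteq> K"
      proof
        fix x assume "x \<in> (H <#> K) \<inter> B"
        then obtain u v where uv: "u \<in> H" "v \<in> K" "x = u \<otimes> v" "x \<in> B" by (elim IntE set_multE)
        have c: "u \<in> carrier G" "v \<in> carrier G" using uv HK sg_mem by auto
        have "u = x \<otimes> inv v" using c uv by (simp add: m_assoc)
        then have "u \<in> B" using uv HK sg_mult[OF A(2)] sg_inv[OF A(2)] by blast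
        then have "u = \<one>" using one uv HK by blast
        then show "x \<in> K" using uv c by simp
      qed
      ultimately show "(H <#> K) \<inter> A = H \<and> (H <#> K) \<inter> B = K"
        using set_mult_upper[OF HK(1,3)] HK by blast
    qed
    show "(\<lambda>H. (H \<inter> A, H \<inter> B)) ` {H. sg H} \<subseteq> {H. sg H \<and> H \<subseteq> A} \<times> {H. sg H \<and> H \<subseteq> B}"
      using A sg_Int by auto
    show "(\<lambda>(H, K). H <#> K) ` ({H. sg H \<and> H \<subseteq> A} \<times> {H. sg H \<and> H \<subseteq> B}) \<subseteq> {H. sg H}"
    proof clarify
      fix H K assume HK: "sg H" "H \<subseteq> A" "sg K" "K \<subseteq> B"
      have "H \<subseteq> norm K"
      proof
        fix h assume h: "h \<in> H"
        then have hG: "h \<in> carrier G" using HK sg_mem by blast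
        have "h \<otimes> x \<otimes> inv h = x" if "x \<in> K" for x
        proof -
          have "x \<in> carrier G" "h \<otimes> x = x \<otimes> h" using that h HK com sg_mem by blast+
          then show ?thesis using hG by (simp add: m_assoc)
        qed
        then have "cj h K = K" by (simp add: cj_def)
        then show "h \<in> norm K" using hG by (simp add: norm_def)
      qed
      then show "sg (H <#> K)" using sg_set_mult HK by blast
    qed
  qed
  show ?thesis using bij_betw_same_card[OF bij] by (simp add: num_subgroups_def card_cartesian_product)
qed

text \<open>\<open>T\<close> is a candidate for the tilde part, and \<open>cyc z\<close> is the
  product of the central cyclic Sylow subgroups that are split off. That \<open>T\<close> has none
  left is a separate hypothesis where it matters.\<close>

definition dec :: "'a set \<Rightarrow> 'a \<Rightarrow> bool" where
  "dec T z \<longleftrightarrow> sg T \<and> z \<in> group_center G \<and> coprime (card T) (ord z) \<and> card T * ord z = card (carrier G)"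

lemma cyclic_restrict_iff:
  assumes "sg P" shows "cyclic_group (G\<lparr>carrier := P\<rparr>) \<longleftrightarrow> (\<exists>x\<in>P. P = cyc x)"
proof -
  interpret P: fin_group "G\<lparr>carrier := P\<rparr>" by (rule sg_restrict[OF assms])
  have "P = range (\<lambda>n::int. x [^]\<^bsub>G\<lparr>carrier := P\<rparr>\<^esub> n) \<longleftrightarrow> P = cyc x" if x: "x \<in> P" for x
  proof -
    have xG: "x \<in> carrier G" using x assms sg_mem by blast
    have e: "x [^]\<^bsub>G\<lparr>carrier := P\<rparr>\<^esub> n = x [^] n" for n :: int
      using int_pow_consistent[OF assms x] by simp
    have "range (\<lambda>n::int. x [^] n) = cyc x"
    proof
      show "range (\<lambda>n::int. x [^] n) \<subseteq> cyc x"
        using subgroup_int_pow_closed[OF sg_cyc[OF xG] cyc_self[OF xG]] by auto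
      show "cyc x \<subseteq> range (\<lambda>n::int. x [^] n)"
        unfolding cyc_def by (metis image_subsetI int_pow_int rangeI)
    qed
    then show ?thesis by (simp add: e)
  qed
  then show ?thesis using P.cyclic_group by simp
qed

lemma sg_center: "sg (group_center G)"
proof (rule sgI)
  show "group_center G \<noteq> {}" by (auto simp: group_center_def)
  fix x y assume xy: "x \<in> group_center G" "y \<in> group_center G"
  have "x \<otimes> y \<otimes> g = g \<otimes> (x \<otimes> y)" if g: "g \<in> carrier G" for g
  proof -
    have c: "x \<in> carrier G" "y \<in> carrier G" "x \<otimes> g = g \<otimes> x" "y \<otimes> g = g \<otimes> y"
      using xy g by (auto simp: group_center_def)
    have "x \<otimes> y \<otimes> g = x \<otimes> (g \<otimes> y)" using c g by (simp add: m_assoc)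
    also have "\<dots> = g \<otimes> x \<otimes> y" using c g by (simp add: m_assoc[symmetric])
    finally show ?thesis using c g by (simp add: m_assoc)
  qed
  moreover have "x \<otimes> y \<in> carrier G" using xy unfolding group_center_def by blast
  ultimately show "x \<otimes> y \<in> group_center G" unfolding group_center_def by blast
qed (auto simp: group_center_def)

text \<open>Single elements in place of Sylow subgroups are easier to carry along isomorphisms and
  into \<open>T\<close>.\<close>

lemma central_cyclic_primes_iff:
  "p \<in> central_cyclic_primes G \<longleftrightarrow> Factorial_Ring.prime p \<and> p dvd card (carrier G) \<and>
     (\<exists>x \<in> group_center G. ord x = p ^ multiplicity p (card (carrier G)))"
proof
  assume "p \<in> central_cyclic_primes G"
  then obtain P where P: "Factorial_Ring.prime p" "p dvd card (carrier G)" "sg P"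
      "card P = p ^ multiplicity p (card (carrier G))" "cyclic_group (G\<lparr>carrier := P\<rparr>)" "P \<subseteq> group_center G"
    by (auto simp: central_cyclic_primes_def sylow_subgroup_def)
  obtain x where x: "x \<in> P" "P = cyc x" using P cyclic_restrict_iff by blast
  then have "ord x = card P" using card_cyc sg_mem[OF P(3)] by metis
  then have "x \<in> group_center G" "ord x = p ^ multiplicity p (card (carrier G))" using P(4,6) x(1) by auto
  then show "Factorial_Ring.prime p \<and> p dvd card (carrier G) \<and>
     (\<exists>x \<in> group_center G. ord x = p ^ multiplicity p (card (carrier G)))" using P(1,2) by blast
next
  assume *: "Factorial_Ring.prime p \<and> p dvd card (carrier G) \<and>
     (\<exists>x \<in> group_center G. ord x = p ^ multiplicity p (card (carrier G)))"
  then obtain x where x: "x \<in> group_center G" "ord x = p ^ multiplicity p (card (carrier G))" by blast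
  have xG: "x \<in> carrier G" using x by (simp add: group_center_def)
  have "sg (cyc x)" "card (cyc x) = p ^ multiplicity p (card (carrier G))" "cyclic_group (G\<lparr>carrier := cyc x\<rparr>)"
     "cyc x \<subseteq> group_center G"
    using sg_cyc[OF xG] card_cyc[OF xG] x cyclic_restrict_iff cyc_self[OF xG] cyc_least[OF sg_center] by auto
  then show "p \<in> central_cyclic_primes G"
    using * unfolding central_cyclic_primes_def sylow_subgroup_def by blast
qed

lemma ord_restrict:
  assumes "sg T" "x \<in> T" shows "group.ord (G\<lparr>carrier := T\<rparr>) x = ord x"
proof -
  interpret T: fin_group "G\<lparr>carrier := T\<rparr>" by (rule sg_restrict[OF assms(1)])
  have "x [^]\<^bsub>G\<lparr>carrier := T\<rparr>\<^esub> n = x [^] n" for n :: nat by (rule nat_pow_consistent[symmetric])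
  then show ?thesis using T.ord_unique[of x "ord x"] assms pow_eq_id[OF sg_mem[OF assms]] by simp
qed

lemma dec_center:
  assumes "dec T z" "x \<in> T" shows "x \<in> group_center G \<longleftrightarrow> x \<in> group_center (G\<lparr>carrier := T\<rparr>)"
proof
  have T: "sg T" "z \<in> group_center G" "coprime (card T) (ord z)" "card T * ord z = card (carrier G)"
    using assms by (auto simp: dec_def)
  have zG: "z \<in> carrier G" using T by (simp add: group_center_def)
  have e: "T <#> cyc z = carrier G"
    using coprime_set_mult T sg_cyc[OF zG] card_cyc[OF zG] by simp
  assume x: "x \<in> group_center (G\<lparr>carrier := T\<rparr>)"
  have xG: "x \<in> carrier G" using assms T sg_mem by blast
  have "x \<otimes> y = y \<otimes> x" if "y \<in> carrier G" for y
  proof -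
    obtain u v where uv: "u \<in> T" "v \<in> cyc z" "y = u \<otimes> v" using \<open>y \<in> carrier G\<close> unfolding e[symmetric] by (rule set_multE)
    have v: "v \<in> group_center G" using uv cyc_least[OF sg_center T(2)] by blast
    have uG: "u \<in> carrier G" "v \<in> carrier G" using uv T sg_mem v by (auto simp: group_center_def)
    have "x \<otimes> u = u \<otimes> x" using x uv by (simp add: group_center_def)
    moreover have "v \<otimes> x = x \<otimes> v" using v xG by (simp add: group_center_def)
    ultimately show ?thesis using uv uG xG by (metis m_assoc)
  qed
  then show "x \<in> group_center G" using xG by (simp add: group_center_def)
qed (use assms sg_mem in \<open>auto simp: group_center_def dec_def\<close>)

text \<open>The component in \<open>cyc z\<close> of an element of \<open>N\<close> lies in
  \<open>N\<close> too, so its order divides two coprime numbers.\<close>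

lemma dec_coprime_le:
  assumes "dec T z" "sg N" "coprime (card N) (ord z)" shows "N \<subseteq> T"
proof
  have T: "sg T" "z \<in> group_center G" "coprime (card T) (ord z)" "card T * ord z = card (carrier G)"
    using assms by (auto simp: dec_def)
  have zG: "z \<in> carrier G" using T by (simp add: group_center_def)
  have e: "T <#> cyc z = carrier G"
    using coprime_set_mult T sg_cyc[OF zG] card_cyc[OF zG] by simp
  fix n assume n: "n \<in> N"
  then have "n \<in> T <#> cyc z" using e sg_mem[OF assms(2)] by blast
  then obtain u v where uv: "u \<in> T" "v \<in> cyc z" "n = u \<otimes> v" by (rule set_multE)
  have v: "v \<in> group_center G" using uv cyc_least[OF sg_center T(2)] by blast
  have uG: "u \<in> carrier G" "v \<in> carrier G" using uv T sg_mem v by (auto simp: group_center_def)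
  have "u \<otimes> v = v \<otimes> u" using v uG by (simp add: group_center_def)
  then have "v \<in> N" using coprime_component(2)[of T "cyc z" N u v] uv T sg_cyc[OF zG] card_cyc[OF zG] assms n by simp
  then have "ord v dvd card N" "ord v dvd ord z" using ord_dvd_card assms uv sg_cyc card_cyc zG by metis+
  then have "ord v = 1" using assms(3) by (meson coprime_common_divisor_nat)
  then have "v = \<one>" using ord_eq_1 uG by simp
  then show "n \<in> T" using uv uG by simp
qed

lemma multiplicity_dec:
  assumes "dec T z" "Factorial_Ring.prime p" "p dvd ord z"
  shows "multiplicity p (card (carrier G)) = multiplicity p (ord z)"
proof -
  have T: "coprime (card T) (ord z)" "card T * ord z = card (carrier G)" "card T > 0"
    using assms sg_card_pos by (auto simp: dec_def)
  have zG: "z \<in> carrier G" using assms by (simp add: dec_def group_center_def)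
  have "\<not> p dvd card T" using T(1) assms(2,3) coprime_common_divisor[of "card T" "ord z" p] not_prime_unit by blast
  then have "multiplicity p (card T) = 0" by (simp add: not_dvd_imp_multiplicity_0)
  moreover have "multiplicity p (card T * ord z) = multiplicity p (card T) + multiplicity p (ord z)"
    by (rule prime_elem_multiplicity_mult_distrib) (use assms(2) T(3) ord_pos[OF zG] in auto)
  ultimately show ?thesis using T(2) by simp
qed

text \<open>A central cyclic Sylow subgroup for another prime would have order prime to
  \<open>ord z\<close>, hence lie in \<open>T\<close> and count there as well. Conversely, each
  prime divisor of \<open>ord z\<close> contributes the corresponding part of
  \<open>cyc z\<close>.\<close>

lemma dec_central_cyclic_primes:
  assumes d: "dec T z" and r: "central_cyclic_primes (G\<lparr>carrier := T\<rparr>) = {}"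
  shows "central_cyclic_primes G = prime_factors (ord z)"
proof (intro equalityI subsetI)
  interpret T: fin_group "G\<lparr>carrier := T\<rparr>" using d sg_restrict by (simp add: dec_def)
  have T: "sg T" "z \<in> group_center G" "coprime (card T) (ord z)" "card T * ord z = card (carrier G)"
    using d by (auto simp: dec_def)
  have zG: "z \<in> carrier G" using T by (simp add: group_center_def)
  have zp: "ord z > 0" "card T > 0" using ord_pos zG sg_card_pos T by auto
  fix p assume "p \<in> central_cyclic_primes G"
  then obtain x where p: "Factorial_Ring.prime p" "p dvd card (carrier G)"
      and x: "x \<in> group_center G" "ord x = p ^ multiplicity p (card (carrier G))"
    by (auto simp: central_cyclic_primes_iff)
  show "p \<in> prime_factors (ord z)"
  proof (rule ccontr)
    assume "p \<notin> prime_factors (ord z)"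
    then have nz: "\<not> p dvd ord z" using p zp by (simp add: prime_factors_dvd)
    then have pT: "p dvd card T" using p T by (metis prime_dvd_mult_iff)
    have xG: "x \<in> carrier G" using x by (simp add: group_center_def)
    have "coprime (card (cyc x)) (ord z)"
      using nz p x card_cyc[OF xG] by (simp add: prime_imp_coprime coprime_power_left_iff)
    then have "cyc x \<subseteq> T" using dec_coprime_le[OF d sg_cyc[OF xG]] by blast
    then have xT: "x \<in> T" using cyc_self[OF xG] by blast
    have "multiplicity p (card (carrier G)) = multiplicity p (card T * ord z)" using T by simp
    also have "\<dots> = multiplicity p (card T) + multiplicity p (ord z)"
      by (rule prime_elem_multiplicity_mult_distrib) (use p zp in auto)
    also have "multiplicity p (ord z) = 0" using nz by (simp add: not_dvd_imp_multiplicity_0)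
    finally have "p \<in> central_cyclic_primes (G\<lparr>carrier := T\<rparr>)"
      unfolding T.central_cyclic_primes_iff using p pT x xT dec_center[OF d xT] ord_restrict[OF T(1) xT] by auto
    then show False using r by simp
  qed
next
  have T: "sg T" "z \<in> group_center G" "coprime (card T) (ord z)" "card T * ord z = card (carrier G)"
    using d by (auto simp: dec_def)
  have zG: "z \<in> carrier G" using T by (simp add: group_center_def)
  fix p assume "p \<in> prime_factors (ord z)"
  then have p: "Factorial_Ring.prime p" "p dvd ord z" by auto
  let ?m = "multiplicity p (ord z)"
  have m: "p ^ ?m dvd ord z" by (rule multiplicity_dvd)
  have z0: "ord z > 0" using ord_pos zG by blast
  have "ord z div p ^ ?m dvd ord z" "ord z div p ^ ?m \<noteq> 0"
    using m z0 by (auto simp: dvd_div_eq_0_iff) (metis dvd_div_mult_self dvd_triv_left)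
  then have "ord (z [^] (ord z div p ^ ?m)) = ord z div (ord z div p ^ ?m)"
    using ord_pow zG by blast
  also have "\<dots> = p ^ ?m" using m z0 by (rule div_div_self)
  finally have "ord (z [^] (ord z div p ^ ?m)) = p ^ multiplicity p (card (carrier G))"
    using multiplicity_dec[OF d p] by simp
  moreover have "z [^] (ord z div p ^ ?m) \<in> group_center G" using T sg_center sg_pow by blast
  moreover have "p dvd card (carrier G)" using p T by (metis dvd_mult)
  ultimately show "p \<in> central_cyclic_primes G" unfolding central_cyclic_primes_iff using p by blast
qed

text \<open>\<open>T\<close> is normal because \<open>cyc z\<close> is central, and
  \<open>dec_coprime_le\<close> puts every competing normal subgroup inside it. So the greatest
  element in the definition exists and is \<open>T\<close>.\<close>

lemma dec_tilde_part:
  assumes d: "dec T z" and r: "central_cyclic_primes (G\<lparr>carrier := T\<rparr>) = {}"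
  shows "tilde_part G = G\<lparr>carrier := T\<rparr>"
proof -
  have T: "sg T" "z \<in> group_center G" "coprime (card T) (ord z)" "card T * ord z = card (carrier G)"
    using d by (auto simp: dec_def)
  have zG: "z \<in> carrier G" using T by (simp add: group_center_def)
  have ccp: "central_cyclic_primes G = prime_factors (ord z)" using dec_central_cyclic_primes d r by blast
  have e: "T <#> cyc z = carrier G"
    using coprime_set_mult T sg_cyc[OF zG] card_cyc[OF zG] by simp
  have "T \<lhd> G"
  proof (rule normal_invI[OF T(1)])
    fix x h assume x: "x \<in> carrier G" and h: "h \<in> T"
    obtain u v where uv: "u \<in> T" "v \<in> cyc z" "x = u \<otimes> v" using x unfolding e[symmetric] by (rule set_multE)
    have v: "v \<in> group_center G" using uv cyc_least[OF sg_center T(2)] by blast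
    have c: "u \<in> carrier G" "v \<in> carrier G" "h \<in> carrier G" using uv h T sg_mem v by (auto simp: group_center_def)
    have "v \<otimes> h = h \<otimes> v" using v c by (simp add: group_center_def)
    then have "x \<otimes> h \<otimes> inv x = u \<otimes> h \<otimes> inv u"
      using c uv by (simp add: m_assoc inv_mult_group) (metis m_assoc r_inv r_one inv_closed m_closed l_one)
    then show "x \<otimes> h \<otimes> inv x \<in> T" using uv h sg_mult[OF T(1)] sg_inv[OF T(1)] by simp
  qed
  moreover have "\<forall>p\<in>central_cyclic_primes G. \<not> p dvd card T"
  proof
    fix p assume "p \<in> central_cyclic_primes G"
    then have "Factorial_Ring.prime p" "p dvd ord z" using ccp by auto
    then show "\<not> p dvd card T" using T(3) coprime_common_divisor[of "card T" "ord z" p] not_prime_unit by blast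
  qed
  moreover have "N \<le> T" if N: "N \<lhd> G \<and> (\<forall>p\<in>central_cyclic_primes G. \<not> p dvd card N)" for N
  proof -
    have sN: "sg N" using N normal_imp_subgroup by blast
    have "coprime (card N) (ord z)"
    proof (rule ccontr)
      assume "\<not> coprime (card N) (ord z)"
      then have "gcd (card N) (ord z) \<noteq> 1" by (simp only: coprime_iff_gcd_eq_1 not_False_eq_True)
      then obtain p where "Factorial_Ring.prime p" "p dvd gcd (card N) (ord z)" using prime_factor_nat by blast
      then have "Factorial_Ring.prime p" "p dvd card N" "p dvd ord z"
        by (blast intro: dvd_trans[OF _ gcd_dvd1] dvd_trans[OF _ gcd_dvd2])+
      moreover have "ord z > 0" using ord_pos zG by blast
      ultimately show False using N ccp by (auto simp: prime_factors_dvd)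
    qed
    then show ?thesis using dec_coprime_le[OF d sN] by simp
  qed
  ultimately have "pi_prime_core (central_cyclic_primes G) G = T"
    unfolding pi_prime_core_def by (intro Greatest_equality) auto
  then show ?thesis by (simp add: tilde_part_def)
qed

lemma dec_num_subgroups:
  assumes d: "dec T z" shows "num_subgroups G = num_subgroups (G\<lparr>carrier := T\<rparr>) * tau (ord z)"
proof -
  have T: "sg T" "z \<in> group_center G" "coprime (card T) (ord z)" "card T * ord z = card (carrier G)"
    using d by (auto simp: dec_def)
  have zG: "z \<in> carrier G" using T by (simp add: group_center_def)
  have "num_subgroups G = card {H. sg H \<and> H \<subseteq> T} * card {H. sg H \<and> H \<subseteq> cyc z}"
  proof (rule num_subgroups_coprime)
    fix u v assume "u \<in> T" "v \<in> cyc z"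
    then have "v \<in> group_center G" "u \<in> carrier G" using cyc_least[OF sg_center T(2)] T sg_mem by auto
    then show "u \<otimes> v = v \<otimes> u" by (simp add: group_center_def)
  qed (use T sg_cyc[OF zG] card_cyc[OF zG] in auto)
  then show ?thesis using num_subgroups_restrict[OF T(1)] card_sg_cyc[OF zG] by (simp add: tau_def)
qed

end

lemma iso_ord:
  assumes "h \<in> iso G H" "group G" "group H" "x \<in> carrier G"
  shows "group.ord H (h x) = group.ord G x"
proof -
  interpret G: group G by fact
  interpret H: group H by fact
  interpret h: group_hom G H h using assms by (simp add: group_hom_def group_hom_axioms_def iso_def)
  have "h x [^]\<^bsub>H\<^esub> n = \<one>\<^bsub>H\<^esub> \<longleftrightarrow> x [^]\<^bsub>G\<^esub> n = \<one>\<^bsub>G\<^esub>" for n :: nat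
  proof -
    have "h x [^]\<^bsub>H\<^esub> n = h (x [^]\<^bsub>G\<^esub> n)" using h.hom_nat_pow assms(4) by simp
    moreover have "inj_on h (carrier G)" using assms(1) by (simp add: iso_def bij_betw_def)
    ultimately show ?thesis using assms(4) by (metis G.nat_pow_closed G.one_closed h.hom_one inj_on_eq_iff)
  qed
  then show ?thesis using assms(4) by (subst H.ord_unique) (auto simp: G.pow_eq_id)
qed

lemma iso_center:
  assumes "h \<in> iso G H" "group G" "group H" "x \<in> carrier G"
  shows "h x \<in> group_center H \<longleftrightarrow> x \<in> group_center G"
proof -
  have b: "h ` carrier G = carrier H" "inj_on h (carrier G)" using assms(1) by (auto simp: iso_def bij_betw_def)
  have m: "h (u \<otimes>\<^bsub>G\<^esub> v) = h u \<otimes>\<^bsub>H\<^esub> h v" if "u \<in> carrier G" "v \<in> carrier G" for u v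
    using assms(1) that by (auto simp: iso_def hom_def)
  have "h x \<otimes>\<^bsub>H\<^esub> h y = h y \<otimes>\<^bsub>H\<^esub> h x \<longleftrightarrow> x \<otimes>\<^bsub>G\<^esub> y = y \<otimes>\<^bsub>G\<^esub> x" if "y \<in> carrier G" for y
    using m that assms b(2) by (metis inj_on_eq_iff monoid.m_closed group.is_monoid)
  then show ?thesis unfolding group_center_def using assms(4) b(1) by (auto simp flip: b(1))
qed

lemma iso_central_cyclic_primes:
  assumes "G \<cong> H" "fin_group G" "fin_group H"
  shows "central_cyclic_primes G = central_cyclic_primes H"
proof -
  obtain h where h: "h \<in> iso G H" using assms(1) by (auto simp: is_iso_def)
  interpret G: fin_group G by fact
  interpret H: fin_group H by fact
  have b: "h ` carrier G = carrier H" "bij_betw h (carrier G) (carrier H)" using h by (auto simp: iso_def bij_betw_def)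
  have "(\<exists>x\<in>group_center G. G.ord x = n) \<longleftrightarrow> (\<exists>x\<in>group_center H. H.ord x = n)" for n
  proof
    assume "\<exists>x\<in>group_center G. G.ord x = n"
    then obtain x where "x \<in> group_center G" "x \<in> carrier G" "G.ord x = n" by (auto simp: group_center_def)
    then show "\<exists>x\<in>group_center H. H.ord x = n"
      using iso_center[OF h G.is_group H.is_group, of x] iso_ord[OF h G.is_group H.is_group, of x] by auto
  next
    assume "\<exists>x\<in>group_center H. H.ord x = n"
    then obtain x where x: "x \<in> group_center H" "x \<in> carrier H" "H.ord x = n" by (auto simp: group_center_def)
    then obtain y where "y \<in> carrier G" "x = h y" using b(1) by blast
    then show "\<exists>x\<in>group_center G. G.ord x = n"
      using x iso_center[OF h G.is_group H.is_group, of y] iso_ord[OF h G.is_group H.is_group, of y] by auto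
  qed
  then show ?thesis
    using bij_betw_same_card[OF b(2)] by (auto simp: G.central_cyclic_primes_iff H.central_cyclic_primes_iff)
qed

definition exps :: "nat \<Rightarrow> nat multiset" where
  "exps n = image_mset (\<lambda>p. multiplicity p n) (mset_set (prime_factors n))"

text \<open>Translates the bijection between primes in the definition of similarity into equality of
  multisets of exponents.\<close>

lemma image_mset_eq_iff_bij:
  assumes "finite A" "finite B"
  shows "image_mset m (mset_set A) = image_mset m' (mset_set B) \<longleftrightarrow>
     (\<exists>f. bij_betw f A B \<and> (\<forall>x\<in>A. m x = m' (f x)))"
proof
  assume "\<exists>f. bij_betw f A B \<and> (\<forall>x\<in>A. m x = m' (f x))"
  then obtain f where f: "bij_betw f A B" "\<forall>x\<in>A. m x = m' (f x)" by blast
  have "image_mset m' (mset_set B) = image_mset m' (image_mset f (mset_set A))"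
    using f(1) by (simp add: image_mset_mset_set bij_betw_def)
  also have "\<dots> = image_mset m (mset_set A)"
    unfolding multiset.map_comp by (rule image_mset_cong) (use f(2) assms in auto)
  finally show "image_mset m (mset_set A) = image_mset m' (mset_set B)" by simp
next
  assume "image_mset m (mset_set A) = image_mset m' (mset_set B)"
  with assms show "\<exists>f. bij_betw f A B \<and> (\<forall>x\<in>A. m x = m' (f x))"
  proof (induction A arbitrary: B rule: finite_induct)
    case empty
    then have "B = {}" by (simp add: mset_set_empty_iff)
    then show ?case by (auto simp: bij_betw_def)
  next
    case (insert a A)
    have "m a \<in># image_mset m' (mset_set B)" using insert.hyps insert.prems(2)[symmetric] by simp
    then obtain b where b: "b \<in> B" "m a = m' b" using insert.prems(1) by auto
    have "mset_set B = add_mset b (mset_set (B - {b}))" using b insert.prems(1)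
      by (metis insert_Diff finite_Diff mset_set.insert Diff_iff singletonI)
    then have "image_mset m (mset_set A) = image_mset m' (mset_set (B - {b}))"
      using insert.prems(2) insert.hyps b by simp
    then obtain f where f: "bij_betw f A (B - {b})" "\<forall>x\<in>A. m x = m' (f x)"
      using insert.IH[of "B - {b}"] insert.prems(1) by auto
    have "bij_betw (f(a := b)) A (B - {b})"
      using f(1) insert.hyps(2) by (subst bij_betw_cong[of _ _ f]) auto
    then have "bij_betw (f(a := b)) (insert a A) (insert b (B - {b}))"
      using notIn_Un_bij_betw[of a A "f(a := b)" "B - {b}"] insert.hyps by simp
    then have "bij_betw (f(a := b)) (insert a A) B" using b by (simp add: insert_absorb)
    moreover have "\<forall>x\<in>insert a A. m x = m' ((f(a := b)) x)" using f(2) b insert.hyps by auto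
    ultimately show ?case by blast
  qed
qed

lemma similar_groups_dec:
  assumes "fin_group G" "fin_group H"
    and d: "fin_group.dec G T z" "fin_group.dec H U w"
    and r: "central_cyclic_primes (G\<lparr>carrier := T\<rparr>) = {}" "central_cyclic_primes (H\<lparr>carrier := U\<rparr>) = {}"
  shows "similar_groups G H \<longleftrightarrow>
    G\<lparr>carrier := T\<rparr> \<cong> H\<lparr>carrier := U\<rparr> \<and> exps (group.ord G z) = exps (group.ord H w)"
proof -
  interpret G: fin_group G by fact
  interpret H: fin_group H by fact
  have "exps (G.ord z) = exps (H.ord w) \<longleftrightarrow>
     (\<exists>f. bij_betw f (prime_factors (G.ord z)) (prime_factors (H.ord w)) \<and>
        (\<forall>p\<in>prime_factors (G.ord z). multiplicity p (G.ord z) = multiplicity (f p) (H.ord w)))"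
    unfolding exps_def by (rule image_mset_eq_iff_bij) auto
  also have "\<dots> \<longleftrightarrow> (\<exists>f. bij_betw f (prime_factors (G.ord z)) (prime_factors (H.ord w)) \<and>
        (\<forall>p\<in>prime_factors (G.ord z). multiplicity p (card (carrier G)) = multiplicity (f p) (card (carrier H))))"
  proof (rule ex_cong1, rule conj_cong[OF refl], rule ball_cong[OF refl])
    fix f p assume f: "bij_betw f (prime_factors (G.ord z)) (prime_factors (H.ord w))" and p: "p \<in> prime_factors (G.ord z)"
    have "f p \<in> prime_factors (H.ord w)" using f p by (rule bij_betwE[rule_format])
    then show "multiplicity p (G.ord z) = multiplicity (f p) (H.ord w) \<longleftrightarrow>
       multiplicity p (card (carrier G)) = multiplicity (f p) (card (carrier H))"
      using p G.multiplicity_dec[OF d(1)] H.multiplicity_dec[OF d(2)] by (simp add: in_prime_factors_iff)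
  qed
  finally show ?thesis
    unfolding similar_groups_def G.dec_tilde_part[OF d(1) r(1)] H.dec_tilde_part[OF d(2) r(2)]
      G.dec_central_cyclic_primes[OF d(1) r(1)] H.dec_central_cyclic_primes[OF d(2) r(2)] by blast
qed

section \<open>Counting similarity classes by codes\<close>

lemma gcd_mult_coprime_dvd:
  assumes "coprime (a::nat) b" "x dvd a" "y dvd b"
  shows "gcd (x * y) a = x" "gcd (x * y) b = y"
proof -
  have c: "coprime a y" "coprime b x"
    using assms coprime_divisors[of a a y b] coprime_divisors[of b b x a] by (auto simp: coprime_commute)
  have "gcd (x * y) a = gcd x a" using c(1) by (metis gcd.commute gcd_mult_right_right_cancel mult.commute coprime_commute)
  then show "gcd (x * y) a = x" using assms(2) by (simp add: gcd_nat.absorb1)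
  have "gcd (x * y) b = gcd y b" using c(2) by (metis gcd.commute gcd_mult_right_left_cancel mult.commute coprime_commute)
  then show "gcd (x * y) b = y" using assms(3) by (simp add: gcd_nat.absorb1)
qed

lemma tau_coprime_mult:
  assumes "coprime a b" "a > 0" "b > 0"
  shows "tau (a * b) = tau a * tau b"
proof -
  have "bij_betw (\<lambda>(x, y). x * y) ({d. d dvd a} \<times> {d. d dvd b}) {d. d dvd a * b}"
  proof (rule bij_betw_byWitness[where f' = "\<lambda>d. (gcd d a, gcd d b)"])
    show "\<forall>q\<in>{d. d dvd a} \<times> {d. d dvd b}. (gcd (case q of (x, y) \<Rightarrow> x * y) a, gcd (case q of (x, y) \<Rightarrow> x * y) b) = q"
    proof clarify
      fix x y assume xy: "x dvd a" "y dvd b"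
      then show "gcd (x * y) a = x \<and> gcd (x * y) b = y" using gcd_mult_coprime_dvd assms(1) by blast
    qed
    show "\<forall>d\<in>{d. d dvd a * b}. (case (gcd d a, gcd d b) of (x, y) \<Rightarrow> x * y) = d"
    proof clarify
      fix d assume d: "d dvd a * b"
      then obtain x y where xy: "d = x * y" "x dvd a" "y dvd b" using division_decomp by blast
      then show "gcd d a * gcd d b = d" using gcd_mult_coprime_dvd[OF assms(1)] by metis
    qed
  qed (auto intro: mult_dvd_mono)
  then show ?thesis using bij_betw_same_card by (fastforce simp: tau_def card_cartesian_product)
qed

lemma tau_prime_power:
  assumes "Factorial_Ring.prime (p::nat)" shows "tau (p ^ e) = Suc e"
proof -
  have "{d. d dvd p ^ e} = (\<lambda>i. p ^ i) ` {..e}"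
  proof (intro equalityI subsetI)
    fix d assume "d \<in> {d. d dvd p ^ e}"
    then show "d \<in> (\<lambda>i. p ^ i) ` {..e}" using divides_primepow_nat[OF assms] by auto
  qed (auto intro: le_imp_power_dvd)
  moreover have "inj_on (\<lambda>i. p ^ i) {..e}"
    using prime_gt_1_nat[OF assms] by (auto simp: inj_on_def)
  ultimately show ?thesis by (simp add: tau_def card_image)
qed

lemma exps_step:
  assumes p: "Factorial_Ring.prime (p::nat)" "\<not> p dvd m" and "e > 0" "m > 0"
  shows "exps (p ^ e * m) = add_mset e (exps m)"
proof -
  have pf: "prime_factors (p ^ e * m) = insert p (prime_factors m)"
    using assms by (auto simp: prime_factors_dvd prime_dvd_mult_iff prime_dvd_power_iff primes_dvd_imp_eq)
  have q: "multiplicity q (p ^ e * m) = multiplicity q m" if "q \<in> prime_factors m" for q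
  proof -
    have "\<not> q dvd p ^ e" "Factorial_Ring.prime q"
      using that p prime_dvd_power[of q p e] primes_dvd_imp_eq[of q p] in_prime_factors_imp_prime in_prime_factors_imp_dvd by blast+
    then show ?thesis using prime_elem_multiplicity_mult_distrib[of q "p ^ e" m] assms
      by (simp add: not_dvd_imp_multiplicity_0)
  qed
  have "multiplicity p (p ^ e * m) = e"
    using prime_elem_multiplicity_mult_distrib[of p "p ^ e" m] assms
    by (simp add: not_dvd_imp_multiplicity_0 multiplicity_same_power)
  moreover have "p \<notin> prime_factors m" using p in_prime_factors_imp_dvd by blast
  moreover have "image_mset (\<lambda>q. multiplicity q (p ^ e * m)) (mset_set (prime_factors m)) = exps m"
    unfolding exps_def by (rule image_mset_cong) (use q in auto)
  ultimately show ?thesis unfolding exps_def[of "p ^ e * m"] pf by simp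
qed

lemma tau_exps: "n > 0 \<Longrightarrow> tau n = prod_mset (image_mset Suc (exps n)) \<and> 0 \<notin># exps n"
proof (induction n rule: less_induct)
  case (less n)
  show ?case
  proof (cases "n = 1")
    case True
    then show ?thesis by (simp add: tau_def exps_def)
  next
    case False
    then obtain p where p: "Factorial_Ring.prime p" "p dvd n" using prime_factor_nat by blast
    define e where "e = multiplicity p n"
    obtain m where m: "n = p ^ e * m" "\<not> p dvd m"
      unfolding e_def by (rule multiplicity_decompose'[of n p]) (use p less.prems not_prime_unit in auto)
    have e: "e > 0" using p m by (metis gr0I mult_1 power_0)
    have m0: "m > 0" using m less.prems by (cases m) auto
    have "p ^ e > 1" using prime_gt_1_nat[OF p(1)] e by (rule one_less_power)
    then have "m < n" using m m0 by simp
    then have IH: "tau m = prod_mset (image_mset Suc (exps m)) \<and> 0 \<notin># exps m" using less.IH m0 by blast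
    have "coprime (p ^ e) m" using p m by (simp add: prime_imp_coprime)
    then have "tau n = Suc e * tau m"
      using tau_coprime_mult[of "p ^ e" m] tau_prime_power[OF p(1)] m m0 p by (simp add: prime_gt_0_nat)
    then show ?thesis using IH exps_step[OF p(1) m(2) e m0] m e by simp
  qed
qed

text \<open>Each exponent gets a new prime, larger than the product of \<open>c\<close> and the
  number built so far. With \<open>c\<close> the order of a representative, every multiset is
  realized by a central cyclic factor.\<close>

lemma ex_exps:
  assumes "0 \<notin># ms" "c > 0" shows "\<exists>n>0. coprime n c \<and> exps n = ms"
  using assms(1)
proof (induction ms)
  case empty
  then show ?case by (intro exI[of _ 1]) (simp add: exps_def)
next
  case (add e ms)
  then obtain n where n: "n > 0" "coprime n c" "exps n = ms" by auto
  obtain p where p: "Factorial_Ring.prime p" "p > c * n" using bigger_prime by blast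
  have "c \<le> c * n" "n \<le> c * n" using n assms(2) by auto
  then have "p > c" "p > n" using p(2) by linarith+
  then have "\<not> p dvd c" "\<not> p dvd n" using n assms(2) by (auto dest: dvd_imp_le)
  then have "coprime (p ^ e * n) c" "exps (p ^ e * n) = add_mset e ms"
    using exps_step[OF p(1), of n e] n add.prems p(1) by (auto simp: prime_imp_coprime)
  then show ?case using n p by (intro exI[of _ "p ^ e * n"]) (simp add: prime_gt_0_nat)
qed

lemma ex_nat_iso:
  assumes "fin_group K" shows "\<exists>G\<in>finite_groups. K \<cong> G"
proof -
  interpret K: fin_group K by fact
  obtain f where f: "bij_betw f (carrier K) {0..<card (carrier K)}"
    using ex_bij_betw_finite_nat[OF K.fin] by blast
  define g where "g = inv_into (carrier K) f"
  have fg: "f (g n) = n" "g n \<in> carrier K" if "n < card (carrier K)" for n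
    using f that unfolding g_def by (auto simp: bij_betw_def f_inv_into_f inv_into_into)
  have gf: "g (f x) = x" "f x < card (carrier K)" if "x \<in> carrier K" for x
    using f that unfolding g_def by (auto simp: bij_betw_def)
  define G :: "nat monoid" where
    "G = \<lparr>carrier = {0..<card (carrier K)}, monoid.mult = (\<lambda>x y. f (g x \<otimes>\<^bsub>K\<^esub> g y)), one = f \<one>\<^bsub>K\<^esub>\<rparr>"
  have h: "f \<in> iso K G"
    by (rule isoI) (use f gf in \<open>auto simp: G_def hom_def\<close>)
  have "monoid G"
    by (rule monoidI) (auto simp: G_def gf fg K.m_assoc)
  then have "group G" using h K.iso_imp_group by (auto simp: is_iso_def)
  then have "G \<in> finite_groups" by (simp add: finite_groups_def G_def)
  then show ?thesis using h by (auto simp: is_iso_def)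
qed

lemma dec_iso:
  assumes "h \<in> iso K G" "fin_group K" "fin_group G" "fin_group.dec K T z"
  shows "fin_group.dec G (h ` T) (h z)" "K\<lparr>carrier := T\<rparr> \<cong> G\<lparr>carrier := h ` T\<rparr>"
    "group.ord G (h z) = group.ord K z"
proof -
  interpret K: fin_group K by fact
  interpret G: fin_group G by fact
  interpret h: group_hom K G h
    using assms K.is_group G.is_group by (simp add: group_hom_def group_hom_axioms_def iso_def)
  have b: "bij_betw h (carrier K) (carrier G)" using assms by (simp add: iso_def)
  have T: "subgroup T K" "z \<in> group_center K" "coprime (card T) (K.ord z)" "card T * K.ord z = card (carrier K)"
    using assms(4) by (auto simp: K.dec_def)
  have zK: "z \<in> carrier K" using T by (simp add: group_center_def)
  have inj: "inj_on h T" using b T(1) subgroup.subset by (meson bij_betw_def inj_on_subset)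
  show o: "G.ord (h z) = K.ord z" using iso_ord[OF assms(1) K.is_group G.is_group zK] .
  show "fin_group.dec G (h ` T) (h z)"
    unfolding G.dec_def o card_image[OF inj]
    using T h.subgroup_img_is_subgroup iso_center[OF assms(1) K.is_group G.is_group zK] bij_betw_same_card[OF b] by simp
  have "h \<in> iso (K\<lparr>carrier := T\<rparr>) (G\<lparr>carrier := h ` T\<rparr>)"
    by (rule isoI) (use inj T(1) subgroup.subset[OF T(1)] in \<open>auto simp: hom_def bij_betw_def subset_iff\<close>)
  then show "K\<lparr>carrier := T\<rparr> \<cong> G\<lparr>carrier := h ` T\<rparr>" by (auto simp: is_iso_def)
qed

text \<open>The group is the direct product of \<open>R\<close> with the integers modulo
  \<open>n\<close>, transported to a carrier of natural numbers.\<close>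

lemma ex_dec_group:
  assumes "fin_group R" "n > 0" "coprime n (card (carrier R))"
  shows "\<exists>G\<in>finite_groups. \<exists>T z. fin_group.dec G T z \<and> G\<lparr>carrier := T\<rparr> \<cong> R \<and> group.ord G z = n"
proof -
  interpret R: fin_group R by fact
  let ?Z = "integer_mod_group n"
  interpret Z: group ?Z by simp
  have cZ: "carrier ?Z = {0..<int n}" using assms(2) by (simp add: carrier_integer_mod_group)
  interpret K: group "R \<times>\<times> ?Z" by (rule DirProd_group) (auto simp: R.is_group)
  interpret K: fin_group "R \<times>\<times> ?Z" by unfold_locales (simp add: R.fin cZ)
  define T where "T = carrier R \<times> {0::int}"
  define z where "z = (\<one>\<^bsub>R\<^esub>, 1 mod int n)"
  have zK: "z \<in> carrier (R \<times>\<times> ?Z)" using assms(2) by (simp add: z_def cZ)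
  have zp: "z [^]\<^bsub>R \<times>\<times> ?Z\<^esub> i = (\<one>\<^bsub>R\<^esub>, int i mod int n)" for i :: nat
    by (induction i) (auto simp: z_def mod_simps add.commute)
  have oz: "K.ord z = n"
    unfolding K.ord_unique[OF zK] zp using zmod_int[symmetric] by (auto simp: dvd_eq_mod_eq_0 simp flip: of_nat_mod)
  have d: "K.dec T z"
    unfolding K.dec_def oz
  proof (intro conjI)
    show "subgroup T (R \<times>\<times> ?Z)"
      by (rule K.sgI) (use assms(2) R.one_closed in \<open>auto simp: T_def cZ\<close>)
    show "z \<in> group_center (R \<times>\<times> ?Z)"
      using zK by (auto simp: group_center_def z_def add.commute)
    show "coprime (card T) n" using assms(3) by (simp add: T_def card_cartesian_product coprime_commute)
    show "card T * n = card (carrier (R \<times>\<times> ?Z))" by (simp add: T_def card_cartesian_product cZ)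
  qed
  have "fst \<in> iso ((R \<times>\<times> ?Z)\<lparr>carrier := T\<rparr>) R"
    by (rule isoI) (auto simp: T_def hom_def bij_betw_def inj_on_def)
  then have i: "(R \<times>\<times> ?Z)\<lparr>carrier := T\<rparr> \<cong> R" by (auto simp: is_iso_def)
  obtain G where G: "G \<in> finite_groups" "R \<times>\<times> ?Z \<cong> G" using ex_nat_iso[OF K.fin_group_axioms] by blast
  then obtain h where h: "h \<in> iso (R \<times>\<times> ?Z) G" by (auto simp: is_iso_def)
  have Gf: "fin_group G" using G by (simp add: finite_groups_def fin_group_def fin_group_axioms_def)
  note di = dec_iso[OF h K.fin_group_axioms Gf d]
  have "group ((R \<times>\<times> ?Z)\<lparr>carrier := T\<rparr>)" using d K.dec_def K.subgroup_imp_group by blast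
  then have "G\<lparr>carrier := h ` T\<rparr> \<cong> R" using di(2) i group.iso_sym iso_trans by blast
  then show ?thesis using G di oz by metis
qed

text \<open>Symmetry of isomorphism needs a group on the left, and \<open>tilde_part G\<close> is
  known to be one only after a decomposition of \<open>G\<close> has been found.\<close>

lemma iso_tilde_sym:
  assumes "group (tilde_part G)" "similar_groups G H" shows "similar_groups H G"
proof -
  obtain f where f: "bij_betw f (central_cyclic_primes G) (central_cyclic_primes H)"
     "\<forall>p \<in> central_cyclic_primes G. multiplicity p (card (carrier G)) = multiplicity (f p) (card (carrier H))"
    using assms(2) by (auto simp: similar_groups_def)
  have "bij_betw (inv_into (central_cyclic_primes G) f) (central_cyclic_primes H) (central_cyclic_primes G)"
    using f(1) by (rule bij_betw_inv_into)
  moreover have "\<forall>p \<in> central_cyclic_primes H. multiplicity p (card (carrier H)) =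
      multiplicity (inv_into (central_cyclic_primes G) f p) (card (carrier G))"
    using f by (metis bij_betw_inv_into_right bij_betw_apply bij_betw_inv_into)
  moreover have "tilde_part H \<cong> tilde_part G" using assms group.iso_sym by (auto simp: similar_groups_def)
  ultimately show ?thesis unfolding similar_groups_def by blast
qed

lemma similar_groups_trans:
  assumes "similar_groups G H" "similar_groups H K" shows "similar_groups G K"
proof -
  obtain f where f: "bij_betw f (central_cyclic_primes G) (central_cyclic_primes H)"
     "\<forall>p \<in> central_cyclic_primes G. multiplicity p (card (carrier G)) = multiplicity (f p) (card (carrier H))"
    using assms(1) by (auto simp: similar_groups_def)
  obtain g where g: "bij_betw g (central_cyclic_primes H) (central_cyclic_primes K)"
     "\<forall>p \<in> central_cyclic_primes H. multiplicity p (card (carrier H)) = multiplicity (g p) (card (carrier K))"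
    using assms(2) by (auto simp: similar_groups_def)
  have "bij_betw (g \<circ> f) (central_cyclic_primes G) (central_cyclic_primes K)" using f(1) g(1) by (rule bij_betw_trans)
  moreover have "\<forall>p \<in> central_cyclic_primes G. multiplicity p (card (carrier G)) = multiplicity ((g \<circ> f) p) (card (carrier K))"
    using f g bij_betw_apply[OF f(1)] by simp
  moreover have "tilde_part G \<cong> tilde_part K" using assms iso_trans by (auto simp: similar_groups_def)
  ultimately show ?thesis unfolding similar_groups_def by blast
qed

lemma similar_groups_refl: "similar_groups G G"
proof -
  have "tilde_part G \<cong> tilde_part G" using iso_set_refl by (auto simp: is_iso_def)
  moreover have "bij_betw id (central_cyclic_primes G) (central_cyclic_primes G)" by simp
  ultimately show ?thesis unfolding similar_groups_def by (metis id_apply)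
qed

text \<open>A group with \<open>n\<close> subgroups has a code: the index of the isomorphism type of
  its tilde part and its multiset of exponents. Similarity is equality of codes and every code with
  the right subgroup count is realized, so the classes are as many as the codes.\<close>

lemma num_similarity_classes_codes:
  fixes R :: "nat \<Rightarrow> 'b monoid"
  assumes grp: "\<And>i. i < m \<Longrightarrow> fin_group (R i)"
    and red: "\<And>i. i < m \<Longrightarrow> central_cyclic_primes (R i) = {}"
    and num: "\<And>i. i < m \<Longrightarrow> num_subgroups (R i) = r i"
    and noniso: "\<And>i i'. i < m \<Longrightarrow> i' < m \<Longrightarrow> R i \<cong> R i' \<Longrightarrow> i = i'"
    and cls: "\<And>G :: nat monoid. fin_group G \<Longrightarrow> num_subgroups G = n \<Longrightarrow>
       \<exists>i<m. \<exists>T z. fin_group.dec G T z \<and> G\<lparr>carrier := T\<rparr> \<cong> R i"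
  shows "num_similarity_classes n =
    card {(i, ms). i < m \<and> 0 \<notin># ms \<and> r i * prod_mset (image_mset Suc ms) = n}"
proof -
  define A where "A = {G \<in> finite_groups. num_subgroups G = n}"
  define cd where "cd G c \<longleftrightarrow> (\<exists>T z. fst c < m \<and> fin_group.dec G T z \<and> G\<lparr>carrier := T\<rparr> \<cong> R (fst c) \<and>
      snd c = exps (group.ord G z))" for G :: "nat monoid" and c
  have fg: "fin_group G" if "G \<in> finite_groups" for G
    using that by (simp add: finite_groups_def fin_group_def fin_group_axioms_def)
  have props: "\<exists>T z. fin_group.dec G T z \<and> G\<lparr>carrier := T\<rparr> \<cong> R (fst c) \<and> snd c = exps (group.ord G z) \<and>
      fin_group (G\<lparr>carrier := T\<rparr>) \<and> central_cyclic_primes (G\<lparr>carrier := T\<rparr>) = {}"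
    if "cd G c" "G \<in> finite_groups" for G c
  proof -
    obtain T z where T: "fst c < m" "fin_group.dec G T z" "G\<lparr>carrier := T\<rparr> \<cong> R (fst c)" "snd c = exps (group.ord G z)"
      using \<open>cd G c\<close> by (auto simp: cd_def)
    have f: "fin_group (G\<lparr>carrier := T\<rparr>)"
      using T(2) fin_group.sg_restrict[OF fg[OF that(2)]] fin_group.dec_def[OF fg[OF that(2)]] by auto
    then have "central_cyclic_primes (G\<lparr>carrier := T\<rparr>) = {}"
      using iso_central_cyclic_primes[OF T(3)] grp red T(1) by simp
    then show ?thesis using T f by blast
  qed
  \<comment> \<open>For \<open>G = H\<close> this shows that the code is unique, so the choice made
    in \<open>code\<close> below is harmless.\<close>
  have sim: "similar_groups G H \<longleftrightarrow> c = c'"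
    if cc: "cd G c" "cd H c'" "G \<in> finite_groups" "H \<in> finite_groups" for G H c c'
  proof -
    obtain T z where T: "fin_group.dec G T z" "G\<lparr>carrier := T\<rparr> \<cong> R (fst c)" "snd c = exps (group.ord G z)"
      "fin_group (G\<lparr>carrier := T\<rparr>)" "central_cyclic_primes (G\<lparr>carrier := T\<rparr>) = {}" using props[OF cc(1,3)] by blast
    obtain U w where U: "fin_group.dec H U w" "H\<lparr>carrier := U\<rparr> \<cong> R (fst c')" "snd c' = exps (group.ord H w)"
      "fin_group (H\<lparr>carrier := U\<rparr>)" "central_cyclic_primes (H\<lparr>carrier := U\<rparr>) = {}" using props[OF cc(2,4)] by blast
    have m: "fst c < m" "fst c' < m" using cc by (auto simp: cd_def)
    have g: "group (G\<lparr>carrier := T\<rparr>)" "group (H\<lparr>carrier := U\<rparr>)"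
      using T(4) U(4) by (simp_all add: fin_group_def)
    have "G\<lparr>carrier := T\<rparr> \<cong> H\<lparr>carrier := U\<rparr> \<longleftrightarrow> fst c = fst c'"
    proof
      assume "G\<lparr>carrier := T\<rparr> \<cong> H\<lparr>carrier := U\<rparr>"
      then have "R (fst c) \<cong> R (fst c')" using iso_trans[OF iso_trans[OF group.iso_sym[OF g(1) T(2)]] U(2)] by blast
      then show "fst c = fst c'" using noniso m by blast
    next
      assume "fst c = fst c'"
      then have "R (fst c) \<cong> H\<lparr>carrier := U\<rparr>" using group.iso_sym[OF g(2) U(2)] by simp
      then show "G\<lparr>carrier := T\<rparr> \<cong> H\<lparr>carrier := U\<rparr>" by (rule iso_trans[OF T(2)])
    qed
    then show ?thesis
      using similar_groups_dec[OF fg[OF cc(3)] fg[OF cc(4)] T(1) U(1) T(5) U(5)] T(3) U(3) by (simp add: prod_eq_iff)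
  qed
  have ex: "\<exists>c. cd G c" if "G \<in> A" for G
    using cls[of G] fg[of G] that unfolding A_def cd_def by (metis (mono_tags, lifting) fst_conv snd_conv mem_Collect_eq)
  define code where "code G = (SOME c. cd G c)" for G
  have code: "cd G (code G)" if "G \<in> A" for G using someI_ex[OF ex[OF that]] by (simp add: code_def)
  have gt: "group (tilde_part G)" if GA': "G \<in> A" for G
  proof -
    have GA: "G \<in> finite_groups" using GA' A_def by simp
    obtain T z where T: "fin_group.dec G T z" "fin_group (G\<lparr>carrier := T\<rparr>)" "central_cyclic_primes (G\<lparr>carrier := T\<rparr>) = {}"
      using props[OF code[OF GA'] GA] by blast
    then show ?thesis using fin_group.dec_tilde_part[OF fg[OF GA] T(1,3)] by (simp add: fin_group_def)
  qed
  have cls_eq: "similarity_rel `` {G} = similarity_rel `` {H} \<longleftrightarrow> code G = code H" if GH: "G \<in> A" "H \<in> A" for G H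
  proof -
    have "similarity_rel `` {G} = similarity_rel `` {H} \<longleftrightarrow> similar_groups G H"
    proof
      assume "similarity_rel `` {G} = similarity_rel `` {H}"
      moreover have "H \<in> similarity_rel `` {H}" using GH similar_groups_refl by (auto simp: similarity_rel_def A_def)
      ultimately show "similar_groups G H" by (auto simp: similarity_rel_def)
    next
      assume "similar_groups G H"
      then have "similar_groups G K \<longleftrightarrow> similar_groups H K" for K
        using similar_groups_trans iso_tilde_sym[OF gt[OF GH(1)]] by blast
      then show "similarity_rel `` {G} = similarity_rel `` {H}" using GH by (auto simp: similarity_rel_def A_def)
    qed
    also have "\<dots> \<longleftrightarrow> code G = code H" using sim[OF code[OF GH(1)] code[OF GH(2)]] GH by (auto simp: A_def)
    finally show ?thesis .
  qed
  have numcd: "num_subgroups G = r (fst c) * prod_mset (image_mset Suc (snd c)) \<and> 0 \<notin># snd c"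
    if c: "cd G c" "G \<in> finite_groups" for G c
  proof -
    obtain T z where T: "fin_group.dec G T z" "G\<lparr>carrier := T\<rparr> \<cong> R (fst c)" "snd c = exps (group.ord G z)"
      "fin_group (G\<lparr>carrier := T\<rparr>)" using props[OF c] by blast
    have m: "fst c < m" using c by (auto simp: cd_def)
    interpret G: fin_group G using fg c by blast
    have "num_subgroups (G\<lparr>carrier := T\<rparr>) = r (fst c)"
      using num_subgroups_cong_iso[OF T(2)] T(4) grp[OF m] num[OF m] by (simp add: fin_group_def)
    moreover have "G.ord z > 0" using T(1) G.ord_pos by (simp add: G.dec_def group_center_def)
    ultimately show ?thesis using G.dec_num_subgroups[OF T(1)] tau_exps[of "G.ord z"] T(3) by simp
  qed
  have img: "code ` A = {(i, ms). i < m \<and> 0 \<notin># ms \<and> r i * prod_mset (image_mset Suc ms) = n}"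
  proof (intro equalityI subsetI)
    fix c assume "c \<in> code ` A"
    then obtain G where G: "G \<in> A" "c = code G" by blast
    have "cd G c" using code G by simp
    moreover from this have "fst c < m" by (simp add: cd_def)
    ultimately show "c \<in> {(i, ms). i < m \<and> 0 \<notin># ms \<and> r i * prod_mset (image_mset Suc ms) = n}"
      using numcd[of G c] G by (auto simp: A_def split: prod.splits)
  next
    fix c assume "c \<in> {(i, ms). i < m \<and> 0 \<notin># ms \<and> r i * prod_mset (image_mset Suc ms) = n}"
    then obtain i ms where c: "c = (i, ms)" "i < m" "0 \<notin># ms" "r i * prod_mset (image_mset Suc ms) = n" by auto
    interpret Ri: fin_group "R i" using grp c by blast
    have "card (carrier (R i)) > 0" using Ri.sg_card_pos[OF Ri.sg_carrier] .
    then obtain k where k: "k > 0" "coprime k (card (carrier (R i)))" "exps k = ms" using ex_exps[OF c(3)] by blast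
    obtain G where G: "G \<in> finite_groups" "\<exists>T z. fin_group.dec G T z \<and> G\<lparr>carrier := T\<rparr> \<cong> R i \<and> group.ord G z = k"
      using ex_dec_group[OF Ri.fin_group_axioms k(1,2)] by blast
    then have cG: "cd G c" using c k by (auto simp: cd_def)
    then have GA: "G \<in> A" using numcd[OF cG G(1)] c G by (simp add: A_def)
    have "code G = c" using sim[OF code[OF GA] cG G(1) G(1)] similar_groups_refl by blast
    then show "c \<in> code ` A" using GA by blast
  qed
  have "similarity_classes n = (\<lambda>G. similarity_rel `` {G}) ` A"
    by (auto simp: similarity_classes_def quotient_def A_def)
  moreover have "card ((\<lambda>G. similarity_rel `` {G}) ` A) = card (code ` A)"
  proof (rule bij_betw_same_card)
    \<comment> \<open>A class is sent to the code of any of its members; \<open>cls_eq\<close> makes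
      this well defined and injective.\<close>
    show "bij_betw (\<lambda>C. code (SOME G. G \<in> A \<and> similarity_rel `` {G} = C)) ((\<lambda>G. similarity_rel `` {G}) ` A) (code ` A)"
    proof -
      have s: "code (SOME G'. G' \<in> A \<and> similarity_rel `` {G'} = similarity_rel `` {G}) = code G" if "G \<in> A" for G
      proof -
        have "(SOME G'. G' \<in> A \<and> similarity_rel `` {G'} = similarity_rel `` {G}) \<in> A \<and>
          similarity_rel `` {SOME G'. G' \<in> A \<and> similarity_rel `` {G'} = similarity_rel `` {G}} = similarity_rel `` {G}"
          by (rule someI[of _ G]) (use that in simp)
        then show ?thesis using cls_eq that by blast
      qed
      show ?thesis
        unfolding bij_betw_def inj_on_def using s cls_eq by (auto simp: image_image)
    qed
  qed
  ultimately show ?thesis using img by (simp add: num_similarity_classes_def)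
qed

text \<open>Unordered factorizations of \<open>n\<close> into factors at least 2. Each factor is
  stored as its predecessor, because an exponent \<open>e\<close> contributes the factor
  \<open>e + 1\<close>.\<close>

definition factorings :: "nat \<Rightarrow> nat multiset set" where
  "factorings n = {ms. 0 \<notin># ms \<and> prod_mset (image_mset Suc ms) = n}"

lemma factorings_1: "factorings (Suc 0) = {{#}}"
proof -
  have "ms = {#}" if "0 \<notin># ms" "prod_mset (image_mset Suc ms) = Suc 0" for ms
  proof (cases ms)
    case (add e ms')
    then have "Suc e * prod_mset (image_mset Suc ms') = 1" using that by simp
    then have "Suc e = 1" by (metis nat_mult_eq_1_iff)
    then show ?thesis using that add by simp
  qed simp
  then show ?thesis by (auto simp: factorings_def)
qed

text \<open>The union is not disjoint: a factorization appears once for each of its distinct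
  factors. Therefore the sets themselves are computed before they are counted.\<close>

lemma factorings_rec:
  assumes "n > 1"
  shows "factorings n = (\<Union>d\<in>set (filter (\<lambda>d. d dvd n) [2..<Suc n]). add_mset (d - 1) ` factorings (n div d))"
proof (intro equalityI subsetI)
  fix ms assume ms: "ms \<in> factorings n"
  then have "ms \<noteq> {#}" using assms by (auto simp: factorings_def)
  then obtain e ms' where e: "ms = add_mset e ms'" by (meson multiset_cases)
  then have "n = Suc e * prod_mset (image_mset Suc ms')" "e \<noteq> 0" "0 \<notin># ms'" using ms by (auto simp: factorings_def)
  moreover from this have "Suc e dvd n" "Suc e \<ge> 2" by (auto simp del: mult_Suc)
  moreover have "Suc e \<le> n" using calculation assms by (meson dvd_imp_le less_trans zero_less_one)
  moreover have "n div Suc e = prod_mset (image_mset Suc ms')"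
    using calculation(1) by (simp del: mult_Suc)
  ultimately have "Suc e \<in> set (filter (\<lambda>d. d dvd n) [2..<Suc n])" "ms' \<in> factorings (n div Suc e)"
    by (auto simp: factorings_def)
  then show "ms \<in> (\<Union>d\<in>set (filter (\<lambda>d. d dvd n) [2..<Suc n]). add_mset (d - 1) ` factorings (n div d))"
    unfolding e by (intro UN_I[of "Suc e"] image_eqI[of _ _ ms']) auto
next
  fix ms assume "ms \<in> (\<Union>d\<in>set (filter (\<lambda>d. d dvd n) [2..<Suc n]). add_mset (d - 1) ` factorings (n div d))"
  then obtain d ms' where d: "d dvd n" "d \<ge> 2" "ms = add_mset (d - 1) ms'" "ms' \<in> factorings (n div d)" by auto
  then show "ms \<in> factorings n" by (auto simp: factorings_def)
qed

lemma card_factorings: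
  "card (factorings (Suc 0)) = 1" "card (factorings 2) = 1" "card (factorings 3) = 1" "card (factorings 4) = 2"
  "card (factorings 5) = 1" "card (factorings 6) = 2" "card (factorings 7) = 1" "card (factorings 8) = 3"
  "card (factorings 9) = 2" "card (factorings 10) = 2" "card (factorings 11) = 1" "card (factorings 12) = 4"
proof -
  have u: "[2..<Suc 2] = [2]" "[2..<Suc 3] = [2,3]" "[2..<Suc 4] = [2,3,4]" "[2..<Suc 5] = [2,3,4,5]"
    "[2..<Suc 6] = [2,3,4,5,6]" "[2..<Suc 7] = [2,3,4,5,6,7]" "[2..<Suc 8] = [2,3,4,5,6,7,8]"
    "[2..<Suc 9] = [2,3,4,5,6,7,8,9]" "[2..<Suc 10] = [2,3,4,5,6,7,8,9,10]"
    "[2..<Suc 11] = [2,3,4,5,6,7,8,9,10,11]" "[2..<Suc 12] = [2,3,4,5,6,7,8,9,10,11,12]"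
    by (simp_all add: upt_rec numeral_eq_Suc)
  note 1 = factorings_1
  have 2: "factorings 2 = {{#1#}}" by (subst factorings_rec) (simp_all add: u 1)
  have 3: "factorings 3 = {{#2#}}" by (subst factorings_rec) (simp_all add: u 1 2)
  have 4: "factorings 4 = {{#3#}, {#1, 1#}}" by (subst factorings_rec) (auto simp add: u 1 2 3)
  have 5: "factorings 5 = {{#4#}}" by (subst factorings_rec) (simp_all add: u 1 2)
  have 6: "factorings 6 = {{#5#}, {#1, 2#}}" by (subst factorings_rec) (auto simp add: u 1 2 3 add_mset_commute)
  have 7: "factorings 7 = {{#6#}}" by (subst factorings_rec) (simp_all add: u 1 2)
  have 8: "factorings 8 = {{#7#}, {#1, 3#}, {#1, 1, 1#}}" by (subst factorings_rec) (auto simp add: u 1 2 3 4 add_mset_commute)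
  have 9: "factorings 9 = {{#8#}, {#2, 2#}}" by (subst factorings_rec) (auto simp add: u 1 2 3)
  have 10: "factorings 10 = {{#9#}, {#1, 4#}}" by (subst factorings_rec) (auto simp add: u 1 2 3 5 add_mset_commute)
  have 11: "factorings 11 = {{#10#}}" by (subst factorings_rec) (simp_all add: u 1 2)
  have 12: "factorings 12 = {{#11#}, {#1, 5#}, {#2, 3#}, {#1, 1, 2#}}"
    by (subst factorings_rec) (auto simp add: u 1 2 3 4 6 add_mset_commute)
  show "card (factorings (Suc 0)) = 1" "card (factorings 2) = 1" "card (factorings 3) = 1" "card (factorings 4) = 2"
    "card (factorings 5) = 1" "card (factorings 6) = 2" "card (factorings 7) = 1" "card (factorings 8) = 3"
    "card (factorings 9) = 2" "card (factorings 10) = 2" "card (factorings 11) = 1" "card (factorings 12) = 4"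
    unfolding 1 2 3 4 5 6 7 8 9 10 11 12 by (simp_all add: add_eq_conv_ex)
qed

lemma card_codes:
  fixes r :: "nat \<Rightarrow> nat" and m :: nat
  assumes n: "n \<in> {1..12}"
  shows "card {(i, ms). i < m \<and> 0 \<notin># ms \<and> r i * prod_mset (image_mset Suc ms) = n} =
     (\<Sum>i<m. if r i dvd n then card (factorings (n div r i)) else 0)"
proof -
  have fin: "finite (factorings k)" if "k \<in> {1..12}" for k
  proof -
    have "k \<in> {Suc 0, 2, 3, 4, 5, 6, 7, 8, 9, 10, 11, 12}" using that by simp presburger
    \<comment> \<open>Infinite sets have \<open>card\<close> 0, so the nonzero values give
      finiteness as well.\<close>
    then have "card (factorings k) \<noteq> 0" using card_factorings by auto
    then show ?thesis by (meson card.infinite)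
  qed
  have q: "n div r i \<in> {1..12}" if rn: "r i dvd n" for i
  proof -
    obtain c where c: "n = r i * c" using rn by blast
    then have "c \<noteq> 0" "r i \<noteq> 0" using n by auto
    then have "n div r i = c" "c \<le> n" using c by auto
    then show ?thesis using n \<open>c \<noteq> 0\<close> by auto
  qed
  have "{(i, ms). i < m \<and> 0 \<notin># ms \<and> r i * prod_mset (image_mset Suc ms) = n} =
      (SIGMA i : {..<m}. if r i dvd n then factorings (n div r i) else {})"
    using n by (auto simp: factorings_def split: if_splits)
  also have "card \<dots> = (\<Sum>i<m. card (if r i dvd n then factorings (n div r i) else {}))"
  proof (rule card_SigmaI)
    show "\<forall>i\<in>{..<m}. finite (if r i dvd n then factorings (n div r i) else {})"
      using fin[OF q] by auto
  qed simp
  also have "\<dots> = (\<Sum>i<m. if r i dvd n then card (factorings (n div r i)) else 0)"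
    by (rule sum.cong) auto
  finally show ?thesis .
qed

section \<open>The representatives\<close>

text \<open>Unlike \<open>list_all\<close>, this stops at the first counterexample when it is evaluated by rewriting.\<close>

primrec all_in :: "'b list \<Rightarrow> ('b \<Rightarrow> bool) \<Rightarrow> bool" where
  "all_in [] P = True"
| "all_in (x # xs) P = (if P x then all_in xs P else False)"

lemma all_in_iff: "all_in xs P \<longleftrightarrow> (\<forall>x\<in>set xs. P x)"
  by (induction xs) auto

definition pow_list :: "('b \<Rightarrow> 'b \<Rightarrow> 'b) \<Rightarrow> 'b \<Rightarrow> 'b \<Rightarrow> nat \<Rightarrow> 'b" where
  "pow_list m e x n = foldl (\<lambda>y _. m y x) e [0..<n]"

definition center_list :: "'b list \<Rightarrow> ('b \<Rightarrow> 'b \<Rightarrow> 'b) \<Rightarrow> 'b list" where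
  "center_list xs m = filter (\<lambda>x. all_in xs (\<lambda>y. m x y = m y x)) xs"

text \<open>A central cyclic Sylow subgroup is generated by a nontrivial central element whose order is coprime to its index.\<close>

definition reduced_list :: "'b list \<Rightarrow> ('b \<Rightarrow> 'b \<Rightarrow> 'b) \<Rightarrow> 'b \<Rightarrow> bool" where
  "reduced_list xs m e \<longleftrightarrow> list_all (\<lambda>x. x = e \<or>
     (case find (\<lambda>n. pow_list m e x n = e) [1..<Suc (length xs)] of None \<Rightarrow> False
        | Some n \<Rightarrow> gcd n (length xs div n) \<noteq> 1)) (center_list xs m)"

definition geo_list :: "nat \<Rightarrow> nat \<Rightarrow> nat" where
  "geo_list k p = sum_list (map (\<lambda>y. k ^ y) [0..<p])"

definition mcount_list :: "nat \<Rightarrow> nat \<Rightarrow> nat \<Rightarrow> nat \<Rightarrow> nat" where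
  "mcount_list N p k j = (let S = geo_list k p in
     sum_list (map (\<lambda>d. Suc (length (filter (\<lambda>t. d dvd t * S + j) [0..<d]))) (filter (\<lambda>d. d dvd N) [1..<Suc N])))"

definition MC_mult :: "nat \<Rightarrow> nat \<Rightarrow> nat \<Rightarrow> nat \<Rightarrow> nat \<times> nat \<Rightarrow> nat \<times> nat \<Rightarrow> nat \<times> nat" where
  "MC_mult N p k j = (\<lambda>(i, y) (i', y'). ((i + k ^ y * i' + j * ((y + y') div p)) mod N, (y + y') mod p))"

text \<open>A semidirect product: the first table is addition in the four-group (bitwise exclusive
  or), the second lists the powers of the automorphism that rotates 1, 2, 3.\<close>

definition A4_mult :: "nat \<times> nat \<Rightarrow> nat \<times> nat \<Rightarrow> nat \<times> nat" where
  "A4_mult = (\<lambda>(v, i) (w, l).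
     ([[0,1,2,3],[1,0,3,2],[2,3,0,1],[3,2,1,0]] ! v ! ([[0,1,2,3],[0,2,3,1],[0,3,1,2]] ! i ! w), (i + l) mod 3))"

definition A4 :: "(nat \<times> nat) monoid" where
  "A4 = \<lparr>carrier = {..<4} \<times> {..<3}, monoid.mult = A4_mult, one = (0, 0)\<rparr>"

text \<open>With D and Q indexed by the order and X:Y a nonabelian semidirect product with normal
  factor X, the groups are in this order: C2 x C2, C3 x C3, S3, Q8 (5 or 6 subgroups); C5 x C5, D10,
  C4 x C2, C3:C4 (8); C7 x C7, D14, C7:C3, C9 x C3, C9:C3, D8, C5:C4 with C4 inverting C5, C3:C8
  (10); C8 x C2, C8:C2 of modular type, Q16 (11); C3:C16, C5:C8 with C8 inverting C5, C7:C4, C7:C9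
  (12).\<close>

definition rep_params :: "(nat \<times> nat \<times> nat \<times> nat) list" where
  "rep_params = [(2,2,1,0), (3,3,1,0), (3,2,2,0), (4,2,3,2), (5,5,1,0), (5,2,4,0), (4,2,1,0), (6,2,5,3),
     (7,7,1,0), (7,2,6,0), (7,3,2,0), (9,3,1,0), (9,3,4,0), (4,2,3,0), (10,2,9,5), (12,2,5,9),
     (8,2,1,0), (8,2,5,0), (8,2,7,4), (24,2,17,9), (20,2,9,5), (14,2,13,7), (21,3,16,7)]"

text \<open>The last two representatives are the trivial group and the alternating group of degree 4.\<close>

definition rep :: "nat \<Rightarrow> (nat \<times> nat) monoid" where
  "rep i = (if i < 23 then (case rep_params ! i of (N, p, k, j) \<Rightarrow> MC N p k j)
     else if i = 23 then MC 1 1 1 0 else A4)"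

definition rep_mult :: "nat \<Rightarrow> nat \<times> nat \<Rightarrow> nat \<times> nat \<Rightarrow> nat \<times> nat" where
  "rep_mult i = (if i < 23 then (case rep_params ! i of (N, p, k, j) \<Rightarrow> MC_mult N p k j)
     else if i = 23 then MC_mult 1 1 1 0 else A4_mult)"

definition rep_elems :: "nat \<Rightarrow> (nat \<times> nat) list" where
  "rep_elems i = (if i < 23 then (case rep_params ! i of (N, p, k, j) \<Rightarrow> List.product [0..<N] [0..<p])
     else if i = 23 then [(0, 0)] else List.product [0..<4] [0..<3])"

definition rep_nums :: "nat list" where
  "rep_nums = [5,6,6,6,8,8,8,8,10,10,10,10,10,10,10,10,11,11,11,12,12,12,12,1,10]"

section \<open>Checking the representatives by evaluation\<close>

lemma geo_list: "geo k p = geo_list k p"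
  by (simp add: geo_def geo_list_def sum_list_distinct_conv_sum_set lessThan_atLeast0)

lemma mcount_list: "N > 0 \<Longrightarrow> mcount N p k j = mcount_list N p k j"
proof -
  assume N: "N > 0"
  have D: "{d. d dvd N} = set (filter (\<lambda>d. d dvd N) [1..<Suc N])"
    using N by (auto dest: dvd_imp_le intro: Suc_leI simp: dvd_pos_nat)
  have "mcpairs N p k j = (SIGMA d : {d. d dvd N}. set (filter (\<lambda>t. d dvd t * geo k p + j) [0..<d]))"
    by (auto simp: mcpairs_def)
  then have "card (mcpairs N p k j) = (\<Sum>d | d dvd N. card (set (filter (\<lambda>t. d dvd t * geo k p + j) [0..<d])))"
    using N by simp
  also have "\<dots> = (\<Sum>d | d dvd N. length (filter (\<lambda>t. d dvd t * geo k p + j) [0..<d]))"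
    by (rule sum.cong[OF refl]) (rule distinct_card, simp)
  finally have "mcount N p k j = (\<Sum>d | d dvd N. Suc (length (filter (\<lambda>t. d dvd t * geo k p + j) [0..<d])))"
    by (simp add: mcount_def sum_Suc)
  also have "\<dots> = mcount_list N p k j"
    unfolding D mcount_list_def Let_def geo_list by (subst sum_list_distinct_conv_sum_set) auto
  finally show ?thesis .
qed

lemma lt25: "i < 25 \<Longrightarrow> i \<in> set [0..<25]" for i :: nat
  by simp

lemma lt23: "i < 23 \<Longrightarrow> i \<in> set [0..<23]" for i :: nat
  by simp

lemma rep_params_ok:
  assumes "i < 23" "rep_params ! i = (N, p, k, j)"
  shows "N > 0" "Factorial_Ring.prime p" "[k ^ p = 1] (mod N)" "[k * j = j] (mod N)" "mcount_list N p k j = rep_nums ! i"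
proof -
  have "list_all (\<lambda>i. case rep_params ! i of (N, p, k, j) \<Rightarrow> N > 0 \<and> p \<in> set [2,3,5,7] \<and> k ^ p mod N = 1 mod N \<and>
     (k * j) mod N = j mod N \<and> mcount_list N p k j = rep_nums ! i) [0..<23]"
    by code_simp
  then have *: "N > 0 \<and> p \<in> set [2,3,5,7] \<and> k ^ p mod N = 1 mod N \<and>
     (k * j) mod N = j mod N \<and> mcount_list N p k j = rep_nums ! i"
    unfolding list_all_iff using lt23[OF assms(1)] assms(2) by (metis (mono_tags, lifting) case_prod_conv)
  then show "N > 0" "[k ^ p = 1] (mod N)" "[k * j = j] (mod N)" "mcount_list N p k j = rep_nums ! i"
    by (auto simp: cong_def)
  have "Factorial_Ring.prime (2::nat)" "Factorial_Ring.prime (3::nat)" "Factorial_Ring.prime (5::nat)" "Factorial_Ring.prime (7::nat)"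
    by simp_all
  then show "Factorial_Ring.prime p" using * by auto
qed

lemma rep_metacyc:
  assumes "i < 23" "rep_params ! i = (N, p, k, j)"
  shows "metacyc (rep i) (1 mod N, 0) (0, 1) N p k j"
  using MC_metacyc[OF rep_params_ok(1-4)[OF assms]] assms by (simp add: rep_def)

lemma rep_elems:
  assumes "i < 25"
  shows "set (rep_elems i) = carrier (rep i)" "distinct (rep_elems i)"
    "x \<otimes>\<^bsub>rep i\<^esub> y = rep_mult i x y" "\<one>\<^bsub>rep i\<^esub> = (0, 0)"
proof -
  have s: "set [0..<n] = {..<n}" for n by auto
  show "set (rep_elems i) = carrier (rep i)"
    by (auto simp: rep_elems_def rep_def MC_def A4_def s split: prod.splits)
  show "distinct (rep_elems i)"
    by (auto simp: rep_elems_def distinct_product split: prod.splits)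
  show "x \<otimes>\<^bsub>rep i\<^esub> y = rep_mult i x y" "\<one>\<^bsub>rep i\<^esub> = (0, 0)"
    by (auto simp: rep_mult_def rep_def MC_def A4_def MC_mult_def split: prod.splits)
qed

lemma A4_group: "fin_group A4"
proof -
  let ?xs = "List.product [0..<4] [0..<3]"
  have c: "carrier A4 = set ?xs" by (auto simp: A4_def)
  have m: "x \<otimes>\<^bsub>A4\<^esub> y = A4_mult x y" for x y by (simp add: A4_def)
  have o: "\<one>\<^bsub>A4\<^esub> = (0, 0)" by (simp add: A4_def)
  have 1: "list_all (\<lambda>x. list_all (\<lambda>y. A4_mult x y \<in> set ?xs) ?xs) ?xs" by code_simp
  have 2: "list_all (\<lambda>x. list_all (\<lambda>y. list_all (\<lambda>z. A4_mult (A4_mult x y) z = A4_mult x (A4_mult y z)) ?xs) ?xs) ?xs"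
    by code_simp
  have 3: "list_all (\<lambda>x. A4_mult (0, 0) x = x \<and> list_ex (\<lambda>y. A4_mult y x = (0, 0)) ?xs) ?xs" by code_simp
  have "group A4"
  proof (rule groupI)
    fix x y assume "x \<in> carrier A4" "y \<in> carrier A4"
    then show "x \<otimes>\<^bsub>A4\<^esub> y \<in> carrier A4" using 1 unfolding c list_all_iff m by blast
  next
    fix x y z assume "x \<in> carrier A4" "y \<in> carrier A4" "z \<in> carrier A4"
    then show "x \<otimes>\<^bsub>A4\<^esub> y \<otimes>\<^bsub>A4\<^esub> z = x \<otimes>\<^bsub>A4\<^esub> (y \<otimes>\<^bsub>A4\<^esub> z)" using 2 unfolding c list_all_iff m by blast
  next
    fix x assume "x \<in> carrier A4"
    then show "\<one>\<^bsub>A4\<^esub> \<otimes>\<^bsub>A4\<^esub> x = x" using 3 unfolding c list_all_iff m o by blast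
  next
    fix x assume x: "x \<in> carrier A4"
    then have "list_ex (\<lambda>y. A4_mult y x = (0, 0)) ?xs" using 3 unfolding c list_all_iff by blast
    then show "\<exists>y\<in>carrier A4. y \<otimes>\<^bsub>A4\<^esub> x = \<one>\<^bsub>A4\<^esub>" unfolding c list_ex_iff m o by blast
  next
    show "\<one>\<^bsub>A4\<^esub> \<in> carrier A4" by (simp add: A4_def)
  qed
  then show ?thesis by (simp add: fin_group_def fin_group_axioms_def A4_def)
qed

lemma rep_23: "rep 23 = MC 1 1 1 0" "rep 24 = A4"
  by (simp_all add: rep_def)

lemma rep_fin_group:
  assumes "i < 25" shows "fin_group (rep i)"
proof -
  consider "i < 23" | "i = 23" | "i = 24" using assms by linarith
  then show ?thesis
  proof cases
    case 1
    obtain N p k j where "rep_params ! i = (N, p, k, j)" by (metis prod_cases4)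
    from rep_metacyc[OF 1 this] show ?thesis by (simp add: metacyc_def)
  next
    case 2
    have "group (MC 1 1 1 0)" by (rule MC_group) auto
    then show ?thesis by (simp add: rep_23 2 fin_group_def fin_group_axioms_def MC_simps)
  next
    case 3
    then show ?thesis using A4_group by (simp add: rep_23)
  qed
qed

text \<open>Branches on each element in turn, so that evaluation never builds the list of all
  subsequences; \<open>ys\<close> holds the elements chosen so far.\<close>

primrec count_subseqs :: "('b list \<Rightarrow> bool) \<Rightarrow> 'b list \<Rightarrow> 'b list \<Rightarrow> nat" where
  "count_subseqs C [] ys = (if C ys then 1 else 0)"
| "count_subseqs C (x # xs) ys = count_subseqs C xs (ys @ [x]) + count_subseqs C xs ys"

lemma count_subseqs: "count_subseqs C xs ys = length (filter (\<lambda>zs. C (ys @ zs)) (subseqs xs))"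
  by (induction xs arbitrary: ys) (simp_all add: Let_def filter_map o_def)

lemma A4_num_subgroups: "num_subgroups A4 = 10"
proof -
  let ?xs = "List.product [0..<4] [0..<3] :: (nat \<times> nat) list"
  \<comment> \<open>The condition on the length comes from Lagrange's theorem. It discards more than
    half of the subsets before closure is tested, and also the empty one because
    \<open>12 mod 0 = 12\<close>.\<close>
  let ?C = "\<lambda>ys. if 12 mod length ys = 0 then all_in ys (\<lambda>x. all_in ys (\<lambda>y. A4_mult x y \<in> set ys)) else False"
  interpret fin_group A4 by (rule A4_group)
  have c: "carrier A4 = set ?xs" by (auto simp: A4_def)
  have "{H. sg H} = set ` set (filter ?C (subseqs ?xs))"
  proof (intro equalityI subsetI)
    fix H assume "H \<in> {H. sg H}"
    then have H: "sg H" by simp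
    then obtain ys where ys: "ys \<in> set (subseqs ?xs)" "set ys = H"
      using subseqs_powset[of ?xs] sg_sub[OF H] c by (metis (no_types, lifting) PowI imageE)
    have "12 mod length ys = 0"
    proof -
      have "distinct (List.product [0..<4] [0..<3] :: (nat \<times> nat) list)" by (rule distinct_product) auto
      then have "distinct ys" using ys(1) subseqs_distinctD by blast
      then have "length ys = card H" using ys(2) distinct_card by force
      then show ?thesis using card_dvd[OF H sg_carrier sg_sub[OF H]] by (simp add: A4_def card_cartesian_product mod_eq_0_iff_dvd)
    qed
    moreover have "A4_mult x y \<in> H" if "x \<in> H" "y \<in> H" for x y
      using sg_mult[OF H that] by (simp add: A4_def)
    ultimately show "H \<in> set ` set (filter ?C (subseqs ?xs))" using ys by (auto simp: all_in_iff)
  next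
    fix H assume "H \<in> set ` set (filter ?C (subseqs ?xs))"
    then obtain ys where ys: "ys \<in> set (subseqs ?xs)" "H = set ys" "?C ys" by auto
    have "H \<subseteq> carrier A4" using ys subseqs_powset[of ?xs] c by (metis PowD image_eqI)
    moreover have "H \<noteq> {}" using ys by (cases ys) auto
    ultimately have "sg H" by (rule sgI) (use ys in \<open>auto simp: all_in_iff A4_def split: if_splits\<close>)
    then show "H \<in> {H. sg H}" by simp
  qed
  then have "num_subgroups A4 = card (set ` set (filter ?C (subseqs ?xs)))" by (simp add: num_subgroups_def)
  also have "\<dots> = card (set (filter ?C (subseqs ?xs)))"
  proof (rule card_image)
    have "distinct ?xs" by (rule distinct_product) auto
    from distinct_set_subseqs[OF this] have "inj_on set (set (subseqs ?xs))" by (simp only: distinct_map)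
    then show "inj_on set (set (filter ?C (subseqs ?xs)))" by (rule inj_on_subset) auto
  qed
  also have "\<dots> = length (filter ?C (subseqs ?xs))"
  proof (rule distinct_card)
    have "distinct ?xs" by (rule distinct_product) auto
    then have "distinct (subseqs ?xs)" using distinct_set_subseqs by (metis distinct_map)
    then show "distinct (filter ?C (subseqs ?xs))" by simp
  qed
  also have "\<dots> = count_subseqs ?C ?xs []" by (simp only: count_subseqs append_Nil)
  also have "\<dots> = 10" by code_simp
  finally show ?thesis .
qed

lemma rep_num_subgroups:
  assumes "i < 25" shows "num_subgroups (rep i) = rep_nums ! i"
proof -
  consider "i < 23" | "i = 23" | "i = 24" using assms by linarith
  then show ?thesis
  proof cases
    case 1
    obtain N p k j where r: "rep_params ! i = (N, p, k, j)" by (metis prod_cases4)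
    interpret metacyc "rep i" "(1 mod N, 0)" "(0, 1)" N p k j using rep_metacyc[OF 1 r] .
    show ?thesis using num_subgroups_metacyc mcount_list rep_params_ok[OF 1 r] by simp
  next
    case 2
    interpret fin_group "rep i" using rep_fin_group assms .
    have "carrier (rep i) = {\<one>\<^bsub>rep i\<^esub>}" by (auto simp: 2 rep_23 MC_simps)
    then have "{H. sg H} = {{\<one>\<^bsub>rep i\<^esub>}}" using sg_one sg_sub sg_ne by blast
    then show ?thesis by (simp add: num_subgroups_def 2 rep_nums_def)
  next
    case 3
    then show ?thesis using A4_num_subgroups by (simp add: rep_23 rep_nums_def)
  qed
qed

lemma rep_center:
  assumes "i < 25" shows "set (center_list (rep_elems i) (rep_mult i)) = group_center (rep i)"
  using rep_elems[OF assms] by (auto simp: center_list_def group_center_def all_in_iff)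

lemma rep_reduced:
  assumes "i < 25" shows "central_cyclic_primes (rep i) = {}"
proof (rule ccontr)
  interpret fin_group "rep i" using rep_fin_group assms .
  note re = rep_elems[OF assms]
  have len: "length (rep_elems i) = card (carrier (rep i))" using re(1,2) by (metis distinct_card)
  have pl: "pow_list (rep_mult i) (0, 0) x n = x [^]\<^bsub>rep i\<^esub> n" for x and n :: nat
    by (induction n) (simp_all add: pow_list_def re(3,4))
  assume "central_cyclic_primes (rep i) \<noteq> {}"
  then obtain p x where p: "Factorial_Ring.prime p" "p dvd card (carrier (rep i))"
      and x: "x \<in> group_center (rep i)" "ord x = p ^ multiplicity p (card (carrier (rep i)))"
    using central_cyclic_primes_iff by blast
  have xG: "x \<in> carrier (rep i)" using x by (simp add: group_center_def)
  have c0: "card (carrier (rep i)) > 0" using sg_card_pos[OF sg_carrier] .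
  have m: "multiplicity p (card (carrier (rep i))) > 0"
    using p c0 by (simp add: prime_multiplicity_gt_zero_iff)
  have "ord x \<noteq> 1" using x m prime_gt_1_nat[OF p(1)] by (metis less_irrefl one_less_power)
  then have x1: "x \<noteq> (0, 0)" using re(4) ord_id by auto
  have "list_all (\<lambda>i. reduced_list (rep_elems i) (rep_mult i) (0, 0)) [0..<25]" by code_simp
  then have "reduced_list (rep_elems i) (rep_mult i) (0, 0)" using lt25[OF assms] by (simp add: list_all_iff)
  then obtain n where n: "find (\<lambda>n. x [^]\<^bsub>rep i\<^esub> n = (0, 0)) [1..<Suc (length (rep_elems i))] = Some n"
     "gcd n (length (rep_elems i) div n) \<noteq> 1"
    using x x1 rep_center[OF assms] unfolding reduced_list_def list_all_iff pl by (force split: option.splits)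
  \<comment> \<open>\<open>find\<close> returns the first positive exponent that gives the identity,
    which is the order.\<close>
  have "ord x = n"
  proof -
    obtain l where l: "l < length (rep_elems i)" "x [^]\<^bsub>rep i\<^esub> n = (0, 0)" "n = Suc l"
      "\<forall>j<l. x [^]\<^bsub>rep i\<^esub> (Suc j) \<noteq> (0, 0)"
      using n(1) unfolding find_Some_iff by (auto simp del: upt_Suc)
    have "ord x dvd n" using l(2) re(4) pow_eq_id[OF xG] by simp
    then have le: "ord x \<le> n" using l by (simp add: dvd_imp_le)
    have "x [^]\<^bsub>rep i\<^esub> ord x = (0, 0)" using re(4) pow_ord_eq_1[OF xG] by simp
    then have "\<not> ord x - 1 < l" using l(4) ord_pos[OF xG] by (metis Suc_diff_1)
    then show ?thesis using le l ord_pos[OF xG] by linarith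
  qed
  then have "\<not> coprime (ord x) (card (carrier (rep i)) div ord x)" using n(2) len by (simp only: coprime_iff_gcd_eq_1 not_False_eq_True)
  moreover have "\<not> p dvd card (carrier (rep i)) div ord x"
    unfolding x(2) using c0 multiplicity_decompose p(1) by (metis not_prime_unit less_irrefl)
  ultimately show False using x(2) p(1) by (metis coprime_power_left_iff prime_imp_coprime)
qed

lemma iso_card_center:
  assumes "G \<cong> H" "group G" "group H" shows "card (group_center G) = card (group_center H)"
proof -
  obtain h where h: "h \<in> iso G H" using assms(1) by (auto simp: is_iso_def)
  have b: "h ` carrier G = carrier H" "inj_on h (carrier G)" using h by (auto simp: iso_def bij_betw_def)
  have "group_center H = h ` group_center G"
  proof (intro equalityI subsetI)
    fix y assume y: "y \<in> group_center H"
    then obtain x where "x \<in> carrier G" "y = h x" using b(1) by (force simp: group_center_def)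
    then show "y \<in> h ` group_center G" using iso_center[OF h assms(2,3)] y by blast
  next
    fix y assume "y \<in> h ` group_center G"
    then obtain x where "x \<in> group_center G" "y = h x" by blast
    then show "y \<in> group_center H" using iso_center[OF h assms(2,3), of x] by (simp add: group_center_def)
  qed
  moreover have "inj_on h (group_center G)" using b(2) by (rule inj_on_subset) (auto simp: group_center_def)
  ultimately show ?thesis by (simp add: card_image)
qed

lemma rep_noniso:
  assumes "i < 25" "i' < 25" "rep i \<cong> rep i'" shows "i = i'"
proof -
  \<comment> \<open>The number of subgroups, the order and the order of the center tell all 25
    groups apart; C9 x C3 and the nonabelian C9:C3 differ only in the last.\<close>
  let ?key = "\<lambda>i. (rep_nums ! i, length (rep_elems i), length (center_list (rep_elems i) (rep_mult i)))"
  have g: "group (rep i)" "group (rep i')" using rep_fin_group assms by (auto simp: fin_group_def)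
  have n: "rep_nums ! i = rep_nums ! i'"
    using num_subgroups_cong_iso[OF assms(3) g] rep_num_subgroups assms by simp
  obtain h where "h \<in> iso (rep i) (rep i')" using assms(3) by (auto simp: is_iso_def)
  then have "card (carrier (rep i)) = card (carrier (rep i'))" by (auto simp: iso_def intro: bij_betw_same_card)
  then have l: "length (rep_elems i) = length (rep_elems i')" using rep_elems assms by (metis distinct_card)
  have dc: "card (set (center_list (rep_elems i) (rep_mult i))) = length (center_list (rep_elems i) (rep_mult i))"
    if "i < 25" for i
    by (rule distinct_card) (unfold center_list_def, rule distinct_filter, rule rep_elems(2)[OF that])
  have "card (set (center_list (rep_elems i) (rep_mult i))) = card (set (center_list (rep_elems i') (rep_mult i')))"
    using iso_card_center[OF assms(3) g] rep_center assms by simp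
  then have "length (center_list (rep_elems i) (rep_mult i)) = length (center_list (rep_elems i') (rep_mult i'))"
    using dc[OF assms(1)] dc[OF assms(2)] by simp
  then have "?key i = ?key i'" using n l by simp
  moreover have "distinct (map ?key [0..<25])" by code_simp
  ultimately show ?thesis
    unfolding distinct_map using lt25[OF assms(1)] lt25[OF assms(2)] by (metis (mono_tags, lifting) inj_onD)
qed

lemma num_similarity_classes_rep:
  assumes n: "n \<in> {1..12}"
    and cls: "\<And>G :: nat monoid. fin_group G \<Longrightarrow> num_subgroups G = n \<Longrightarrow>
       \<exists>i<25. \<exists>T z. fin_group.dec G T z \<and> G\<lparr>carrier := T\<rparr> \<cong> rep i"
  shows "num_similarity_classes n =
     (\<Sum>i<25. if rep_nums ! i dvd n then card (factorings (n div rep_nums ! i)) else 0)"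
  using num_similarity_classes_codes[OF rep_fin_group rep_reduced rep_num_subgroups rep_noniso cls]
    card_codes[OF n] by simp

lemma num_similarity_classes_if_classified:
  assumes "\<And>G :: nat monoid. fin_group G \<Longrightarrow> num_subgroups G \<le> 12 \<Longrightarrow>
       \<exists>i<25. \<exists>T z. fin_group.dec G T z \<and> G\<lparr>carrier := T\<rparr> \<cong> rep i"
  shows "map num_similarity_classes [1, 2, 3, 4, 5, 6, 7, 8, 9, 10, 11, 12]
    = [1, 1, 1, 2, 2, 5, 1, 7, 2, 12, 4, 11]"
proof -
  have n: "num_similarity_classes n =
     (\<Sum>i<25. if rep_nums ! i dvd n then card (factorings (n div rep_nums ! i)) else 0)" if "n \<in> {1..12}" for n
    by (rule num_similarity_classes_rep[OF that]) (use assms that in auto)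
  \<comment> \<open>The representatives are grouped by their subgroup counts; the last two summands
    belong to the trivial group and to \<open>A4\<close>.\<close>
  have s: "(\<Sum>i<25. f (rep_nums ! i)) = f 5 + 3 * f 6 + 4 * f 8 + 8 * f 10 + 3 * f 11 + 4 * f 12 + f 1 + f 10" for f :: "nat \<Rightarrow> nat"
    unfolding rep_nums_def by (simp add: numeral_eq_Suc lessThan_Suc)
  show ?thesis
    using n[of 1] n[of 2] n[of 3] n[of 4] n[of 5] n[of 6] n[of 7] n[of 8] n[of 9] n[of 10] n[of 11] n[of 12]
    unfolding s[of "\<lambda>r. if r dvd n then card (factorings (n div r)) else 0" for n]
    by (simp add: card_factorings)
qed

section \<open>Metacyclic groups with at most 12 subgroups\<close>

subsection \<open>Arithmetic of the parameters\<close>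

lemma geo_mult: "(int k - 1) * int (geo k n) = int k ^ n - 1"
  unfolding geo_def by (induction n) (auto simp: algebra_simps)

lemma geo_cong_1: assumes "[k = 1] (mod m)" shows "[geo k n = n] (mod m)"
proof -
  have "[(\<Sum>y<n. k ^ y) = (\<Sum>y<n. 1)] (mod m)"
    by (rule cong_sum) (metis assms cong_pow power_one)
  then show ?thesis by (simp add: geo_def)
qed

lemma tau_pos_ge: "N > 0 \<Longrightarrow> D \<subseteq> {d. d dvd N} \<Longrightarrow> card D \<le> tau N"
  unfolding tau_def by (rule card_mono) auto

text \<open>While the parameters are still variable, a few divisors with a guaranteed number of
  solutions are enough to exceed 12.\<close>

lemma mcount_ge:
  assumes "N > 0" "D \<subseteq> {d. d dvd N}" "\<And>d. d \<in> D \<Longrightarrow> h d \<le> card {t. t < d \<and> d dvd t * geo k p + j}"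
  shows "tau N + (\<Sum>d\<in>D. h d) \<le> mcount N p k j"
proof -
  have f: "finite {d. d dvd N}" using assms(1) by simp
  have "mcpairs N p k j = (SIGMA d : {d. d dvd N}. {t. t < d \<and> d dvd t * geo k p + j})"
    by (auto simp: mcpairs_def)
  then have "card (mcpairs N p k j) = (\<Sum>d | d dvd N. card {t. t < d \<and> d dvd t * geo k p + j})"
    using f by simp
  also have "\<dots> \<ge> (\<Sum>d\<in>D. card {t. t < d \<and> d dvd t * geo k p + j})"
    by (rule sum_mono2[OF f assms(2)]) simp
  finally have "(\<Sum>d\<in>D. h d) \<le> card (mcpairs N p k j)" using sum_mono[of D h, OF assms(3)] by (meson le_trans)
  then show ?thesis by (simp add: mcount_def tau_def)
qed

lemma all_solutions: "d dvd S \<Longrightarrow> d dvd j \<Longrightarrow> card {t. t < d \<and> d dvd t * S + (j::nat)} = d"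
proof -
  assume "d dvd S" "d dvd j"
  then have "{t. t < d \<and> d dvd t * S + j} = {..<d}" by auto
  then show ?thesis by simp
qed

text \<open>In an entry \<open>(N, p, q)\<close> the number \<open>q\<close> is the part of
  \<open>N\<close> prime to \<open>p\<close>, which turns out to be 1 or a prime. The list holds the
  pairs \<open>(N, p)\<close> that survive the bound 12; \<open>k\<close> and \<open>j\<close> are
  left to the search.\<close>

definition mc_pairs :: "(nat \<times> nat \<times> nat) list" where
  "mc_pairs = [(3,2,3), (6,2,3), (12,2,3), (24,2,3), (5,2,5), (10,2,5), (20,2,5), (7,2,7), (14,2,7), (7,3,7), (21,3,7),
     (2,2,1), (4,2,1), (8,2,1), (3,3,1), (9,3,1), (5,5,1), (7,7,1)]"

text \<open>If \<open>k\<close> were 1 modulo \<open>q\<close>, then \<open>geo k p\<close> would be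
  \<open>p\<close> modulo \<open>q\<close>, hence a unit, and
  \<open>(k - 1) * geo k p = k^p - 1\<close> would make \<open>k\<close> equal to 1 modulo the full
  power of \<open>q\<close>, against \<open>red\<close>. So \<open>k - 1\<close> is invertible
  modulo \<open>n\<close>, and the relations \<open>kp\<close> and \<open>kj\<close> force
  \<open>geo k p\<close> and \<open>j\<close> to vanish there.\<close>

lemma coprime_part_zero:
  assumes p: "Factorial_Ring.prime (p::nat)" "\<not> p dvd n" and N: "N = p ^ f * n" "N > 0"
    and kp: "[k ^ p = 1] (mod N)" and kj: "[k * j = j] (mod N)"
    and red: "\<And>q. Factorial_Ring.prime q \<Longrightarrow> q dvd N \<Longrightarrow> q \<noteq> p \<Longrightarrow> \<not> [k = 1] (mod q ^ multiplicity q N)"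
  shows "n dvd geo k p" "n dvd j" "\<And>q. Factorial_Ring.prime q \<Longrightarrow> q dvd n \<Longrightarrow> \<not> [k = 1] (mod q)"
proof -
  show nk: "\<not> [k = 1] (mod q)" if q: "Factorial_Ring.prime q" "q dvd n" for q
  proof
    assume k1: "[k = 1] (mod q)"
    have qp: "q \<noteq> p" using q p by auto
    have qN: "q dvd N" using q N by simp
    let ?e = "multiplicity q N"
    have "[geo k p = p] (mod q)" by (rule geo_cong_1[OF k1])
    then have "\<not> q dvd geo k p" using cong_dvd_iff q(1) p(1) qp primes_dvd_imp_eq by blast
    then have "coprime (int (q ^ ?e)) (int (geo k p))"
      using q(1) by (simp add: prime_imp_coprime coprime_power_left_iff)
    moreover have "int (q ^ ?e) dvd (int k - 1) * int (geo k p)"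
    proof -
      have "[int (k ^ p) = int 1] (mod int N)" using kp by (simp only: cong_int_iff)
      then have "int N dvd int k ^ p - 1" by (simp add: cong_iff_dvd_diff)
      moreover have "int (q ^ ?e) dvd int N" using multiplicity_dvd[of q N] by (simp only: of_nat_dvd_iff)
      ultimately show ?thesis unfolding geo_mult by (meson dvd_trans)
    qed
    ultimately have "int (q ^ ?e) dvd int k - 1" by (simp add: coprime_dvd_mult_left_iff)
    then have "[int k = int 1] (mod int (q ^ ?e))" by (simp add: cong_iff_dvd_diff)
    then have "[k = 1] (mod q ^ ?e)" by (simp only: cong_int_iff)
    then show False using red q(1) qN qp by blast
  qed
  have n0: "n > 0" using N by (cases n) auto
  have cop: "coprime (int n) (int k - 1)"
  proof (rule ccontr)
    assume "\<not> coprime (int n) (int k - 1)"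
    then obtain r where r: "r dvd int n" "r dvd int k - 1" "\<not> is_unit r" using not_coprimeE by blast
    then have "nat \<bar>r\<bar> \<noteq> 1" by auto
    then obtain q where q: "Factorial_Ring.prime q" "q dvd nat \<bar>r\<bar>" using prime_factor_nat by blast
    have "int q dvd r" using q by (metis abs_ge_zero dvd_abs_iff int_dvd_int_iff int_nat_eq)
    then have "int q dvd int n" "int q dvd int k - 1" using r dvd_trans by blast+
    then have "q dvd n" "[int k = int 1] (mod int q)" by (simp_all add: cong_iff_dvd_diff)
    then show False using nk[OF q(1)] by (simp only: cong_int_iff)
  qed
  have nN: "n dvd N" using N by simp
  have "[int (k ^ p) = int 1] (mod int n)" using kp nN cong_dvd_modulus_nat by (metis cong_int_iff)
  then have "int n dvd (int k - 1) * int (geo k p)" unfolding geo_mult by (simp add: cong_iff_dvd_diff)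
  then have "int n dvd int (geo k p)" using cop by (simp add: coprime_dvd_mult_right_iff)
  then show "n dvd geo k p" by simp
  have "[int (k * j) = int j] (mod int n)" using kj nN cong_dvd_modulus_nat by (metis cong_int_iff)
  then have "int n dvd (int k - 1) * int j" by (simp add: cong_iff_dvd_diff algebra_simps)
  then have "int n dvd int j" using cop by (simp add: coprime_dvd_mult_right_iff)
  then show "n dvd j" by simp
qed

text \<open>After cancelling one factor \<open>p\<close> the coefficient \<open>s\<close> is
  invertible, which leaves one solution modulo \<open>p ^ (i - 1)\<close>; it lifts to
  \<open>p\<close> residues modulo \<open>p ^ i\<close>.\<close>

lemma prime_power_solutions:
  assumes p: "Factorial_Ring.prime (p::nat)" and S: "S = p * s" "\<not> p dvd s" and j: "p dvd j" and i: "i > 0"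
  shows "p \<le> card {t. t < p ^ i \<and> p ^ i dvd t * S + j}"
proof -
  obtain j' where j': "j = p * j'" using j by blast
  let ?q = "p ^ (i - 1)"
  have pi: "p ^ i = p * ?q" using i by (metis power_eq_if less_numeral_extra(3))
  have q0: "?q > 0" using p prime_gt_0_nat by simp
  have "coprime s ?q" using S p by (simp add: prime_imp_coprime coprime_commute coprime_power_left_iff)
  then obtain x where x: "[s * x = 1] (mod ?q)" using cong_solve_coprime_nat[of s ?q] by (metis One_nat_def)
  \<comment> \<open>\<open>?q * j' - j'\<close> stands for the negative of \<open>j'\<close> modulo
    \<open>?q\<close> without leaving \<open>nat\<close>.\<close>
  define t0 where "t0 = (x * (?q * j' - j')) mod ?q"
  have "[t0 = x * (?q * j' - j')] (mod ?q)" by (simp add: t0_def cong_def)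
  then have "[t0 * s + j' = x * (?q * j' - j') * s + j'] (mod ?q)" by (intro cong_add cong_mult cong_refl)
  also have "x * (?q * j' - j') * s + j' = (s * x) * (?q * j' - j') + j'" by (simp only: ac_simps)
  also have "[(s * x) * (?q * j' - j') + j' = 1 * (?q * j' - j') + j'] (mod ?q)"
    by (intro cong_add cong_mult x cong_refl)
  also have "1 * (?q * j' - j') + j' = ?q * j'" using q0 by (simp add: Suc_leI)
  finally have t0: "?q dvd t0 * s + j'" using cong_dvd_iff by (metis dvd_triv_left)
  have "(\<lambda>m. t0 + m * ?q) ` {..<p} \<subseteq> {t. t < p ^ i \<and> p ^ i dvd t * S + j}"
  proof clarify
    fix m assume m: "m < p"
    have "t0 < ?q" unfolding t0_def using q0 by simp
    then have "t0 + m * ?q < (m + 1) * ?q" by simp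
    also have "\<dots> \<le> p * ?q" using m by (intro mult_right_mono) auto
    finally have "t0 + m * ?q < p ^ i" using pi by simp
    moreover have "?q dvd (t0 + m * ?q) * s + j'"
    proof -
      have "(t0 + m * ?q) * s + j' = (t0 * s + j') + ?q * (m * s)" by (simp add: algebra_simps)
      moreover have "?q dvd (t0 * s + j') + ?q * (m * s)" using t0 by (rule dvd_add) simp
      ultimately show ?thesis by (simp only:)
    qed
    then have B: "p * ?q dvd p * ((t0 + m * ?q) * s + j')" by (rule mult_dvd_mono[OF dvd_refl])
    have C: "p * ((t0 + m * ?q) * s + j') = (t0 + m * ?q) * S + j" by (simp add: S(1) j' algebra_simps)
    have "p ^ i dvd (t0 + m * ?q) * S + j" using B unfolding C pi[symmetric] .
    ultimately show "t0 + m * ?q < p ^ i \<and> p ^ i dvd (t0 + m * ?q) * S + j" by blast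
  qed
  moreover have "inj_on (\<lambda>m. t0 + m * ?q) {..<p}" using q0 by (auto simp: inj_on_def)
  ultimately have "card {..<p} \<le> card {t. t < p ^ i \<and> p ^ i dvd t * S + j}"
    by (intro card_inj_on_le) auto
  then show ?thesis by simp
qed

lemma fermat_k: assumes "Factorial_Ring.prime (p::nat)" "[k ^ p = 1] (mod p)" shows "[k = 1] (mod p)"
proof -
  have "\<not> p dvd k"
  proof
    assume "p dvd k"
    then have "p dvd k ^ p" using assms(1) by (simp add: prime_gt_0_nat dvd_power_iff_le prime_dvd_power_iff)
    then have "p dvd 1" using assms(2) cong_dvd_iff by blast
    then show False using assms(1) not_prime_unit by blast
  qed
  then have "[k ^ (p - 1) = 1] (mod p)" using fermat_theorem assms(1) by blast
  then have "[k * k ^ (p - 1) = k * 1] (mod p)" by (rule cong_scalar_left)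
  moreover have "k * k ^ (p - 1) = k ^ p" using prime_gt_0_nat[OF assms(1)] by (metis power_eq_if less_numeral_extra(3))
  ultimately show ?thesis using assms(2) by (metis cong_sym cong_trans mult.right_neutral)
qed

lemma prime_le_9: "Factorial_Ring.prime (p::nat) \<Longrightarrow> p \<le> 9 \<Longrightarrow> p = 2 \<or> p = 3 \<or> p = 5 \<or> p = 7"
proof -
  assume p: "Factorial_Ring.prime p" "p \<le> 9"
  have "\<not> Factorial_Ring.prime (0::nat)" "\<not> Factorial_Ring.prime (1::nat)" by simp_all
  moreover have "\<not> Factorial_Ring.prime (4::nat)" "\<not> Factorial_Ring.prime (6::nat)" "\<not> Factorial_Ring.prime (8::nat)"
    by (auto simp: prime_nat_iff' intro!: bexI[of _ 2])
  moreover have "\<not> Factorial_Ring.prime (9::nat)" by (auto simp: prime_nat_iff' intro!: bexI[of _ 3])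
  moreover have "p = 0 \<or> p = 1 \<or> p = 2 \<or> p = 3 \<or> p = 4 \<or> p = 5 \<or> p = 6 \<or> p = 7 \<or> p = 8 \<or> p = 9"
    using p(2) by presburger
  ultimately show ?thesis using p(1) by metis
qed

text \<open>Writing \<open>k = 1 + p * x\<close>, one has \<open>k^y = 1 + p * x * y\<close> modulo
  \<open>p^2\<close>. The sum of the \<open>y\<close> below \<open>p\<close> is a multiple of
  \<open>p\<close> because \<open>p\<close> is odd, so \<open>geo k p\<close> is \<open>p\<close>
  modulo \<open>p^2\<close>.\<close>

lemma geo_odd_prime:
  assumes p: "Factorial_Ring.prime (p::nat)" "odd p" and k: "[k = 1] (mod p)" "k > 0"
  obtains s where "geo k p = p * s" "\<not> p dvd s"
proof -
  obtain x where x: "k = 1 + p * x" using k cong_le_nat[of 1 k p] by (metis Suc_leI add.commute cong_sym mult.commute One_nat_def)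
  have pw: "[k ^ y = 1 + p * x * y] (mod p ^ 2)" for y
  proof (induction y)
    case (Suc y)
    have "[k * k ^ y = k * (1 + p * x * y)] (mod p ^ 2)" using Suc by (rule cong_scalar_left)
    also have "k * (1 + p * x * y) = (1 + p * x * Suc y) + p ^ 2 * (x * x * y)"
      by (simp add: x algebra_simps power2_eq_square)
    also have "[\<dots> = 1 + p * x * Suc y] (mod p ^ 2)" by (simp add: cong_def)
    finally show ?case by simp
  qed simp
  have "[geo k p = (\<Sum>y<p. 1 + p * x * y)] (mod p ^ 2)" unfolding geo_def by (intro cong_sum pw)
  also have "(\<Sum>y<p. 1 + p * x * y) = p + p * x * (\<Sum>y<p. y)"
    by (simp only: sum.distrib sum_distrib_left) simp
  also have "[\<dots> = p] (mod p ^ 2)"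
  proof -
    obtain m where m: "p = 2 * m + 1" using p(2) oddE by blast
    have "2 * (\<Sum>y<p. y) = p * (p - 1)" by (induction p) (auto simp: algebra_simps)
    then have "(\<Sum>y<p. y) = p * m" using m by simp
    then have "p + p * x * (\<Sum>y<p. y) = p + p ^ 2 * (x * m)" by (simp add: power2_eq_square)
    then show ?thesis by (metis cong_def mod_mult_self2)
  qed
  finally have g: "[geo k p = p] (mod p ^ 2)" .
  then have "[geo k p = p] (mod p)" using cong_dvd_modulus_nat by (metis dvd_triv_left power2_eq_square)
  then have "p dvd geo k p" using cong_dvd_iff by (metis dvd_refl)
  then obtain s where s: "geo k p = p * s" by blast
  have "\<not> p dvd s"
  proof
    assume "p dvd s"
    then have "p ^ 2 dvd geo k p" using s by (simp add: power2_eq_square)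
    then have "p ^ 2 dvd p" using g cong_dvd_iff by blast
    then have "p * p \<le> p" using p prime_gt_0_nat by (metis dvd_imp_le power2_eq_square)
    then show False using prime_gt_1_nat[OF p(1)] by simp
  qed
  then show ?thesis using s that by blast
qed

text \<open>The divisors 1 and \<open>p\<close> alone give \<open>f + p \<le> 10\<close>, which
  leaves four primes. For odd \<open>p\<close>, or \<open>p = 2\<close> with \<open>k\<close> equal
  to 1 modulo 4, \<open>p\<close> divides \<open>geo k p\<close> exactly once and all larger
  divisors contribute too; \<open>p = 2\<close> with \<open>k\<close> equal to 3 modulo 4 needs its
  own estimate.\<close>

lemma pgroup_params:
  assumes p: "Factorial_Ring.prime (p::nat)" and f: "f > 0"
    and kp: "[k ^ p = 1] (mod p ^ f)" and kj: "[k * j = j] (mod p ^ f)" and j: "p dvd j"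
    and c: "mcount (p ^ f) p k j \<le> 12"
  shows "(p ^ f, p, 1) \<in> set mc_pairs"
proof -
  have p1: "p > 1" using prime_gt_1_nat p .
  have pf0: "p ^ f > 0" using p1 by simp
  have k1: "[k = 1] (mod p)"
    using fermat_k[OF p] kp f cong_dvd_modulus_nat dvd_power[of f p] by blast
  have k0: "k > 0"
  proof (rule ccontr)
    assume "\<not> k > 0"
    then have "p dvd 1" using k1 cong_0_iff cong_sym by blast
    then show False using p not_prime_unit by blast
  qed
  have pS: "p dvd geo k p" using geo_cong_1[OF k1, of p] cong_dvd_iff dvd_refl by blast
  have tau: "tau (p ^ f) = Suc f" by (rule tau_prime_power[OF p])
  have inj: "inj_on (\<lambda>i. p ^ i) I" for I :: "nat set" using p1 by (auto simp: inj_on_def)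
  have ge: "Suc f + (\<Sum>i\<in>I. h i) \<le> 12"
    if "I \<subseteq> {..f}" "\<And>i. i \<in> I \<Longrightarrow> h i \<le> card {t. t < p ^ i \<and> p ^ i dvd t * geo k p + j}" for I h
  proof -
    have D: "(\<lambda>i. p ^ i) ` I \<subseteq> {d. d dvd p ^ f}" using that(1) by (auto intro: le_imp_power_dvd)
    have "tau (p ^ f) + (\<Sum>d\<in>(\<lambda>i. p ^ i) ` I. h (the_inv_into I (\<lambda>i. p ^ i) d)) \<le> mcount (p ^ f) p k j"
    proof (rule mcount_ge[OF pf0 D])
      fix d assume "d \<in> (\<lambda>i. p ^ i) ` I"
      then obtain i where i: "i \<in> I" "d = p ^ i" by blast
      then have "the_inv_into I (\<lambda>i. p ^ i) d = i" using the_inv_into_f_f[OF inj] by simp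
      then show "h (the_inv_into I (\<lambda>i. p ^ i) d) \<le> card {t. t < d \<and> d dvd t * geo k p + j}" using that(2)[OF i(1)] i(2) by simp
    qed
    also have "(\<Sum>d\<in>(\<lambda>i. p ^ i) ` I. h (the_inv_into I (\<lambda>i. p ^ i) d)) = (\<Sum>i\<in>I. h i)"
      by (subst sum.reindex[OF inj]) (auto intro!: sum.cong simp: the_inv_into_f_f[OF inj])
    finally show ?thesis using c tau by simp
  qed
  have g0: "1 \<le> card {t. t < p ^ 0 \<and> p ^ 0 dvd t * geo k p + j}" by simp
  have g1: "p \<le> card {t. t < p ^ 1 \<and> p ^ 1 dvd t * geo k p + j}" using all_solutions[OF pS j] by simp
  have "Suc f + (\<Sum>i\<in>{0,1::nat}. if i = 0 then 1 else p) \<le> 12"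
  proof (rule ge)
    show "(if i = 0 then 1 else p) \<le> card {t. t < p ^ i \<and> p ^ i dvd t * geo k p + j}" if "i \<in> {0, 1}" for i
      using that g0 g1 by (cases "i = 0") simp_all
  qed (use f in auto)
  then have fp: "f + p \<le> 10" by simp
  then have pp: "p = 2 \<or> p = 3 \<or> p = 5 \<or> p = 7" using prime_le_9[OF p] f by simp
  show ?thesis
  proof (cases "f = 1")
    case True
    then show ?thesis using pp by (auto simp: mc_pairs_def)
  next
    case False
    then have f2: "f \<ge> 2" using f by simp
    \<comment> \<open>Every divisor \<open>p ^ i\<close> with \<open>i > 0\<close> contributes at
      least \<open>p\<close> pairs, so the bound reads
      \<open>Suc f + 1 + f * p \<le> 12\<close>.\<close>
    have regular: "f * (p + 1) \<le> 10" if s: "geo k p = p * s" "\<not> p dvd s" for s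
    proof -
      have "Suc f + (\<Sum>i\<in>{..f}. if i = 0 then 1 else p) \<le> 12"
      proof (rule ge)
        show "(if i = 0 then 1 else p) \<le> card {t. t < p ^ i \<and> p ^ i dvd t * geo k p + j}" for i
          using prime_power_solutions[OF p s j, of i] g0 by (cases "i = 0") simp_all
      qed simp
      moreover have "(\<Sum>i\<in>{..f}. if i = 0 then 1 else p) = 1 + f * p"
        by (subst sum.atMost_shift) (simp add: lessThan_Suc_atMost)
      ultimately show ?thesis by (simp add: algebra_simps)
    qed
    have small: ?thesis if b: "f * (p + 1) \<le> 10"
    proof -
      have "2 * (p + 1) \<le> f * (p + 1)" using f2 by (rule mult_right_mono) simp
      then have "p \<le> 4" using b by simp
      then have "p = 2 \<or> p = 3" using pp by auto
      then show ?thesis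
      proof
        assume "p = 2"
        then have "f = 2 \<or> f = 3" using b f2 by auto
        then show ?thesis using \<open>p = 2\<close> by (auto simp: mc_pairs_def)
      next
        assume "p = 3"
        then have "f = 2" using b f2 by auto
        then show ?thesis using \<open>p = 3\<close> by (auto simp: mc_pairs_def)
      qed
    qed
    show ?thesis
    proof (cases "odd p")
      case True
      then show ?thesis using geo_odd_prime[OF p True k1 k0] regular small by metis
    next
      case False
      then have p2: "p = 2" using pp by auto
      have S: "geo k p = 1 + k" by (simp add: p2 geo_def numeral_2_eq_2)
      have ok: "odd k" using pS S p2 by simp
      show ?thesis
      proof (cases "k mod 4 = 1")
        case True
        have "k + 1 = 2 * ((k + 1) div 2)" "\<not> 2 dvd (k + 1) div 2" using True by presburger+
        then show ?thesis using regular[of "(k + 1) div 2"] small S p2 by simp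
      next
        case False
        \<comment> \<open>Now \<open>k - 1\<close> is twice an odd number, so the two relations
          force \<open>2 ^ (f - 1)\<close> to divide both \<open>geo k 2\<close> and
          \<open>j\<close>. For \<open>f\<close> at least 4 the divisors 1, 2, 4, 8 then contribute
          15 pairs.\<close>
        then have "k = 4 * (k div 4) + 3" using ok by presburger
        then obtain w where w: "k = 4 * w + 3" by blast
        define u where "u = 2 * w + 1"
        have ku: "int k - 1 = 2 * int u" "odd u" using w by (simp_all add: u_def)
        have cu: "coprime (int (2 ^ (f - 1))) (int u)" using ku(2) by (simp add: coprime_power_left_iff)
        have pf: "(2::nat) ^ f = 2 * 2 ^ (f - 1)" using f by (metis power_eq_if less_numeral_extra(3))
        have "[int (k * j) = int j] (mod int (2 ^ f))" using kj p2 by (metis cong_int_iff)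
        then have "int (2 ^ f) dvd (int k - 1) * int j" by (simp add: cong_iff_dvd_diff algebra_simps)
        then have "2 * int (2 ^ (f - 1)) dvd 2 * (int u * int j)" unfolding ku pf by (simp add: ac_simps)
        then have "int (2 ^ (f - 1)) dvd int u * int j" by (simp only: dvd_mult_cancel_left) simp
        then have "int (2 ^ (f - 1)) dvd int j" using cu by (simp only: coprime_dvd_mult_right_iff)
        then have dj: "2 ^ (f - 1) dvd j" by (simp only: of_nat_dvd_iff)
        have "[int (k ^ 2) = int 1] (mod int (2 ^ f))" using kp p2 by (metis cong_int_iff)
        then have "int (2 ^ f) dvd (int k - 1) * int (geo k 2)" unfolding geo_mult by (simp add: cong_iff_dvd_diff)
        then have "2 * int (2 ^ (f - 1)) dvd 2 * (int u * int (geo k 2))" unfolding ku pf by (simp add: ac_simps)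
        then have "int (2 ^ (f - 1)) dvd int u * int (geo k 2)" by (simp only: dvd_mult_cancel_left) simp
        then have "int (2 ^ (f - 1)) dvd int (geo k 2)" using cu by (simp only: coprime_dvd_mult_right_iff)
        then have dS: "2 ^ (f - 1) dvd geo k 2" by (simp only: of_nat_dvd_iff)
        have "f \<le> 3"
        proof (rule ccontr)
          assume f4: "\<not> f \<le> 3"
          have "Suc f + (\<Sum>i\<in>{0,1,2,3}. 2 ^ i) \<le> 12"
          proof (rule ge[of "{0,1,2,3}" "\<lambda>i. 2 ^ i"])
            fix i :: nat assume i: "i \<in> {0,1,2,3}"
            then have "2 ^ i dvd (2::nat) ^ (f - 1)" using f4 by (auto intro!: le_imp_power_dvd)
            then have "(2::nat) ^ i dvd geo k p" "2 ^ i dvd j" using dS dj p2 dvd_trans by blast+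
            then show "2 ^ i \<le> card {t. t < p ^ i \<and> p ^ i dvd t * geo k p + j}" using all_solutions p2 by simp
          qed (use f4 in auto)
          then show False using f4 by simp
        qed
        then have "f = 2 \<or> f = 3" using f2 by auto
        then show ?thesis using p2 by (auto simp: mc_pairs_def)
      qed
    qed
  qed
qed

text \<open>Modulo a prime divisor \<open>q\<close> of \<open>n\<close> the number \<open>k\<close>
  has order exactly \<open>p\<close>, so \<open>p\<close> divides \<open>q - 1\<close>. By
  \<open>coprime_part_zero\<close> every residue is a solution for every divisor of
  \<open>n\<close>. Hence \<open>tau N\<close> plus the divisor sum of \<open>n\<close> is at most
  12, which leaves \<open>n\<close> equal to 3, 5 or 7 and few values of \<open>f\<close>.\<close>

lemma mixed_params:
  assumes p: "Factorial_Ring.prime (p::nat)" "\<not> p dvd n" and N: "N = p ^ f * n" "n > 1"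
    and kp: "[k ^ p = 1] (mod N)" and kj: "[k * j = j] (mod N)"
    and red: "\<And>q. Factorial_Ring.prime q \<Longrightarrow> q dvd N \<Longrightarrow> q \<noteq> p \<Longrightarrow> \<not> [k = 1] (mod q ^ multiplicity q N)"
    and c: "mcount N p k j \<le> 12"
  shows "(N, p, n) \<in> set mc_pairs \<and> Factorial_Ring.prime n \<and> \<not> [k = 1] (mod n)"
proof -
  have p1: "p > 1" using prime_gt_1_nat p(1) .
  have N0: "N > 0" using N p1 by simp
  have cp: "n dvd geo k p" "n dvd j" "\<And>q. Factorial_Ring.prime q \<Longrightarrow> q dvd n \<Longrightarrow> \<not> [k = 1] (mod q)"
    using coprime_part_zero[OF p N(1) N0 kp kj] red by blast+
  have qp: "p dvd q - 1" if q: "Factorial_Ring.prime q" "q dvd n" for q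
  proof -
    have k1: "\<not> [k = 1] (mod q)" by (rule cp(3)[OF q])
    have kq: "[k ^ p = 1] (mod q)" using kp q(2) N(1) cong_dvd_modulus_nat by (metis dvd_mult)
    have "\<not> q dvd k"
    proof
      assume "q dvd k"
      then have "q dvd k ^ p" using p1 by (simp add: prime_dvd_power_iff q(1))
      then have "q dvd 1" using kq cong_dvd_iff by blast
      then show False using q(1) not_prime_unit by blast
    qed
    then have fe: "[k ^ (q - 1) = 1] (mod q)" using fermat_theorem q(1) by blast
    have "Pocklington.ord q k dvd p" "Pocklington.ord q k dvd q - 1" using kq fe ord_divides by blast+
    moreover have "Pocklington.ord q k \<noteq> 1"
    proof
      assume "Pocklington.ord q k = 1"
      then have "[k ^ 1 = 1] (mod q)" by (simp only: ord_divides) simp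
      then show False using k1 by simp
    qed
    ultimately show ?thesis using p(1) by (metis prime_nat_iff)
  qed
  have ge: "tau N + (\<Sum>d | d dvd n. d) \<le> 12"
  proof -
    have "tau N + (\<Sum>d | d dvd n. d) \<le> mcount N p k j"
    proof (rule mcount_ge[OF N0])
      show "{d. d dvd n} \<subseteq> {d. d dvd N}" using N(1) by auto
      fix d assume "d \<in> {d. d dvd n}"
      then have "d dvd geo k p" "d dvd j" using cp(1,2) dvd_trans by blast+
      then show "d \<le> card {t. t < d \<and> d dvd t * geo k p + j}" using all_solutions by simp
    qed
    then show ?thesis using c by simp
  qed
  have fd: "finite {d. d dvd n}" using N(2) by simp
  have "(\<Sum>d\<in>{1, n}. d) \<le> (\<Sum>d | d dvd n. d)" by (rule sum_mono2[OF fd]) auto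
  then have s1: "1 + n \<le> (\<Sum>d | d dvd n. d)" using N(2) by simp
  have tN: "tau N = Suc f * tau n"
  proof -
    have "coprime (p ^ f) n" using p by (simp add: prime_imp_coprime)
    then show ?thesis using tau_coprime_mult[of "p ^ f" n] tau_prime_power[OF p(1)] N p1 by simp
  qed
  have t2: "tau n \<ge> 2" using tau_pos_ge[of n "{1, n}"] N(2) by simp
  have n9: "n \<le> 9"
  proof -
    have "2 \<le> tau N" unfolding tN using t2 by (metis le_trans mult_Suc le_add1)
    then show ?thesis using ge s1 by linarith
  qed
  obtain q where q: "Factorial_Ring.prime q" "q dvd n" using prime_factor_nat[of n] N(2) by auto
  have odd_n: "\<not> 2 dvd n"
  proof
    assume "2 dvd n"
    then have "p dvd 2 - 1" using qp[of 2] by simp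
    then show False using p1 by simp
  qed
  have n_ne_9: "n \<noteq> 9"
  proof
    assume n: "n = 9"
    have "(\<Sum>d\<in>{1, 3, 9}. d) \<le> (\<Sum>d | d dvd n. d)" by (rule sum_mono2[OF fd]) (use n in auto)
    then show False using ge by simp
  qed
  have n357: "n = 3 \<or> n = 5 \<or> n = 7"
  proof -
    have "n = 2 \<or> n = 3 \<or> n = 4 \<or> n = 5 \<or> n = 6 \<or> n = 7 \<or> n = 8" using N(2) n9 n_ne_9 by presburger
    then show ?thesis using odd_n by auto
  qed
  then have pn: "Factorial_Ring.prime n" by auto
  then have pd: "p dvd n - 1" using qp[of n] by simp
  have ff: "2 * Suc f + 1 + n \<le> 12"
  proof -
    have "Suc f * 2 \<le> tau N" unfolding tN using t2 by (rule mult_left_mono) simp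
    then show ?thesis using ge s1 by linarith
  qed
  have "(N, p, n) \<in> set mc_pairs"
    using n357
  proof (elim disjE)
    assume n: "n = 3"
    then have "p dvd 2" using pd by simp
    then have "p = 2" using p(1) primes_dvd_imp_eq[of p 2] by simp
    moreover have "f = 0 \<or> f = 1 \<or> f = 2 \<or> f = 3" using ff n by presburger
    ultimately show ?thesis using n N(1) by (auto simp: mc_pairs_def)
  next
    assume n: "n = 5"
    then have "p dvd 2 ^ 2" using pd by simp
    then have "p = 2" using p(1) prime_dvd_power[of p 2 2] primes_dvd_imp_eq[of p 2] by simp
    moreover have "f = 0 \<or> f = 1 \<or> f = 2" using ff n by presburger
    ultimately show ?thesis using n N(1) by (auto simp: mc_pairs_def)
  next
    assume n: "n = 7"
    then have "p dvd 2 * 3" using pd by simp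
    then have "p dvd 2 \<or> p dvd 3" using p(1) prime_dvd_mult_iff by blast
    moreover have "p dvd 2 \<Longrightarrow> p = 2" "p dvd 3 \<Longrightarrow> p = 3"
      using p(1) primes_dvd_imp_eq[of p 2] primes_dvd_imp_eq[of p 3] by simp_all
    ultimately have "p = 2 \<or> p = 3" by blast
    moreover have "f = 0 \<or> f = 1" using ff n by presburger
    ultimately show ?thesis using n N(1) by (auto simp: mc_pairs_def)
  qed
  then show ?thesis using pn cp(3)[of n] by simp
qed

text \<open>The finite search: the generators \<open>a\<close>, \<open>b\<close> are replaced by \<open>a\<^sup>u\<close>, \<open>a\<^sup>t b\<^sup>v\<close> to reach the parameters of a representative.\<close>

primrec some_in :: "'b list \<Rightarrow> ('b \<Rightarrow> bool) \<Rightarrow> bool" where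
  "some_in [] P = False"
| "some_in (x # xs) P = (if P x then True else some_in xs P)"

lemma some_in_iff: "some_in xs P \<longleftrightarrow> (\<exists>x\<in>set xs. P x)"
  by (induction xs) auto

definition reparam_search :: "nat \<Rightarrow> nat \<Rightarrow> nat \<Rightarrow> nat \<Rightarrow> nat \<Rightarrow> nat \<Rightarrow> bool" where
  "reparam_search N p k j k' j' = some_in [1..<p] (\<lambda>v. if k' mod N = (k ^ v) mod N then
     (let S = geo_list (k ^ v) p in
      some_in [0..<N] (\<lambda>t. some_in [0..<N] (\<lambda>u. if (t * S + j * v) mod N = (u * j') mod N then gcd u N = 1 else False)))
     else False)"

text \<open>Nested conditionals stop the evaluation at the first filter that fails. The filters are
  the relations \<open>kp\<close> and \<open>kj\<close>, the conditions known after splitting off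
  central factors and excluding cyclic groups, and the bound on the count.\<close>

definition mc_check :: "nat \<times> nat \<times> nat \<Rightarrow> bool" where
  "mc_check = (\<lambda>(N, p, q). all_in [0..<N] (\<lambda>k. if (k ^ p) mod N = 1 mod N then if q = 1 \<or> k mod q \<noteq> 1 then
      all_in [0..<N] (\<lambda>j. if (k * j) mod N = j then if q \<noteq> 1 \<or> j mod p = 0 then if mcount_list N p k j \<le> 12 then
        some_in [0..<23] (\<lambda>i. case rep_params ! i of (N', p', k', j') \<Rightarrow>
           if N' = N then if p' = p then reparam_search N p k j k' j' else False else False)
        else True else True else True) else True else True))"

lemma mc_check: "list_all mc_check mc_pairs"
  by code_simp

text \<open>\<open>N2\<close> is the largest divisor of \<open>N\<close>, prime to its cofactor and
  to \<open>p\<close>, on which the action is trivial; a further prime power with trivial action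
  could be absorbed into it. It becomes the order of the central factor.\<close>

lemma split_params:
  assumes N: "N > 0" and p: "Factorial_Ring.prime (p::nat)"
  shows "\<exists>N1 N2. N = N1 * N2 \<and> coprime N1 N2 \<and> coprime N2 p \<and> [k = 1] (mod N2) \<and>
    (\<forall>q. Factorial_Ring.prime q \<longrightarrow> q dvd N1 \<longrightarrow> q \<noteq> p \<longrightarrow> \<not> [k = 1] (mod q ^ multiplicity q N1))"
proof -
  define D where "D = {d. d dvd N \<and> coprime d (N div d) \<and> coprime d p \<and> [k = 1] (mod d)}"
  have fin: "finite D" by (rule finite_subset[of _ "{d. d dvd N}"]) (use N in \<open>auto simp: D_def\<close>)
  have "1 \<in> D" by (simp add: D_def)
  then have ne: "D \<noteq> {}" by blast
  define d where "d = Max D"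
  have dD: "d \<in> D" using Max_in[OF fin ne] d_def by simp
  have mx: "x \<le> d" if "x \<in> D" for x using Max_ge[OF fin that] d_def by simp
  define N1 where "N1 = N div d"
  have d: "N = N1 * d" "coprime N1 d" "coprime d p" "[k = 1] (mod d)"
    using dD by (auto simp: D_def N1_def coprime_commute)
  have pos: "N1 > 0" "d > 0" using N d(1) by (auto intro: gr0I)
  have "\<not> [k = 1] (mod q ^ multiplicity q N1)" if q: "Factorial_Ring.prime q" "q dvd N1" "q \<noteq> p" for q
  proof
    assume k: "[k = 1] (mod q ^ multiplicity q N1)"
    let ?Q = "q ^ multiplicity q N1"
    have Qd: "?Q dvd N1" by (rule multiplicity_dvd)
    then obtain r where r: "N1 = ?Q * r" by blast
    have r0: "r > 0" using r pos by (auto intro: gr0I)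
    have Q0: "?Q > 0" using q prime_gt_0_nat by simp
    have qr: "\<not> q dvd r"
    proof -
      have "N1 div ?Q = r" by (subst r) (use Q0 in simp)
      then show ?thesis using multiplicity_decompose[of N1 q] pos q(1) by (metis less_irrefl not_prime_unit)
    qed
    have cQr: "coprime ?Q r" using q(1) qr by (simp add: prime_imp_coprime coprime_power_left_iff)
    have cdQ: "coprime d ?Q" using d(2) Qd by (meson coprime_commute coprime_divisors dvd_refl)
    have cdr: "coprime d r" using d(2) r by (metis coprime_commute coprime_mult_left_iff)
    have Nd: "N = (d * ?Q) * r" using d(1) r by (simp add: ac_simps)
    have "N div (d * ?Q) = r" using Nd pos Q0 by simp
    moreover have "d * ?Q dvd N" unfolding Nd by simp
    moreover have "coprime (d * ?Q) r" using cQr cdr by simp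
    moreover have "coprime ?Q p" using q(1,3) p primes_dvd_imp_eq by (metis coprime_power_left_iff prime_imp_coprime)
    moreover have "[k = 1] (mod d * ?Q)" using coprime_cong_mult_nat d(4) k cdQ by blast
    ultimately have "d * ?Q \<in> D" using d(3) by (simp add: D_def)
    then have "d * ?Q \<le> d" by (rule mx)
    moreover have "?Q > 1"
      by (rule one_less_power) (use prime_gt_1_nat[OF q(1)] q(1,2) pos in \<open>simp_all add: prime_multiplicity_gt_zero_iff\<close>)
    ultimately show False using pos by simp
  qed
  then show ?thesis using d by blast
qed

context fin_group
begin

lemma cyc_restrict: "fin_group.cyc (G\<lparr>carrier := T\<rparr>) x = cyc x" if "sg T"
proof -
  interpret T: fin_group "G\<lparr>carrier := T\<rparr>" using sg_restrict[OF that] .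
  show ?thesis unfolding T.cyc_def cyc_def nat_pow_consistent[of x _ T] ..
qed

lemma dec_cyclic:
  assumes d: "dec T z" "c \<in> T" "T = cyc c" shows "carrier G = cyc (c \<otimes> z)"
proof
  have T: "sg T" "z \<in> group_center G" "coprime (card T) (ord z)" "card T * ord z = card (carrier G)"
    using d(1) by (auto simp: dec_def)
  have zG: "z \<in> carrier G" "c \<in> carrier G" using T d sg_mem by (auto simp: group_center_def)
  have "c \<otimes> z = z \<otimes> c" using T(2) zG by (simp add: group_center_def)
  from coprime_component[OF T(1) sg_cyc[OF zG(1)] _ sg_cyc[of "c \<otimes> z"] d(2) cyc_self[OF zG(1)] this]
  have "c \<in> cyc (c \<otimes> z)" "z \<in> cyc (c \<otimes> z)" using zG T card_cyc cyc_self by auto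
  then have "T \<subseteq> cyc (c \<otimes> z)" "cyc z \<subseteq> cyc (c \<otimes> z)" using d(3) cyc_least sg_cyc zG by (metis m_closed)+
  then have "T <#> cyc z \<subseteq> cyc (c \<otimes> z)" using set_mult_least sg_cyc zG by (metis m_closed)
  then show "carrier G \<subseteq> cyc (c \<otimes> z)" using coprime_set_mult T sg_cyc[OF zG(1)] card_cyc[OF zG(1)] by simp
  show "cyc (c \<otimes> z) \<subseteq> carrier G" using cyc_carrier zG by simp
qed

text \<open>A cyclic group is its own central factor, so the tilde part is trivial and the
  representative is number 23.\<close>

lemma cyclic_classified:
  assumes "x \<in> carrier G" "carrier G = cyc x"
  shows "\<exists>i<25. \<exists>T z. dec T z \<and> G\<lparr>carrier := T\<rparr> \<cong> rep i"
proof -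
  have "y \<otimes> z = z \<otimes> y" if "y \<in> carrier G" "z \<in> carrier G" for y z
    using cyc_commute[OF assms(1)] that assms(2) by metis
  then have "x \<in> group_center G" using assms(1) by (simp add: group_center_def)
  then have d: "dec {\<one>} x" using sg_one card_cyc[OF assms(1)] assms(2) by (simp add: dec_def)
  have "(\<lambda>_. (0, 0)) \<in> iso (G\<lparr>carrier := {\<one>}\<rparr>) (rep 23)"
    by (rule isoI) (auto simp: rep_23 MC_simps hom_def bij_betw_def)
  then have "G\<lparr>carrier := {\<one>}\<rparr> \<cong> rep 23" by (auto simp: is_iso_def)
  moreover have "(23::nat) < 25" by simp
  ultimately show ?thesis using d by blast
qed

end

section \<open>Splitting off the central factor and running the finite search\<close>

context metacyc
begin

text \<open>In this case \<open>b^p\<close> already generates \<open>cyc a\<close>.\<close>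

lemma metacyc_cyclic: assumes "coprime j N" shows "carrier G = cyc b"
proof
  have "cyc (a [^] j) = cyc a" using cyc_pow_coprime aG assms ord_a by simp
  then have "a \<in> cyc (b [^] p)" using bp cyc_self aG by simp
  then have a: "a \<in> cyc b" using cyc_least[OF sg_cyc[OF bG] cyc_pow] by blast
  show "carrier G \<subseteq> cyc b"
  proof
    fix x assume "x \<in> carrier G"
    then obtain i y :: nat where "x = a [^] i \<otimes> b [^] y" using elem_ex by blast
    then show "x \<in> cyc b" using a sg_pow sg_mult sg_cyc[OF bG] cyc_pow by metis
  qed
qed (use cyc_carrier bG in simp)

text \<open>Modulo \<open>N2\<close> the sum \<open>geo k p\<close> is \<open>p\<close>, hence
  invertible. So some \<open>a^t b\<close> has its \<open>p\<close>-th power in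
  \<open>cyc (a^N2)\<close>, and the subgroup encoded by \<open>(N2, t)\<close> is a complement to
  the central subgroup generated by \<open>a^N1\<close>.\<close>

lemma metacyc_dec:
  assumes N: "N = N1 * N2" "coprime N1 N2" "coprime N2 p" "[k = 1] (mod N2)"
  shows "\<exists>T z a' b' j'. dec T z \<and> b' \<in> T \<and> metacyc (G\<lparr>carrier := T\<rparr>) a' b' N1 p k j'"
proof -
  have pos: "N1 > 0" "N2 > 0" using N_pos N(1) by auto
  have g: "[geo k p = p] (mod N2)" by (rule geo_cong_1[OF N(4)])
  obtain x where x: "[p * x = 1] (mod N2)" using cong_solve_coprime_nat[of p N2] N(3) by (auto simp: coprime_commute)
  \<comment> \<open>The solution of \<open>t * p + j = 0\<close> modulo \<open>N2\<close>, with
    \<open>N2 * j - j\<close> as the negative of \<open>j\<close>.\<close>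
  define t where "t = (x * (N2 * j - j)) mod N2"
  have "[t * geo k p + j = x * (N2 * j - j) * p + j] (mod N2)"
    unfolding t_def by (intro cong_add cong_mult g cong_refl) (simp add: cong_def)
  also have "x * (N2 * j - j) * p + j = (p * x) * (N2 * j - j) + j" by (simp add: ac_simps)
  also have "[\<dots> = 1 * (N2 * j - j) + j] (mod N2)" by (intro cong_add cong_mult x cong_refl)
  also have "1 * (N2 * j - j) + j = N2 * j" using pos by (simp add: Suc_leI)
  finally have tS: "N2 dvd t * geo k p + j" using cong_dvd_iff by (metis dvd_triv_left)
  then have pr: "(N2, t) \<in> mcpairs N p k j" using pos N(1) by (simp add: mcpairs_def t_def)
  define T where "T = mcsub N2 t"
  have sT: "sg T" using sg_mcsub T_def by simp
  have "card T * N2 = N1 * p * N2" using card_mcsub[OF pr] N(1) by (simp add: T_def ac_simps)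
  then have cT: "card T = N1 * p" using pos by simp
  define z where "z = a [^] N1"
  have zG: "z \<in> carrier G" using aG z_def by simp
  have oz: "ord z = N2" unfolding z_def using ord_pow[OF aG, of N1] ord_a N(1) pos by simp
  have kN: "[k ^ y * N1 = N1] (mod N)" for y
  proof -
    have "[k ^ y = 1 ^ y] (mod N2)" by (rule cong_pow[OF N(4)])
    then have "[k ^ y * N1 = 1 * N1] (mod N2 * N1)" by (simp add: cong_def mod_mult_mult2)
    then show ?thesis using N(1) by (simp add: mult.commute)
  qed
  have "z \<otimes> g = g \<otimes> z" if gG: "g \<in> carrier G" for g
  proof -
    obtain i y :: nat where g: "g = a [^] i \<otimes> b [^] y" using elem_ex[OF gG] by blast
    have "g \<otimes> z = a [^] (i + k ^ y * N1) \<otimes> b [^] y" using elem_mult[of i y N1 0] g aG bG by (simp add: z_def)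
    also have "a [^] (i + k ^ y * N1) = a [^] (N1 + i)"
      unfolding apow_eq add.commute[of N1] by (rule cong_add[OF cong_refl kN])
    also have "a [^] (N1 + i) \<otimes> b [^] y = z \<otimes> g" using g aG bG by (simp add: z_def m_assoc[symmetric] nat_pow_mult)
    finally show ?thesis by simp
  qed
  then have zc: "z \<in> group_center G" using zG by (simp add: group_center_def)
  have d: "dec T z"
    unfolding dec_def using sT zc cT oz N order by (auto simp: coprime_commute ac_simps)
  define a' where "a' = a [^] N2"
  define c where "c = a [^] t \<otimes> b"
  have aT: "a' \<in> T" unfolding a'_def T_def using mcsub_a[OF pr] by simp
  have cT': "c \<in> T" unfolding c_def T_def by (rule mcsub_c)
  obtain j' where j': "t * geo k p + j = N2 * j'" using tS by blast
  interpret s: metacyc G a c N p k "t * geo k p + j" unfolding c_def by (rule metacyc_shift)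
  interpret T: fin_group "G\<lparr>carrier := T\<rparr>" by (rule sg_restrict[OF sT])
  have pT: "x [^]\<^bsub>G\<lparr>carrier := T\<rparr>\<^esub> n = x [^] n" for x and n :: nat by (rule nat_pow_consistent[symmetric])
  have "metacyc (G\<lparr>carrier := T\<rparr>) a' c N1 p k j'"
  proof unfold_locales
    show "a' \<in> carrier (G\<lparr>carrier := T\<rparr>)" "c \<in> carrier (G\<lparr>carrier := T\<rparr>)" using aT cT' by auto
    show "T.ord a' = N1" using ord_restrict[OF sT aT] ord_pow[OF aG, of N2] ord_a N(1) pos by (simp add: a'_def)
    show "Factorial_Ring.prime p" by (rule p)
    show "card (carrier (G\<lparr>carrier := T\<rparr>)) = N1 * p" using cT by simp
    show "c \<notin> T.cyc a'"
      using s.b_notin cyc_restrict[OF sT] cyc_least[OF sgA cyc_pow, of N2] by (auto simp: a'_def)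
    show "c [^]\<^bsub>G\<lparr>carrier := T\<rparr>\<^esub> p = a' [^]\<^bsub>G\<lparr>carrier := T\<rparr>\<^esub> j'"
      using s.bp aG by (simp add: pT a'_def j' nat_pow_pow)
    show "c \<otimes>\<^bsub>G\<lparr>carrier := T\<rparr>\<^esub> a' = a' [^]\<^bsub>G\<lparr>carrier := T\<rparr>\<^esub> k \<otimes>\<^bsub>G\<lparr>carrier := T\<rparr>\<^esub> c"
      using s.b_apow[of N2] aG by (simp add: pT a'_def nat_pow_pow mult.commute)
  qed
  then show ?thesis using d cT' by blast
qed

lemma pair_classified:
  assumes q: "(N, p, q) \<in> set mc_pairs" "q = 1 \<or> \<not> [k = 1] (mod q)" "q \<noteq> 1 \<or> p dvd j" "q dvd N" "q \<noteq> 1 \<longrightarrow> q > 1"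
    and c: "num_subgroups G \<le> 12"
  shows "\<exists>i<23. G \<cong> rep i"
proof -
  define k0 where "k0 = k mod N"
  define j0 where "j0 = j mod N"

  \<comment> \<open>The change of generators is the trivial one; its only effect is to reduce
    \<open>k\<close> and \<open>j\<close> modulo \<open>N\<close>, into the range of the
    search.\<close>
  have m0: "metacyc G (a [^] (1::nat)) (a [^] (0::nat) \<otimes> b [^] (1::nat)) N p k0 j0"
    by (rule reparam) (use p not_prime_unit in \<open>auto simp: k0_def j0_def cong_def geo_def\<close>)
  then interpret m: metacyc G "a [^] (1::nat)" "a [^] (0::nat) \<otimes> b [^] (1::nat)" N p k0 j0 .
  have kj: "k0 \<in> set [0..<N]" "j0 \<in> set [0..<N]" using N_pos by (auto simp: k0_def j0_def)
  have kp: "(k0 ^ p) mod N = 1 mod N" using m.kp by (simp add: cong_def)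
  have kj0: "(k0 * j0) mod N = j0" using m.kj kj by (simp add: cong_def)
  have q1: "q = 1 \<or> k0 mod q \<noteq> 1"
    using q(2,4,5) by (auto simp: cong_def k0_def mod_mod_cancel)
  have q2: "q \<noteq> 1 \<or> j0 mod p = 0"
  proof (cases "q = 1")
    case True
    have "p dvd N" using q(1) True by (auto simp: mc_pairs_def)
    then show ?thesis using q(3) True by (simp add: j0_def mod_mod_cancel dvd_imp_mod_0)
  qed simp
  have cnt: "mcount_list N p k0 j0 \<le> 12" using c m.num_subgroups_metacyc mcount_list[OF N_pos] by simp
  have ck: "mc_check (N, p, q)" using mc_check q(1) by (simp add: list_all_iff)
  note ck' = ck[unfolded mc_check_def case_prod_conv all_in_iff, THEN bspec, OF kj(1)]
  note ck'' = ck'[unfolded if_P[OF kp] if_P[OF q1], THEN bspec, OF kj(2)]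
  have "some_in [0..<23] (\<lambda>i. case rep_params ! i of (N', p', k', j') \<Rightarrow>
           if N' = N then if p' = p then reparam_search N p k0 j0 k' j' else False else False)"
    by (rule ck''[unfolded if_P[OF kj0] if_P[OF q2] if_P[OF cnt]])
  then obtain i k' j' where i: "i < 23" "rep_params ! i = (N, p, k', j')" "reparam_search N p k0 j0 k' j'"
  proof -
    assume "some_in [0..<23] (\<lambda>i. case rep_params ! i of (N', p', k', j') \<Rightarrow>
           if N' = N then if p' = p then reparam_search N p k0 j0 k' j' else False else False)"
    then obtain i where i: "i < 23" "case rep_params ! i of (N', p', k', j') \<Rightarrow>
           if N' = N then if p' = p then reparam_search N p k0 j0 k' j' else False else False"
      unfolding some_in_iff by auto
    obtain N' p' k' j' where r: "rep_params ! i = (N', p', k', j')" by (metis prod_cases4)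
    then have "N' = N" "p' = p" "reparam_search N p k0 j0 k' j'" using i(2) by (auto split: if_splits)
    then show ?thesis using that i(1) r by simp
  qed
  then obtain v t u where v: "v \<in> {1..<p}" "k' mod N = (k0 ^ v) mod N"
     "(t * geo_list (k0 ^ v) p + j0 * v) mod N = (u * j') mod N" "gcd u N = 1"
    unfolding reparam_search_def some_in_iff by (auto split: if_splits simp: Let_def some_in_iff)
  have nv: "\<not> p dvd v" using v(1) by (auto dest: dvd_imp_le)
  have "metacyc G ((a [^] (1::nat)) [^] u) ((a [^] (1::nat)) [^] t \<otimes> (a [^] (0::nat) \<otimes> b [^] (1::nat)) [^] v) N p k' j'"
  proof (rule m.reparam)
    show "\<not> p dvd v" by (rule nv)
    show "coprime u N" using v(4) by (simp only: coprime_iff_gcd_eq_1)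
    show "[k' = k0 ^ v] (mod N)" using v(2) by (simp only: cong_def)
    show "[t * geo (k0 ^ v) p + j0 * v = u * j'] (mod N)" using v(3) by (simp only: cong_def geo_list)
  qed
  from metacyc_iso[OF this rep_metacyc[OF i(1,2)]] show ?thesis using i(1) by blast
qed

text \<open>Cyclic groups are treated beforehand, because for a noncyclic one \<open>j'\<close> is
  not prime to \<open>N1\<close>; in the prime power case this supplies \<open>p dvd j'\<close>, on
  which the count in \<open>pgroup_params\<close> rests.\<close>

lemma metacyc_classified:
  assumes c: "num_subgroups G \<le> 12"
  shows "\<exists>i<25. \<exists>T z. dec T z \<and> G\<lparr>carrier := T\<rparr> \<cong> rep i"
proof (cases "\<exists>x\<in>carrier G. carrier G = cyc x")
  case True
  then show ?thesis using cyclic_classified by blast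
next
  case nc: False
  obtain N1 N2 where N: "N = N1 * N2" "coprime N1 N2" "coprime N2 p" "[k = 1] (mod N2)"
    and red: "\<And>q. Factorial_Ring.prime q \<Longrightarrow> q dvd N1 \<Longrightarrow> q \<noteq> p \<Longrightarrow> \<not> [k = 1] (mod q ^ multiplicity q N1)"
    using split_params[OF N_pos p, of k] by blast
  obtain T z a' b' j' where d: "dec T z" "b' \<in> T" and m: "metacyc (G\<lparr>carrier := T\<rparr>) a' b' N1 p k j'"
    using metacyc_dec[OF N] by blast
  have sT: "sg T" using d by (simp add: dec_def)
  have b'G: "b' \<in> carrier G" using d sT sg_mem by blast
  have zG: "z \<in> carrier G" using d by (simp add: dec_def group_center_def)
  interpret T: metacyc "G\<lparr>carrier := T\<rparr>" a' b' N1 p k j' by (rule m)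
  have ncT: "\<not> coprime j' N1"
  proof
    assume "coprime j' N1"
    then have "T = cyc b'" using T.metacyc_cyclic cyc_restrict[OF sT] by simp
    from dec_cyclic[OF d(1,2) this] show False using nc b'G zG by (metis m_closed)
  qed
  have cT: "num_subgroups (G\<lparr>carrier := T\<rparr>) \<le> 12" using num_subgroups_mono[OF sT] c by simp
  then have mc: "mcount N1 p k j' \<le> 12" using T.num_subgroups_metacyc by simp
  define f where "f = multiplicity p N1"
  obtain n where n: "N1 = p ^ f * n" "\<not> p dvd n"
    unfolding f_def by (rule multiplicity_decompose'[of N1 p]) (use T.N_pos p not_prime_unit in auto)
  have "\<exists>i<23. G\<lparr>carrier := T\<rparr> \<cong> rep i"
  proof (cases "n > 1")
    case True
    have "(N1, p, n) \<in> set mc_pairs \<and> Factorial_Ring.prime n \<and> \<not> [k = 1] (mod n)"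
      by (rule mixed_params[OF p n(2,1) True T.kp T.kj red mc])
    then show ?thesis using T.pair_classified[of n] n(1) True cT by auto
  next
    case False
    moreover have "n \<noteq> 0" using n T.N_pos by (metis dvd_0_right)
    ultimately have n1: "N1 = p ^ f" using n by simp
    have pj: "p dvd j'"
    proof (rule ccontr)
      assume "\<not> p dvd j'"
      then have "coprime p j'" using p by (simp add: prime_imp_coprime)
      then have "coprime j' N1" using n1 by (simp add: coprime_commute)
      then show False using ncT by blast
    qed
    have "f > 0" using ncT n1 by (cases f) auto
    then have "(N1, p, 1) \<in> set mc_pairs"
      using pgroup_params[OF p _ _ _ pj] T.kp T.kj mc n1 by simp
    then show ?thesis using T.pair_classified[of 1] pj cT by simp
  qed
  then obtain i where "i < 23" "G\<lparr>carrier := T\<rparr> \<cong> rep i" by blast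
  moreover from this have "i < 25" by simp
  ultimately show ?thesis using d(1) by blast
qed

end

section \<open>Groups all of whose Sylow subgroups are normal\<close>

context fin_group
begin

definition is_cyclic :: "'a set \<Rightarrow> bool" where
  "is_cyclic H \<longleftrightarrow> (\<exists>x\<in>H. H = cyc x)"

definition has_mc :: bool where
  "has_mc \<longleftrightarrow> is_cyclic (carrier G) \<or>
    (\<exists>a\<in>carrier G. \<exists>p. Factorial_Ring.prime p \<and> card (carrier G) = ord a * p \<and> carrier G \<subseteq> norm (cyc a))"

definition subs :: "'a set \<Rightarrow> 'a set set" where
  "subs H = {K. sg K \<and> K \<subseteq> H}"

lemma finite_subs: "finite (subs H)"
  by (rule finite_subset[OF _ finite_sgs]) (auto simp: subs_def)

lemma subs_geI: "S \<subseteq> subs H \<Longrightarrow> n \<le> card S \<Longrightarrow> n \<le> card (subs H)"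
  using card_mono[OF finite_subs] le_trans by blast

lemma sg_setI_le: "S \<subseteq> {H. sg H} \<Longrightarrow> card S \<le> num_subgroups G"
  unfolding num_subgroups_def by (rule card_mono[OF finite_sgs])

lemma maxin_sg: "maxin M K \<Longrightarrow> sg M" "maxin M K \<Longrightarrow> sg K" "maxin M K \<Longrightarrow> M \<subseteq> K" "maxin M K \<Longrightarrow> M \<noteq> K"
  by (auto simp: maxin_def)

lemma maxin_between: "maxin M K \<Longrightarrow> sg H \<Longrightarrow> M \<subseteq> H \<Longrightarrow> H \<subseteq> K \<Longrightarrow> H = M \<or> H = K"
  by (simp add: maxin_def)

section \<open>Maximal subgroups of noncyclic p-groups\<close>

lemma prime_card_cyclic:
  assumes "sg H" "Factorial_Ring.prime (card H)" shows "is_cyclic H"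
proof -
  have "card H > 1" using prime_gt_1_nat assms by blast
  then have "H \<noteq> {\<one>}" by auto
  then obtain x where x: "x \<in> H" "x \<noteq> \<one>" using sg_ne[OF assms(1)] by blast
  have xG: "x \<in> carrier G" using x sg_mem assms by blast
  have "card (cyc x) dvd card H" using ord_dvd_card assms x card_cyc[OF xG] by simp
  moreover have "card (cyc x) \<noteq> 1" using card_cyc[OF xG] ord_eq_1[OF xG] x by simp
  ultimately have "card (cyc x) = card H" using assms(2) by (metis prime_nat_iff)
  then have "cyc x = H" using card_subset_eq[OF sg_fin[OF assms(1)]] cyc_least assms x by blast
  then show ?thesis using x by (auto simp: is_cyclic_def)
qed

lemma noncyclic_two_max:
  assumes P: "sg P" "\<not> is_cyclic P"
  obtains M1 M2 where "maxin M1 P" "maxin M2 P" "M1 \<noteq> M2"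
proof -
  have ex: "\<exists>M. maxin M P \<and> x \<in> M" if x: "x \<in> P" for x
  proof -
    have "cyc x \<subset> P" using P x cyc_least by (auto simp: is_cyclic_def)
    then obtain M where "maxin M P" "cyc x \<subseteq> M" using ex_maxin[OF sg_cyc P(1)] sg_mem[OF P(1) x] by blast
    then show ?thesis using cyc_self sg_mem[OF P(1) x] by blast
  qed
  obtain M1 where M1: "maxin M1 P" using ex[OF sg_ne[OF P(1)]] by blast
  obtain x where x: "x \<in> P" "x \<notin> M1" using maxin_sg[OF M1] by blast
  obtain M2 where "maxin M2 P" "x \<in> M2" using ex[OF x(1)] by blast
  then show ?thesis using that M1 x by blast
qed

lemma prime_index_maxin:
  assumes "sg M" "sg P" "M \<subseteq> P" "card P = p * card M" "Factorial_Ring.prime (p::nat)"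
  shows "maxin M P"
  unfolding maxin_def
proof (intro conjI allI impI)
  show "M \<subset> P" using assms prime_gt_1_nat[OF assms(5)] sg_card_pos[OF assms(1)] by auto
  fix H assume H: "sg H" "M \<subseteq> H" "H \<subseteq> P"
  obtain c where c: "card H = card M * c" using card_dvd[OF assms(1) H(1,2)] by blast
  obtain d where d: "card P = card H * d" using card_dvd[OF H(1) assms(2) H(3)] by blast
  have "card M * c * d = p * card M" by (simp only: c[symmetric] d[symmetric] assms(4))
  then have "card M * (c * d) = card M * p" by (simp only: ac_simps)
  then have "c * d = p" by (rule iffD1[OF nat_mult_eq_cancel1[OF sg_card_pos[OF assms(1)]]])
  then have "c dvd p" by auto
  then have "c = 1 \<or> c = p" using assms(5) by (metis prime_nat_iff)
  then show "H = M \<or> H = P"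
  proof
    assume "c = 1" then show ?thesis using c card_eqI[OF assms(1) H(1,2)] by simp
  next
    assume "c = p" then show ?thesis using c assms(4) card_eqI[OF H(1) assms(2) H(3)] by simp
  qed
qed (use assms in auto)

text \<open>The order of \<open>x\<close> modulo \<open>M\<close> divides the index
  \<open>p\<close>, by the product formula for \<open>cyc x\<close> and \<open>M\<close>.\<close>

lemma pow_index_mem:
  assumes p: "Factorial_Ring.prime (p::nat)" and M: "sg M" "sg P" "M \<subseteq> P" "card P = p * card M" "P \<subseteq> norm M" and x: "x \<in> P"
  shows "x [^] p \<in> M"
proof (cases "x \<in> M")
  case True then show ?thesis using sg_pow M by blast
next
  case False
  have xG: "x \<in> carrier G" using x M sg_mem by blast
  obtain d where d: "d > 0" "\<And>n. x [^] n \<in> M \<longleftrightarrow> d dvd n" "d dvd ord x" using pow_mem_sg[OF M(1) xG] by metis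
  have n: "cyc x \<subseteq> norm M" "cyc x \<subseteq> P" using cyc_least[OF M(2) x] M(5) by auto
  have s: "sg (cyc x <#> M)" using sg_set_mult[OF sg_cyc[OF xG] M(1)] n by blast
  have "M \<inter> cyc x = cyc (x [^] d)" using cyc_Int[OF M(1) xG d(2,3)] .
  then have "card (cyc x \<inter> M) = ord x div d" using card_cyc xG d by (simp add: Int_commute ord_pow)
  then have "card (cyc x <#> M) * (ord x div d) = ord x * card M"
    using card_set_mult[OF sg_cyc[OF xG] M(1)] card_cyc[OF xG] by simp
  then have "card (cyc x <#> M) = d * card M" using d ord_pos[OF xG] by (auto elim!: dvdE)
  moreover have "card (cyc x <#> M) dvd card P" using card_dvd[OF s M(2)] set_mult_least[OF M(2)] n M(3) by blast
  ultimately have "d dvd p" using M(4) sg_card_pos[OF M(1)] by simp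
  moreover have "d \<noteq> 1" using d(2)[of 1] False xG by simp
  ultimately have "d = p" using p by (metis prime_nat_iff)
  then show ?thesis using d by simp
qed

lemma card_cyc_mult:
  assumes p: "Factorial_Ring.prime (p::nat)" and D: "sg D" and x: "x \<in> carrier G" "x \<in> norm D" "x \<notin> D" "x [^] p \<in> D"
  shows "sg (cyc x <#> D)" "card (cyc x <#> D) = p * card D"
proof -
  have n: "cyc x \<subseteq> norm D" using cyc_least[OF sg_norm x(2)] sg_sub[OF D] by blast
  show "sg (cyc x <#> D)" using sg_set_mult[OF sg_cyc[OF x(1)] D n] .
  obtain d where d: "d > 0" "\<And>n. x [^] n \<in> D \<longleftrightarrow> d dvd n" "d dvd ord x" using pow_mem_sg[OF D x(1)] by metis
  have "d dvd p" "d \<noteq> 1" using d(2)[of p] d(2)[of 1] x by auto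
  then have dp: "d = p" using p by (metis prime_nat_iff)
  have "D \<inter> cyc x = cyc (x [^] d)" using cyc_Int[OF D x(1) d(2,3)] .
  then have "card (cyc x \<inter> D) = ord x div d" using card_cyc x d by (simp add: Int_commute ord_pow)
  then have "card (cyc x <#> D) * (ord x div d) = ord x * card D"
    using card_set_mult[OF sg_cyc[OF x(1)] D] card_cyc[OF x(1)] by simp
  then show "card (cyc x <#> D) = p * card D" using d dp ord_pos[OF x(1)] by (auto elim!: dvdE)
qed

text \<open>In a \<open>p\<close>-group the maximal subgroups over the intersection \<open>D\<close> of two of them form a projective line.\<close>

lemma pgroup_line:
  assumes p: "Factorial_Ring.prime (p::nat)" and P: "sg P" "card P = p ^ n" and nc: "\<not> is_cyclic P"
  obtains D where "sg D" "D \<subseteq> P" "card P = p * (p * card D)" "p + 1 \<le> card {M. maxin M P \<and> D \<subseteq> M}"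
    "\<And>M. maxin M P \<Longrightarrow> card M = p * card D"
    "\<And>M M'. maxin M P \<Longrightarrow> maxin M' P \<Longrightarrow> D \<subseteq> M \<Longrightarrow> D \<subseteq> M' \<Longrightarrow> M \<noteq> M' \<Longrightarrow> M \<inter> M' = D"
    "\<And>x. x \<in> P \<Longrightarrow> x \<notin> D \<Longrightarrow> \<exists>M. maxin M P \<and> D \<subseteq> M \<and> x \<in> M"
proof -
  have p1: "p > 1" using prime_gt_1_nat p .
  obtain M1 M2 where M: "maxin M1 P" "maxin M2 P" "M1 \<noteq> M2" using noncyclic_two_max[OF P(1) nc] by blast
  define D where "D = M1 \<inter> M2"
  note mp = maxin_pgroup[OF p P(2)]
  have sD: "sg D" using M maxin_sg sg_Int D_def by simp
  \<comment> \<open>Two distinct maximal subgroups generate \<open>P\<close>, so by the product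
    formula their intersection has index \<open>p * p\<close>.\<close>
  have meet: "p * (p * card (A \<inter> B)) = card P" if A: "maxin A P" "maxin B P" "A \<noteq> B" for A B
  proof -
    have s: "sg A" "sg B" "A \<subseteq> P" "B \<subseteq> P" using A maxin_sg by auto
    have "A \<subseteq> norm B" using mp(1)[OF A(2)] s by blast
    then have sAB: "sg (A <#> B)" using sg_set_mult s by blast
    note up = set_mult_upper[OF s(1,2)]
    have AP: "A <#> B \<subseteq> P" using set_mult_least[OF P(1)] s by blast
    have "A <#> B = A \<or> A <#> B = P" "A <#> B = B \<or> A <#> B = P"
      by (rule maxin_between[OF A(1) sAB up(1) AP]) (rule maxin_between[OF A(2) sAB up(2) AP])
    then have "A <#> B = P" using A(3) by auto
    then have e: "card P * card (A \<inter> B) = card A * card B" using card_set_mult[OF s(1,2)] by simp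
    have "p * card P * card (A \<inter> B) * p = p * card A * (p * card B)" using e by (simp add: ac_simps)
    also have "\<dots> = card P * card P" by (simp only: mp(2)[OF A(1), symmetric] mp(2)[OF A(2), symmetric])
    finally have "card P * (p * (p * card (A \<inter> B))) = card P * card P" by (simp add: ac_simps)
    then show ?thesis using sg_card_pos[OF P(1)] by simp
  qed
  have cP: "card P = p * (p * card D)" using meet[OF M] D_def by simp
  have DP: "D \<subseteq> P" using M maxin_sg D_def by blast
  have cM: "card A = p * card D" if "maxin A P" for A
    using mp(2)[OF that] cP p1 by simp
  have int: "A \<inter> B = D" if A: "maxin A P" "maxin B P" "D \<subseteq> A" "D \<subseteq> B" "A \<noteq> B" for A B
  proof -
    have "p * (p * card (A \<inter> B)) = p * (p * card D)" using meet[OF A(1,2,5)] cP by simp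
    then have "card (A \<inter> B) = card D" using p1 by simp
    then show ?thesis using card_eqI[OF sD sg_Int[of A B]] A maxin_sg by simp
  qed
  have cov: "\<exists>A. maxin A P \<and> D \<subseteq> A \<and> x \<in> A" if x: "x \<in> P" "x \<notin> D" for x
  proof -
    have xG: "x \<in> carrier G" using x P sg_mem by blast
    have "x [^] p \<in> A" if A: "maxin A P" for A
      by (rule pow_index_mem[OF p maxin_sg(1)[OF A] P(1) maxin_sg(3)[OF A] mp(2)[OF A] mp(1)[OF A] x(1)])
    then have "x [^] p \<in> M1" "x [^] p \<in> M2" using M by auto
    then have xp: "x [^] p \<in> D" by (simp add: D_def)
    have "x \<in> norm M1" "x \<in> norm M2" using mp(1) M x by blast+
    then have xD: "x \<in> norm D"
    proof -
      assume nn: "x \<in> norm M1" "x \<in> norm M2"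
      have "cj x D \<subseteq> D" using nn cj_mono[of D M1 x] cj_mono[of D M2 x] by (auto simp: D_def norm_def)
      then have "cj x D = D" using card_eqI[OF sg_cj[OF xG sD] sD] card_cj[OF xG sg_sub[OF sD]] by simp
      then show ?thesis using xG by (simp add: norm_def)
    qed
    \<comment> \<open>As \<open>x\<close> normalizes \<open>D\<close> and has its
      \<open>p\<close>-th power there, adjoining it multiplies the order by \<open>p\<close>; the
      result has index \<open>p\<close> and is maximal.\<close>
    note cc = card_cyc_mult[OF p sD xG xD x(2) xp]
    have "cyc x <#> D \<subseteq> P" using set_mult_least[OF P(1)] cyc_least[OF P(1) x(1)] DP by blast
    then have "maxin (cyc x <#> D) P" using prime_index_maxin[OF cc(1) P(1) _ _ p] cc(2) cP by simp
    moreover have "D \<subseteq> cyc x <#> D" "x \<in> cyc x <#> D"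
      using set_mult_upper[OF sg_cyc[OF xG] sD] cyc_self[OF xG] by auto
    ultimately show ?thesis by blast
  qed
  let ?F = "{A. maxin A P \<and> D \<subseteq> A}"
  have finF: "finite ?F" by (rule finite_subset[OF _ finite_sgs]) (auto dest: maxin_sg)
  \<comment> \<open>Each maximal subgroup over \<open>D\<close> covers
    \<open>(p - 1) * card D\<close> of the \<open>(p + 1) * (p - 1) * card D\<close> elements
    outside \<open>D\<close>, so at least \<open>p + 1\<close> of them are needed.\<close>
  have "P - D \<subseteq> (\<Union>A\<in>?F. A - D)" using cov by blast
  then have "card (P - D) \<le> card (\<Union>A\<in>?F. A - D)"
    by (rule card_mono[rotated]) (use finF sg_fin maxin_sg in blast)
  also have "\<dots> \<le> (\<Sum>A\<in>?F. card (A - D))" by (rule card_UN_le[OF finF])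
  also have "\<dots> = (\<Sum>A\<in>?F. (p - 1) * card D)"
  proof (rule sum.cong[OF refl])
    fix A assume "A \<in> ?F"
    then show "card (A - D) = (p - 1) * card D"
      using cM[of A] by (simp add: card_Diff_subset[OF sg_fin[OF sD]] diff_mult_distrib)
  qed
  also have "\<dots> = card ?F * ((p - 1) * card D)" by simp
  finally have le: "card (P - D) \<le> card ?F * ((p - 1) * card D)" .
  have "card (P - D) = p * (p * card D) - card D" using card_Diff_subset[OF sg_fin[OF sD] DP] cP by simp
  also have "\<dots> = (p + 1) * ((p - 1) * card D)"
    using p1 by (cases p) (auto simp: algebra_simps)
  finally have "(p + 1) * ((p - 1) * card D) \<le> card ?F * ((p - 1) * card D)" using le by simp
  then have "p + 1 \<le> card ?F"
    by (rule mult_right_le_imp_le) (use p1 sg_card_pos[OF sD] in simp)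
  then show ?thesis using that[of D] sD DP cP cM int cov by blast
qed

lemma pgroup_max_count:
  assumes "Factorial_Ring.prime (p::nat)" "sg P" "card P = p ^ n" "\<not> is_cyclic P"
  shows "p + 1 \<le> card {M. maxin M P}"
proof -
  obtain D where "p + 1 \<le> card {M. maxin M P \<and> D \<subseteq> M}" using pgroup_line[OF assms] by metis
  also have "\<dots> \<le> card {M. maxin M P}"
    by (rule card_mono) (auto intro: finite_subset[OF _ finite_sgs] dest: maxin_sg)
  finally show ?thesis .
qed

text \<open>Counted are \<open>P\<close>, \<open>D\<close> and at least three maximal subgroups
  between them.\<close>

lemma pgroup_noncyclic_ge_5:
  assumes p: "Factorial_Ring.prime (p::nat)" and P: "sg P" "card P = p ^ n" "\<not> is_cyclic P"
  shows "5 \<le> card (subs P)"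
proof -
  have p1: "p > 1" using prime_gt_1_nat p .
  obtain D where D: "sg D" "D \<subseteq> P" "card P = p * (p * card D)" "p + 1 \<le> card {M. maxin M P \<and> D \<subseteq> M}"
    "\<And>M. maxin M P \<Longrightarrow> card M = p * card D"
    by (rule pgroup_line[OF p P]) (rule that; (assumption | simp | blast))
  let ?F = "{M. maxin M P \<and> D \<subseteq> M}"
  have finF: "finite ?F" by (rule finite_subset[OF _ finite_sgs]) (auto dest: maxin_sg)
  have pos: "card D > 0" using sg_card_pos[OF D(1)] .
  have lt: "c < p * c" if "0 < c" for c using that p1 by simp
  have "P \<notin> ?F" using maxin_sg(4)[of P P] by auto
  moreover have "D \<notin> ?F"
  proof
    assume "D \<in> ?F"
    then have "card D = p * card D" using D(5)[of D] by simp
    then show False using lt[OF pos] by simp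
  qed
  moreover have "P \<noteq> D"
  proof
    assume "P = D"
    then have "card D = p * (p * card D)" using D(3) by simp
    then show False using less_trans[OF lt[OF pos] lt[OF less_trans[OF pos lt[OF pos]]]] by simp
  qed
  ultimately have "card (insert P (insert D ?F)) = card ?F + 2" using finF by simp
  then have "5 \<le> card (insert P (insert D ?F))" using D(4) p1 by simp
  moreover have "insert P (insert D ?F) \<subseteq> subs P" using D(1,2) P(1) maxin_sg(1,3) unfolding subs_def by blast
  ultimately show ?thesis using subs_geI by blast
qed

text \<open>Each of the \<open>p + 1\<close> maximal subgroups over \<open>D\<close> is noncyclic
  and so has at least \<open>p\<close> maximal subgroups besides \<open>D\<close>; these differ for
  different \<open>M\<close>, which meet only in \<open>D\<close>. With \<open>P\<close>,
  \<open>D\<close> and the trivial subgroup this gives \<open>(p + 1) * (p + 1) + 3\<close>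
  subgroups, enough unless \<open>p = 2\<close>.\<close>

lemma pgroup_no_cyclic_max_ge_13:
  assumes p: "Factorial_Ring.prime (p::nat)" and P: "sg P" "card P = p ^ n" "\<not> is_cyclic P"
    and nm: "\<And>M. maxin M P \<Longrightarrow> \<not> is_cyclic M"
  shows "13 \<le> card (subs P)"
proof -
  have p1: "p > 1" using prime_gt_1_nat p .
  obtain D where D: "sg D" "D \<subseteq> P" "card P = p * (p * card D)" "p + 1 \<le> card {M. maxin M P \<and> D \<subseteq> M}"
    "\<And>M. maxin M P \<Longrightarrow> card M = p * card D"
    "\<And>M M'. maxin M P \<Longrightarrow> maxin M' P \<Longrightarrow> D \<subseteq> M \<Longrightarrow> D \<subseteq> M' \<Longrightarrow> M \<noteq> M' \<Longrightarrow> M \<inter> M' = D"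
    "\<And>x. x \<in> P \<Longrightarrow> x \<notin> D \<Longrightarrow> \<exists>M. maxin M P \<and> D \<subseteq> M \<and> x \<in> M"
    by (rule pgroup_line[OF p P]) (rule that; (assumption | simp | blast))
  let ?F = "{M. maxin M P \<and> D \<subseteq> M}"
  define E where "E M = {K. maxin K M} - {D}" for M
  have finF: "finite ?F" by (rule finite_subset[OF _ finite_sgs]) (auto dest: maxin_sg)
  have finE: "finite (E M)" for M by (rule finite_subset[OF _ finite_sgs]) (auto simp: E_def dest: maxin_sg)
  have pos: "card D > 0" using sg_card_pos[OF D(1)] .
  have pp: "\<exists>m. card M = p ^ m" if "maxin M P" for M
    using card_dvd[of M P] maxin_sg[OF that] P(2) divides_primepow_nat[OF p] by metis
  have cE: "card K = card D" if MK: "M \<in> ?F" "K \<in> E M" for M K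
  proof -
    obtain m where m: "card M = p ^ m" using pp[of M] MK(1) by blast
    have "card M = p * card K" using maxin_pgroup(2)[OF p m] MK by (simp add: E_def)
    then show ?thesis using D(5)[of M] MK p1 by simp
  qed
  have gE: "p \<le> card (E M)" if MF: "M \<in> ?F" for M
  proof -
    have MP: "maxin M P" using MF by simp
    obtain m where m: "card M = p ^ m" using pp[OF MP] by blast
    have "p + 1 \<le> card {K. maxin K M}" by (rule pgroup_max_count[OF p maxin_sg(1)[OF MP] m nm[OF MP]])
    also have "\<dots> \<le> card (E M) + 1"
      unfolding E_def using diff_card_le_card_Diff[of "{D}" "{K. maxin K M}"] by simp
    finally show ?thesis by simp
  qed
  have disj: "E M \<inter> E M' = {}" if "M \<in> ?F" "M' \<in> ?F" "M \<noteq> M'" for M M'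
  proof (rule ccontr)
    assume "E M \<inter> E M' \<noteq> {}"
    then obtain K where K: "K \<in> E M" "K \<in> E M'" by blast
    have sK: "sg K" "K \<subseteq> M \<inter> M'" using K maxin_sg unfolding E_def by blast+
    have "M \<inter> M' = D" using D(6)[of M M'] that by simp
    then have "K \<subseteq> D" using sK by simp
    then have "K = D" using card_eqI[OF sK(1) D(1)] cE[OF that(1) K(1)] by simp
    then show False using K by (simp add: E_def)
  qed
  have cU: "p * (p + 1) \<le> card (\<Union>M\<in>?F. E M)"
  proof -
    have "card (\<Union>M\<in>?F. E M) = (\<Sum>M\<in>?F. card (E M))"
      by (rule card_UN_disjoint) (use finF finE disj in auto)
    moreover have "(\<Sum>M\<in>?F. p) \<le> (\<Sum>M\<in>?F. card (E M))" by (rule sum_mono) (rule gE)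
    moreover have "p * (p + 1) \<le> (\<Sum>M\<in>?F. p)" using mult_le_mono2[OF D(4), of p] by (simp add: mult.commute)
    ultimately show ?thesis by linarith
  qed
  have "card D \<noteq> 1"
  proof
    assume d: "card D = 1"
    obtain M where M: "maxin M P" using noncyclic_two_max[OF P(1,3)] by blast
    then have "is_cyclic M" using prime_card_cyclic maxin_sg D(5)[OF M] d p by simp
    then show False using nm M by blast
  qed
  then have d2: "card D > 1" using pos by simp
  let ?A2 = "insert D (\<Union>M\<in>?F. E M)"
  have finU: "finite (\<Union>M\<in>?F. E M)" using finF finE by blast
  have "D \<notin> (\<Union>M\<in>?F. E M)" by (simp add: E_def)
  then have c2: "p * (p + 1) + 1 \<le> card ?A2" using cU finU by simp
  have k0: "card H = p * card D" if "H \<in> ?F" for H using D(5) that by blast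
  have k2: "card H = card D" if "H \<in> ?A2" for H using that cE by blast
  have dj: "?F \<inter> ?A2 = {}"
  proof (rule ccontr)
    assume "?F \<inter> ?A2 \<noteq> {}"
    then obtain H where "H \<in> ?F" "H \<in> ?A2" by blast
    from k0[OF this(1)] k2[OF this(2)] have "p * card D = card D" by (rule trans[OF sym])
    then show False using p1 pos by simp
  qed
  have cFA: "p + 1 + (p * (p + 1) + 1) \<le> card (?F \<union> ?A2)"
    using card_Un_disjoint[OF finF _ dj] finU c2 D(4) by simp
  have "P \<notin> ?F \<union> ?A2"
  proof
    assume "P \<in> ?F \<union> ?A2"
    then have "card P = p * card D \<or> card P = card D" using k0[of P] k2[of P] by blast
    then show False using D(3) p1 pos by auto
  qed
  moreover have one: "{\<one>} \<notin> ?F \<union> ?A2"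
  proof
    assume "{\<one>} \<in> ?F \<union> ?A2"
    then have "card {\<one>} = p * card D \<or> card {\<one>} = card D" using k0[of "{\<one>}"] k2[of "{\<one>}"] by blast
    then show False using d2 p1 by auto
  qed
  moreover have "P \<noteq> {\<one>}" using D(3) d2 p1 by auto
  ultimately have c12: "p + 1 + (p * (p + 1) + 1) + 2 \<le> card (insert P (insert {\<one>} (?F \<union> ?A2)))"
    using cFA finF finU by simp
  let ?S = "insert P (insert {\<one>} (?F \<union> ?A2))"
  have Ssub: "?S \<subseteq> subs P"
  proof -
    have F: "?F \<subseteq> subs P" using maxin_sg(1,3) unfolding subs_def by blast
    have "E M \<subseteq> subs P" if MF: "M \<in> ?F" for M
    proof
      fix K assume "K \<in> E M"
      then have "maxin K M" by (simp add: E_def)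
      then have "sg K" "K \<subseteq> P" using maxin_sg(1,3)[of K M] maxin_sg(3)[of M P] MF by auto
      then show "K \<in> subs P" by (simp add: subs_def)
    qed
    then have U: "(\<Union>M\<in>?F. E M) \<subseteq> subs P" by (rule UN_least)
    have "P \<in> subs P" "{\<one>} \<in> subs P" "D \<in> subs P"
      using P(1) D(1,2) sg_one sg_ne[OF P(1)] by (auto simp: subs_def)
    then show ?thesis using F U by simp
  qed
  show ?thesis
  proof (cases "p = 2")
    case False
    then have "p \<ge> 3" using p1 by simp
    then have "3 * (p + 1) \<le> p * (p + 1)" by (rule mult_right_mono) simp
    then have "13 \<le> card ?S" using c12 \<open>p \<ge> 3\<close> by simp
    then show ?thesis using subs_geI[OF Ssub] by blast
  next
    case p2: True
    \<comment> \<open>For \<open>p = 2\<close> the count stops at 12. One more subgroup is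
      exhibited: a maximal subgroup of \<open>D\<close> if \<open>D\<close> does not have order 2,
      otherwise a four-group that does not contain \<open>D\<close>.\<close>
    have c12': "12 \<le> card ?S" using c12 p2 by simp
    have "\<exists>K. K \<in> subs P \<and> K \<notin> ?S"
    proof (cases "card D = 2")
      case False
      obtain m where m: "card D = p ^ m" using card_dvd[OF D(1) P(1) D(2)] P(2) divides_primepow_nat[OF p] by metis
      have "{\<one>} \<subset> D" using sg_ne[OF D(1)] d2 by auto
      then obtain K where K: "maxin K D" using ex_maxin[OF sg_one D(1)] by blast
      have cK: "card D = 2 * card K" using maxin_pgroup(2)[OF p m K] p2 by simp
      have "K \<in> subs P" using maxin_sg[OF K] D(2) by (auto simp: subs_def)
      moreover have "K \<notin> ?S"
      proof
        assume "K \<in> ?S"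
        then have "card K = card P \<or> card K = 1 \<or> card K = p * card D \<or> card K = card D"
          using k0[of K] k2[of K] by auto
        then show False using cK False p2 D(3) pos by auto
      qed
      ultimately show ?thesis by blast
    next
      case True
      \<comment> \<open>The maximal subgroups over \<open>D\<close> now have order 4 and are not
        cyclic, so \<open>P\<close> has exponent 2.\<close>
      have invol: "x \<otimes> x = \<one>" if x: "x \<in> P" for x
      proof (cases "x \<in> D")
        case True
        have "x [^] card D = \<one>" using pow_card_sg[OF D(1) True] .
        then show ?thesis using \<open>card D = 2\<close> sg_mem[OF P(1) x] by (simp add: numeral_2_eq_2)
      next
        case False
        then obtain M where M: "maxin M P" "x \<in> M" using D(7) x by blast
        have xG: "x \<in> carrier G" using sg_mem[OF P(1) x] .
        have c4: "card M = 2 ^ 2" using D(5)[OF M(1)] p2 \<open>card D = 2\<close> by simp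
        have "ord x dvd 2 ^ 2" using ord_dvd_card[OF maxin_sg(1)[OF M(1)] M(2)] c4 by simp
        then obtain e where e: "ord x = 2 ^ e" "e \<le> 2" using divides_primepow_nat[of 2 "ord x" 2] by auto
        have "e \<noteq> 2"
        proof
          assume "e = 2"
          then have "cyc x = M"
            using card_eqI[OF sg_cyc[OF xG] maxin_sg(1)[OF M(1)] cyc_least[OF maxin_sg(1)[OF M(1)] M(2)]] e c4 card_cyc[OF xG] by simp
          then show False using nm[OF M(1)] M(2) by (auto simp: is_cyclic_def)
        qed
        then have "ord x dvd 2" using e le_imp_power_dvd[of e 1 2] by simp
        then have "x [^] (2::nat) = \<one>" using pow_eq_id[OF xG] by blast
        then show ?thesis using xG by (simp add: numeral_2_eq_2)
      qed
      obtain M1 M2 where M: "M1 \<in> ?F" "M2 \<in> ?F" "M1 \<noteq> M2"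
      proof -
        have "\<not> card ?F \<le> 1" using D(4) p1 by linarith
        then show ?thesis using that card_le_Suc0_iff_eq[OF finF] by auto
      qed
      have ne: "\<exists>x\<in>A. x \<notin> D" if "A \<in> ?F" for A
      proof (rule ccontr)
        assume "\<not> (\<exists>x\<in>A. x \<notin> D)"
        then have "A = D" using that by blast
        then show False using k0[OF that] p1 pos by simp
      qed
      obtain x where x: "x \<in> M1" "x \<notin> D" using ne[OF M(1)] by blast
      obtain y where y: "y \<in> M2" "y \<notin> D" using ne[OF M(2)] by blast
      have sM: "sg M1" "sg M2" "D \<subseteq> M1" "D \<subseteq> M2" "M1 \<subseteq> P" "M2 \<subseteq> P" using M maxin_sg by auto
      have xy: "x \<in> P" "y \<in> P" "x \<in> carrier G" "y \<in> carrier G" using x y sM sg_mem by auto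
      have yM1: "y \<notin> M1" using D(6)[of M1 M2] M y by blast
      have xyP: "x \<otimes> y \<in> P" using sg_mult[OF P(1)] xy by blast
      have com: "x \<otimes> y = y \<otimes> x"
      proof -
        have "inv (x \<otimes> y) = x \<otimes> y" using inv_equality[of "x \<otimes> y" "x \<otimes> y"] invol[OF xyP] xy by simp
        moreover have "inv x = x" "inv y = y" using inv_equality invol xy by blast+
        ultimately show ?thesis using inv_mult_group[of x y] xy by simp
      qed
      \<comment> \<open>The generators lie outside \<open>D\<close> in two different maximal
        subgroups over \<open>D\<close>. If \<open>V\<close> contained \<open>D\<close>, it would
        share at least three elements with \<open>M1\<close> and so lie in \<open>M1\<close>, but
        \<open>y\<close> does not.\<close>
      define V where "V = cyc y <#> cyc x"
      have yn: "y \<in> norm (cyc x)"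
      proof -
        have "y \<otimes> x [^] i \<otimes> inv y = x [^] i" for i :: nat
        proof -
          have "y \<otimes> x [^] i = x [^] i \<otimes> y" using com xy group_commutes_pow[of x y i] by simp
          then show ?thesis using xy by (simp add: m_assoc)
        qed
        then have "cj y (cyc x) = cyc x" unfolding cj_def cyc_def image_image by simp
        then show ?thesis using xy by (simp add: norm_def)
      qed
      have cx: "card (cyc x) = 2"
      proof -
        have "ord x dvd 2" using invol[OF xy(1)] pow_eq_id[OF xy(3), of 2] xy by (simp add: numeral_2_eq_2)
        moreover have "ord x \<noteq> 1" using ord_eq_1[OF xy(3)] x(2) sg_ne[OF D(1)] by auto
        ultimately have "ord x = 2" by (metis two_is_prime_nat prime_nat_iff)
        then show ?thesis using card_cyc xy by simp
      qed
      have ynx: "y \<notin> cyc x" using cyc_least[OF sM(1) x(1)] yM1 by blast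
      have y2: "y [^] (2::nat) \<in> cyc x"
        using invol[OF xy(2)] sg_ne[OF sg_cyc[OF xy(3)]] xy by (simp add: numeral_2_eq_2)
      have sV: "sg V" "card V = 4"
        using card_cyc_mult[OF two_is_prime_nat sg_cyc[OF xy(3)] xy(4) yn ynx y2] cx by (simp_all add: V_def)
      have VP: "V \<subseteq> P" unfolding V_def using set_mult_least[OF P(1)] cyc_least[OF P(1)] xy by blast
      have xV: "x \<in> V" "y \<in> V"
        using set_mult_upper[OF sg_cyc[OF xy(4)] sg_cyc[OF xy(3)]] cyc_self xy by (auto simp: V_def)
      have "\<not> D \<subseteq> V"
      proof
        assume DV: "D \<subseteq> V"
        have "V = M1 \<inter> V"
        proof -
          have "D \<union> {x} \<subseteq> M1 \<inter> V" using DV xV x sM by blast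
          then have "card (D \<union> {x}) \<le> card (M1 \<inter> V)" using sg_fin[OF sV(1)] by (simp add: card_mono)
          moreover have "card (D \<union> {x}) = 3" using x(2) True sg_fin[OF D(1)] by simp
          ultimately have "3 \<le> card (M1 \<inter> V)" by simp
          moreover have "2 * card (M1 \<inter> V) \<le> card V" if "M1 \<inter> V \<noteq> V"
            using card_lt[OF sg_Int[OF sM(1) sV(1)] sV(1)] that by blast
          ultimately show ?thesis using sV(2) by (cases "M1 \<inter> V = V") auto
        qed
        then show False using xV yM1 by blast
      qed
      then have "V \<notin> ?F" by blast
      moreover have "V \<notin> ?A2" using k2[of V] sV True by auto
      moreover have "V \<noteq> {\<one>}" "V \<noteq> P" using sV D(3) p2 True by auto
      ultimately show ?thesis using sV VP by (auto simp: subs_def)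
    qed
    then obtain K where K: "K \<in> subs P" "K \<notin> ?S" by blast
    have "finite ?S" using finF finU by simp
    then have "card (insert K ?S) = Suc (card ?S)" using K(2) by (rule card_insert_disjoint)
    then have "13 \<le> card (insert K ?S)" using c12' by linarith
    moreover have "insert K ?S \<subseteq> subs P" using Ssub K(1) by (rule insert_subsetI[rotated])
    ultimately show ?thesis using subs_geI by blast
  qed
qed

section \<open>Products of normal subgroups of coprime orders\<close>

lemma normal_commute:
  assumes A: "sg A" "sg B" "A \<subseteq> norm B" "B \<subseteq> norm A" "A \<inter> B = {\<one>}" and uv: "u \<in> A" "v \<in> B"
  shows "u \<otimes> v = v \<otimes> u"
proof -
  have c: "u \<in> carrier G" "v \<in> carrier G" using A uv sg_mem by auto
  have "u \<otimes> v \<otimes> inv u \<in> B" using A(3) uv by (auto simp: norm_def cj_def)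
  then have 1: "u \<otimes> v \<otimes> inv u \<otimes> inv v \<in> B" using sg_mult[OF A(2)] sg_inv[OF A(2)] uv by blast
  have "v \<otimes> inv u \<otimes> inv v \<in> A" using A(4) uv sg_inv[OF A(1)] by (auto simp: norm_def cj_def)
  then have "u \<otimes> (v \<otimes> inv u \<otimes> inv v) \<in> A" using sg_mult[OF A(1)] uv by blast
  then have "u \<otimes> v \<otimes> inv u \<otimes> inv v \<in> A" using c by (simp add: m_assoc)
  then have "u \<otimes> v \<otimes> inv u \<otimes> inv v = \<one>" using 1 A(5) by blast
  then have "u \<otimes> v \<otimes> inv u = v" using c by (metis inv_equality inv_inv inv_closed m_closed)
  then show ?thesis using c by (metis inv_solve_right' m_closed)
qed

lemma coprime_cyc:
  assumes "x \<in> carrier G" "y \<in> carrier G" "x \<otimes> y = y \<otimes> x" "coprime (ord x) (ord y)"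
  shows "cyc (x \<otimes> y) = cyc x <#> cyc y"
proof
  have s: "sg (cyc x)" "sg (cyc y)" "sg (cyc (x \<otimes> y))" using sg_cyc assms by auto
  have "x \<otimes> y \<in> cyc (x \<otimes> y)" using cyc_self assms by simp
  from coprime_component[OF s(1,2) _ s(3) cyc_self[OF assms(1)] cyc_self[OF assms(2)] assms(3) this]
  have "x \<in> cyc (x \<otimes> y)" "y \<in> cyc (x \<otimes> y)" using card_cyc assms by auto
  then show "cyc x <#> cyc y \<subseteq> cyc (x \<otimes> y)" using set_mult_least[OF s(3)] cyc_least[OF s(3)] by blast
  show "cyc (x \<otimes> y) \<subseteq> cyc x <#> cyc y"
  proof
    fix w assume "w \<in> cyc (x \<otimes> y)"
    then obtain n :: nat where "w = (x \<otimes> y) [^] n" by (rule cycE)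
    then have "w = x [^] n \<otimes> y [^] n" by (simp only: pow_mult_distrib[OF assms(3,1,2)])
    then show "w \<in> cyc x <#> cyc y" using cyc_pow unfolding set_mult_def by blast
  qed
qed

lemma norm_set_mult:
  assumes "g \<in> norm H" "g \<in> norm K" "sg H" "sg K" "sg (H <#> K)"
  shows "g \<in> norm (H <#> K)"
proof -
  have gG: "g \<in> carrier G" using assms norm_sub by blast
  have "cj g (H <#> K) \<subseteq> H <#> K"
  proof
    fix w assume "w \<in> cj g (H <#> K)"
    then obtain h k where hk: "h \<in> H" "k \<in> K" "w = g \<otimes> (h \<otimes> k) \<otimes> inv g" by (auto simp: cj_def set_mult_def)
    have c: "h \<in> carrier G" "k \<in> carrier G" using hk assms sg_mem by auto
    have "inv g \<otimes> (g \<otimes> (k \<otimes> inv g)) = k \<otimes> inv g" using c gG by (simp add: m_assoc[symmetric])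
    then have "w = (g \<otimes> h \<otimes> inv g) \<otimes> (g \<otimes> k \<otimes> inv g)" using hk c gG by (simp add: m_assoc)
    moreover have "g \<otimes> h \<otimes> inv g \<in> H" "g \<otimes> k \<otimes> inv g \<in> K" using assms hk by (auto simp: norm_def cj_def)
    ultimately show "w \<in> H <#> K" unfolding set_mult_def by blast
  qed
  then have "cj g (H <#> K) = H <#> K"
    using card_eqI[OF sg_cj[OF gG assms(5)] assms(5)] card_cj[OF gG sg_sub[OF assms(5)]] by simp
  then show ?thesis using gG by (simp add: norm_def)
qed

lemma psyl_card:
  assumes "Factorial_Ring.prime (p::nat)" "psyl p P (carrier G)"
  shows "card P = p ^ multiplicity p (card (carrier G))"
proof -
  obtain a where a: "card P = p ^ a" using assms by (auto simp: psyl_def)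
  obtain i where i: "card (carrier G) = card P * i" "\<not> p dvd i" "i > 0" using psyl_index[OF assms(2) sg_carrier] by blast
  have "multiplicity p (p ^ a * i) = a"
    using prime_elem_multiplicity_mult_distrib[of p "p ^ a" i] i assms(1)
    by (simp add: not_dvd_imp_multiplicity_0 multiplicity_same_power)
  then show ?thesis using a i by simp
qed

text \<open>The set \<open>S\<close> is left open because the product is needed twice: over all
  primes for the whole group, and over all but one for a complement of a Sylow subgroup.\<close>

lemma nilpotent_product:
  assumes nrm: "\<forall>p P. Factorial_Ring.prime p \<longrightarrow> psyl p P (carrier G) \<longrightarrow> carrier G \<subseteq> norm P"
    and S: "finite S" "\<And>q. q \<in> S \<Longrightarrow> Factorial_Ring.prime q"
  shows "\<exists>N. sg N \<and> carrier G \<subseteq> norm N \<and> card N = (\<Prod>q\<in>S. q ^ multiplicity q (card (carrier G))) \<and>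
     ((\<forall>q\<in>S. \<forall>P. psyl q P (carrier G) \<longrightarrow> is_cyclic P) \<longrightarrow> is_cyclic N)"
  using S
proof (induction S rule: finite_induct)
  case empty
  have "carrier G \<subseteq> norm {\<one>}" by (auto simp: norm_def cj_def)
  moreover have "is_cyclic {\<one>}" by (auto simp: is_cyclic_def cyc_def)
  ultimately show ?case using sg_one by (intro exI[of _ "{\<one>}"]) auto
next
  case (insert q S)
  then obtain N where N: "sg N" "carrier G \<subseteq> norm N" "card N = (\<Prod>q\<in>S. q ^ multiplicity q (card (carrier G)))"
     "(\<forall>q\<in>S. \<forall>P. psyl q P (carrier G) \<longrightarrow> is_cyclic P) \<longrightarrow> is_cyclic N" by auto
  have q: "Factorial_Ring.prime q" using insert.prems by simp
  obtain P where P: "psyl q P (carrier G)" using ex_psyl[OF q sg_carrier] by blast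
  have sP: "sg P" using P by (simp add: psyl_def)
  have nP: "carrier G \<subseteq> norm P" using nrm q P by blast
  have cP: "card P = q ^ multiplicity q (card (carrier G))" using psyl_card[OF q P] .
  have cop: "coprime (card P) (card N)"
    unfolding cP N(3)
  proof (rule prod_coprime_right)
    fix r assume r: "r \<in> S"
    then have "Factorial_Ring.prime r" "q \<noteq> r" using insert by auto
    then have "coprime q r" using q primes_coprime by blast
    then show "coprime (q ^ multiplicity q (card (carrier G))) (r ^ multiplicity r (card (carrier G)))" by simp
  qed
  have int: "P \<inter> N = {\<one>}" by (rule coprime_Int[OF sP N(1) cop])
  have le: "P \<subseteq> norm N" "N \<subseteq> norm P" using N(2) nP sg_sub sP N(1) by blast+
  have s: "sg (P <#> N)" using sg_set_mult[OF sP N(1) le(1)] .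
  have c: "card (P <#> N) = card P * card N" using card_set_mult[OF sP N(1)] int by simp
  have "carrier G \<subseteq> norm (P <#> N)" using norm_set_mult nP N(1,2) sP s by blast
  moreover have "is_cyclic (P <#> N)" if h: "\<forall>q\<in>insert q S. \<forall>P. psyl q P (carrier G) \<longrightarrow> is_cyclic P"
  proof -
    obtain x where x: "x \<in> P" "P = cyc x" using h P by (auto simp: is_cyclic_def)
    obtain y where y: "y \<in> N" "N = cyc y" using h N(4) by (auto simp: is_cyclic_def)
    have xy: "x \<in> carrier G" "y \<in> carrier G" using x y sP N(1) sg_mem by auto
    have "x \<otimes> y = y \<otimes> x" by (rule normal_commute[OF sP N(1) le int x(1) y(1)])
    moreover have "coprime (ord x) (ord y)" using cop x(2) y(2) card_cyc xy by metis
    ultimately have "cyc (x \<otimes> y) = P <#> N" using coprime_cyc xy x(2) y(2) by simp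
    then show ?thesis using cyc_self[of "x \<otimes> y"] xy by (auto simp: is_cyclic_def)
  qed
  ultimately show ?case
    using s c cP N(3) insert.hyps by (intro exI[of _ "P <#> N"]) auto
qed

text \<open>If some Sylow subgroup \<open>P\<close> is noncyclic, it has at least 5 subgroups, so
  its complement \<open>Q\<close> has at most 2 and is cyclic. The bound 13 yields a cyclic maximal
  subgroup \<open>M\<close> of \<open>P\<close>; then \<open>M <#> Q\<close> is cyclic, normal and
  of index \<open>p\<close>.\<close>

lemma sylow_normal_has_mc:
  assumes nrm: "\<And>p P. Factorial_Ring.prime p \<Longrightarrow> psyl p P (carrier G) \<Longrightarrow> carrier G \<subseteq> norm P"
    and n: "num_subgroups G \<le> 12"
  shows has_mc
proof -
  have c0: "card (carrier G) > 0" using sg_card_pos[OF sg_carrier] .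
  let ?S = "prime_factors (card (carrier G))"
  have nrm': "\<forall>p P. Factorial_Ring.prime p \<longrightarrow> psyl p P (carrier G) \<longrightarrow> carrier G \<subseteq> norm P"
    using nrm by blast
  have pf: "(\<Prod>q\<in>?S. q ^ multiplicity q (card (carrier G))) = card (carrier G)"
    using c0 prime_factorization_nat by (simp add: prime_factorization_nat[symmetric])
  show ?thesis
  proof (cases "\<forall>q\<in>?S. \<forall>P. psyl q P (carrier G) \<longrightarrow> is_cyclic P")
    case True
    obtain N where N: "sg N" "card N = card (carrier G)" "is_cyclic N"
      using nilpotent_product[OF nrm', of ?S] True pf by auto
    then have "N = carrier G" using card_eqI[OF N(1) sg_carrier sg_sub] by simp
    then show ?thesis using N(3) by (simp add: has_mc_def)
  next
    case False
    then obtain p P where p: "p \<in> ?S" and P: "psyl p P (carrier G)" "\<not> is_cyclic P" by blast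
    have pp: "Factorial_Ring.prime p" using p by auto
    have sP: "sg P" using P by (simp add: psyl_def)
    obtain e where e: "card P = p ^ e" using P by (auto simp: psyl_def)
    obtain Q where Q: "sg Q" "carrier G \<subseteq> norm Q" "card Q = (\<Prod>q\<in>?S - {p}. q ^ multiplicity q (card (carrier G)))"
      using nilpotent_product[OF nrm', of "?S - {p}"] by auto
    have PQ: "card P * card Q = card (carrier G)"
      using prod.remove[of ?S p "\<lambda>q. q ^ multiplicity q (card (carrier G))"] p pf psyl_card[OF pp P(1)] Q(3) by simp
    have cop: "coprime (card P) (card Q)"
      unfolding psyl_card[OF pp P(1)] Q(3)
    proof (rule prod_coprime_right)
      fix r assume r: "r \<in> ?S - {p}"
      then have "coprime p r" using pp primes_coprime by auto
      then show "coprime (p ^ multiplicity p (card (carrier G))) (r ^ multiplicity r (card (carrier G)))" by simp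
    qed
    have nP: "carrier G \<subseteq> norm P" using nrm[OF pp P(1)] .
    have le: "P \<subseteq> norm Q" "Q \<subseteq> norm P" using Q(2) nP sg_sub sP Q(1) by blast+
    note int = coprime_Int[OF sP Q(1) cop]
    have com: "u \<otimes> v = v \<otimes> u" if "u \<in> P" "v \<in> Q" for u v by (rule normal_commute[OF sP Q(1) le int that])
    have s: "num_subgroups G = card (subs P) * card (subs Q)"
      unfolding subs_def by (rule num_subgroups_coprime[OF sP Q(1) cop PQ com])
    have P5: "5 \<le> card (subs P)" by (rule pgroup_noncyclic_ge_5[OF pp sP e P(2)])
    have Q0: "card (subs Q) > 0" using Q(1) finite_subs[of Q] by (auto simp: card_gt_0_iff subs_def)
    have "5 * card (subs Q) \<le> 12" using s n P5 mult_right_mono[OF P5, of "card (subs Q)"] by linarith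
    then have Q2: "card (subs Q) \<le> 2" by simp
    have "card (subs P) \<le> 12" using s n Q0 by (metis le_trans mult_le_mono2 nat_mult_1_right Suc_leI One_nat_def)
    then obtain M where M: "maxin M P" "is_cyclic M"
      using pgroup_no_cyclic_max_ge_13[OF pp sP e P(2)] by fastforce
    have cQ: "is_cyclic Q"
    proof (rule ccontr)
      assume nc: "\<not> is_cyclic Q"
      then obtain M1 M2 where mm: "maxin M1 Q" "maxin M2 Q" "M1 \<noteq> M2" using noncyclic_two_max[OF Q(1)] by blast
      then have "card {M1, M2, Q} = 3" "{M1, M2, Q} \<subseteq> subs Q" using maxin_sg by (auto simp: subs_def card_insert_if)
      then show False using Q2 card_mono[OF finite_subs, of "{M1, M2, Q}" Q] by simp
    qed
    obtain x where x: "x \<in> M" "M = cyc x" using M by (auto simp: is_cyclic_def)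
    obtain y where y: "y \<in> Q" "Q = cyc y" using cQ by (auto simp: is_cyclic_def)
    have sM: "sg M" "M \<subseteq> P" using maxin_sg[OF M(1)] by auto
    have xy: "x \<in> carrier G" "y \<in> carrier G" using x y sM Q(1) sg_mem by auto
    have cMQ: "coprime (card M) (card Q)" using cop card_dvd[OF sM(1) sP sM(2)] by (meson coprime_divisors dvd_refl)
    have "cyc (x \<otimes> y) = M <#> Q"
      using coprime_cyc[OF xy] com[of x y] x y sM(2) cMQ card_cyc xy by (metis subsetD)
    then have A: "cyc (x \<otimes> y) = M <#> Q" .
    have sA: "sg (M <#> Q)" using A sg_cyc xy by (metis m_closed)
    have "card (M <#> Q) = card M * card Q"
      using card_set_mult[OF sM(1) Q(1)] coprime_Int[OF sM(1) Q(1) cMQ] by simp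
    then have o: "card (carrier G) = ord (x \<otimes> y) * p"
      using PQ maxin_pgroup(2)[OF pp e M(1)] A card_cyc[of "x \<otimes> y"] xy by (simp add: ac_simps)
    have "carrier G \<subseteq> norm M"
    proof -
      have QM: "Q \<subseteq> norm M"
      proof
        fix v assume v: "v \<in> Q"
        have vG: "v \<in> carrier G" using v Q(1) sg_mem by blast
        have "v \<otimes> u \<otimes> inv v = u" if "u \<in> M" for u
        proof -
          have "u \<otimes> v = v \<otimes> u" "u \<in> carrier G" using com[of u v] v that sM sg_mem by auto
          then show ?thesis using vG by (metis inv_solve_right' m_closed)
        qed
        then have "cj v M = M" by (simp add: cj_def)
        then show "v \<in> norm M" using vG by (simp add: norm_def)
      qed
      have "P <#> Q \<subseteq> norm M"
        using set_mult_least[OF sg_norm] maxin_pgroup(1)[OF pp e M(1)] QM sg_sub[OF sM(1)] by blast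
      then show ?thesis using coprime_set_mult[OF sP Q(1) cop PQ] by simp
    qed
    then have "carrier G \<subseteq> norm (cyc (x \<otimes> y))" unfolding A using norm_set_mult sM(1) Q(1,2) sA by blast
    then show ?thesis using o pp xy by (auto simp: has_mc_def)
  qed
qed

end

section \<open>Groups with a maximal subgroup that is not normal\<close>

lemma prime_only_power:
  assumes "n > 0" "Factorial_Ring.prime (p::nat)" "\<And>r. Factorial_Ring.prime r \<Longrightarrow> r dvd n \<Longrightarrow> r = p"
  shows "\<exists>k. n = p ^ k"
proof -
  obtain m where m: "n = p ^ multiplicity p n * m" "\<not> p dvd m"
    by (rule multiplicity_decompose'[of n p]) (use assms not_prime_unit in auto)
  have "m = 1"
  proof (rule ccontr)
    assume "m \<noteq> 1"
    then obtain r where r: "Factorial_Ring.prime r" "r dvd m" using prime_factor_nat by blast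
    then have "r dvd n" using m(1) by (metis dvd_mult)
    then show False using assms(3) r m(2) by blast
  qed
  then show ?thesis using m(1) by auto
qed

lemma not_prime_small:
  assumes "\<not> Factorial_Ring.prime (m::nat)" "3 \<le> m" "m \<le> 8" shows "m = 4 \<or> m = 6 \<or> m = 8"
proof -
  have "m = 3 \<or> m = 4 \<or> m = 5 \<or> m = 6 \<or> m = 7 \<or> m = 8" using assms(2,3) by presburger
  moreover have "Factorial_Ring.prime (3::nat)" "Factorial_Ring.prime (5::nat)" "Factorial_Ring.prime (7::nat)" by simp_all
  ultimately show ?thesis using assms(1) by metis
qed

context fin_group
begin

section \<open>Conjugacy classes of maximal subgroups\<close>

lemma Int_norm_cj:
  assumes "sg K" "H \<subseteq> carrier G" "x \<in> K" shows "K \<inter> norm (cj x H) = cj x (K \<inter> norm H)"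
proof -
  have xG: "x \<in> carrier G" using assms sg_mem by blast
  have i: "cj x (A \<inter> B) = cj x A \<inter> cj x B" if "A \<subseteq> carrier G" "B \<subseteq> carrier G" for A B
    unfolding cj_def by (rule inj_on_image_Int[of _ "carrier G"]) (use that xG in \<open>auto simp: inj_on_def\<close>)
  show ?thesis unfolding norm_cj[OF xG assms(2)] i[OF sg_sub[OF assms(1)] norm_sub] cj_self[OF assms(1,3)] ..
qed

lemma orbE:
  assumes "H' \<in> orb K H" obtains x where "x \<in> K" "H' = cj x H"
  using assms by (auto simp: orb_def)

lemma maxin_cj:
  assumes H: "maxin H K" and x: "x \<in> K" shows "maxin (cj x H) K"
proof -
  have s: "sg H" "sg K" "H \<subseteq> K" "H \<noteq> K" using maxin_sg[OF H] by auto
  have xG: "x \<in> carrier G" using x s sg_mem by blast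
  have cK: "cj x K = K" "cj (inv x) K = K" using cj_self[OF s(2)] x sg_inv[OF s(2)] by auto
  have sub: "H \<subseteq> carrier G" "K \<subseteq> carrier G" using sg_sub s by auto
  show ?thesis
    unfolding maxin_def
  proof (intro conjI allI impI)
    show "sg (cj x H)" using sg_cj xG s by blast
    show "cj x H \<subset> K" using cj_mono[OF s(3), of x] cK(1) cj_inj[OF xG sub] s(4) by auto
    fix U assume U: "sg U" "cj x H \<subseteq> U" "U \<subseteq> K"
    have UG: "U \<subseteq> carrier G" using sg_sub U by blast
    have "sg (cj (inv x) U)" "H \<subseteq> cj (inv x) U" "cj (inv x) U \<subseteq> K"
      using sg_cj U(1) xG cj_mono[OF U(2), of "inv x"] cj_mono[OF U(3), of "inv x"] cj_inv_cj[OF xG sub(1)] cK(2) by auto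
    then have "cj (inv x) U = H \<or> cj (inv x) U = K" using H unfolding maxin_def by blast
    then show "U = cj x H \<or> U = K" using cj_cj_inv[OF xG UG] cK(1) by auto
  qed (rule s(2))
qed

lemma orb_card: "sg K \<Longrightarrow> H \<subseteq> carrier G \<Longrightarrow> H' \<in> orb K H \<Longrightarrow> card H' = card H"
  using card_cj sg_mem by (auto simp: orb_def)

lemma orb_maxin: "maxin H K \<Longrightarrow> H' \<in> orb K H \<Longrightarrow> maxin H' K"
  using maxin_cj by (auto simp: orb_def)

lemma maxin_self_norm: "maxin H K \<Longrightarrow> \<not> K \<subseteq> norm H \<Longrightarrow> K \<inter> norm H = H"
  using maxin_norm by blast

lemma orb_self_norm:
  assumes "maxin H K" "\<not> K \<subseteq> norm H" "H' \<in> orb K H" shows "K \<inter> norm H' = H'"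
proof -
  obtain x where x: "x \<in> K" "H' = cj x H" using assms(3) by (rule orbE)
  have "H \<subseteq> carrier G" "sg K" using maxin_sg[OF assms(1)] sg_sub by auto
  then show ?thesis using Int_norm_cj x maxin_self_norm[OF assms(1,2)] by simp
qed

lemma orb_card_mult:
  assumes "maxin H K" "\<not> K \<subseteq> norm H" shows "card (orb K H) * card H = card K"
  using orbit_stab[OF maxin_sg(2) sg_sub[OF maxin_sg(1)], OF assms(1,1)] maxin_self_norm[OF assms] by simp

lemma orb_sub_eq:
  assumes "maxin H K" "H1 \<in> orb K H" "H2 \<in> orb K H" "H1 \<subseteq> H2" shows "H1 = H2"
proof -
  have s: "sg K" "H \<subseteq> carrier G" "sg H" using maxin_sg[OF assms(1)] sg_sub by auto
  show ?thesis using card_eqI[of H1 H2] orb_sg[OF s(3,1)] orb_card[OF s(1,2)] assms by simp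
qed

text \<open>With only two conjugates, \<open>H\<close> would normalize the other one and hence lie
  in it, as conjugates of \<open>H\<close> are self-normalizing in \<open>K\<close>.\<close>

lemma orb_ge_3:
  assumes H: "maxin H K" "\<not> K \<subseteq> norm H" shows "3 \<le> card (orb K H)"
proof (rule ccontr)
  assume "\<not> 3 \<le> card (orb K H)"
  have s: "sg H" "sg K" "H \<subseteq> K" "H \<noteq> K" "H \<subseteq> carrier G" using maxin_sg[OF H(1)] sg_sub by auto
  have cm: "card (orb K H) * card H = card K" using orb_card_mult[OF H] .
  have "card (orb K H) \<noteq> 0" using cm sg_card_pos[OF s(2)] by (metis mult_0 less_irrefl)
  moreover have "card (orb K H) \<noteq> 1"
  proof
    assume "card (orb K H) = 1"
    then show False using cm card_eqI[OF s(1,2,3)] s(4) by simp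
  qed
  ultimately have c2: "card (orb K H) = 2" using \<open>\<not> 3 \<le> card (orb K H)\<close> by linarith
  have Hin: "H \<in> orb K H" using orb_self s by blast
  then have "card (orb K H - {H}) = 1" using c2 finite_orb[OF s(2)] by simp
  then obtain H' where H': "orb K H - {H} = {H'}" by (rule card_1_singletonE)
  then have h: "H' \<in> orb K H" "H' \<noteq> H" by auto
  have H'G: "H' \<subseteq> carrier G" using orb_sub[OF s(5,2)] h by blast
  have "H \<subseteq> norm H'"
  proof
    fix y assume y: "y \<in> H"
    have yG: "y \<in> carrier G" using y s sg_mem by blast
    have "cj y H' \<in> orb K H" using orb_closed[OF s(5,2) h(1)] y s(3) by blast
    moreover have "cj y H' \<noteq> H"
    proof
      assume "cj y H' = H"
      then have "cj y H' = cj y H" using cj_self[OF s(1) y] by simp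
      then show False using cj_inj[OF yG H'G s(5)] h(2) by simp
    qed
    ultimately have "cj y H' = H'" using H' by blast
    then show "y \<in> norm H'" using yG by (simp add: norm_def)
  qed
  then have "H \<subseteq> H'" using orb_self_norm[OF H h(1)] s(3) by blast
  then show False using orb_sub_eq[OF H(1) Hin h(1)] h(2) by blast
qed

lemma index_2_norm:
  assumes "sg H" "sg K" "H \<subseteq> K" "card K = 2 * card H" shows "K \<subseteq> norm H"
proof (rule ccontr)
  assume n: "\<not> K \<subseteq> norm H"
  have m: "maxin H K" using prime_index_maxin[OF assms two_is_prime_nat] .
  have "card (orb K H) * card H = 2 * card H" using orb_card_mult[OF m n] assms(4) by simp
  then have "card (orb K H) = 2" using sg_card_pos[OF assms(1)] by simp
  then show False using orb_ge_3[OF m n] by simp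
qed

text \<open>The conjugates share the identity, so \<open>n\<close> conjugates of order
  \<open>h + 1\<close> have at most \<open>n * h\<close> other elements, fewer than the
  \<open>n * (h + 1) - 1\<close> available in \<open>K\<close>.\<close>

lemma orb_union_ne:
  assumes H: "maxin H K" "\<not> K \<subseteq> norm H" shows "\<exists>y\<in>K. \<forall>H'\<in>orb K H. y \<notin> H'"
proof (rule ccontr)
  assume "\<not> ?thesis"
  then have cov: "K \<subseteq> (\<Union>H'\<in>orb K H. H')" by blast
  have s: "sg H" "sg K" "H \<subseteq> carrier G" using maxin_sg[OF H(1)] sg_sub by auto
  have so: "sg H'" "card H' = card H" if "H' \<in> orb K H" for H' using that orb_sg s orb_card by blast+
  have "K - {\<one>} \<subseteq> (\<Union>H'\<in>orb K H. H' - {\<one>})" using cov by blast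
  then have "card (K - {\<one>}) \<le> card (\<Union>H'\<in>orb K H. H' - {\<one>})"
    by (rule card_mono[rotated]) (use so(1) sg_fin finite_orb[OF s(2)] in auto)
  also have "\<dots> \<le> (\<Sum>H'\<in>orb K H. card (H' - {\<one>}))" by (rule card_UN_le[OF finite_orb[OF s(2)]])
  also have "\<dots> = (\<Sum>H'\<in>orb K H. card H - 1)"
    by (rule sum.cong[OF refl]) (use so sg_fin sg_ne in auto)
  also have "\<dots> = card (orb K H) * (card H - 1)" by simp
  finally have le: "card K - 1 \<le> card (orb K H) * (card H - 1)" using sg_fin[OF s(2)] sg_ne[OF s(2)] by simp
  obtain h where h: "card H = Suc h" using sg_card_pos[OF s(1)] by (metis Suc_pred)
  define n where "n = card (orb K H)"
  have "card K = n + n * h" using orb_card_mult[OF H] h by (simp add: n_def)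
  moreover have "card K - 1 \<le> n * h" using le h by (simp add: n_def)
  moreover have "3 \<le> n" using orb_ge_3[OF H] by (simp add: n_def)
  ultimately show False by linarith
qed

text \<open>Two different ones would generate \<open>M\<close> and make it normal as well.\<close>

lemma maxin_normal_unique:
  assumes nn: "\<not> carrier G \<subseteq> norm M" and L: "maxin L1 M" "maxin L2 M" "carrier G \<subseteq> norm L1" "carrier G \<subseteq> norm L2"
  shows "L1 = L2"
proof (rule ccontr)
  assume ne: "L1 \<noteq> L2"
  have s: "sg L1" "sg L2" "L1 \<subseteq> M" "L2 \<subseteq> M" "sg M" "L1 \<noteq> M" using maxin_sg L by auto
  have "L1 \<subseteq> norm L2" using L(4) sg_sub[OF s(1)] by blast
  then have sL: "sg (L1 <#> L2)" using sg_set_mult s by blast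
  have le: "L1 <#> L2 \<subseteq> M" using set_mult_least[OF s(5,3,4)] .
  note up = set_mult_upper[OF s(1,2)]
  have a: "L1 <#> L2 = L1 \<or> L1 <#> L2 = M" "L1 <#> L2 = L2 \<or> L1 <#> L2 = M"
    by (rule maxin_between[OF L(1) sL up(1) le]) (rule maxin_between[OF L(2) sL up(2) le])
  then have "L1 <#> L2 = M" using ne by auto
  then have "carrier G \<subseteq> norm M" using norm_set_mult[OF _ _ s(1,2) sL] L(3,4) by auto
  then show False using nn by blast
qed

lemma norm_one: "norm {\<one>} = carrier G"
  by (auto simp: norm_def cj_def)

text \<open>Conjugation by \<open>x\<close> moves \<open>u\<close>, so \<open>u\<close> and its
  images \<open>v\<close>, \<open>w\<close> are the three involutions of the four-group
  \<open>R\<close>, rotated by \<open>x\<close>.\<close>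

lemma A4_iso:
  assumes R: "sg R" "card R = 4" "carrier G \<subseteq> norm R" and c: "card (carrier G) = 12"
    and x: "x \<in> carrier G" "ord x = 3" and u: "u \<in> R" "u \<noteq> \<one>" "u \<otimes> u = \<one>" and xu: "x \<otimes> u \<otimes> inv x \<noteq> u"
  shows "G \<cong> A4"
proof -
  have uG: "u \<in> carrier G" using u R sg_mem by blast
  have xR: "x \<otimes> r \<otimes> inv x \<in> R" if "r \<in> R" for r using R(3) x(1) that by (auto simp: norm_def cj_def)
  define v where "v = x \<otimes> u \<otimes> inv x"
  define w where "w = x \<otimes> v \<otimes> inv x"
  have vR: "v \<in> R" "w \<in> R" using xR u(1) by (auto simp: v_def w_def)
  have G: "v \<in> carrier G" "w \<in> carrier G" using vR R sg_mem by auto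
  have xv: "x \<otimes> u = v \<otimes> x" "x \<otimes> v = w \<otimes> x" using x uG G by (simp_all add: v_def w_def m_assoc)
  have x3: "x \<otimes> (x \<otimes> x) = \<one>" using pow_ord_eq_1[OF x(1)] x by (simp add: numeral_3_eq_3 m_assoc)
  have xw: "x \<otimes> w = u \<otimes> x"
  proof -
    have "x \<otimes> (x \<otimes> (x \<otimes> u)) = x \<otimes> (x \<otimes> v \<otimes> x)" using x uG G by (simp add: xv(1) m_assoc)
    also have "\<dots> = x \<otimes> w \<otimes> (x \<otimes> x)" using xv x uG G by (simp add: m_assoc)
    finally have e: "x \<otimes> w \<otimes> (x \<otimes> x) = x \<otimes> (x \<otimes> (x \<otimes> u))" by simp
    also have "\<dots> = u" using x3 x uG by (simp add: m_assoc[symmetric])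
    finally have "x \<otimes> w \<otimes> (x \<otimes> x) \<otimes> x = u \<otimes> x" by simp
    then show ?thesis using x3 x G by (simp add: m_assoc)
  qed
  have inj: "r = s" if "x \<otimes> r \<otimes> inv x = x \<otimes> s \<otimes> inv x" "r \<in> carrier G" "s \<in> carrier G" for r s
    using that x by simp
  have w_eq: "x \<otimes> w \<otimes> inv x = u" using xw x uG G by (simp add: m_assoc)
  have one: "x \<otimes> \<one> \<otimes> inv x = \<one>" using x by simp
  have vu: "v \<noteq> u" using xu v_def by simp
  have v1: "v \<noteq> \<one>" using inj[of u \<one>] one uG u(2) v_def by auto
  have w1: "w \<noteq> \<one>" using inj[of v \<one>] one G v1 w_def by auto
  have wv: "w \<noteq> v" using inj[of v u] vu G uG w_def v_def by auto
  have wu: "w \<noteq> u" using inj[of w v] w_eq wv v_def w_def G by auto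
  have Req: "R = {\<one>, u, v, w}"
  proof -
    have "{\<one>, u, v, w} \<subseteq> R" using u vR sg_ne[OF R(1)] by auto
    moreover have "card {\<one>, u, v, w} = card R" using u(2) vu v1 w1 wv wu R(2) by (auto simp: card_insert_if)
    ultimately show ?thesis using card_subset_eq[OF sg_fin[OF R(1)]] by blast
  qed
  have sq: "(x \<otimes> r \<otimes> inv x) \<otimes> (x \<otimes> r \<otimes> inv x) = \<one>" if "r \<otimes> r = \<one>" "r \<in> carrier G" for r
  proof -
    have "(x \<otimes> r \<otimes> inv x) \<otimes> (x \<otimes> r \<otimes> inv x) = x \<otimes> (r \<otimes> r) \<otimes> inv x"
      using that x by (simp add: m_assoc) (simp add: m_assoc[symmetric])
    then show ?thesis using that x by simp
  qed
  have vv: "v \<otimes> v = \<one>" using sq[OF u(3) uG] v_def by simp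
  have ww: "w \<otimes> w = \<one>" using sq[OF vv G(1)] w_def by simp
  have third: "a \<otimes> b = d" if "a \<in> R" "b \<in> R" "a \<otimes> a = \<one>" "b \<noteq> \<one>" "a \<noteq> \<one>" "a \<noteq> b" "b \<otimes> b = \<one>"
      "d \<in> R" "d \<noteq> \<one>" "d \<noteq> a" "d \<noteq> b" for a b d
  proof -
    have g: "a \<in> carrier G" "b \<in> carrier G" using that R(1) sg_mem by auto
    have "a \<otimes> b \<in> R" using that sg_mult R(1) by blast
    moreover have "a \<otimes> b \<noteq> \<one>"
    proof
      assume "a \<otimes> b = \<one>"
      then have "a \<otimes> b = a \<otimes> a" using that by simp
      then show False using g that(6) by simp
    qed
    moreover have "a \<otimes> b \<noteq> a" using g that(4) by (metis r_one l_cancel_one one_closed)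
    moreover have "a \<otimes> b \<noteq> b" using g that(5) by (metis l_one right_cancel one_closed)
    ultimately show ?thesis using that Req by auto
  qed
  have tab: "u \<otimes> v = w" "v \<otimes> u = w" "u \<otimes> w = v" "w \<otimes> u = v" "v \<otimes> w = u" "w \<otimes> v = u"
    using u vR vu v1 w1 wv wu vv ww by (auto intro!: third)
  define f where "f i = (if i = 0 then \<one> else if i = 1 then u else if i = 2 then v else w)" for i :: nat
  define h where "h = (\<lambda>(i, l). f i \<otimes> x [^] (l::nat))"
  have fG: "f i \<in> carrier G" "f i \<in> R" for i using uG G u vR sg_ne[OF R(1)] by (auto simp: f_def)
  have i4: "i = 0 \<or> i = 1 \<or> i = 2 \<or> i = 3" if "i < 4" for i :: nat using that by presburger
  have i3: "i = 0 \<or> i = 1 \<or> i = 2" if "i < 3" for i :: nat using that by presburger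
  \<comment> \<open>\<open>?rot\<close> and \<open>?xr\<close> are the tables of
    \<open>A4_mult\<close>; it remains to see that they describe conjugation by powers of
    \<open>x\<close> and products in \<open>R\<close>.\<close>
  let ?rot = "\<lambda>l i. [[0,1,2,3],[0,2,3,1],[0,3,1,2]] ! l ! i :: nat"
  let ?xr = "\<lambda>i k. [[0,1,2,3],[1,0,3,2],[2,3,0,1],[3,2,1,0]] ! i ! k :: nat"
  have fx: "f (?xr i k) = f i \<otimes> f k" if "i < 4" "k < 4" for i k
    using i4[OF that(1)] i4[OF that(2)] by (elim disjE; simp add: f_def uG G tab u(3) vv ww)
  have rot1: "x \<otimes> f i = f (?rot 1 i) \<otimes> x" if "i < 4" for i
    using i4[OF that] xv xw x by (auto simp: f_def)
  have rot4: "?rot l i < 4" if "l < 3" "i < 4" for l i using i3[OF that(1)] i4[OF that(2)] by auto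
  have rot2: "x \<otimes> x \<otimes> f i = f (?rot 2 i) \<otimes> (x \<otimes> x)" if i: "i < 4" for i
  proof -
    have "x \<otimes> x \<otimes> f i = f (?rot 1 (?rot 1 i)) \<otimes> x \<otimes> x"
      using rot1[OF i] rot1[OF rot4[OF _ i, of 1]] x fG by (simp add: m_assoc) (simp add: m_assoc[symmetric])
    moreover have "?rot 1 (?rot 1 i) = ?rot 2 i" using i4[OF i] by auto
    ultimately show ?thesis using x fG by (simp add: m_assoc)
  qed
  have rot: "x [^] l \<otimes> f i = f (?rot l i) \<otimes> x [^] l" if l: "l < 3" and i: "i < 4" for l i
    using i3[OF l]
  proof (elim disjE)
    assume "l = 0" then show ?thesis using i4[OF i] fG by auto
  next
    assume "l = 1" then show ?thesis using rot1[OF i] x by simp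
  next
    assume "l = 2" then show ?thesis using rot2[OF i] x by (simp add: numeral_2_eq_2)
  qed
  have xm: "x [^] (l mod 3) = x [^] l" for l :: nat using pow_eq_cong[OF x(1)] x(2) by (simp add: cong_def)
  have hom: "h ((i, l) \<otimes>\<^bsub>A4\<^esub> (k, m)) = h (i, l) \<otimes> h (k, m)" if "i < 4" "l < 3" "k < 4" "m < 3" for i l k m
  proof -
    have "h (i, l) \<otimes> h (k, m) = f i \<otimes> (x [^] l \<otimes> f k) \<otimes> x [^] m" using fG x by (simp add: h_def m_assoc)
    also have "\<dots> = f i \<otimes> f (?rot l k) \<otimes> x [^] (l + m)" using rot that fG x by (simp add: m_assoc nat_pow_mult)
    also have "\<dots> = f (?xr i (?rot l k)) \<otimes> x [^] ((l + m) mod 3)" using fx[of i "?rot l k"] rot4 that xm by simp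
    finally show ?thesis by (simp add: h_def A4_def A4_mult_def)
  qed
  have "h \<in> iso A4 G"
  proof (rule isoI)
    have cA: "carrier A4 = {..<4} \<times> {..<3}" by (simp add: A4_def)
    show "h \<in> hom A4 G"
    proof (rule homI)
      show "h p \<in> carrier G" for p using fG x by (auto simp: h_def split: prod.split)
      show "h (p \<otimes>\<^bsub>A4\<^esub> q) = h p \<otimes> h q" if "p \<in> carrier A4" "q \<in> carrier A4" for p q
        using hom that unfolding cA by (cases p; cases q) auto
    qed
    have "coprime (4::nat) 3" using coprime_mult_left_iff[of 2 2 "3::nat"] by simp
    then have "R <#> cyc x = carrier G"
      using R c x card_cyc[OF x(1)] by (intro coprime_set_mult sg_cyc) simp_all
    then have sur: "carrier G \<subseteq> h ` carrier A4"
    proof -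
      assume e: "R <#> cyc x = carrier G"
      show ?thesis
      proof
        fix g assume "g \<in> carrier G"
        then obtain r y where ry: "r \<in> R" "y \<in> cyc x" "g = r \<otimes> y" unfolding e[symmetric] by (rule set_multE)
        obtain l :: nat where l: "y = x [^] l" using ry(2) by (rule cycE)
        have "r = f 0 \<or> r = f 1 \<or> r = f 2 \<or> r = f 3" using ry(1) Req by (simp add: f_def)
        then have "\<exists>i<4. r = f i" by (elim disjE) (rule exI, rule conjI[rotated], assumption, simp)+
        then obtain i where "i < 4" "r = f i" by blast
        then have "g = h (i, l mod 3)" "(i, l mod 3) \<in> carrier A4" using ry l xm by (auto simp: h_def cA)
        then show "g \<in> h ` carrier A4" by blast
      qed
    qed
    have im: "h ` carrier A4 = carrier G"
      using sur fG x by (auto simp: h_def)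
    moreover have "inj_on h (carrier A4)"
      by (rule eq_card_imp_inj_on) (use im c in \<open>simp_all add: cA card_cartesian_product\<close>)
    ultimately show "bij_betw h (carrier A4) (carrier G)" by (simp add: bij_betw_def)
  qed
  then have "A4 \<cong> G" by (auto simp: is_iso_def)
  then show ?thesis using A4_group group.iso_sym by (metis fin_group_def)
qed

end

text \<open>The first case: all maximal subgroups of \<open>M\<close> are normal in \<open>G\<close>. Then \<open>M\<close> is cyclic of prime power order,
  its maximal subgroup \<open>L\<close> is central, and the elements outside the sets \<open>M\<^sup>g - L\<close> form a subgroup
  \<open>R \<times> L\<close>, where \<open>R\<close> is a Sylow subgroup (\<open>G / L\<close> is a Frobenius group).\<close>

locale frobenius_case = fin_group G for G (structure) +
  fixes M :: "'a set"
  assumes maxM: "maxin M (carrier G)" and nn: "\<not> carrier G \<subseteq> norm M"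
    and maxL: "\<And>L. maxin L M \<Longrightarrow> carrier G \<subseteq> norm L" and num: "num_subgroups G \<le> 12"
begin

abbreviation "MM \<equiv> orb (carrier G) M"

lemma sgM: "sg M" "M \<subseteq> carrier G"
  using maxin_sg maxM sg_sub by auto

lemma uniq: "maxin L1 M \<Longrightarrow> maxin L2 M \<Longrightarrow> L1 = L2"
  using maxin_normal_unique[OF nn] maxL by blast

text \<open>By \<open>uniq\<close> there is only one maximal subgroup, so \<open>M\<close> is
  cyclic; as each prime divisor of its order gives a maximal subgroup of that index, only one prime
  occurs.\<close>

lemma structure_M:
  obtains p k x L where "Factorial_Ring.prime p" "card M = p ^ k" "card M = p * card L" "maxin L M" "x \<in> M" "M = cyc x" "L = cyc (x [^] p)"
proof -
  have "is_cyclic M"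
  proof (rule ccontr)
    assume "\<not> is_cyclic M"
    then obtain L1 L2 where "maxin L1 M" "maxin L2 M" "L1 \<noteq> L2" using noncyclic_two_max[OF sgM(1)] by blast
    then show False using uniq by blast
  qed
  then obtain x where x: "x \<in> M" "M = cyc x" by (auto simp: is_cyclic_def)
  have xG: "x \<in> carrier G" using x sgM by blast
  have cM: "card M = ord x" using x card_cyc xG by simp
  have "M \<noteq> {\<one>}" using nn norm_one by auto
  then have "ord x \<noteq> 1" using ord_eq_1[OF xG] x(2) by (auto simp: cyc_def)
  then obtain p where p: "Factorial_Ring.prime p" "p dvd ord x" using prime_factor_nat by blast
  have sub: "maxin (cyc (x [^] r)) M" "card M = r * card (cyc (x [^] r))" if r: "Factorial_Ring.prime r" "r dvd ord x" for r
  proof -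
    have "card (cyc (x [^] r)) = ord x div r" using card_cyc xG ord_pow[OF xG r(2)] r(1) by (simp add: prime_gt_0_nat)
    then show c: "card M = r * card (cyc (x [^] r))" using cM r by simp
    show "maxin (cyc (x [^] r)) M"
      by (rule prime_index_maxin[OF sg_cyc sgM(1) _ c r(1)]) (use xG x cyc_least[OF sgM(1)] cyc_pow in auto)
  qed
  have "r = p" if r: "Factorial_Ring.prime r" "r dvd ord x" for r
  proof -
    have "cyc (x [^] r) = cyc (x [^] p)" using uniq sub(1) r p by blast
    then have "r * card (cyc (x [^] p)) = p * card (cyc (x [^] p))" using sub(2)[OF r] sub(2)[OF p] by metis
    then show ?thesis using sg_card_pos[OF sg_cyc[of "x [^] p"]] xG by simp
  qed
  then obtain k where "ord x = p ^ k" using prime_only_power[OF ord_pos[OF xG] p(1)] by blast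
  then show ?thesis using that[of p k "cyc (x [^] p)" x] p sub[OF p] x cM by simp
qed

lemma MM_card: "card MM * card M = card (carrier G)"
  using orb_card_mult[OF maxM nn] .

lemma MM_ge: "3 \<le> card MM"
  using orb_ge_3[OF maxM nn] .

lemma MM_sg: "H \<in> MM \<Longrightarrow> sg H" "H \<in> MM \<Longrightarrow> card H = card M"
  using orb_sg[OF sgM(1) sg_carrier] orb_card[OF sg_carrier sgM(2)] by auto

lemma MM_fin: "finite MM"
  using finite_orb[OF sg_carrier] .

text \<open>\<open>M\<close> normalizes no other conjugate, since each conjugate is its own
  normalizer and all have the same order.\<close>

lemma MM_mod:
  assumes "Factorial_Ring.prime p" "card M = p ^ k" shows "p dvd card MM - 1"
proof -
  have "p dvd card {f \<in> MM. \<not> M \<subseteq> norm f}"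
    by (rule fixed_points[OF assms(1) sgM(1) assms(2) MM_fin])
      (erule orb_sub[OF sgM(2) sg_carrier], erule orb_closed[OF sgM(2) sg_carrier], erule subsetD[OF sgM(2)])
  moreover have "{f \<in> MM. \<not> M \<subseteq> norm f} = MM - {M}"
  proof -
    have "f = M" if f: "f \<in> MM" "M \<subseteq> norm f" for f
    proof -
      have "M \<subseteq> f" using orb_self_norm[OF maxM nn f(1)] f(2) sgM(2) by blast
      then show ?thesis using orb_sub_eq[OF maxM orb_self[OF sgM(2) sg_carrier] f(1)] by simp
    qed
    moreover have "M \<subseteq> norm M" using sub_norm sgM by blast
    ultimately show ?thesis by blast
  qed
  ultimately show ?thesis using orb_self[OF sgM(2) sg_carrier] MM_fin by simp
qed

text \<open>If \<open>M\<close> normalized \<open>S\<close>, their product would lie strictly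
  between \<open>M\<close> and the whole group. So \<open>M\<close> moves \<open>S\<close> through
  at least \<open>p\<close> conjugates, which are counted together with those of \<open>M\<close>,
  the trivial subgroup and the whole group.\<close>

lemma small_orbit:
  assumes p: "Factorial_Ring.prime p" "card M = p ^ k" and S: "sg S" "1 < card S" "card S < card MM" "coprime (card S) p"
  shows "\<not> M \<subseteq> norm S" "p \<le> card (orb M S)" "card MM + 2 + p \<le> 12"
proof -
  have cop: "coprime (card M) (card S)" using S(4) p by (simp add: coprime_commute coprime_power_right_iff)
  show nS: "\<not> M \<subseteq> norm S"
  proof
    assume n: "M \<subseteq> norm S"
    have s: "sg (M <#> S)" using sg_set_mult[OF sgM(1) S(1) n] .
    have c: "card (M <#> S) = card M * card S" using card_set_mult[OF sgM(1) S(1)] coprime_Int[OF sgM(1) S(1) cop] by simp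
    have "M <#> S = M \<or> M <#> S = carrier G"
      using maxM s set_mult_upper[OF sgM(1) S(1)] sg_sub[OF s] unfolding maxin_def by blast
    then have "card M * card S = card M \<or> card M * card S = card M * card MM" using c MM_card by (auto simp: mult.commute)
    then show False using S(2,3) sg_card_pos[OF sgM(1)] by auto
  qed
  have SG: "S \<subseteq> carrier G" using sg_sub S by blast
  have os: "card (orb M S) * card (M \<inter> norm S) = p ^ k" using orbit_stab[OF sgM(1) SG] p(2) by simp
  then obtain e where e: "card (orb M S) = p ^ e" using divides_primepow_nat[OF p(1)] by (metis dvd_triv_left)
  have "e \<noteq> 0"
  proof
    assume "e = 0"
    then have "card (M \<inter> norm S) = card M" using os e p by simp
    then have "M \<inter> norm S = M" using card_subset_eq[OF sg_fin[OF sgM(1)]] by blast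
    then show False using nS by blast
  qed
  then have "p ^ 1 \<le> p ^ e" using prime_gt_0_nat[OF p(1)] by (intro power_increasing) auto
  then show po: "p \<le> card (orb M S)" using e by simp
  have so: "sg H" "card H = card S" if "H \<in> orb M S" for H
    using orb_sg[OF S(1) sgM(1) that] orb_card[OF sgM(1) SG that] by auto
  have cG: "card (carrier G) > card M" "card M > 1" "card (carrier G) > card S"
  proof -
    show g: "card (carrier G) > card M" using maxin_sg[OF maxM] psubset_card_mono[OF fin] by (metis psubsetI)
    have "M \<noteq> {\<one>}" using nn norm_one by auto
    then show "card M > 1" using sg_card_pos[OF sgM(1)] sg_ne[OF sgM(1)] by (metis One_nat_def card_1_singletonE Suc_lessI singletonD)
    have "card MM \<le> card MM * card M" using sg_card_pos[OF sgM(1)] by simp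
    then show "card (carrier G) > card S" using S(3) MM_card by simp
  qed
  have d1: "MM \<inter> orb M S = {}"
  proof -
    have "card M \<noteq> card S" using cop cG(2) by auto
    then show ?thesis using MM_sg(2) so(2) by force
  qed
  let ?T = "MM \<union> orb M S"
  have fT: "finite ?T" using MM_fin finite_orb[OF sgM(1)] by blast
  have cT: "card ?T = card MM + card (orb M S)" using card_Un_disjoint[OF MM_fin finite_orb[OF sgM(1)] d1] .
  have cH: "card H = card M \<or> card H = card S" if "H \<in> ?T" for H using that MM_sg(2) so(2) by blast
  have "{\<one>} \<notin> ?T" using cH[of "{\<one>}"] cG S(2) by auto
  moreover have "carrier G \<notin> ?T" using cH[of "carrier G"] cG by auto
  moreover have "{\<one>} \<noteq> carrier G" using cG by (metis card.empty card.insert empty_iff finite.emptyI less_irrefl less_trans One_nat_def)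
  ultimately have "card (insert {\<one>} (insert (carrier G) ?T)) = card ?T + 2" using fT by simp
  moreover have "insert {\<one>} (insert (carrier G) ?T) \<subseteq> {H. sg H}" using sg_one sg_carrier MM_sg(1) so(1) by auto
  ultimately have "card ?T + 2 \<le> num_subgroups G" using sg_setI_le by metis
  then show "card MM + 2 + p \<le> 12" using cT po num by simp
qed

text \<open>A subgroup whose order is a prime divisor of a composite index satisfies
  \<open>small_orbit\<close>. The index is then 4, 6 or 8 with \<open>p\<close> equal to 3, 5 or 7,
  as \<open>p\<close> divides the index minus 1, and only the first pair respects the bound.\<close>

lemma MM_values:
  assumes p: "Factorial_Ring.prime p" "card M = p ^ k"
  shows "Factorial_Ring.prime (card MM) \<or> card MM = 4 \<and> p = 3"
proof (cases "Factorial_Ring.prime (card MM)")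
  case False
  have pm: "p dvd card MM - 1" using MM_mod[OF p] .
  have "card MM \<noteq> 1" using MM_ge by simp
  then obtain r where r: "Factorial_Ring.prime r" "r dvd card MM" using prime_factor_nat by blast
  have "r \<noteq> card MM" using r False by auto
  then have rl: "r < card MM" using r MM_ge dvd_imp_le[of r "card MM"] by simp
  have "r ^ 1 dvd card (carrier G)" using r MM_card by (metis dvd_mult2 power_one_right)
  then obtain S where S: "sg S" "card S = r ^ 1" using ex_prime_power_sg[OF r(1) sg_carrier] by blast
  have "r \<noteq> p"
  proof
    assume "r = p"
    then have "p dvd card MM - (card MM - 1)" using pm r(2) dvd_diff_nat by blast
    then show False using MM_ge p(1) not_prime_unit by simp
  qed
  then have "coprime r p" using r p primes_coprime by blast
  then have b: "card MM + 2 + p \<le> 12" using small_orbit(3)[OF p S(1)] S(2) rl prime_gt_1_nat[OF r(1)] by simp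
  have p2: "p \<ge> 2" using p prime_ge_2_nat by blast
  then have "card MM \<le> 8" using b by simp
  then have v: "card MM = 4 \<or> card MM = 6 \<or> card MM = 8" using not_prime_small[OF False MM_ge] by blast
  have p357: "Factorial_Ring.prime (3::nat)" "Factorial_Ring.prime (5::nat)" "Factorial_Ring.prime (7::nat)" by simp_all
  from v show ?thesis
  proof (elim disjE)
    assume "card MM = 4"
    then show ?thesis using pm primes_dvd_imp_eq[OF p(1) p357(1)] by simp
  next
    assume m: "card MM = 6"
    then have "p = 5" using pm primes_dvd_imp_eq[OF p(1) p357(2)] by simp
    then show ?thesis using b m by simp
  next
    assume m: "card MM = 8"
    then have "p = 7" using pm primes_dvd_imp_eq[OF p(1) p357(3)] by simp
    then show ?thesis using b m by simp
  qed
qed simp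

context
  fixes p k :: nat and x :: 'a and L :: "'a set"
  assumes p: "Factorial_Ring.prime p" and cM: "card M = p ^ k" "card M = p * card L" and L: "maxin L M"
    and x: "x \<in> M" "M = cyc x" "L = cyc (x [^] p)"
begin

lemma sgL: "sg L" "L \<subseteq> M" "L \<subseteq> carrier G"
  using maxin_sg[OF L] sg_sub by auto

text \<open>The centralizer of the normal subgroup \<open>L\<close> is normal and contains the
  abelian group \<open>M\<close>; by maximality it is \<open>M\<close> or everything, and
  \<open>M\<close> is not normal.\<close>

lemma L_central: "g \<in> carrier G \<Longrightarrow> l \<in> L \<Longrightarrow> g \<otimes> l = l \<otimes> g"
proof -
  have xG: "x \<in> carrier G" using x sgM by blast
  define C where "C = {g \<in> carrier G. \<forall>l\<in>L. g \<otimes> l = l \<otimes> g}"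
  have sC: "sg C"
  proof (rule sgI)
    show "C \<subseteq> carrier G" "C \<noteq> {}" using sgL(3) by (auto simp: C_def intro!: exI[of _ \<one>])
    fix a b assume ab: "a \<in> C" "b \<in> C"
    have "a \<otimes> b \<otimes> l = l \<otimes> (a \<otimes> b)" if "l \<in> L" for l
    proof -
      have c: "a \<in> carrier G" "b \<in> carrier G" "l \<in> carrier G" "a \<otimes> l = l \<otimes> a" "b \<otimes> l = l \<otimes> b"
        using ab that sgL(3) by (auto simp: C_def)
      have "a \<otimes> b \<otimes> l = a \<otimes> l \<otimes> b" using c(1-3,5) by (simp add: m_assoc)
      then show ?thesis using c by (simp add: m_assoc)
    qed
    then show "a \<otimes> b \<in> C" using ab by (auto simp: C_def)
  qed
  have MC: "M \<subseteq> C"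
  proof
    fix g assume "g \<in> M"
    then show "g \<in> C" using sgM(2) sgL(2) cyc_commute[OF xG] x(2) unfolding C_def by blast
  qed
  have nC: "carrier G \<subseteq> norm C"
  proof
    fix g assume g: "g \<in> carrier G"
    have "cj g C \<subseteq> C"
    proof
      fix y assume "y \<in> cj g C"
      then obtain c where c: "c \<in> C" "y = g \<otimes> c \<otimes> inv g" by (auto simp: cj_def)
      have cG: "c \<in> carrier G" using c by (simp add: C_def)
      have "y \<otimes> l = l \<otimes> y" if l: "l \<in> L" for l
      proof -
        have "cj g L = L" using maxL[OF L] g by (auto simp: norm_def)
        then obtain l' where l': "l' \<in> L" "l = g \<otimes> l' \<otimes> inv g" using l by (auto simp: cj_def)
        have lG: "l' \<in> carrier G" using l' sgL by blast
        have "c \<otimes> l' = l' \<otimes> c" using c l' by (simp add: C_def)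
        then have "g \<otimes> (c \<otimes> l') \<otimes> inv g = g \<otimes> (l' \<otimes> c) \<otimes> inv g" by simp
        moreover have "(g \<otimes> s \<otimes> inv g) \<otimes> (g \<otimes> t \<otimes> inv g) = g \<otimes> (s \<otimes> t) \<otimes> inv g"
          if "s \<in> carrier G" "t \<in> carrier G" for s t
        proof -
          have "inv g \<otimes> (g \<otimes> (t \<otimes> inv g)) = t \<otimes> inv g" using that g by (simp add: m_assoc[symmetric])
          then show ?thesis using that g by (simp add: m_assoc)
        qed
        ultimately show ?thesis using c(2) l'(2) cG lG by simp
      qed
      then show "y \<in> C" using c(2) cG g by (simp add: C_def)
    qed
    then have "cj g C = C" using card_eqI[OF sg_cj[OF g sC] sC] card_cj[OF g sg_sub[OF sC]] by simp
    then show "g \<in> norm C" using g by (simp add: norm_def)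
  qed
  have "C = M \<or> C = carrier G" using maxM sC MC sg_sub[OF sC] unfolding maxin_def by blast
  then have "C = carrier G" using nC nn by auto
  then show "g \<in> carrier G \<Longrightarrow> l \<in> L \<Longrightarrow> g \<otimes> l = l \<otimes> g" by (auto simp: C_def)
qed

lemma conj_fix_L: "g \<in> carrier G \<Longrightarrow> cj g L = L"
  using maxL[OF L] by (auto simp: norm_def)

text \<open>A proper subgroup of a conjugate of \<open>M\<close> lies in its only maximal subgroup,
  which is a conjugate of \<open>L\<close> and thus \<open>L\<close>.\<close>

lemma MM_Int: assumes "A \<in> MM" "B \<in> MM" "A \<noteq> B" shows "L \<subseteq> A" "A \<inter> B = L"
proof -
  have LA: "L \<subseteq> A" if "A \<in> MM" for A
  proof -
    obtain g where g: "g \<in> carrier G" "A = cj g M" using \<open>A \<in> MM\<close> by (rule orbE)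
    then show ?thesis using cj_mono[OF sgL(2), of g] conj_fix_L by simp
  qed
  then show "L \<subseteq> A" using assms by blast
  have s: "sg (A \<inter> B)" using assms MM_sg(1) sg_Int by blast
  have ne: "A \<inter> B \<noteq> A" using orb_sub_eq[OF maxM assms(1,2)] assms(3) by blast
  obtain g where g: "g \<in> carrier G" "A = cj g M" using assms(1) by (rule orbE)
  have sub: "A \<inter> B \<subseteq> carrier G" using s sg_sub by blast
  have "cj (inv g) (A \<inter> B) \<subseteq> M" using cj_mono[of "A \<inter> B" A "inv g"] g cj_inv_cj[OF g(1) sgM(2)] by auto
  moreover have "cj (inv g) (A \<inter> B) \<noteq> M" using ne g cj_cj_inv[OF g(1) sub] by auto
  ultimately obtain L' where L': "maxin L' M" "cj (inv g) (A \<inter> B) \<subseteq> L'"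
    using ex_maxin[OF sg_cj[OF _ s] sgM(1)] g(1) by blast
  then have "L' = L" using uniq L by blast
  then have "A \<inter> B \<subseteq> cj g L" using L'(2) cj_mono[of "cj (inv g) (A \<inter> B)" L g] cj_cj_inv[OF g(1) sub] by simp
  then show "A \<inter> B = L" using conj_fix_L[OF g(1)] LA assms by auto
qed

lemma R_normal:
  assumes r: "Factorial_Ring.prime r" "r \<noteq> p" and m: "card MM = r ^ a" and R: "sg R" "card R = card MM"
  shows "carrier G \<subseteq> norm R" "card (R <#> L) = card MM * card L" "sg (R <#> L)" "carrier G \<subseteq> norm (R <#> L)"
proof -
  define W where "W = carrier G - (\<Union>A\<in>MM. A - L)"
  have crp: "coprime r p" using r p primes_coprime by blast
  obtain e where e: "card L = p ^ e" using card_dvd[OF sgL(1) sgM(1) sgL(2)] cM(1) divides_primepow_nat[OF p] by metis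
  have LA: "L \<subseteq> A" if "A \<in> MM" for A
  proof -
    have "card (MM - {A}) \<noteq> 0" using MM_ge that MM_fin by simp
    then obtain B where "B \<in> MM" "A \<noteq> B" by (metis Diff_iff card.empty equals0I singletonI)
    then show ?thesis using MM_Int(1) that by blast
  qed
  have cA: "card (A - L) = card M - card L" if "A \<in> MM" for A
    using card_Diff_subset[OF sg_fin[OF sgL(1)] LA[OF that]] MM_sg(2)[OF that] by simp
  have "card (\<Union>A\<in>MM. A - L) = (\<Sum>A\<in>MM. card (A - L))"
  proof (rule card_UN_disjoint[OF MM_fin])
    show "\<forall>A\<in>MM. finite (A - L)" using MM_sg(1) sg_fin by blast
    show "\<forall>A\<in>MM. \<forall>B\<in>MM. A \<noteq> B \<longrightarrow> (A - L) \<inter> (B - L) = {}"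
    proof (intro ballI impI)
      fix A B assume "A \<in> MM" "B \<in> MM" "A \<noteq> B"
      then have "A \<inter> B = L" by (rule MM_Int(2))
      then show "(A - L) \<inter> (B - L) = {}" by blast
    qed
  qed
  also have "\<dots> = card MM * (card M - card L)" using cA by simp
  finally have cU: "card (\<Union>A\<in>MM. A - L) = card MM * (card M - card L)" .
  have "(\<Union>A\<in>MM. A - L) \<subseteq> carrier G" using MM_sg(1) sg_sub by blast
  then have "card W = card MM * card M - card MM * (card M - card L)"
    unfolding W_def using cU MM_card by (subst card_Diff_subset) (auto intro: finite_subset[OF _ fin])
  also have "\<dots> = card MM * card L"
    using cM(2) p prime_gt_0_nat[OF p] by (simp add: diff_mult_distrib2[symmetric])
  finally have cW: "card W = card MM * card L" .
  \<comment> \<open>A conjugate of \<open>M\<close> meets \<open>Q <#> L\<close> in a subgroup of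
    order prime to \<open>card MM\<close>, hence in \<open>L\<close> alone. So
    \<open>Q <#> L\<close> lies in \<open>W\<close> and fills it by size.\<close>
  have RL: "sg (Q <#> L) \<and> card (Q <#> L) = card MM * card L \<and> Q <#> L = W" if Q: "sg Q" "card Q = card MM" for Q
  proof -
    have "Q \<subseteq> norm L" using maxL[OF L] sg_sub[OF Q(1)] by blast
    then have s: "sg (Q <#> L)" using sg_set_mult[OF Q(1) sgL(1)] by blast
    have "coprime (card Q) (card L)" using Q m e crp by simp
    then have c: "card (Q <#> L) = card MM * card L"
      using card_set_mult[OF Q(1) sgL(1)] coprime_Int[OF Q(1) sgL(1)] Q(2) by simp
    have "Q <#> L \<subseteq> W"
    proof
      fix w assume w: "w \<in> Q <#> L"
      have "w \<in> L" if A: "A \<in> MM" "w \<in> A" for A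
      proof -
        have sB: "sg ((Q <#> L) \<inter> A)" using s MM_sg(1)[OF A(1)] sg_Int by blast
        have "card ((Q <#> L) \<inter> A) dvd card MM * card L" using card_dvd[OF sB s] c by simp
        moreover have "card ((Q <#> L) \<inter> A) dvd p ^ k" using card_dvd[OF sB MM_sg(1)[OF A(1)]] MM_sg(2)[OF A(1)] cM(1) by simp
        then have "coprime (card ((Q <#> L) \<inter> A)) (card MM)"
          using divides_primepow_nat[OF p] m crp by (metis coprime_commute coprime_power_left_iff coprime_power_right_iff)
        ultimately have "card ((Q <#> L) \<inter> A) dvd card L" by (simp add: coprime_dvd_mult_right_iff)
        then have "card ((Q <#> L) \<inter> A) \<le> card L" using sg_card_pos[OF sgL(1)] dvd_imp_le by blast
        moreover have "L \<subseteq> (Q <#> L) \<inter> A" using set_mult_upper(2)[OF Q(1) sgL(1)] LA[OF A(1)] by blast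
        ultimately have "L = (Q <#> L) \<inter> A" using card_eqI[OF sgL(1) sB] by blast
        then show ?thesis using w A by blast
      qed
      then show "w \<in> W" using w sg_mem[OF s] by (auto simp: W_def)
    qed
    then have "Q <#> L = W" using card_subset_eq[of W "Q <#> L"] c cW fin by (simp add: W_def)
    then show ?thesis using s c by blast
  qed
  note RLR = RL[OF R]
  then show "card (R <#> L) = card MM * card L" "sg (R <#> L)" by auto
  have RW: "R \<subseteq> W" using RLR set_mult_upper(1)[OF R(1) sgL(1)] by blast
  have sW: "sg W" using RLR by metis
  have WR: "W \<subseteq> norm R"
  proof -
    have LN: "L \<subseteq> norm R"
    proof
      fix l assume l: "l \<in> L"
      have lG: "l \<in> carrier G" using l sgL by blast
      have "l \<otimes> g \<otimes> inv l = g" if "g \<in> R" for g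
      proof -
        have gG: "g \<in> carrier G" using that R sg_mem by blast
        have "l \<otimes> g = g \<otimes> l" using L_central[OF gG l] by simp
        then show ?thesis using gG lG by (simp add: m_assoc)
      qed
      then have "cj l R = R" by (simp add: cj_def)
      then show "l \<in> norm R" using lG by (simp add: norm_def)
    qed
    have "R <#> L \<subseteq> norm R"
      by (rule set_mult_least[OF sg_norm[OF sg_sub[OF R(1)]] sub_norm[OF R(1)] LN])
    then show ?thesis using RLR by simp
  qed
  have rL: "\<not> r dvd card L"
  proof
    assume "r dvd card L"
    then have "r dvd p ^ e" using e by simp
    then have "r dvd p" by (rule prime_dvd_power[OF r(1)])
    then show False using r p primes_dvd_imp_eq by blast
  qed
  have "card W div card R = card L" using cW R(2) MM_ge by simp
  then have psR: "psyl r R W" unfolding psyl_def using R m RW rL by auto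
  show nR: "carrier G \<subseteq> norm R"
  proof
    fix g assume g: "g \<in> carrier G"
    \<comment> \<open>A conjugate of \<open>R\<close> has the same order, so it lies in
      \<open>W\<close> too, where \<open>R\<close> is a normal Sylow subgroup.\<close>
    have R': "sg (cj g R)" "card (cj g R) = card MM" using sg_cj[OF g R(1)] card_cj[OF g sg_sub[OF R(1)]] R(2) by auto
    have gW: "cj g R \<subseteq> W" using RL[OF R'] set_mult_upper(1)[OF R'(1) sgL(1)] by blast
    have "cj g R \<subseteq> R"
      by (rule psyl_max[OF r(1) psR sW R'(1) gW R'(2)[unfolded m] subset_trans[OF gW WR]])
    then have "cj g R = R" using card_eqI[OF R'(1) R(1)] R'(2) R(2) by simp
    then show "g \<in> norm R" using g by (simp add: norm_def)
  qed
  show "carrier G \<subseteq> norm (R <#> L)" using norm_set_mult[OF _ _ R(1) sgL(1)] nR maxL[OF L] RLR by blast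
qed

text \<open>\<open>R\<close> has prime order and \<open>L\<close> is cyclic, central and of coprime
  order, so \<open>R <#> L\<close> is cyclic; its index is \<open>p\<close>.\<close>

lemma prime_index_case:
  assumes m: "Factorial_Ring.prime (card MM)" shows has_mc
proof -
  have xG: "x \<in> carrier G" using x sgM by blast
  have mp: "card MM \<noteq> p"
  proof
    assume "card MM = p"
    then have "p dvd p - 1" using MM_mod[OF p cM(1)] by simp
    then show False using prime_gt_1_nat[OF p] by (auto dest: dvd_imp_le)
  qed
  have "card MM ^ 1 dvd card (carrier G)" using MM_card by (metis dvd_triv_left power_one_right)
  then obtain R where R: "sg R" "card R = card MM" using ex_prime_power_sg[OF m sg_carrier] by (metis power_one_right)
  note Rn = R_normal[OF m mp _ R, of 1]
  obtain y where y: "y \<in> R" "R = cyc y" using prime_card_cyclic[OF R(1)] R(2) m by (auto simp: is_cyclic_def)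
  have yG: "y \<in> carrier G" using y R sg_mem by blast
  obtain e where e: "card L = p ^ e" using card_dvd[OF sgL(1) sgM(1) sgL(2)] cM(1) divides_primepow_nat[OF p] by metis
  have "coprime (card MM) p" using primes_coprime m p mp by blast
  then have cop: "coprime (ord y) (ord (x [^] p))"
    using card_cyc[OF yG] card_cyc[of "x [^] p"] xG y(2) x(3) R(2) e by simp
  have "x [^] p \<in> L" using x(3) cyc_self xG by simp
  then have "y \<otimes> x [^] p = x [^] p \<otimes> y" using L_central yG by blast
  then have A: "cyc (y \<otimes> x [^] p) = R <#> L" using coprime_cyc[OF yG _ _ cop] xG y(2) x(3) by simp
  have "ord (y \<otimes> x [^] p) = card MM * card L" using card_cyc[of "y \<otimes> x [^] p"] A Rn(2) yG xG by simp
  then have "card (carrier G) = ord (y \<otimes> x [^] p) * p" using MM_card cM(2) by (simp add: ac_simps)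
  moreover have "carrier G \<subseteq> norm (cyc (y \<otimes> x [^] p))" using A Rn(4) by simp
  ultimately show ?thesis unfolding has_mc_def using p yG xG by blast
qed

text \<open>A nontrivial \<open>L\<close> would give 13 subgroups: four conjugates of
  \<open>M\<close>, three of a subgroup \<open>S\<close> of order 2, and \<open>L\<close>,
  \<open>R\<close>, \<open>R <#> L\<close>, \<open>L <#> S\<close> besides the trivial subgroup and
  the whole group.\<close>

lemma index_4_case:
  assumes m: "card MM = 4" "p = 3" shows "G \<cong> A4"
proof -
  have xG: "x \<in> carrier G" using x sgM by blast
  have "2 ^ 2 dvd card (carrier G)" using MM_card m by (metis dvd_triv_left numeral_Bit0 power2_eq_square mult_2 mult_2_right)
  then obtain R where R: "sg R" "card R = card MM" using ex_prime_power_sg[OF two_is_prime_nat sg_carrier, of 2] m by auto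
  have Rn: "carrier G \<subseteq> norm R" "card (R <#> L) = card MM * card L" "sg (R <#> L)"
    using R_normal[OF two_is_prime_nat _ _ R, of 2] m by auto
  obtain S where S: "sg S" "S \<subseteq> R" "card S = 2"
    using ex_prime_power_sg[OF two_is_prime_nat R(1), of 1] R(2) m by auto
  have SG: "S \<subseteq> carrier G" using sg_sub S by blast
  have "coprime (2::nat) 3" by simp
  note so = small_orbit[OF p cM(1) S(1)]
  have nS: "\<not> M \<subseteq> norm S" and oS: "3 \<le> card (orb M S)" using so S(3) m by auto
  have cSo: "sg H" "card H = 2" if "H \<in> orb M S" for H
    using orb_sg[OF S(1) sgM(1) that] orb_card[OF sgM(1) SG that] S(3) by auto
  obtain e where e: "card L = 3 ^ e" using card_dvd[OF sgL(1) sgM(1) sgL(2)] cM(1) divides_primepow_nat[OF p] m by metis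
  have cG: "card (carrier G) = 12 * card L" using MM_card m cM(2) by simp
  have L1: "card L = 1"
  proof (rule ccontr)
    assume n1: "card L \<noteq> 1"
    define c where "c = card L"
    have "odd c" using e by (simp add: c_def)
    moreover have "c \<ge> 3" using e n1 by (cases e) (auto simp: c_def)
    ultimately have c: "odd c" "c \<ge> 3" by auto
    have "L \<subseteq> norm S"
    proof
      fix l assume l: "l \<in> L"
      have lG: "l \<in> carrier G" using l sgL by blast
      have "l \<otimes> g \<otimes> inv l = g" if "g \<in> S" for g
      proof -
        have gG: "g \<in> carrier G" using that SG by blast
        have "l \<otimes> g = g \<otimes> l" using L_central[OF gG l] by simp
        then show ?thesis using gG lG by (simp add: m_assoc)
      qed
      then have "cj l S = S" by (simp add: cj_def)
      then show "l \<in> norm S" using lG by (simp add: norm_def)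
    qed
    then have sLS: "sg (L <#> S)" using sg_set_mult[OF sgL(1) S(1)] by blast
    have "coprime (card L) (card S)" using e S(3) by simp
    then have cLS: "card (L <#> S) = c * 2"
      using card_set_mult[OF sgL(1) S(1)] coprime_Int[OF sgL(1) S(1)] S(3) by (simp add: c_def)
    have cM': "card H = 3 * c" if "H \<in> MM" for H using MM_sg(2)[OF that] cM(2) m by (simp add: c_def)
    have d1: "MM \<inter> orb M S = {}" using cM' cSo(2) c by force
    let ?T = "MM \<union> orb M S"
    have fT: "finite ?T" using MM_fin finite_orb[OF sgM(1)] by blast
    have cT: "7 \<le> card ?T" using card_Un_disjoint[OF MM_fin finite_orb[OF sgM(1)] d1] m oS by simp
    have cH: "card H = 3 * c \<or> card H = 2" if "H \<in> ?T" for H using that cM' cSo(2) by blast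
    have nin: "H \<notin> ?T" if "card H \<noteq> 3 * c" "card H \<noteq> 2" for H using cH that by blast
    have cc: "card (carrier G) = 12 * c" "card {\<one>} = 1" "card R = 4" "card L = c" "card (R <#> L) = 4 * c"
      using cG R(2) m Rn(2) by (auto simp: c_def)
    have ne: "A \<noteq> B" if "card A \<noteq> card B" for A B :: "'a set" using that by auto
    have "{\<one>} \<notin> ?T" "carrier G \<notin> ?T" "R \<notin> ?T" "L \<notin> ?T" "R <#> L \<notin> ?T" "L <#> S \<notin> ?T"
      by (rule nin; simp only: cc cLS; insert c; presburger)+
    moreover have "carrier G \<noteq> {\<one>}" "R \<noteq> {\<one>}" "R \<noteq> carrier G" "L \<noteq> {\<one>}" "L \<noteq> carrier G" "L \<noteq> R"
      "R <#> L \<noteq> {\<one>}" "R <#> L \<noteq> carrier G" "R <#> L \<noteq> R" "R <#> L \<noteq> L"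
      "L <#> S \<noteq> {\<one>}" "L <#> S \<noteq> carrier G" "L <#> S \<noteq> R" "L <#> S \<noteq> L" "L <#> S \<noteq> R <#> L"
      by (rule ne; simp only: cc cLS; insert c; presburger)+
    ultimately have "card (insert (L <#> S) (insert (R <#> L) (insert L (insert R (insert (carrier G) (insert {\<one>} ?T)))))) = 6 + card ?T"
      using fT by simp
    moreover have "insert (L <#> S) (insert (R <#> L) (insert L (insert R (insert (carrier G) (insert {\<one>} ?T))))) \<subseteq> {H. sg H}"
      using sLS Rn(3) sgL(1) R(1) sg_carrier sg_one MM_sg(1) cSo(1) by blast
    ultimately have "6 + card ?T \<le> num_subgroups G" using sg_setI_le by metis
    then show False using cT num by simp
  qed
  have "card M = 3" using cM(2) m L1 by simp
  then have ox: "ord x = 3" using card_cyc[OF xG] x(2) by simp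
  obtain u where u: "S = {\<one>, u}" "u \<noteq> \<one>"
  proof -
    have "card (S - {\<one>}) = 1" using S(3) sg_ne[OF S(1)] sg_fin[OF S(1)] by simp
    then obtain u where "S - {\<one>} = {u}" by (rule card_1_singletonE)
    then show ?thesis using that[of u] sg_ne[OF S(1)] by blast
  qed
  have uG: "u \<in> carrier G" using u SG by blast
  have uu: "u \<otimes> u = \<one>"
  proof -
    have "u [^] card S = \<one>" using pow_card_sg[OF S(1)] u by blast
    then show ?thesis using S(3) uG by (simp add: numeral_2_eq_2)
  qed
  have "x \<otimes> u \<otimes> inv x \<noteq> u"
  proof
    assume e: "x \<otimes> u \<otimes> inv x = u"
    then have "cj x S = S" using xG by (simp add: cj_def u)
    then have "x \<in> norm S" using xG by (simp add: norm_def)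
    then have "M \<subseteq> norm S" using cyc_least[OF sg_norm[OF SG]] x(2) by simp
    then show False using nS by blast
  qed
  then show ?thesis
    using A4_iso[OF R(1) _ Rn(1) _ xG ox _ u(2) uu] R(2) m cG L1 u(1) S(2) by simp
qed

end

theorem frobenius_case: "has_mc \<or> G \<cong> A4"
proof -
  obtain p k x L where s: "Factorial_Ring.prime p" "card M = p ^ k" "card M = p * card L" "maxin L M" "x \<in> M" "M = cyc x" "L = cyc (x [^] p)"
    by (rule structure_M)
  show ?thesis using MM_values[OF s(1,2)] prime_index_case[OF s] index_4_case[OF s] by blast
qed

end

context fin_group
begin

lemma cyclic_sub_norm:
  assumes "is_cyclic K" "sg K" "sg H" "H \<subseteq> K" shows "K \<subseteq> norm H"
proof
  obtain x where x: "x \<in> K" "K = cyc x" using assms(1) by (auto simp: is_cyclic_def)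
  have xG: "x \<in> carrier G" using x assms(2) sg_mem by blast
  fix y assume y: "y \<in> K"
  have yG: "y \<in> carrier G" using y assms(2) sg_mem by blast
  have "y \<otimes> h \<otimes> inv y = h" if "h \<in> H" for h
  proof -
    have "h \<in> cyc x" "y \<in> cyc x" using that assms(4) x(2) y by auto
    then have "y \<otimes> h = h \<otimes> y" using cyc_commute[OF xG] by blast
    then show ?thesis using yG sg_mem[OF assms(3) that] by (simp add: m_assoc)
  qed
  then have "cj y H = H" by (simp add: cj_def)
  then show "y \<in> norm H" using yG by (simp add: norm_def)
qed

lemma cyc_sub_dvd:
  assumes "sg H" "H \<subseteq> cyc x" "sg K" "K \<subseteq> cyc x" "x \<in> carrier G" "card H dvd card K"
  shows "H \<subseteq> K"
proof -
  obtain d where d: "d dvd ord x" "K = cyc (x [^] d)" using sg_cyc_eq assms by blast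
  obtain c where c: "card K = card H * c" using assms(6) by blast
  define z where "z = x [^] d"
  have zG: "z \<in> carrier G" using assms z_def by simp
  have oz: "ord z = card H * c" using d card_cyc[OF zG] c z_def by simp
  then have c0: "c \<noteq> 0" using ord_pos[OF zG] by (metis less_irrefl mult_0_right)
  have "card (cyc (z [^] c)) = card H"
    using card_cyc[of "z [^] c"] ord_pow[OF zG, of c] zG oz c0 by simp
  moreover have "cyc (z [^] c) \<subseteq> K" using cyc_least[OF assms(3)] d(2) z_def cyc_pow by metis
  ultimately have "cyc (z [^] c) = H"
    using cyc_card_unique[OF sg_cyc[of "z [^] c"] _ assms(1,2,5)] assms(4) zG by simp
  then show ?thesis using \<open>cyc (z [^] c) \<subseteq> K\<close> by simp
qed

end

text \<open>The second case: some maximal subgroup \<open>L\<close> of \<open>M\<close> is not normal in \<open>G\<close>, so that the conjugates of \<open>L\<close>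
  provide many subgroups and the index of \<open>M\<close> is at most 5.\<close>

locale nonfrobenius_case = fin_group G for G (structure) +
  fixes M L :: "'a set"
  assumes maxM: "maxin M (carrier G)" and nn: "\<not> carrier G \<subseteq> norm M"
    and maxL: "maxin L M" and nL: "\<not> carrier G \<subseteq> norm L" and num: "num_subgroups G \<le> 12"
begin

abbreviation "MM \<equiv> orb (carrier G) M"
abbreviation "LL \<equiv> orb (carrier G) L"

section \<open>Conjugates of M and L and the counts they force\<close>

lemma sgM: "sg M" "M \<subseteq> carrier G"
  using maxin_sg maxM sg_sub by auto

lemma sgL: "sg L" "L \<subseteq> M" "L \<noteq> M" "L \<subseteq> carrier G"
  using maxin_sg maxL sg_sub by auto

lemma MM_card: "card MM * card M = card (carrier G)"
  using orb_card_mult[OF maxM nn] .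

lemma MM_ge: "3 \<le> card MM"
  using orb_ge_3[OF maxM nn] .

lemma fin_orbs: "finite MM" "finite LL"
  using finite_orb[OF sg_carrier] by auto

lemma MM_sg: "H \<in> MM \<Longrightarrow> sg H" "H \<in> MM \<Longrightarrow> card H = card M"
  using orb_sg[OF sgM(1) sg_carrier] orb_card[OF sg_carrier sgM(2)] by auto

lemma LL_sg: "H \<in> LL \<Longrightarrow> sg H" "H \<in> LL \<Longrightarrow> card H = card L"
  using orb_sg[OF sgL(1) sg_carrier] orb_card[OF sg_carrier sgL(4)] by auto

lemma MM_self: "M \<in> MM" using orb_self[OF sgM(2) sg_carrier] .
lemma LL_le: "H \<in> LL \<Longrightarrow> \<exists>A\<in>MM. H \<subseteq> A"
  using cj_mono[OF sgL(2)] by (auto simp: orb_def)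

lemma MM_norm: "H \<in> MM \<Longrightarrow> norm H = H"
  using orb_self_norm[OF maxM nn] norm_sub[of H] by blast

lemma MM_sub_eq: "A \<in> MM \<Longrightarrow> B \<in> MM \<Longrightarrow> A \<subseteq> B \<Longrightarrow> A = B"
  using orb_sub_eq[OF maxM] by blast

lemma MM_closed: "A \<in> MM \<Longrightarrow> g \<in> carrier G \<Longrightarrow> cj g A \<in> MM"
  using orb_closed[OF sgM(2) sg_carrier] by blast

lemma above_M: "sg H \<Longrightarrow> M \<subseteq> H \<Longrightarrow> H = M \<or> H = carrier G"
  using maxM sg_sub unfolding maxin_def by blast

lemma cards: "1 < card L" "card L < card M" "card M < card (carrier G)"
proof -
  have "L \<noteq> {\<one>}" using nL norm_one by auto
  then have "card L \<noteq> 1" using sg_ne[OF sgL(1)] by (metis card_1_singletonE singletonD)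
  then show "1 < card L" using sg_card_pos[OF sgL(1)] by linarith
  show "card L < card M" using sgL sg_fin[OF sgM(1)] psubset_card_mono[of M L] by blast
  show "card M < card (carrier G)" using maxin_sg[OF maxM] psubset_card_mono[OF fin, of M] by blast
qed

text \<open>The standing stock of subgroups. Each contradiction below comes from finding enough
  subgroups outside it, through \<open>extra\<close>.\<close>

definition base :: "'a set set" where
  "base = insert {\<one>} (insert (carrier G) (MM \<union> LL))"

text \<open>Used in the contrapositive: a proper subgroup that lies in no conjugate of
  \<open>M\<close> is new.\<close>

lemma base_cases: "H \<in> base \<Longrightarrow> H = carrier G \<or> (\<exists>A\<in>MM. H \<subseteq> A)"
  unfolding base_def using LL_le sg_ne[OF sgM(1)] MM_self by blast

lemma base_finite: "finite base"
  using fin_orbs by (simp add: base_def)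

lemma base_sub: "base \<subseteq> {H. sg H}"
  unfolding base_def using sg_one sg_carrier MM_sg(1) LL_sg(1) by blast

lemma base_card: "card base = 2 + card MM + card LL"
proof -
  have d: "MM \<inter> LL = {}" using MM_sg(2) LL_sg(2) cards(2) by force
  have "card (MM \<union> LL) = card MM + card LL" using card_Un_disjoint[OF fin_orbs d] .
  moreover have "{\<one>} \<notin> MM \<union> LL"
  proof
    assume "{\<one>} \<in> MM \<union> LL"
    then have "card {\<one>} = card M \<or> card {\<one>} = card L" using MM_sg(2) LL_sg(2) by blast
    then show False using cards by auto
  qed
  moreover have "carrier G \<notin> MM \<union> LL"
  proof
    assume "carrier G \<in> MM \<union> LL"
    then have "card (carrier G) = card M \<or> card (carrier G) = card L" using MM_sg(2) LL_sg(2) by blast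
    then show False using cards by auto
  qed
  moreover have "{\<one>} \<noteq> carrier G"
  proof
    assume "{\<one>} = carrier G"
    then have "card (carrier G) = card {\<one>}" by simp
    then show False using cards by simp
  qed
  ultimately show ?thesis using fin_orbs by (simp add: base_def)
qed

lemma extra:
  assumes "finite U" "U \<subseteq> {H. sg H}" "U \<inter> base = {}" shows "2 + card MM + card LL + card U \<le> 12"
proof -
  have "card (base \<union> U) = card base + card U" using card_Un_disjoint[OF base_finite assms(1)] assms(3) by blast
  moreover have "card (base \<union> U) \<le> num_subgroups G" by (rule sg_setI_le) (use base_sub assms(2) in blast)
  ultimately show ?thesis using base_card num by simp
qed

lemma LL_card: "card LL * card (norm L) = card (carrier G)"
proof -
  have "carrier G \<inter> norm L = norm L" using norm_sub by blast
  then show ?thesis using orbit_stab[OF sg_carrier sgL(4)] by simp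
qed

lemma LL_normal: "M \<subseteq> norm L \<Longrightarrow> norm L = M \<and> card LL = card MM"
proof -
  assume "M \<subseteq> norm L"
  then have "norm L = M" using above_M[OF sg_norm[OF sgL(4)]] nL by auto
  moreover have "card M > 0" using cards by simp
  ultimately show ?thesis using LL_card MM_card by (metis mult_right_cancel less_irrefl)
qed

text \<open>Otherwise \<open>L\<close> would lie in the intersection of all conjugates of
  \<open>M\<close>, a normal subgroup that would have to be \<open>L\<close> or
  \<open>M\<close>.\<close>

lemma outer_conjugate: "\<exists>H\<in>LL. \<not> H \<subseteq> M"
proof (rule ccontr)
  assume "\<not> ?thesis"
  then have all: "H \<subseteq> M" if "H \<in> LL" for H using that by blast
  define I where "I = {y \<in> carrier G. \<forall>A\<in>MM. y \<in> A}"
  have sI: "sg I"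
  proof (rule sgI)
    show "I \<noteq> {}" using MM_sg(1) sg_ne by (auto simp: I_def)
    fix u v assume "u \<in> I" "v \<in> I"
    then show "u \<otimes> v \<in> I" using MM_sg(1) sg_mult by (auto simp: I_def)
  qed (auto simp: I_def)
  have nI: "carrier G \<subseteq> norm I"
  proof
    fix g assume g: "g \<in> carrier G"
    have "cj g I \<subseteq> I"
    proof
      fix z assume "z \<in> cj g I"
      then obtain y where y: "y \<in> I" "z = g \<otimes> y \<otimes> inv g" by (auto simp: cj_def)
      have yG: "y \<in> carrier G" using y by (simp add: I_def)
      have "z \<in> A" if A: "A \<in> MM" for A
      proof -
        have "y \<in> cj (inv g) A" using y(1) MM_closed[OF A, of "inv g"] g by (auto simp: I_def)
        then obtain w where w: "w \<in> A" "y = inv g \<otimes> w \<otimes> g" using g by (auto simp: cj_def)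
        have wG: "w \<in> carrier G" using w sg_mem[OF MM_sg(1)[OF A]] by blast
        have "z = g \<otimes> inv g \<otimes> w \<otimes> (g \<otimes> inv g)" using y(2) w(2) wG g by (simp only: m_assoc m_closed inv_closed)
        then show ?thesis using w wG g by simp
      qed
      then show "z \<in> I" using y yG g by (simp add: I_def)
    qed
    then have "cj g I = I" using card_eqI[OF sg_cj[OF g sI] sI] card_cj[OF g sg_sub[OF sI]] by simp
    then show "g \<in> norm I" using g by (simp add: norm_def)
  qed
  have "L \<subseteq> I"
  proof
    fix l assume l: "l \<in> L"
    have "l \<in> A" if A: "A \<in> MM" for A
    proof -
      obtain g where g: "g \<in> carrier G" "A = cj g M" using A by (rule orbE)
      have "cj (inv g) L \<subseteq> M" using all g(1) by (auto simp: orb_def)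
      then have "cj g (cj (inv g) L) \<subseteq> cj g M" by (rule cj_mono)
      then show ?thesis using cj_cj_inv[OF g(1) sgL(4)] g(2) l by auto
    qed
    then show "l \<in> I" using l sgL(4) by (auto simp: I_def)
  qed
  moreover have "I \<subseteq> M" using MM_self by (auto simp: I_def)
  ultimately have "I = L \<or> I = M" using maxL sI unfolding maxin_def by blast
  then show False using nI nL nn by auto
qed

text \<open>Three conjugates come from the action of \<open>M\<close>, and
  \<open>outer_conjugate\<close> adds one outside \<open>M\<close>.\<close>

lemma LL_ge: assumes "\<not> M \<subseteq> norm L" shows "4 \<le> card LL"
proof -
  obtain H where H: "H \<in> LL" "\<not> H \<subseteq> M" using outer_conjugate by blast
  have sub: "orb M L \<subseteq> LL" using sgM(2) by (auto simp: orb_def)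
  have "H \<notin> orb M L"
  proof
    assume "H \<in> orb M L"
    then have "H \<subseteq> M" using orb_maxin[OF maxL] maxin_sg by blast
    then show False using H by blast
  qed
  then have "card (insert H (orb M L)) = Suc (card (orb M L))" using finite_orb[OF sgM(1)] by simp
  moreover have "card (insert H (orb M L)) \<le> card LL" using H sub fin_orbs by (intro card_mono) auto
  ultimately show ?thesis using orb_ge_3[OF maxL assms] by simp
qed

text \<open>Inside a conjugate of \<open>M\<close> the Sylow subgroup would have an index divisible
  by \<open>p\<close>; and if the whole group were a \<open>p\<close>-group, \<open>M\<close> would
  be normal.\<close>

lemma psyl_not_le:
  assumes p: "Factorial_Ring.prime (p::nat)" "p dvd card MM" and S: "psyl p S (carrier G)"
  shows "A \<in> MM \<Longrightarrow> \<not> S \<subseteq> A" "S \<noteq> carrier G" "S \<notin> base"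
proof -
  have sS: "sg S" using S by (simp add: psyl_def)
  show nle: "\<not> S \<subseteq> A" if A: "A \<in> MM" for A
  proof
    assume "S \<subseteq> A"
    then have "card S dvd card M" using card_dvd[OF sS MM_sg(1)[OF A]] MM_sg(2)[OF A] by simp
    then obtain c where c: "card M = card S * c" by blast
    obtain i where i: "card (carrier G) = card S * i" "\<not> p dvd i" using psyl_index[OF S sg_carrier] by blast
    have "card S * (card MM * c) = card S * i" using MM_card c i(1) by (simp add: ac_simps)
    then have "i = card MM * c" using sg_card_pos[OF sS] by simp
    then show False using i(2) p(2) by simp
  qed
  show ne: "S \<noteq> carrier G"
  proof
    assume e: "S = carrier G"
    obtain a where "card S = p ^ a" using S by (auto simp: psyl_def)
    then have "card (carrier G) = p ^ a" using e by simp
    from maxin_pgroup(1)[OF p(1) this maxM] nn show False by blast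
  qed
  show "S \<notin> base" using base_cases[of S] nle ne by blast
qed

text \<open>A Sylow 2-subgroup \<open>S\<close> meets every conjugate of \<open>M\<close> in index
  4, so a maximal subgroup \<open>E\<close> of \<open>S\<close> over \<open>S \<inter> M\<close>
  lies in none of them. It is not normal, since \<open>M <#> E\<close> would have order
  \<open>2 * card M\<close>. Thus \<open>S\<close>, \<open>E\<close> and a conjugate of
  \<open>E\<close> are new, and 2 + 4 + 4 + 3 = 13.\<close>

lemma index_4: "card MM \<noteq> 4"
proof
  assume m: "card MM = 4"
  have p: "Factorial_Ring.prime (2::nat)" "(2::nat) dvd card MM" using m by simp_all
  obtain S where S: "psyl 2 S (carrier G)" using ex_psyl[OF p(1) sg_carrier] by blast
  have sS: "sg S" using S by (simp add: psyl_def)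
  obtain a where a: "card S = 2 ^ a" using S by (auto simp: psyl_def)
  obtain i where i: "card (carrier G) = card S * i" "\<not> 2 dvd i" using psyl_index[OF S sg_carrier] by blast
  note nS = psyl_not_le[OF p S]
  have SA: "card S = 4 * card (S \<inter> A)" if A: "A \<in> MM" for A
  proof (rule antisym)
    have sA: "sg A" "card A = card M" using MM_sg A by auto
    have e: "card (S <#> A) * card (S \<inter> A) = card S * card A" using card_set_mult[OF sS sA(1)] .
    have "S <#> A \<subseteq> carrier G" using sg_sub sS sA(1) by (simp add: set_mult_closed)
    then have "card (S <#> A) \<le> 4 * card A" using card_mono[OF fin] MM_card m sA(2) by metis
    then have "card S * card A \<le> (4 * card A) * card (S \<inter> A)" unfolding e[symmetric] by (rule mult_right_mono) simp
    then have "card A * card S \<le> card A * (4 * card (S \<inter> A))" by (simp add: ac_simps)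
    then show "card S \<le> 4 * card (S \<inter> A)" using sg_card_pos[OF sA(1)] by simp
    have sI: "sg (S \<inter> A)" using sg_Int sS sA by blast
    have "card (S \<inter> A) dvd card A" using card_dvd[OF sI sA(1)] by simp
    then have "4 * card (S \<inter> A) dvd 2 ^ a * i" using MM_card m sA(2) i(1) a by (metis mult_dvd_mono dvd_refl)
    moreover have "card (S \<inter> A) dvd 2 ^ a" using card_dvd[OF sI sS] a by simp
    then obtain b where b: "card (S \<inter> A) = 2 ^ b" using divides_primepow_nat[OF p(1)] by blast
    have "4 * card (S \<inter> A) = 2 ^ (b + 2)" using b by simp
    moreover have "coprime ((2::nat) ^ (b + 2)) i" using i(2) by (simp only: coprime_power_left_iff coprime_left_2_iff_odd) simp
    ultimately have "4 * card (S \<inter> A) dvd 2 ^ a" by (simp only: coprime_dvd_mult_left_iff)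
    then show "4 * card (S \<inter> A) \<le> card S" using a by (simp add: dvd_imp_le)
  qed
  have sSM: "sg (S \<inter> M)" using sg_Int sS sgM by blast
  have "S \<inter> M \<subset> S" using nS(1)[OF MM_self] by blast
  then obtain E where E: "maxin E S" "S \<inter> M \<subseteq> E" using ex_maxin[OF sSM sS] by blast
  have sE: "sg E" "E \<subseteq> S" using maxin_sg[OF E(1)] by auto
  have cE: "card S = 2 * card E" using maxin_pgroup(2)[OF p(1) a E(1)] .
  have EG: "E \<subseteq> carrier G" using sg_sub sE by blast
  have nEA: "\<not> E \<subseteq> A" if A: "A \<in> MM" for A
  proof
    assume "E \<subseteq> A"
    then have "card E \<le> card (S \<inter> A)" using sE(2) card_mono[of "S \<inter> A" E] sg_fin[OF sS] by blast
    then show False using cE SA[OF A] sg_card_pos[OF sE(1)] by simp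
  qed
  have nE: "\<not> carrier G \<subseteq> norm E"
  proof
    assume n: "carrier G \<subseteq> norm E"
    then have s: "sg (M <#> E)" using sg_set_mult[OF sgM(1) sE(1)] sgM(2) by blast
    have "M \<inter> E = S \<inter> M" using E(2) sE(2) by blast
    then have "card (M <#> E) * card (S \<inter> M) = card M * card E" using card_set_mult[OF sgM(1) sE(1)] by simp
    moreover have "card E = 2 * card (S \<inter> M)" using cE SA[OF MM_self] by simp
    ultimately have "card (M <#> E) * card (S \<inter> M) = (2 * card M) * card (S \<inter> M)" by (simp add: ac_simps)
    then have c: "card (M <#> E) = 2 * card M" using sg_card_pos[OF sSM] by simp
    have "M <#> E = M \<or> M <#> E = carrier G" using above_M[OF s] set_mult_upper(1)[OF sgM(1) sE(1)] by blast
    then show False using c MM_card m cards by auto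
  qed
  then obtain g where g: "g \<in> carrier G" "cj g E \<noteq> E" by (auto simp: norm_def)
  have sE': "sg (cj g E)" "card (cj g E) = card E" using sg_cj[OF g(1) sE(1)] card_cj[OF g(1) EG] by auto
  have nE'A: "\<not> cj g E \<subseteq> A" if A: "A \<in> MM" for A
  proof
    assume "cj g E \<subseteq> A"
    then have "cj (inv g) (cj g E) \<subseteq> cj (inv g) A" by (rule cj_mono)
    then have "E \<subseteq> cj (inv g) A" using cj_inv_cj[OF g(1) EG] by simp
    then show False using nEA[OF MM_closed[OF A]] g(1) by simp
  qed
  have lt: "card E < card S" using cE sg_card_pos[OF sE(1)] by simp
  then have neq: "E \<noteq> S" "cj g E \<noteq> S" using sE'(2) by auto
  have "card S \<le> card (carrier G)" using card_mono[OF fin sg_sub[OF sS]] .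
  then have neqG: "E \<noteq> carrier G" "cj g E \<noteq> carrier G" using lt sE'(2) by auto
  have "E \<notin> base" "cj g E \<notin> base" using base_cases nEA nE'A neqG by blast+
  then have "{S, E, cj g E} \<inter> base = {}" using nS(3) by blast
  then have "2 + card MM + card LL + card {S, E, cj g E} \<le> 12"
    by (rule extra[rotated 2]) (use sS sE(1) sE'(1) in auto)
  moreover have "card {S, E, cj g E} = 3" using neq g(2) by auto
  moreover have "4 \<le> card LL" using LL_ge LL_normal m by (cases "M \<subseteq> norm L") auto
  ultimately show False using m by simp
qed

text \<open>\<open>L\<close> has as many conjugates as \<open>M\<close>, so the index is at most 5.
  Index 5 is excluded by a Sylow 5-subgroup as the 13th subgroup, and index 4 by
  \<open>index_4\<close>.\<close>

lemma index_5_normal: assumes "M \<subseteq> norm L" shows "card MM = 3"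
proof -
  have l: "card LL = card MM" using LL_normal[OF assms] by blast
  have "2 + card MM + card LL + card ({}::'a set set) \<le> 12" by (rule extra) auto
  then have "card MM \<le> 5" using l by simp
  moreover have "card MM \<noteq> 5"
  proof
    assume m: "card MM = 5"
    have p: "Factorial_Ring.prime (5::nat)" "(5::nat) dvd card MM" using m by simp_all
    obtain S where S: "psyl 5 S (carrier G)" using ex_psyl[OF p(1) sg_carrier] by blast
    have "2 + card MM + card LL + card {S} \<le> 12"
      by (rule extra) (use S psyl_not_le(3)[OF p S] in \<open>auto simp: psyl_def\<close>)
    then show False using l m by simp
  qed
  ultimately show ?thesis using MM_ge index_4 by linarith
qed

text \<open>An index of at least 5 would give six subgroups inside \<open>M\<close> and seven
  outside. Neither list would be long enough without the cyclic subgroups generated by elements that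
  avoid all conjugates, \<open>y\<close> for those of \<open>M\<close> and \<open>y'\<close> for the
  \<open>M\<close>-conjugates of \<open>L\<close>.\<close>

lemma index_3_nonnormal: assumes n: "\<not> M \<subseteq> norm L" shows "card MM = 3"
proof (rule ccontr)
  assume "card MM \<noteq> 3"
  then have m: "5 \<le> card MM" using MM_ge index_4 by linarith
  obtain H where H: "H \<in> LL" "\<not> H \<subseteq> M" using outer_conjugate by blast
  obtain y where y: "y \<in> carrier G" "\<And>A. A \<in> MM \<Longrightarrow> y \<notin> A" using orb_union_ne[OF maxM nn] by blast
  obtain y' where y': "y' \<in> M" "\<And>A. A \<in> orb M L \<Longrightarrow> y' \<notin> A" using orb_union_ne[OF maxL n] by blast
  have y'G: "y' \<in> carrier G" using y' sgM by blast
  have "\<not> is_cyclic (carrier G)" using cyclic_sub_norm[OF _ sg_carrier sgM] nn by blast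
  then have cy: "cyc y \<noteq> carrier G" using y(1) by (auto simp: is_cyclic_def)
  have "\<not> is_cyclic M" using cyclic_sub_norm[OF _ sgM(1) sgL(1,2)] n by blast
  then have cy': "cyc y' \<noteq> M" using y'(1) by (auto simp: is_cyclic_def)
  let ?I = "insert M (insert {\<one>} (insert (cyc y') (orb M L)))"
  let ?O = "insert (carrier G) (insert H (insert (cyc y) (MM - {M})))"
  have oL: "card A = card L" "A \<subseteq> M" "sg A" if "A \<in> orb M L" for A
    using orb_card[OF sgM(1) sgL(4) that] orb_maxin[OF maxL that] maxin_sg by auto
  have "L \<in> orb M L" using orb_self[OF sgL(4) sgM(1)] .
  then have y'1: "y' \<noteq> \<one>" using y'(2) sg_ne[OF sgL(1)] by blast
  have "cyc y' \<notin> orb M L" using y'(2) cyc_self[OF y'G] by blast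
  moreover have "{\<one>} \<noteq> cyc y'" using cyc_self[OF y'G] y'1 by auto
  moreover have "{\<one>} \<notin> orb M L" using oL(1)[of "{\<one>}"] cards by auto
  moreover have "M \<notin> orb M L" using oL(1)[of M] cards by auto
  moreover have "M \<noteq> {\<one>}" using cards by auto
  ultimately have "card ?I = card (orb M L) + 3" using finite_orb[OF sgM(1)] cy' by auto
  then have cI: "6 \<le> card ?I" using orb_ge_3[OF maxL n] by simp
  have "\<exists>A\<in>MM. H \<subseteq> A" using LL_le H by blast
  then have yH: "y \<notin> H" using y(2) by blast
  have "cyc y \<notin> MM" "cyc y \<noteq> H" using y(2) yH cyc_self[OF y(1)] by blast+
  moreover have "H \<notin> MM" "H \<noteq> carrier G" using LL_sg(2)[OF H(1)] MM_sg(2)[of H] cards by auto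
  moreover have "carrier G \<notin> MM" using MM_sg(2)[of "carrier G"] cards by auto
  ultimately have "card ?O = card (MM - {M}) + 3" using fin_orbs cy by auto
  then have cO: "7 \<le> card ?O" using m MM_self fin_orbs by simp
  have "?I \<inter> ?O = {}"
  proof -
    have i: "A \<subseteq> M" if "A \<in> ?I" for A
      using that oL(2) cyc_least[OF sgM(1) y'(1)] sg_ne[OF sgM(1)] by blast
    have o: "\<not> A \<subseteq> M" if "A \<in> ?O" for A
    proof -
      have "\<not> cyc y \<subseteq> M" using y(2)[OF MM_self] cyc_self[OF y(1)] by blast
      moreover have "\<not> carrier G \<subseteq> M" using cards(3) card_mono[OF sg_fin[OF sgM(1)]] by (metis not_less)
      moreover have "\<not> A \<subseteq> M" if "A \<in> MM - {M}" using MM_sub_eq[OF _ MM_self, of A] that by blast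
      ultimately show ?thesis using that H(2) by blast
    qed
    show ?thesis
    proof (rule equals0I)
      fix B assume "B \<in> ?I \<inter> ?O"
      then have "B \<in> ?I" "B \<in> ?O" by (rule IntD1, rule IntD2)
      from i[OF this(1)] o[OF this(2)] show False by blast
    qed
  qed
  then have "card (?I \<union> ?O) = card ?I + card ?O"
    by (rule card_Un_disjoint[rotated 2]) (use finite_orb[OF sgM(1)] fin_orbs in auto)
  moreover have "?I \<union> ?O \<subseteq> {H. sg H}"
    using sgM(1) sg_one sg_cyc[OF y'G] oL(3) sg_carrier LL_sg(1)[OF H(1)] sg_cyc[OF y(1)] MM_sg(1) by blast
  ultimately have "card ?I + card ?O \<le> num_subgroups G" using sg_setI_le by metis
  then show False using cI cO num by linarith
qed

lemma index_3: "card MM = 3"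
  using index_5_normal index_3_nonnormal by blast

text \<open>\<open>M\<close> permutes the two other conjugates and fixes neither of them, so its
  intersection \<open>K\<close> with one has index 2. Hence \<open>K\<close> is normalized by two
  maximal subgroups and is normal; the quotient by \<open>K\<close> is S3.\<close>

lemma core:
  obtains K where "sg K" "K \<subseteq> M" "carrier G \<subseteq> norm K" "card M = 2 * card K"
    "\<And>A B. A \<in> MM \<Longrightarrow> B \<in> MM \<Longrightarrow> A \<noteq> B \<Longrightarrow> A \<inter> B = K"
proof -
  have "card (MM - {M}) \<noteq> 0" using index_3 MM_self fin_orbs by simp
  then obtain N where N: "N \<in> MM" "N \<noteq> M" by (metis Diff_iff card.empty equals0I singletonI)
  define K where "K = M \<inter> N"
  have sN: "sg N" "card N = card M" "N \<subseteq> carrier G" using MM_sg N sg_sub by auto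
  have sK: "sg K" using sg_Int sgM sN K_def by blast
  have KG: "K \<subseteq> carrier G" using sg_sub sK by blast
  have "orb M N \<subseteq> MM - {M}"
  proof
    fix H assume "H \<in> orb M N"
    then obtain y where y: "y \<in> M" "H = cj y N" by (rule orbE)
    have yG: "y \<in> carrier G" using y sgM by blast
    have "cj y N \<noteq> M"
    proof
      assume "cj y N = M"
      then have "cj y N = cj y M" using cj_self[OF sgM(1) y(1)] by simp
      then show False using cj_inj[OF yG sN(3) sgM(2)] N(2) by simp
    qed
    then show "H \<in> MM - {M}" using MM_closed[OF N(1) yG] y by simp
  qed
  then have "card (orb M N) \<le> card (MM - {M})" using fin_orbs by (intro card_mono) auto
  then have le: "card (orb M N) \<le> 2" using index_3 MM_self fin_orbs by simp
  have os: "card (orb M N) * card K = card M"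
    using orbit_stab[OF sgM(1) sN(3)] MM_norm[OF N(1)] by (simp add: K_def)
  have "card (orb M N) \<noteq> 0" using os cards by (metis mult_0 not_less_zero)
  moreover have "card (orb M N) \<noteq> 1"
  proof
    assume "card (orb M N) = 1"
    then have "card K = card M" using os by simp
    then have "K = M" using card_subset_eq[OF sg_fin[OF sgM(1)], of K] by (simp add: K_def)
    then have "M \<subseteq> N" by (auto simp: K_def)
    then show False using MM_sub_eq[OF MM_self N(1)] N(2) by simp
  qed
  ultimately have "card (orb M N) = 2" using le by linarith
  then have c2: "card M = 2 * card K" using os by simp
  have "M \<subseteq> norm K" using index_2_norm[OF sK sgM(1) _ c2] by (simp add: K_def)
  moreover have "N \<subseteq> norm K" using index_2_norm[OF sK sN(1)] c2 sN(2) by (simp add: K_def)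
  ultimately have "norm K = carrier G" using above_M[OF sg_norm[OF KG]] MM_sub_eq[OF N(1) MM_self] N(2) by auto
  then have nK: "carrier G \<subseteq> norm K" by simp
  have KA: "K \<subseteq> A" if AM: "A \<in> MM" for A
  proof -
    obtain g where g: "g \<in> carrier G" "A = cj g M" using AM by (rule orbE)
    have "cj g K = K" using nK g(1) by (auto simp: norm_def)
    then show ?thesis using cj_mono[of K M g] g(2) by (simp add: K_def)
  qed
  have "A \<inter> B = K" if AB: "A \<in> MM" "B \<in> MM" "A \<noteq> B" for A B
  proof -
    have s: "sg (A \<inter> B)" using MM_sg(1) AB sg_Int by blast
    have "A \<inter> B \<subset> A" using MM_sub_eq[OF AB(1,2)] AB(3) by blast
    then have "2 * card (A \<inter> B) \<le> 2 * card K" using card_lt[OF s MM_sg(1)[OF AB(1)]] MM_sg(2)[OF AB(1)] c2 by simp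
    then show ?thesis using card_eqI[OF sK s] KA AB by simp
  qed
  then show ?thesis using that[OF sK _ nK c2] by (simp add: K_def)
qed

section \<open>The case of index 3, over the normal subgroup K\<close>

context
  fixes K :: "'a set"
  assumes K: "sg K" "K \<subseteq> M" "carrier G \<subseteq> norm K" "card M = 2 * card K"
    "\<And>A B. A \<in> MM \<Longrightarrow> B \<in> MM \<Longrightarrow> A \<noteq> B \<Longrightarrow> A \<inter> B = K"
begin

lemma maxK: "maxin K M"
  using prime_index_maxin[OF K(1) sgM(1) K(2,4) two_is_prime_nat] .

lemma cj_K: "g \<in> carrier G \<Longrightarrow> cj g K = K"
  using K(3) by (auto simp: norm_def)

lemma K_pos: "card K > 0"
  using sg_card_pos[OF K(1)] .

lemma L_not_le_K: "\<not> L \<subseteq> K"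
proof
  assume "L \<subseteq> K"
  then have "K = L \<or> K = M" using maxL K(1,2) unfolding maxin_def by blast
  then show False using K(3) nL K(4) K_pos by auto
qed

lemma LL_not_le_K: "H \<in> LL \<Longrightarrow> \<not> H \<subseteq> K"
proof
  assume H: "H \<in> LL" "H \<subseteq> K"
  obtain g where g: "g \<in> carrier G" "H = cj g L" using H(1) by (rule orbE)
  have "cj g L \<subseteq> cj g K" using H(2) g cj_K by simp
  then show False using cj_le_iff[OF g(1) sgL(4) sg_sub[OF K(1)]] L_not_le_K by blast
qed

lemma card_G: "card (carrier G) = 6 * card K"
  using MM_card index_3 K(4) by simp

text \<open>An element that normalizes \<open>L\<close> but lies outside \<open>M\<close> would put
  \<open>L\<close> into two conjugates of \<open>M\<close>, hence into \<open>K\<close>. So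
  otherwise \<open>L\<close> would be self-normalizing, with three times as many conjugates as
  inside \<open>M\<close>, at least 9.\<close>

lemma M_norm_L: "M \<subseteq> norm L"
proof (rule ccontr)
  assume n: "\<not> M \<subseteq> norm L"
  have "norm L \<subseteq> M"
  proof
    fix g assume g: "g \<in> norm L"
    then have gG: "g \<in> carrier G" "cj g L = L" by (auto simp: norm_def)
    show "g \<in> M"
    proof (rule ccontr)
      assume "g \<notin> M"
      then have "cj g M \<noteq> M" using MM_norm[OF MM_self] gG(1) by (auto simp: norm_def)
      then have "M \<inter> cj g M = K" using K(5)[OF MM_self MM_closed[OF MM_self gG(1)]] by blast
      moreover have "L \<subseteq> cj g M" using cj_mono[OF sgL(2), of g] gG(2) by simp
      ultimately show False using sgL(2) L_not_le_K by blast
    qed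
  qed
  then have "norm L = L" using maxin_self_norm[OF maxL n] by blast
  then have "card LL * card L = 3 * card M" using LL_card MM_card index_3 by simp
  also have "\<dots> = 3 * (card (orb M L) * card L)" using orb_card_mult[OF maxL n] by simp
  finally have "card LL = 3 * card (orb M L)" using cards(1) by simp
  then have "9 \<le> card LL" using orb_ge_3[OF maxL n] by simp
  moreover have "2 + card MM + card LL + card ({}::'a set set) \<le> 12" by (rule extra) auto
  ultimately show False using index_3 by simp
qed

lemma LL_3: "card LL = 3" "norm L = M"
  using LL_normal[OF M_norm_L] index_3 by auto

lemma LL_in_M: "H \<in> LL \<Longrightarrow> H \<subseteq> M \<Longrightarrow> H = L"
proof -
  assume H: "H \<in> LL" "H \<subseteq> M"
  obtain g where g: "g \<in> carrier G" "H = cj g L" using H(1) by (rule orbE)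
  have "cj g M = M"
  proof (rule ccontr)
    assume "cj g M \<noteq> M"
    then have "M \<inter> cj g M = K" using K(5)[OF MM_self MM_closed[OF MM_self g(1)]] by blast
    moreover have "H \<subseteq> cj g M" using cj_mono[OF sgL(2), of g] g(2) by simp
    ultimately show False using H LL_not_le_K by blast
  qed
  then have "g \<in> M" using MM_norm[OF MM_self] g(1) by (auto simp: norm_def)
  then show "H = L" using M_norm_L g(2) by (auto simp: norm_def)
qed

lemma LK: "card L = 2 * card (L \<inter> K)"
proof -
  have "L \<subseteq> norm K" using K(3) sgL(4) by blast
  then have s: "sg (L <#> K)" using sg_set_mult[OF sgL(1) K(1)] by blast
  have "L <#> K \<subseteq> M" using set_mult_least[OF sgM(1) sgL(2) K(2)] .
  then have "L <#> K = K \<or> L <#> K = M" using maxK s set_mult_upper(2)[OF sgL(1) K(1)] unfolding maxin_def by blast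
  then have "L <#> K = M" using set_mult_upper(1)[OF sgL(1) K(1)] L_not_le_K by auto
  then have "2 * card K * card (L \<inter> K) = card L * card K" using card_set_mult[OF sgL(1) K(1)] K(4) by simp
  then show ?thesis using K_pos by simp
qed

lemma K_ne: "card K \<noteq> 1"
proof
  assume "card K = 1"
  then have "card M = 2" using K(4) by simp
  moreover have "card (L \<inter> K) > 0" using sg_card_pos[OF sg_Int[OF sgL(1) K(1)]] .
  ultimately show False using LK cards(2) by simp
qed

context
  fixes T :: "'a set"
  assumes T: "psyl 3 T (carrier G)"
begin

text \<open>The preimage of the subgroup of order 3 in the quotient by \<open>K\<close>.\<close>

definition A :: "'a set" where "A = T <#> K"

lemma sgT: "sg T" "T \<subseteq> carrier G"
  using T by (auto simp: psyl_def)

lemma T_not: "B \<in> MM \<Longrightarrow> \<not> T \<subseteq> B" "T \<noteq> carrier G" "T \<notin> base"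
  using psyl_not_le[OF _ _ T] index_3 by auto

lemma sgA: "sg A" "T \<subseteq> A" "K \<subseteq> A"
  unfolding A_def using sg_set_mult[OF sgT(1) K(1)] K(3) sgT(2) set_mult_upper[OF sgT(1) K(1)] by blast+

text \<open>The index of \<open>K\<close> in \<open>A\<close> divides 6 and a power of 3, and it is
  not 1 because \<open>T\<close> does not lie in \<open>M\<close>.\<close>

lemma card_A: "card A = 3 * card K"
proof -
  obtain e where e: "card T = 3 ^ e" using T by (auto simp: psyl_def)
  obtain c where c: "card A = card K * c" using card_dvd[OF K(1) sgA(1,3)] by blast
  obtain d where d: "card (carrier G) = card A * d" using card_dvd[OF sgA(1) sg_carrier sg_sub[OF sgA(1)]] by blast
  have "card K * (c * d) = card K * 6" using c d card_G by (simp add: ac_simps)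
  then have c6: "c dvd 6" using K_pos by (metis dvd_triv_left mult_left_cancel less_irrefl)
  have "card A * card (T \<inter> K) = card T * card K" unfolding A_def using card_set_mult[OF sgT(1) K(1)] .
  then have "card K * (c * card (T \<inter> K)) = card K * 3 ^ e" using c e by (simp add: ac_simps)
  then have "c dvd 3 ^ e" using K_pos by (metis dvd_triv_left mult_left_cancel less_irrefl)
  then obtain f where f: "c = 3 ^ f" using divides_primepow_nat[of 3 c e] by auto
  have "f \<noteq> 0"
  proof
    assume "f = 0"
    then have "K = A" using card_eqI[OF K(1) sgA(1,3)] c f by simp
    then show False using sgA(2) K(2) T_not(1)[OF MM_self] by blast
  qed
  moreover have "f < 2"
  proof (rule ccontr)
    assume "\<not> f < 2"
    then have "2 \<le> f" by simp
    then have "(3::nat) ^ 2 dvd 3 ^ f" by (rule le_imp_power_dvd)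
    then have "(3::nat) ^ 2 dvd 6" using c6 unfolding f by (rule dvd_trans)
    then show False by simp
  qed
  ultimately have "f = 1" by linarith
  then show ?thesis using c f by simp
qed

lemma norm_A: "carrier G \<subseteq> norm A"
  using index_2_norm[OF sgA(1) sg_carrier sg_sub[OF sgA(1)]] card_A card_G by simp

lemma LL_not_le_A: "H \<in> LL \<Longrightarrow> \<not> H \<subseteq> A"
proof
  assume H: "H \<in> LL" "H \<subseteq> A"
  obtain g where g: "g \<in> carrier G" "H = cj g L" using H(1) by (rule orbE)
  have "cj g A = A" using norm_A g(1) by (auto simp: norm_def)
  then have "cj g L \<subseteq> cj g A" using H(2) g by simp
  then have LA: "L \<subseteq> A" using cj_le_iff[OF g(1) sgL(4) sg_sub[OF sgA(1)]] by blast
  have sI: "sg (A \<inter> M)" using sg_Int sgA sgM by blast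
  have "A \<inter> M = K \<or> A \<inter> M = M" using maxK sI sgA(3) K(2) unfolding maxin_def by blast
  moreover have "A \<inter> M \<noteq> M"
  proof
    assume "A \<inter> M = M"
    then have "card M dvd card A" using card_dvd[OF sgM(1) sgA(1)] by blast
    then have "card K * 2 dvd card K * 3" using card_A K(4) by (simp add: ac_simps)
    then have "(2::nat) dvd 3" using K_pos by (simp only: nat_mult_dvd_cancel1)
    then show False by simp
  qed
  ultimately have "A \<inter> M = K" by blast
  then show False using LA sgL(2) L_not_le_K by blast
qed

lemma K_not_base: "K \<notin> base" "A \<notin> base" "A \<noteq> K"
proof -
  have k1: "card K > 1" using K_pos K_ne by linarith
  have "K \<notin> LL" using LL_not_le_K by blast
  then show "K \<notin> base" using k1 MM_sg(2)[of K] K(4) card_G by (auto simp: base_def)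
  have "A \<notin> LL" using LL_not_le_A by blast
  then show "A \<notin> base" using k1 MM_sg(2)[of A] K(4) card_G card_A by (auto simp: base_def)
  show "A \<noteq> K" using card_A K_pos by auto
qed

text \<open>If the 3-group \<open>A\<close> were not cyclic, \<open>A\<close> and at least four
  maximal subgroups of it would be new, and 2 + 3 + 3 + 5 = 13.\<close>

lemma normal_3_group_case: assumes "T = A" shows has_mc
proof (cases "is_cyclic A")
  case True
  then obtain x where x: "x \<in> A" "A = cyc x" by (auto simp: is_cyclic_def)
  have xG: "x \<in> carrier G" using x sgA sg_mem by blast
  have "card (carrier G) = ord x * 2" using card_cyc[OF xG] x(2) card_A card_G by simp
  moreover have "carrier G \<subseteq> norm (cyc x)" using norm_A x(2) by simp
  ultimately show ?thesis unfolding has_mc_def using xG two_is_prime_nat by blast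
next
  case False
  obtain e where e: "card A = 3 ^ e" using T assms by (auto simp: psyl_def)
  have p3: "Factorial_Ring.prime (3::nat)" by simp
  let ?U = "{Q. maxin Q A}"
  have U4: "4 \<le> card ?U" using pgroup_max_count[OF p3 sgA(1) e False] by simp
  have finU: "finite ?U" by (rule finite_subset[OF _ finite_sgs]) (auto dest: maxin_sg)
  have cU: "card Q = card K" "Q \<subseteq> A" "sg Q" if "maxin Q A" for Q
    using maxin_pgroup(2)[OF p3 e that] card_A maxin_sg[OF that] by auto
  have k1: "card K > 1" using K_pos K_ne by linarith
  have "Q \<notin> base" if "maxin Q A" for Q
  proof -
    have "Q \<notin> LL" using LL_not_le_A cU(2)[OF that] by blast
    then show ?thesis using cU(1)[OF that] k1 MM_sg(2)[of Q] K(4) card_G by (auto simp: base_def)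
  qed
  moreover have "A \<notin> ?U" using maxin_sg by blast
  ultimately have "2 + card MM + card LL + card (insert A ?U) \<le> 12"
    using K_not_base(2) by (intro extra) (use finU sgA(1) cU(3) in auto)
  then have False using index_3 LL_3(1) U4 \<open>A \<notin> ?U\<close> finU by simp
  then show ?thesis ..
qed

text \<open>Otherwise there would be at least four conjugates of \<open>T\<close>, by
  \<open>sylow3\<close>; with \<open>K\<close> and \<open>A\<close> these are six new
  subgroups.\<close>

lemma T_normal: assumes "T \<noteq> A" shows "carrier G \<subseteq> norm T"
proof (rule ccontr)
  assume n: "\<not> carrier G \<subseteq> norm T"
  have p3: "Factorial_Ring.prime (3::nat)" by simp
  have md: "card (orb (carrier G) T) mod 3 = 1" using sylow3[OF p3 T sg_carrier] .
  obtain g where g: "g \<in> carrier G" "cj g T \<noteq> T" using n by (auto simp: norm_def)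
  have two: "{T, cj g T} \<subseteq> orb (carrier G) T" using orb_self[OF sgT(2) sg_carrier] g(1) by (auto simp: orb_def)
  have "card {T, cj g T} \<le> card (orb (carrier G) T)" using card_mono[OF finite_orb[OF sg_carrier] two] .
  then have "card (orb (carrier G) T) \<noteq> 1" using g(2) by auto
  then have c4: "4 \<le> card (orb (carrier G) T)" using md by presburger
  have new: "H \<notin> base" "H \<noteq> K" "H \<noteq> A" "sg H" if H: "H \<in> orb (carrier G) T" for H
  proof -
    obtain h where h: "h \<in> carrier G" "H = cj h T" using H by (rule orbE)
    have ps: "psyl 3 H (carrier G)" using psyl_cj[OF T sg_carrier h(1)] h(2) by simp
    then show "sg H" by (simp add: psyl_def)
    note np = psyl_not_le[OF p3 _ ps]
    show "H \<notin> base" using np(3) index_3 by simp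
    show "H \<noteq> K" using np(1)[OF _ MM_self] index_3 K(2) by auto
    show "H \<noteq> A"
    proof
      assume "H = A"
      moreover have "cj h A = A" using norm_A h(1) by (auto simp: norm_def)
      ultimately have "cj h T = cj h A" using h(2) by simp
      then show False using cj_inj[OF h(1) sgT(2) sg_sub[OF sgA(1)]] assms by blast
    qed
  qed
  have fo: "finite (orb (carrier G) T)" using finite_orb[OF sg_carrier] .
  have "2 + card MM + card LL + card (insert K (insert A (orb (carrier G) T))) \<le> 12"
    by (rule extra) (use fo K(1) sgA(1) new K_not_base in auto)
  moreover have "card (insert K (insert A (orb (carrier G) T))) = 2 + card (orb (carrier G) T)"
  proof -
    have "K \<notin> insert A (orb (carrier G) T)" "A \<notin> orb (carrier G) T" using new(2,3) K_not_base(3) by blast+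
    then show ?thesis using fo by simp
  qed
  ultimately show False using c4 index_3 LL_3 by simp
qed

text \<open>A nontrivial intersection \<open>Y\<close> completes a list of 12 subgroups, so there
  are no others. Then an element of \<open>M\<close> outside \<open>K\<close> and \<open>L\<close>
  must generate \<open>M\<close>; but a cyclic group of the order of \<open>M\<close> has at least
  six subgroups, while only five of the list lie in \<open>M\<close>.\<close>

lemma L_meets_K: assumes TA: "T \<noteq> A" shows "L \<inter> K = {\<one>}"
proof (rule ccontr)
  define Y where "Y = L \<inter> K"
  assume "L \<inter> K \<noteq> {\<one>}"
  then have Y1: "Y \<noteq> {\<one>}" by (simp add: Y_def)
  have sY: "sg Y" "Y \<subseteq> L" "Y \<subseteq> K" using sg_Int sgL K(1) by (auto simp: Y_def)
  have "card Y \<noteq> 1" using Y1 sg_ne[OF sY(1)] by (metis card_1_singletonE singletonD)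
  then have cY1: "card Y > 1" using sg_card_pos[OF sY(1)] by linarith
  have cL: "card L = 2 * card Y" using LK Y_def by simp
  have YK: "Y \<noteq> K"
  proof
    assume "Y = K"
    then have "K \<subseteq> L" using sY by simp
    then have "L = K \<or> L = M" using maxK sgL(1,2) unfolding maxin_def by blast
    then show False using L_not_le_K sgL(3) by blast
  qed
  then have cYK: "card Y < card K" using sY(3) psubset_card_mono[OF sg_fin[OF K(1)]] by blast
  have "card Y \<noteq> card L" using cL cY1 by simp
  then have "Y \<notin> LL" using LL_sg(2) by blast
  then have Yb: "Y \<notin> base" using cY1 cYK Y1 MM_sg(2)[of Y] K(4) card_G by (auto simp: base_def)
  have TK: "T \<noteq> K" "T \<noteq> Y" using T_not(1)[OF MM_self] K(2) sY(3) by auto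
  have YA: "Y \<noteq> A" using cYK card_A by auto
  let ?U = "{K, A, T, Y}"
  have cU: "card ?U = 4" using K_not_base(3) TK TA YK YA by (auto simp: card_insert_if)
  have Ub: "?U \<inter> base = {}" using K_not_base T_not(3) Yb by blast
  \<comment> \<open>The 8 members of \<open>base\<close> and the 4 further subgroups exhaust the
    bound.\<close>
  have full: "{H. sg H} = base \<union> ?U"
  proof (rule card_subset_eq[symmetric])
    show "finite {H. sg H}" by (rule finite_sgs)
    show sub: "base \<union> ?U \<subseteq> {H. sg H}" using base_sub K(1) sgA(1) sgT(1) sY(1) by blast
    have "card (base \<union> ?U) = card base + card ?U" by (rule card_Un_disjoint) (use base_finite Ub in auto)
    then have "card (base \<union> ?U) = 12" using base_card index_3 LL_3 cU by simp
    moreover have "card {H. sg H} \<le> 12" using num by (simp add: num_subgroups_def)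
    ultimately show "card (base \<union> ?U) = card {H. sg H}" using card_mono[OF finite_sgs sub] by simp
  qed
  have subM: "H \<in> {{\<one>}, M, K, L, Y}" if H: "sg H" "H \<subseteq> M" for H
  proof -
    have "H \<in> base \<union> ?U" using full H by blast
    moreover have "H \<noteq> carrier G" using H(2) cards(3) card_mono[OF sg_fin[OF sgM(1)] H(2)] by auto
    moreover have "H \<noteq> A"
    proof
      assume "H = A"
      then have "card A \<le> card M" using H(2) card_mono[OF sg_fin[OF sgM(1)]] by blast
      then show False using card_A K(4) K_pos by simp
    qed
    moreover have "H \<noteq> T" using T_not(1)[OF MM_self] H(2) by blast
    moreover have "H \<in> MM \<Longrightarrow> H = M" using MM_sub_eq[OF _ MM_self H(2)] by blast
    moreover have "H \<in> LL \<Longrightarrow> H = L" using LL_in_M H(2) by blast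
    ultimately show ?thesis unfolding base_def by blast
  qed
  have "\<exists>y\<in>M. y \<notin> K \<and> y \<notin> L"
  proof (rule ccontr)
    assume "\<not> ?thesis"
    then have cov: "y \<in> K \<or> y \<in> L" if "y \<in> M" for y using that by blast
    obtain u where u: "u \<in> L" "u \<notin> K" using L_not_le_K by blast
    have "\<not> M \<subseteq> L" using sgL by blast
    then obtain v where v: "v \<in> M" "v \<notin> L" by blast
    then have vK: "v \<in> K" using cov by blast
    have uM: "u \<in> M" using u sgL by blast
    have c: "u \<in> carrier G" "v \<in> carrier G" using uM v sgM by auto
    have "u \<otimes> v \<in> M" using sg_mult[OF sgM(1) uM v(1)] .
    then consider "u \<otimes> v \<in> K" | "u \<otimes> v \<in> L" using cov by blast
    then show False
    proof cases
      case 1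
      have "u = u \<otimes> v \<otimes> inv v" using c by (simp add: m_assoc)
      then show False using 1 vK u(2) sg_mult[OF K(1)] sg_inv[OF K(1)] by metis
    next
      case 2
      have "v = inv u \<otimes> (u \<otimes> v)" using c by (simp add: m_assoc[symmetric])
      then show False using 2 u(1) v(2) sg_mult[OF sgL(1)] sg_inv[OF sgL(1)] by metis
    qed
  qed
  then obtain y where y: "y \<in> M" "y \<notin> K" "y \<notin> L" by blast
  have yG: "y \<in> carrier G" using y sgM by blast
  have "cyc y \<in> {{\<one>}, M, K, L, Y}" using subM[OF sg_cyc[OF yG]] cyc_least[OF sgM(1) y(1)] by blast
  moreover have "y \<in> cyc y" using cyc_self[OF yG] .
  ultimately have My: "cyc y = M" using y sY(2) sg_ne[OF K(1)] by auto
  have oy: "ord y = 2 * card K" using card_cyc[OF yG] My K(4) by simp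
  have "{H. sg H \<and> H \<subseteq> cyc y} \<subseteq> {{\<one>}, M, K, L, Y}" using subM My by blast
  then have "card {H. sg H \<and> H \<subseteq> cyc y} \<le> card {{\<one>}, M, K, L, Y}" by (intro card_mono) auto
  also have "\<dots> \<le> 5" by (simp add: card_insert_if)
  finally have t5: "card {d. d dvd 2 * card K} \<le> 5" using card_sg_cyc[OF yG] oy by simp
  have fd: "finite {d. d dvd 2 * card K}" using K_pos by simp
  obtain c where c: "card K = card Y * c" using card_dvd[OF sY(1) K(1) sY(3)] by blast
  \<comment> \<open>In a cyclic group subgroups are ordered by divisibility of their orders, and
    \<open>L\<close> does not lie in \<open>K\<close>. So \<open>2 * card Y\<close> does not divide
    \<open>card Y * c\<close>.\<close>
  have "\<not> card L dvd card K" using cyc_sub_dvd[OF sgL(1) _ K(1) _ yG] My sgL(2) K(2) L_not_le_K by blast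
  then have "odd c" using c cL by (auto elim!: evenE)
  moreover have "c \<noteq> 1" using c cYK by auto
  moreover have "c \<noteq> 0" using c K_pos by (metis less_irrefl mult_0_right)
  ultimately have c3: "odd c" "c \<ge> 3" by (auto elim!: oddE)
  define w where "w = card Y"
  have w1: "w > 1" using cY1 w_def by simp
  have n: "2 * card K = 2 * (w * c)" using c w_def by simp
  have "6 \<le> card {d. d dvd 2 * card K}"
  \<comment> \<open>The general list of divisors has a coincidence for \<open>w = 2\<close>, hence
    the separate list.\<close>
  proof (cases "w = 2")
    case True
    have "{1, 2, 4, c, 2 * c, 4 * c} \<subseteq> {d. d dvd 2 * card K}" unfolding n True by auto
    then have "card {1, 2, 4, c, 2 * c, 4 * c} \<le> card {d. d dvd 2 * card K}" using card_mono[OF fd] by blast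
    moreover have "c \<noteq> 4" "c \<noteq> 2" using c3(1) by auto
    ultimately show ?thesis using c3 by (simp add: card_insert_if)
  next
    case False
    have "{1, 2, w, 2 * w, w * c, 2 * (w * c)} \<subseteq> {d. d dvd 2 * card K}" unfolding n by auto
    then have "card {1, 2, w, 2 * w, w * c, 2 * (w * c)} \<le> card {d. d dvd 2 * card K}" using card_mono[OF fd] by blast
    moreover have "w * c \<noteq> 1" "w * c \<noteq> 2" "w * c \<noteq> w" "w * c \<noteq> 2 * w" "2 * (w * c) \<noteq> w" "w \<noteq> 1" "w \<noteq> 0" "w * c \<noteq> 0"
    proof -
      have "2 * 3 \<le> w * c" using w1 c3 by (intro mult_mono) auto
      then show "w * c \<noteq> 1" "w * c \<noteq> 2" "w * c \<noteq> 0" by linarith+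
      have "w * 3 \<le> w * c" using c3 by (intro mult_left_mono) auto
      then show "w * c \<noteq> w" "w * c \<noteq> 2 * w" "2 * (w * c) \<noteq> w" using w1 by auto
      show "w \<noteq> 1" "w \<noteq> 0" using w1 by auto
    qed
    ultimately show ?thesis using False by (simp add: card_insert_if)
  qed
  then show False using t5 by simp
qed

text \<open>Now \<open>L\<close> has order 2. For a subgroup \<open>B\<close> of \<open>K\<close>
  the product \<open>B <#> L\<close> lies between \<open>L\<close> and \<open>M\<close>, so
  \<open>K\<close> has no proper nontrivial subgroup and is cyclic. It commutes with
  \<open>T\<close> of order 3, and their product \<open>A\<close> is cyclic of index 2.\<close>

lemma product_case: assumes TA: "T \<noteq> A" shows has_mc
proof -
  have nT: "carrier G \<subseteq> norm T" by (rule T_normal[OF TA])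
  have LK1: "L \<inter> K = {\<one>}" by (rule L_meets_K[OF TA])
  then have cL: "card L = 2" using LK by simp
  have sub: "B = {\<one>} \<or> B = K" if B: "sg B" "B \<subseteq> K" for B
  proof -
    have "B \<subseteq> norm L" using B(2) K(2) M_norm_L by blast
    then have s: "sg (B <#> L)" using sg_set_mult[OF B(1) sgL(1)] by blast
    have le: "B <#> L \<subseteq> M" using set_mult_least[OF sgM(1)] B(2) K(2) sgL(2) by blast
    have "B \<inter> L = {\<one>}" using LK1 B(2) sg_ne[OF B(1)] sg_ne[OF sgL(1)] by blast
    then have c: "card (B <#> L) = card B * 2" using card_set_mult[OF B(1) sgL(1)] cL by simp
    have "B <#> L = L \<or> B <#> L = M" using maxL s le set_mult_upper(2)[OF B(1) sgL(1)] unfolding maxin_def by blast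
    then have "card B = 1 \<or> card B = card K" using c cL K(4) by auto
    then show ?thesis
      using sg_ne[OF B(1)] card_subset_eq[OF sg_fin[OF K(1)] B(2)] by (metis card_1_singletonE singletonD)
  qed
  have "K \<noteq> {\<one>}" using K_ne by auto
  then obtain y where y: "y \<in> K" "y \<noteq> \<one>" using sg_ne[OF K(1)] by blast
  have yG: "y \<in> carrier G" using y K(1) sg_mem by blast
  have "cyc y \<noteq> {\<one>}" using cyc_self[OF yG] y(2) by auto
  then have Ky: "K = cyc y" using sub[OF sg_cyc[OF yG] cyc_least[OF K(1) y(1)]] by blast
  have sTK: "sg (T \<inter> K)" using sg_Int sgT K(1) by blast
  have "T \<inter> K \<noteq> K"
  proof
    assume "T \<inter> K = K"
    then have "K \<subseteq> T" by blast
    then have "A \<subseteq> T" unfolding A_def using set_mult_least[OF sgT(1)] by blast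
    then show False using sgA(2) TA by blast
  qed
  then have TK: "T \<inter> K = {\<one>}" using sub[OF sTK] by blast
  then have "card T * card K = 3 * card K" using card_set_mult[OF sgT(1) K(1)] card_A A_def by simp
  then have cT: "card T = 3" using K_pos by simp
  then obtain x where x: "x \<in> T" "T = cyc x" using prime_card_cyclic[OF sgT(1)] by (auto simp: is_cyclic_def)
  have xG: "x \<in> carrier G" using x sgT by blast
  obtain i where i: "card (carrier G) = card T * i" "\<not> 3 dvd i" using psyl_index[OF T sg_carrier] by blast
  have "3 * (2 * card K) = 3 * i" using i(1) cT card_G by simp
  then have "i = 2 * card K" by simp
  then have "\<not> 3 dvd card K" using i(2) by auto
  moreover have "Factorial_Ring.prime (3::nat)" by simp
  ultimately have "coprime 3 (card K)" by (rule prime_imp_coprime[rotated])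
  then have cop: "coprime (ord x) (ord y)" using card_cyc[OF xG] card_cyc[OF yG] x(2) Ky cT by simp
  have "x \<otimes> y = y \<otimes> x"
    by (rule normal_commute[OF sgT(1) K(1) _ _ TK x(1) y(1)]) (use K(3) nT sgT(2) sg_sub[OF K(1)] in blast)+
  then have xy: "cyc (x \<otimes> y) = A" using coprime_cyc[OF xG yG _ cop] x(2) Ky A_def by simp
  have "card (carrier G) = ord (x \<otimes> y) * 2" using card_cyc[of "x \<otimes> y"] xG yG xy card_A card_G by simp
  moreover have "carrier G \<subseteq> norm (cyc (x \<otimes> y))" using norm_A xy by simp
  ultimately show ?thesis unfolding has_mc_def using xG yG two_is_prime_nat by blast
qed

end

lemma core_case: has_mc
proof -
  obtain T where T: "psyl 3 T (carrier G)" using ex_psyl[of 3, OF _ sg_carrier] by auto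
  show ?thesis using normal_3_group_case[OF T] product_case[OF T] by blast
qed

end

theorem nonfrobenius_case: has_mc
proof -
  obtain K where "sg K" "K \<subseteq> M" "carrier G \<subseteq> norm K" "card M = 2 * card K"
    "\<And>A B. A \<in> MM \<Longrightarrow> B \<in> MM \<Longrightarrow> A \<noteq> B \<Longrightarrow> A \<inter> B = K"
    by (rule core) (rule that; (assumption | simp | blast))
  then show ?thesis by (rule core_case)
qed

end

section \<open>The classification\<close>

context fin_group
begin

lemma has_mc_or_A4:
  assumes n: "num_subgroups G \<le> 12" shows "has_mc \<or> G \<cong> A4"
proof (cases "\<forall>p P. Factorial_Ring.prime p \<longrightarrow> psyl p P (carrier G) \<longrightarrow> carrier G \<subseteq> norm P")
  case True
  then show ?thesis using sylow_normal_has_mc n by blast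
next
  case False
  then obtain p P where p: "Factorial_Ring.prime p" and P: "psyl p P (carrier G)" and nP: "\<not> carrier G \<subseteq> norm P" by blast
  have sP: "sg P" "P \<subseteq> carrier G" using P by (auto simp: psyl_def)
  have "norm P \<subset> carrier G" using nP norm_sub by blast
  then obtain M where M: "maxin M (carrier G)" "norm P \<subseteq> M" using ex_maxin[OF sg_norm[OF sP(2)] sg_carrier] by blast
  have sM: "sg M" "M \<subseteq> carrier G" "M \<noteq> carrier G" using maxin_sg[OF M(1)] by auto
  have PM: "P \<subseteq> M" using sub_norm[OF sP(1)] M(2) by blast
  \<comment> \<open>The Frattini argument needs \<open>P\<close> as a Sylow subgroup of
    \<open>M\<close>, not only of the whole group.\<close>
  have psM: "psyl p P M"
  proof -
    obtain c where c: "card M = card P * c" using card_dvd[OF sP(1) sM(1) PM] by blast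
    obtain d where d: "card (carrier G) = card M * d" using card_dvd[OF sM(1) sg_carrier sM(2)] by blast
    have P0: "card P > 0" using sg_card_pos[OF sP(1)] .
    have "card (carrier G) div card P = c * d" using c d P0 by (simp add: ac_simps)
    then have "\<not> p dvd c" using P by (auto simp: psyl_def)
    then show ?thesis using P PM c P0 by (auto simp: psyl_def)
  qed
  have nn: "\<not> carrier G \<subseteq> norm M"
  proof
    assume "carrier G \<subseteq> norm M"
    then have "carrier G = M <#> norm P" using frattini[OF p psM sM(1)] by blast
    also have "\<dots> \<subseteq> M" using set_mult_least[OF sM(1)] M(2) by blast
    finally show False using sM by blast
  qed
  show ?thesis
  proof (cases "\<forall>L. maxin L M \<longrightarrow> carrier G \<subseteq> norm L")
    case True
    interpret frobenius_case G M by unfold_locales (use M nn True n in auto)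
    show ?thesis by (rule frobenius_case)
  next
    case False
    then obtain L where L: "maxin L M" "\<not> carrier G \<subseteq> norm L" by blast
    interpret nonfrobenius_case G M L by unfold_locales (use M nn L n in auto)
    show ?thesis using nonfrobenius_case by blast
  qed
qed

theorem classification:
  assumes n: "num_subgroups G \<le> 12"
  shows "\<exists>i<25. \<exists>T z. dec T z \<and> G\<lparr>carrier := T\<rparr> \<cong> rep i"
  using has_mc_or_A4[OF n]
proof
  assume "G \<cong> A4"
  \<comment> \<open>For \<open>A4\<close> no central factor is split off, so \<open>z\<close> is the
    identity.\<close>
  moreover have "dec (carrier G) \<one>" using sg_carrier by (auto simp: dec_def group_center_def)
  moreover have "(24::nat) < 25" "rep 24 = A4" using rep_23 by auto
  ultimately show ?thesis by (metis partial_object.update_convs(1) partial_object.surjective)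
next
  assume has_mc
  then consider x where "x \<in> carrier G" "carrier G = cyc x" |
    a p where "a \<in> carrier G" "Factorial_Ring.prime p" "card (carrier G) = ord a * p" "carrier G \<subseteq> norm (cyc a)"
    unfolding has_mc_def is_cyclic_def by blast
  then show ?thesis
  proof cases
    case 1
    then show ?thesis by (rule cyclic_classified)
  next
    case 2
    then obtain b k j where "metacyc G a b (ord a) p k j" using metacyc_ex by blast
    then interpret metacyc G a b "ord a" p k j .
    show ?thesis by (rule metacyc_classified[OF n])
  qed
qed

end

theorem mainTheorem1:
  shows "map num_similarity_classes [1, 2, 3, 4, 5, 6, 7, 8, 9, 10, 11, 12]
    = [1, 1, 1, 2, 2, 5, 1, 7, 2, 12, 4, 11]"
  by (rule num_similarity_classes_if_classified) (rule fin_group.classification)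

end
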